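(* Let $d\in\{1,2,3\}$, let $F:L^1(\Omega)\to\mathbb{R}$ be continuous and bounded from below, and let $\alpha>0$. Let $c\ge1$ if $d=1$, $c\ge\sqrt2$ if $d=2$, and $c\ge13\sqrt3$ if $d=3$. Let $\{(h,\tau_h)\}_h$ be a family of admissible mesh pairs such that $\frac{\tau_h}{h}\to0$ as $h\searrow0$. Let $w\in\mathrm{BV}_W(\Omega)$. Then there exists a sequence $\{(w^{\tau_h},V^h)\}_h\subset\mathrm{BV}_W(\Omega)\times\mathbb{R}$ such that $(w^{\tau_h},V^h)\in Z^h$ for all $h$, $w^{\tau_h}\overset{*}{\rightharpoonup}w$ in $\mathrm{BV}(\Omega)$ as $h\searrow0$, and $$G(w)\ge\limsup_{h\searrow0}G^h(w^{\tau_h},V^h).$$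
   Context: Setting. $\Omega\subset\mathbb{R}^d$, $d\in\{1,2,3\}$, is a bounded Lipschitz domain that is a finite union of bounded intervals ($d=1$), axis-aligned squares ($d=2$) or axis-aligned cubes ($d=3$). $W\subset\mathbb{Z}$ is a finite nonempty set. $\|\cdot\|$ is the Euclidean norm and $\|\phi\|_{L^\infty(\Omega;\mathbb{R}^d)}=\operatorname{ess\,sup}_{x\in\Omega}\|\phi(x)\|$. For $w\in L^1(\Omega)$, $\operatorname{TV}(w)=\sup\{\int_\Omega w\,\operatorname{div}\phi\,dx : \phi\in C^1_c(\Omega;\mathbb{R}^d),\ \sup_{x}\|\phi(x)\|\le 1\}\in[0,\infty]$; $\mathrm{BV}(\Omega)=\{w\in L^1(\Omega):\operatorname{TV}(w)<\infty\}$; $L^1_W(\Omega)=\{w\in L^1(\Omega): w(x)\in W \text{ for a.a. } x\in\Omega\}$; $\mathrm{BV}_W(\Omega)=L^1_W(\Omega)\cap \mathrm{BV}(\Omega)$. Meshes. A mesh of $\Omega$ of size $\tau>0$ is a conforming finite element mesh $\mathcal{Q}_\tau$: a finite collection of intervals / axis-aligned squares / axis-aligned cubes of side length $\tau$ with pairwise disjoint interiors, whose union is $\Omega$ up to a Lebesgue null set, and such that two distinct closed cells intersect in the empty set or a common face. A pair $(h,\tau_h)$ with $h>0$ and $\tau_h\in(0,h]$ is an admissible mesh pair if there are given a mesh $\mathcal{Q}_h$ of size $h$ (the TV mesh) and a mesh $\mathcal{Q}_{\tau_h}$ of size $\tau_h$ (the input mesh) such that every cell of $\mathcal{Q}_h$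 is a union of cells of $\mathcal{Q}_{\tau_h}$. Families are indexed by $h$ in a set of positive numbers accumulating at $0$. $P0^\tau$ is the space of functions that are constant on each cell of $\mathcal{Q}_\tau$. Discretized total variation. For a cell $Q$, $RT0^h(Q)$ is the space of maps $Q\to\mathbb{R}^d$, $x\mapsto (a_i+c_ix_i)_{i=1}^d$ with $a,c\in\mathbb{R}^d$. $RT0^h=\{\phi\in H(\operatorname{div};\Omega):\phi|_Q\in RT0^h(Q)\ \forall Q\in\mathcal{Q}_h\}$, and $RT0^h_0=\{\phi\in RT0^h:(\phi\cdot n)|_{\partial\Omega}\equiv0\}$ with $n$ the outer unit normal of $\Omega$. For $w\in L^1(\Omega)$, $\operatorname{TV}^h(w)=\sup\{\int_\Omega w\operatorname{div}\phi\,dx:\phi\in RT0^h_0,\ \|\phi\|_{L^\infty(\Omega;\mathbb{R}^d)}\le1\}$. Functionals. $G(w)=F(w)+\alpha\operatorname{TV}(w)+I_Z(w)$ with $Z=\{w\in L^1_W(\Omega):\operatorname{TV}(w)\le c\operatorname{TV}(w)\}$. $G^h(w,V)=F(w)+\alpha V+I_{Z^h}(w,V)$ with $Z^h=\{(w,V)\in(P0^{\tau_h}\cap L^1_W(\Omega))\times\mathbb{R}:\operatorname{TV}(w)\le cV,\ \operatorname{TV}^h(w)\le V\}$. $I_A$ denotes the $\{0,\infty\}$-valued indicator functional of $A$. Weak-$*$ convergence $w^h\overset{*}{\rightharpoonup}w$ in $\mathrm{BV}(\Omega)$ means $w^h\to w$ in $L^1(\Omega)$ and $Dw^h\overset{*}{\rightharpoonup}Dw$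 as measures. *)

theory Defs
  imports "HOL-Analysis.Analysis" "HOL-Probability.Essential_Supremum"
begin

section \<open>Domains and meshes\<close>

text \<open>Locally the set is the strict epigraph, in the direction of a unit vector \<open>\<nu>\<close>, of a
  Lipschitz function of the component orthogonal to \<open>\<nu>\<close>. Connectedness is not demanded.\<close>

definition lipschitz_domain :: "(real^'n) set \<Rightarrow> bool" where
  "lipschitz_domain \<Omega> \<longleftrightarrow> open \<Omega> \<and> \<Omega> \<noteq> {} \<and>
     (\<forall>x\<in>frontier \<Omega>. \<exists>\<nu> r L \<gamma>. norm \<nu> = 1 \<and> 0 < r \<and>
        L-lipschitz_on UNIV (\<gamma> :: real^'n \<Rightarrow> real) \<and>
        \<Omega> \<inter> ball x r = {y \<in> ball x r. \<gamma> (y - (y \<bullet> \<nu>) *\<^sub>R \<nu>) < y \<bullet> \<nu>})"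

definition cube :: "real^'n \<Rightarrow> real \<Rightarrow> (real^'n) set" where
  "cube a s = cbox a (a + vec s)"

definition eq_up_to_null :: "(real^'n) set \<Rightarrow> (real^'n) set \<Rightarrow> bool" where
  "eq_up_to_null A B \<longleftrightarrow> sym_diff A B \<in> null_sets lebesgue"

text \<open>The cubes may have different side lengths; for \<open>CARD('n) = 1\<close> they are the compact intervals.
  As \<open>\<Omega>\<close> is open, it can equal a union of such cubes only up to boundary points.\<close>

definition cubical_lipschitz_domain :: "(real^'n) set \<Rightarrow> bool" where
  "cubical_lipschitz_domain \<Omega> \<longleftrightarrow> bounded \<Omega> \<and> lipschitz_domain \<Omega> \<and>
     (\<exists>\<C>. finite \<C> \<and> (\<forall>Q\<in>\<C>. \<exists>a s. 0 < s \<and> Q = cube a s) \<and> eq_up_to_null (\<Union>\<C>) \<Omega>)"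

definition is_mesh :: "(real^'n) set \<Rightarrow> real \<Rightarrow> (real^'n) set set \<Rightarrow> bool" where
  "is_mesh \<Omega> \<tau> \<Q> \<longleftrightarrow> 0 < \<tau> \<and> finite \<Q> \<and>
     (\<forall>Q\<in>\<Q>. \<exists>a. Q = cube a \<tau>) \<and>
     (\<forall>Q\<in>\<Q>. \<forall>R\<in>\<Q>. Q \<noteq> R \<longrightarrow> interior Q \<inter> interior R = {}) \<and>
     (\<forall>Q\<in>\<Q>. \<forall>R\<in>\<Q>. Q \<noteq> R \<longrightarrow>
        Q \<inter> R = {} \<or> ((Q \<inter> R) face_of Q \<and> (Q \<inter> R) face_of R)) \<and>
     eq_up_to_null (\<Union>\<Q>) \<Omega>"

definition admissible_mesh_pair ::
    "(real^'n) set \<Rightarrow> real \<Rightarrow> real \<Rightarrow> (real^'n) set set \<Rightarrow> (real^'n) set set \<Rightarrow> bool" where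
  "admissible_mesh_pair \<Omega> h \<tau> \<Q> \<R> \<longleftrightarrow> 0 < h \<and> 0 < \<tau> \<and> \<tau> \<le> h \<and>
     is_mesh \<Omega> h \<Q> \<and> is_mesh \<Omega> \<tau> \<R> \<and> (\<forall>Q\<in>\<Q>. \<exists>\<S>. \<S> \<subseteq> \<R> \<and> Q = \<Union>\<S>)"


section \<open>Function spaces and total variation\<close>

text \<open>Elements of \<open>L\<^sup>1\<close>, \<open>L\<^sup>2\<close>, \<open>BV\<close>, etc. are represented by functions on the whole space of which
  only the values almost everywhere in \<open>\<Omega>\<close> matter.\<close>

definition L1 :: "(real^'n) set \<Rightarrow> (real^'n \<Rightarrow> real) set" where
  "L1 \<Omega> = {w. integrable (lebesgue_on \<Omega>) w}"

definition L1_dist :: "(real^'n) set \<Rightarrow> (real^'n \<Rightarrow> real) \<Rightarrow> (real^'n \<Rightarrow> real) \<Rightarrow> real" where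
  "L1_dist \<Omega> v w = (LINT x|lebesgue_on \<Omega>. \<bar>v x - w x\<bar>)"

text \<open>Continuity for the pseudometric \<open>L1_dist\<close> forces \<open>F\<close> to agree on functions that are equal
  almost everywhere, so that \<open>F\<close> is a functional on equivalence classes.\<close>

definition L1_continuous :: "(real^'n) set \<Rightarrow> ((real^'n \<Rightarrow> real) \<Rightarrow> real) \<Rightarrow> bool" where
  "L1_continuous \<Omega> F \<longleftrightarrow> (\<forall>w\<in>L1 \<Omega>. \<forall>\<epsilon>>0. \<exists>\<delta>>0. \<forall>v\<in>L1 \<Omega>.
     L1_dist \<Omega> v w < \<delta> \<longrightarrow> \<bar>F v - F w\<bar> < \<epsilon>)"

definition L2 :: "(real^'n) set \<Rightarrow> (real^'n \<Rightarrow> 'b::euclidean_space) set" where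
  "L2 \<Omega> = {f. f \<in> borel_measurable (lebesgue_on \<Omega>) \<and>
     integrable (lebesgue_on \<Omega>) (\<lambda>x. (norm (f x))\<^sup>2)}"

text \<open>Functions in \<open>C\<^sup>1\<^sub>c(\<Omega>)\<close> are extended by zero to the whole space.\<close>

definition C1c :: "(real^'n) set \<Rightarrow> (real^'n \<Rightarrow> 'b::real_normed_vector) set" where
  "C1c \<Omega> = {\<phi>. (\<exists>K. compact K \<and> K \<subseteq> \<Omega> \<and> (\<forall>x. x \<notin> K \<longrightarrow> \<phi> x = 0)) \<and>
     (\<forall>x. \<phi> differentiable (at x)) \<and>
     (\<forall>i. continuous_on UNIV (\<lambda>x. frechet_derivative \<phi> (at x) (axis i 1)))}"

definition divergence :: "(real^'n \<Rightarrow> real^'n) \<Rightarrow> real^'n \<Rightarrow> real" where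
  "divergence \<phi> x = (\<Sum>i\<in>UNIV. frechet_derivative \<phi> (at x) (axis i 1) $ i)"

definition gradient :: "(real^'n \<Rightarrow> real) \<Rightarrow> real^'n \<Rightarrow> real^'n" where
  "gradient \<psi> x = (\<chi> i. frechet_derivative \<psi> (at x) (axis i 1))"

definition TV :: "(real^'n) set \<Rightarrow> (real^'n \<Rightarrow> real) \<Rightarrow> ereal" where
  "TV \<Omega> w = (SUP \<phi>\<in>{\<phi> \<in> C1c \<Omega>. \<forall>x. norm (\<phi> x) \<le> 1}.
     ereal (LINT x|lebesgue_on \<Omega>. w x * divergence \<phi> x))"

definition BV :: "(real^'n) set \<Rightarrow> (real^'n \<Rightarrow> real) set" where
  "BV \<Omega> = {w \<in> L1 \<Omega>. TV \<Omega> w < \<infinity>}"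

definition L1_W :: "(real^'n) set \<Rightarrow> int set \<Rightarrow> (real^'n \<Rightarrow> real) set" where
  "L1_W \<Omega> W = {w \<in> L1 \<Omega>. AE x in lebesgue_on \<Omega>. w x \<in> real_of_int ` W}"

definition BV_W :: "(real^'n) set \<Rightarrow> int set \<Rightarrow> (real^'n \<Rightarrow> real) set" where
  "BV_W \<Omega> W = L1_W \<Omega> W \<inter> BV \<Omega>"

definition P0 :: "(real^'n) set set \<Rightarrow> (real^'n \<Rightarrow> real) set" where
  "P0 \<Q> = {w. \<forall>Q\<in>\<Q>. \<exists>v. AE x in lebesgue_on Q. w x = v}"


section \<open>Raviart--Thomas functions and discretized total variation\<close>

definition has_weak_div :: "(real^'n) set \<Rightarrow> (real^'n \<Rightarrow> real^'n) \<Rightarrow> (real^'n \<Rightarrow> real) \<Rightarrow> bool" where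
  "has_weak_div \<Omega> \<phi> g \<longleftrightarrow> g \<in> L2 \<Omega> \<and> (\<forall>\<psi>\<in>C1c \<Omega>.
     (LINT x|lebesgue_on \<Omega>. \<phi> x \<bullet> gradient \<psi> x) = - (LINT x|lebesgue_on \<Omega>. g x * \<psi> x))"

definition Hdiv :: "(real^'n) set \<Rightarrow> (real^'n \<Rightarrow> real^'n) set" where
  "Hdiv \<Omega> = {\<phi> \<in> L2 \<Omega>. \<exists>g. has_weak_div \<Omega> \<phi> g}"

text \<open>Determined up to equality almost everywhere in \<open>\<Omega>\<close>.\<close>

definition weak_div :: "(real^'n) set \<Rightarrow> (real^'n \<Rightarrow> real^'n) \<Rightarrow> real^'n \<Rightarrow> real" where
  "weak_div \<Omega> \<phi> = (SOME g. has_weak_div \<Omega> \<phi> g)"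

definition rt0_map :: "real^'n \<Rightarrow> real^'n \<Rightarrow> real^'n \<Rightarrow> real^'n" where
  "rt0_map a c x = (\<chi> i. a $ i + c $ i * x $ i)"

text \<open>The restriction to a cell is understood almost everywhere: on a face shared by two cells the
  two polynomials agree in the normal component only.\<close>

definition RT0 :: "(real^'n) set \<Rightarrow> (real^'n) set set \<Rightarrow> (real^'n \<Rightarrow> real^'n) set" where
  "RT0 \<Omega> \<Q> = {\<phi> \<in> Hdiv \<Omega>. \<forall>Q\<in>\<Q>. \<exists>a c. AE x in lebesgue_on Q. \<phi> x = rt0_map a c x}"

text \<open>Every open cone with apex \<open>x\<close>, axis \<open>-n\<close> and half-angle less than a right angle lies in the
  set near \<open>x\<close>, and every such cone with axis \<open>n\<close> lies in the complement. A Lipschitz domain has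
  such an \<open>n\<close> at almost all boundary points; for unions of cubes the exceptions are the corners
  and edges.\<close>

definition outer_unit_normal :: "(real^'n) set \<Rightarrow> real^'n \<Rightarrow> real^'n \<Rightarrow> bool" where
  "outer_unit_normal \<Omega> x n \<longleftrightarrow> x \<in> frontier \<Omega> \<and> norm n = 1 \<and>
     (\<forall>\<epsilon>>0. \<exists>\<delta>>0. \<forall>y\<in>ball x \<delta>.
        ((y - x) \<bullet> n < - \<epsilon> * norm (y - x) \<longrightarrow> y \<in> \<Omega>) \<and>
        ((y - x) \<bullet> n > \<epsilon> * norm (y - x) \<longrightarrow> y \<notin> \<Omega>))"

text \<open>The boundary values of \<open>\<phi>\<close> are those of its polynomial pieces on the closed cells.\<close>

definition RT0_0 :: "(real^'n) set \<Rightarrow> (real^'n) set set \<Rightarrow> (real^'n \<Rightarrow> real^'n) set" where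
  "RT0_0 \<Omega> \<Q> = {\<phi> \<in> RT0 \<Omega> \<Q>. \<forall>Q\<in>\<Q>. \<forall>a c.
     (AE x in lebesgue_on Q. \<phi> x = rt0_map a c x) \<longrightarrow>
     (\<forall>x\<in>Q \<inter> frontier \<Omega>. \<forall>n. outer_unit_normal \<Omega> x n \<longrightarrow> rt0_map a c x \<bullet> n = 0)}"

definition Linf_norm :: "(real^'n) set \<Rightarrow> (real^'n \<Rightarrow> real^'n) \<Rightarrow> ereal" where
  "Linf_norm \<Omega> \<phi> = esssup (lebesgue_on \<Omega>) (\<lambda>x. ereal (norm (\<phi> x)))"

definition TVh :: "(real^'n) set \<Rightarrow> (real^'n) set set \<Rightarrow> (real^'n \<Rightarrow> real) \<Rightarrow> ereal" where
  "TVh \<Omega> \<Q> w = (SUP \<phi>\<in>{\<phi> \<in> RT0_0 \<Omega> \<Q>. Linf_norm \<Omega> \<phi> \<le> 1}.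
     ereal (LINT x|lebesgue_on \<Omega>. w x * weak_div \<Omega> \<phi> x))"


section \<open>Weak-star convergence in BV\<close>

text \<open>The finite vector measure \<open>Dw\<close> in polar form \<open>Dw = \<sigma> \<mu>\<close>, where \<open>\<mu> = |Dw|\<close>.\<close>

definition is_derivative_measure ::
    "(real^'n) set \<Rightarrow> (real^'n \<Rightarrow> real) \<Rightarrow> (real^'n) measure \<times> (real^'n \<Rightarrow> real^'n) \<Rightarrow> bool" where
  "is_derivative_measure \<Omega> w = (\<lambda>(\<mu>, \<sigma>).
     space \<mu> = \<Omega> \<and> sets \<mu> = sets (restrict_space borel \<Omega>) \<and> finite_measure \<mu> \<and>
     \<sigma> \<in> borel_measurable \<mu> \<and> (AE x in \<mu>. norm (\<sigma> x) = 1) \<and>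
     (\<forall>\<phi>\<in>C1c \<Omega>. (LINT x|lebesgue_on \<Omega>. w x * divergence \<phi> x) = - (LINT x|\<mu>. \<phi> x \<bullet> \<sigma> x)))"

definition derivative_measure ::
    "(real^'n) set \<Rightarrow> (real^'n \<Rightarrow> real) \<Rightarrow> (real^'n) measure \<times> (real^'n \<Rightarrow> real^'n)" where
  "derivative_measure \<Omega> w = (SOME D. is_derivative_measure \<Omega> w D)"

definition vector_measure_integral ::
    "(real^'n) measure \<times> (real^'n \<Rightarrow> real^'n) \<Rightarrow> (real^'n \<Rightarrow> real) \<Rightarrow> real^'n" where
  "vector_measure_integral D \<psi> = (LINT x|fst D. \<psi> x *\<^sub>R snd D x)"

text \<open>Continuous functions vanishing at the boundary, the predual of the finite Radon measures.\<close>

definition C0 :: "(real^'n) set \<Rightarrow> (real^'n \<Rightarrow> real) set" where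
  "C0 \<Omega> = {\<psi>. continuous_on \<Omega> \<psi> \<and> (\<forall>\<epsilon>>0. compact {x\<in>\<Omega>. \<epsilon> \<le> \<bar>\<psi> x\<bar>})}"

definition weak_star_BV ::
    "(real^'n) set \<Rightarrow> ('i \<Rightarrow> real^'n \<Rightarrow> real) \<Rightarrow> (real^'n \<Rightarrow> real) \<Rightarrow> 'i filter \<Rightarrow> bool" where
  "weak_star_BV \<Omega> ws w \<F> \<longleftrightarrow> (\<forall>\<^sub>F i in \<F>. ws i \<in> BV \<Omega>) \<and> w \<in> BV \<Omega> \<and>
     ((\<lambda>i. L1_dist \<Omega> (ws i) w) \<longlongrightarrow> 0) \<F> \<and>
     (\<forall>\<psi>\<in>C0 \<Omega>. ((\<lambda>i. vector_measure_integral (derivative_measure \<Omega> (ws i)) \<psi>)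
        \<longlongrightarrow> vector_measure_integral (derivative_measure \<Omega> w) \<psi>) \<F>)"


section \<open>Functionals\<close>

definition ind_fun :: "'a set \<Rightarrow> 'a \<Rightarrow> ereal" where
  "ind_fun A x = (if x \<in> A then 0 else \<infinity>)"

definition Z_set :: "(real^'n) set \<Rightarrow> int set \<Rightarrow> real \<Rightarrow> (real^'n \<Rightarrow> real) set" where
  "Z_set \<Omega> W c = {w \<in> L1_W \<Omega> W. TV \<Omega> w \<le> ereal c * TV \<Omega> w}"

definition G_fun :: "(real^'n) set \<Rightarrow> int set \<Rightarrow> ((real^'n \<Rightarrow> real) \<Rightarrow> real) \<Rightarrow> real \<Rightarrow> real \<Rightarrow>
    (real^'n \<Rightarrow> real) \<Rightarrow> ereal" where
  "G_fun \<Omega> W F \<alpha> c w = ereal (F w) + ereal \<alpha> * TV \<Omega> w + ind_fun (Z_set \<Omega> W c) w"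

text \<open>Here and below \<open>\<Q>\<close> is the TV mesh and \<open>\<R>\<close> the input mesh.\<close>

definition Zh_set :: "(real^'n) set \<Rightarrow> int set \<Rightarrow> real \<Rightarrow> (real^'n) set set \<Rightarrow> (real^'n) set set \<Rightarrow>
    ((real^'n \<Rightarrow> real) \<times> real) set" where
  "Zh_set \<Omega> W c \<Q> \<R> = {(w, V). w \<in> P0 \<R> \<inter> L1_W \<Omega> W \<and>
     TV \<Omega> w \<le> ereal (c * V) \<and> TVh \<Omega> \<Q> w \<le> ereal V}"

definition Gh_fun :: "(real^'n) set \<Rightarrow> int set \<Rightarrow> ((real^'n \<Rightarrow> real) \<Rightarrow> real) \<Rightarrow> real \<Rightarrow> real \<Rightarrow>
    (real^'n) set set \<Rightarrow> (real^'n) set set \<Rightarrow> (real^'n \<Rightarrow> real) \<Rightarrow> real \<Rightarrow> ereal" where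
  "Gh_fun \<Omega> W F \<alpha> c \<Q> \<R> w V =
     ereal (F w) + ereal (\<alpha> * V) + ind_fun (Zh_set \<Omega> W c \<Q> \<R>) (w, V)"

end

(*
  Sample w on the input mesh at the points (lower corner of the cell) + y with a common shift y in
  (0, tau)^d. On average over y, the jumps of the sampled function across the faces, weighted by
  the face area, are the integrals of |w(x + tau e_i) - w(x)| / tau, whose sum over i is at most
  sqrt d TV(w), because the l1 norm in R^d is at most sqrt d times the Euclidean one; the L1
  distance to w is O(tau) on average. Choosing y well for the sum of the jump term and
  sqrt (tau / h) / tau times the distance yields TV(w^tau) <= sqrt d TV(w) (1 + o(1)) together with
  an L1 distance o(h). Admissible Raviart-Thomas fields have divergence at most 2d / h, so
  TV^h(w^tau) and TV^h(w) differ by o(1).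

  TV^h(w) <= TV(w) for bounded w: multiply the field by a cutoff that varies in a boundary layer of
  width delta, and mollify the product. The cutoff has gradient O(1 / delta), but away from the
  edges it varies only in the direction normal to a boundary face, where that component of the field
  is O(delta); the neighbourhoods of the edges have volume O(delta^2). So the term that the cutoff
  adds to the divergence tends to 0 in L1. Hence V^h = TV(w) + O(sqrt (tau / h))
  is admissible and tends to TV(w).

  The measures Dw appear in the weak-* convergence, so they must be constructed: they are limits of
  the mollified gradients, by Helly's selection theorem transported along a space-filling curve.
*)
theory Submission
  imports Defs "HOL-Probability.Helly_Selection"
begin

text \<open>One shift y must serve two purposes. The weight sqrt (tau / h) balances them: it tends
  to 0, so the jump term keeps the sharp factor sqrt d in the limit, but slowly enough that the L1
  error, at most a constant times sqrt (tau / h) h, is still small after division by h. If c equals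
  sqrt d, the relative surplus 2^d sqrt (tau / h) in the variation of the sample finds no room in c;
  it is absorbed by the surplus of V^h over TV(w), which has the larger coefficient. TV^h(w) <=
  TV(w) is not an inclusion of test fields: Raviart-Thomas fields jump tangentially across faces,
  and on the boundary only their normal component vanishes. Hence the inequality for TV is extended
  to bounded fields with compact support and bounded weak divergence; the error of mollifying them
  is controlled by the variation of w, not by regularity of the field. The values of w are given up
  to null sets, while sampling needs points and translations need the whole space. All estimates are
  therefore made for a Borel representative that is extended by zero outside the domain.\<close>

section \<open>Translations and reflections of Lebesgue measure\<close>

lemma lborel_distr_translate: "distr lborel borel (\<lambda>x. x + c) = (lborel :: 'a::euclidean_space measure)"
proof -
  have "(\<lambda>x. x + c) = (+) c" by (auto simp: add.commute)
  then show ?thesis using lborel_distr_plus[of c] by simp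
qed

lemma lborel_distr_reflect: "distr lborel borel (\<lambda>x. c - x) = (lborel :: 'a::euclidean_space measure)"
  using lborel_affine[of "-1::real" c] by (simp add: density_1)

lemma lborel_integral_translate:
  fixes f :: "'a::euclidean_space \<Rightarrow> 'b::{banach,second_countable_topology}"
  assumes [measurable]: "f \<in> borel_measurable borel"
  shows "(LINT x|lborel. f (x + c)) = (LINT x|lborel. f x)"
  by (subst (2) lborel_distr_translate[symmetric, of c]) (simp add: integral_distr)

lemma lborel_integral_reflect:
  fixes f :: "'a::euclidean_space \<Rightarrow> 'b::{banach,second_countable_topology}"
  assumes [measurable]: "f \<in> borel_measurable borel"
  shows "(LINT x|lborel. f (c - x)) = (LINT x|lborel. f x)"
  by (subst (2) lborel_distr_reflect[symmetric, of c]) (simp add: integral_distr)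

lemma lborel_integrable_translate:
  fixes f :: "'a::euclidean_space \<Rightarrow> 'b::{banach,second_countable_topology}"
  assumes "integrable lborel f"
  shows "integrable lborel (\<lambda>x. f (x + c))"
proof -
  have [measurable]: "f \<in> borel_measurable borel" using assms by auto
  have "integrable (distr lborel borel (\<lambda>x. x + c)) f" using assms by (simp add: lborel_distr_translate)
  then show ?thesis by (subst (asm) integrable_distr_eq) auto
qed

lemma lborel_integrable_reflect:
  fixes f :: "'a::euclidean_space \<Rightarrow> 'b::{banach,second_countable_topology}"
  assumes "integrable lborel f"
  shows "integrable lborel (\<lambda>x. f (c - x))"
proof -
  have [measurable]: "f \<in> borel_measurable borel" using assms by auto
  have "integrable (distr lborel borel (\<lambda>x. c - x)) f" using assms by (simp add: lborel_distr_reflect)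
  then show ?thesis by (subst (asm) integrable_distr_eq) auto
qed

lemma integrable_lborel_bounded_support:
  fixes f :: "'a::euclidean_space \<Rightarrow> 'b::{banach,second_countable_topology}"
  assumes [measurable]: "f \<in> borel_measurable borel" and "\<And>x. norm (f x) \<le> B"
    and "bounded K" and "\<And>x. x \<notin> K \<Longrightarrow> f x = 0"
  shows "integrable lborel f"
proof -
  obtain R where R: "K \<subseteq> cball 0 R" using bounded_subset_ballD[OF \<open>bounded K\<close>, of 0] ball_subset_cball by (metis order_trans)
  have "integrable lborel (\<lambda>x. B * indicator (cball (0::'a) R) x)"
    by (intro integrable_mult_right integrable_real_indicator) (auto simp: emeasure_bounded_finite[unfolded infinity_ennreal_def])
  then show ?thesis
  proof (rule Bochner_Integration.integrable_bound)
    show "AE x in lborel. norm (f x) \<le> norm (B * indicator (cball 0 R) x)"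
    proof (rule AE_I2)
      fix x
      show "norm (f x) \<le> norm (B * indicator (cball 0 R) x)"
        using assms(2)[of x] assms(4)[of x] R by (cases "x \<in> cball 0 R") (auto simp: indicator_def subset_iff)
    qed
  qed simp
qed

subsection \<open>Test functions\<close>

lemma C1cI:
  fixes \<phi> :: "real^'n \<Rightarrow> 'b::real_normed_vector"
  assumes "\<And>x. (\<phi> has_derivative D x) (at x)"
    and "\<And>i. continuous_on UNIV (\<lambda>x. D x (axis i 1))"
    and "compact K" "K \<subseteq> \<Omega>" "\<And>x. x \<notin> K \<Longrightarrow> \<phi> x = 0"
  shows "\<phi> \<in> C1c \<Omega>"
proof -
  have "frechet_derivative \<phi> (at x) = D x" for x
    using frechet_derivative_at[OF assms(1)] by simp
  then show ?thesis using assms unfolding C1c_def differentiable_def by auto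
qed

lemma C1c_has_derivative:
  "\<phi> \<in> C1c \<Omega> \<Longrightarrow> (\<phi> has_derivative frechet_derivative \<phi> (at x)) (at x)"
  unfolding C1c_def by (simp add: frechet_derivative_works)

lemma C1c_mono: "\<phi> \<in> C1c U \<Longrightarrow> U \<subseteq> V \<Longrightarrow> \<phi> \<in> C1c V"
  unfolding C1c_def by blast

lemma C1c_continuous: "\<phi> \<in> C1c \<Omega> \<Longrightarrow> continuous_on S \<phi>"
  by (meson C1c_has_derivative continuous_at_imp_continuous_on has_derivative_continuous)

lemma axis_expand: "(v :: real^'n) = (\<Sum>i\<in>UNIV. (v $ i) *\<^sub>R axis i 1)"
  by (metis basis_expansion scalar_mult_eq_scaleR)

lemma C1c_deriv_expand:
  fixes \<phi> :: "real^'n \<Rightarrow> 'b::real_normed_vector"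
  assumes "\<phi> \<in> C1c \<Omega>"
  shows "frechet_derivative \<phi> (at x) v = (\<Sum>i\<in>UNIV. v $ i *\<^sub>R frechet_derivative \<phi> (at x) (axis i 1))"
proof -
  have l: "linear (frechet_derivative \<phi> (at x))"
    using C1c_has_derivative[OF assms] has_derivative_linear by blast
  have "frechet_derivative \<phi> (at x) v = frechet_derivative \<phi> (at x) (\<Sum>i\<in>UNIV. (v $ i) *\<^sub>R axis i 1)"
    using axis_expand[of v] by simp
  also have "\<dots> = (\<Sum>i\<in>UNIV. v $ i *\<^sub>R frechet_derivative \<phi> (at x) (axis i 1))"
    by (simp add: linear_sum[OF l] linear_cmul[OF l])
  finally show ?thesis .
qed

lemma C1c_deriv_continuous:
  fixes \<phi> :: "real^'n \<Rightarrow> 'b::real_normed_vector"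
  assumes "\<phi> \<in> C1c \<Omega>"
  shows "continuous_on S (\<lambda>x. frechet_derivative \<phi> (at x) v)"
proof -
  have "continuous_on S (\<lambda>x. \<Sum>i\<in>UNIV. v $ i *\<^sub>R frechet_derivative \<phi> (at x) (axis i 1))"
    using assms unfolding C1c_def
    by (intro continuous_intros) (auto intro: continuous_on_subset)
  then show ?thesis by (subst C1c_deriv_expand[OF assms])
qed

lemma C1c_support:
  fixes \<phi> :: "real^'n \<Rightarrow> 'b::real_normed_vector"
  assumes "\<phi> \<in> C1c \<Omega>"
  obtains K where "compact K" "K \<subseteq> \<Omega>" "\<And>x. x \<notin> K \<Longrightarrow> \<phi> x = 0"
    "\<And>x v. x \<notin> K \<Longrightarrow> frechet_derivative \<phi> (at x) v = 0"
proof -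
  obtain K where K: "compact K" "K \<subseteq> \<Omega>" "\<And>x. x \<notin> K \<Longrightarrow> \<phi> x = 0"
    using assms unfolding C1c_def by blast
  have "frechet_derivative \<phi> (at x) v = 0" if "x \<notin> K" for x v
  proof -
    have "(\<phi> has_derivative (\<lambda>h. 0)) (at x)"
    proof (rule has_derivative_transform_within_open[of "\<lambda>x. 0" _ _ UNIV "- K"])
      show "open (- K)" using compact_imp_closed[OF K(1)] by auto
    qed (use K that in auto)
    then have "(\<lambda>h. 0) = frechet_derivative \<phi> (at x)" by (rule frechet_derivative_at)
    then show ?thesis by metis
  qed
  then show ?thesis using that K by blast
qed

lemma C1c_deriv_bounded:
  fixes \<phi> :: "real^'n \<Rightarrow> 'b::real_normed_vector"
  assumes "\<phi> \<in> C1c \<Omega>"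
  obtains B where "0 \<le> B" "\<And>x v. norm (frechet_derivative \<phi> (at x) v) \<le> B * norm v"
proof -
  obtain K where K: "compact K" "\<And>x v. x \<notin> K \<Longrightarrow> frechet_derivative \<phi> (at x) v = 0"
    using C1c_support[OF assms] by metis
  have "\<exists>B. \<forall>x. norm (frechet_derivative \<phi> (at x) (axis i 1)) \<le> B" for i
  proof -
    have "compact ((\<lambda>x. frechet_derivative \<phi> (at x) (axis i 1)) ` K)"
      by (intro compact_continuous_image C1c_deriv_continuous[OF assms] K)
    from compact_imp_bounded[OF this] obtain B
      where B: "\<And>x. x \<in> K \<Longrightarrow> norm (frechet_derivative \<phi> (at x) (axis i 1)) \<le> B"
      unfolding bounded_iff by blast
    have "norm (frechet_derivative \<phi> (at x) (axis i 1)) \<le> max B 0" for x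
      using B[of x] K(2)[of x "axis i 1"] by (cases "x \<in> K") auto
    then show ?thesis by blast
  qed
  then obtain B where B: "\<And>i x. norm (frechet_derivative \<phi> (at x) (axis i 1)) \<le> B i" by metis
  have Bn: "0 \<le> B i" for i using B[of undefined i] norm_ge_zero order_trans by blast
  have "norm (frechet_derivative \<phi> (at x) v) \<le> (\<Sum>i\<in>UNIV. B i) * norm v" for x v
  proof -
    have "norm (frechet_derivative \<phi> (at x) v) \<le> (\<Sum>i\<in>UNIV. norm (v $ i *\<^sub>R frechet_derivative \<phi> (at x) (axis i 1)))"
      by (subst C1c_deriv_expand[OF assms]) (rule norm_sum)
    also have "\<dots> \<le> (\<Sum>i\<in>UNIV. norm v * B i)"
      by (rule sum_mono) (auto intro!: mult_mono B simp: component_le_norm_cart)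
    finally show ?thesis by (simp add: sum_distrib_left mult.commute)
  qed
  then show ?thesis using that[of "\<Sum>i\<in>UNIV. B i"] Bn by (simp add: sum_nonneg)
qed

lemma C1c_lipschitz:
  fixes \<phi> :: "real^'n \<Rightarrow> 'b::real_normed_vector"
  assumes "\<phi> \<in> C1c \<Omega>" and "0 \<le> B" and B: "\<And>x v. norm (frechet_derivative \<phi> (at x) v) \<le> B * norm v"
  shows "norm (\<phi> (x + v) - \<phi> x) \<le> B * norm v"
proof -
  have "norm (\<phi> (x + v) - \<phi> x) \<le> B * norm ((x + v) - x)"
  proof (rule differentiable_bound[where S=UNIV and f'="\<lambda>x. frechet_derivative \<phi> (at x)"])
    show "onorm (frechet_derivative \<phi> (at y)) \<le> B" for y
      using B \<open>0 \<le> B\<close> by (intro onorm_bound) auto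
  qed (use C1c_has_derivative[OF assms(1)] in auto)
  then show ?thesis by simp
qed

lemma C1c_measurable:
  fixes \<phi> :: "real^'n \<Rightarrow> 'b::real_normed_vector"
  assumes "\<phi> \<in> C1c \<Omega>"
  shows "\<phi> \<in> borel_measurable borel"
  using C1c_continuous[OF assms] by (rule borel_measurable_continuous_onI)

lemma C1c_deriv_measurable:
  fixes \<phi> :: "real^'n \<Rightarrow> 'b::real_normed_vector"
  assumes "\<phi> \<in> C1c \<Omega>"
  shows "(\<lambda>x. frechet_derivative \<phi> (at x) v) \<in> borel_measurable borel"
  using C1c_deriv_continuous[OF assms] by (rule borel_measurable_continuous_onI)

lemma C1c_bounded:
  fixes \<phi> :: "real^'n \<Rightarrow> 'b::real_normed_vector"
  assumes "\<phi> \<in> C1c \<Omega>"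
  obtains B where "0 \<le> B" "\<And>x. norm (\<phi> x) \<le> B"
proof -
  obtain K where K: "compact K" "\<And>x. x \<notin> K \<Longrightarrow> \<phi> x = 0"
    using C1c_support[OF assms] by metis
  have "compact (\<phi> ` K)" by (intro compact_continuous_image C1c_continuous[OF assms] K)
  from compact_imp_bounded[OF this] obtain B where B: "\<And>x. x \<in> K \<Longrightarrow> norm (\<phi> x) \<le> B"
    unfolding bounded_iff by blast
  have "norm (\<phi> x) \<le> max B 0" for x using B[of x] K(2)[of x] by (cases "x \<in> K") auto
  then show ?thesis using that[of "max B 0"] by auto
qed

lemma C1c_deriv_integrable:
  fixes \<phi> :: "real^'n \<Rightarrow> 'b::{banach,second_countable_topology}"
  assumes "\<phi> \<in> C1c \<Omega>"
  shows "integrable lborel (\<lambda>x. frechet_derivative \<phi> (at x) v)"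
proof -
  obtain K where K: "compact K" "\<And>x v. x \<notin> K \<Longrightarrow> frechet_derivative \<phi> (at x) v = 0"
    using C1c_support[OF assms] by metis
  obtain B where B: "\<And>x v. norm (frechet_derivative \<phi> (at x) v) \<le> B * norm v"
    using C1c_deriv_bounded[OF assms] by metis
  show ?thesis
    using C1c_deriv_measurable[OF assms] B compact_imp_bounded[OF K(1)] K(2)
    by (rule integrable_lborel_bounded_support)
qed

lemma C1c_integrable:
  fixes \<phi> :: "real^'n \<Rightarrow> 'b::{banach,second_countable_topology}"
  assumes "\<phi> \<in> C1c \<Omega>"
  shows "integrable lborel \<phi>"
proof -
  obtain K where K: "compact K" "\<And>x. x \<notin> K \<Longrightarrow> \<phi> x = 0" using C1c_support[OF assms] by metis
  obtain B where B: "\<And>x. norm (\<phi> x) \<le> B" using C1c_bounded[OF assms] by metis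
  show ?thesis
    using C1c_measurable[OF assms] B compact_imp_bounded[OF K(1)] K(2)
    by (rule integrable_lborel_bounded_support)
qed

lemma C1c_component:
  fixes \<phi> :: "real^'n \<Rightarrow> real^'m"
  assumes "\<phi> \<in> C1c \<Omega>"
  shows "(\<lambda>x. \<phi> x $ i) \<in> C1c \<Omega>"
    and "frechet_derivative (\<lambda>x. \<phi> x $ i) (at x) v = frechet_derivative \<phi> (at x) v $ i"
proof -
  have d: "((\<lambda>x. \<phi> x $ i) has_derivative (\<lambda>v. frechet_derivative \<phi> (at x) v $ i)) (at x)" for x
    by (rule bounded_linear.has_derivative[OF bounded_linear_vec_nth C1c_has_derivative[OF assms]])
  show "frechet_derivative (\<lambda>x. \<phi> x $ i) (at x) v = frechet_derivative \<phi> (at x) v $ i"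
    using frechet_derivative_at[OF d] by metis
  obtain K where K: "compact K" "K \<subseteq> \<Omega>" "\<And>x. x \<notin> K \<Longrightarrow> \<phi> x = 0" using C1c_support[OF assms] by metis
  show "(\<lambda>x. \<phi> x $ i) \<in> C1c \<Omega>"
    by (rule C1cI[OF d _ K(1,2)])
      (auto intro!: continuous_intros C1c_deriv_continuous[OF assms] simp: K(3))
qed

lemma C1c_mult:
  fixes f g :: "real^'n \<Rightarrow> real"
  assumes f: "f \<in> C1c \<Omega>" and g: "\<And>x. (g has_derivative D x) (at x)"
    and Dg: "\<And>v. continuous_on UNIV (\<lambda>x. D x v)"
  shows "(\<lambda>x. f x * g x) \<in> C1c \<Omega>"
    and "frechet_derivative (\<lambda>x. f x * g x) (at x) v = frechet_derivative f (at x) v * g x + f x * D x v"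
proof -
  have d: "((\<lambda>x. f x * g x) has_derivative (\<lambda>v. f x * D x v + frechet_derivative f (at x) v * g x)) (at x)" for x
    by (rule has_derivative_mult[OF C1c_has_derivative[OF f] g])
  show "frechet_derivative (\<lambda>x. f x * g x) (at x) v = frechet_derivative f (at x) v * g x + f x * D x v"
    using frechet_derivative_at[OF d] by (metis add.commute)
  obtain K where K: "compact K" "K \<subseteq> \<Omega>" "\<And>x. x \<notin> K \<Longrightarrow> f x = 0" using C1c_support[OF f] by metis
  have gc: "continuous_on UNIV g"
    by (meson g continuous_at_imp_continuous_on has_derivative_continuous)
  show "(\<lambda>x. f x * g x) \<in> C1c \<Omega>"
    by (rule C1cI[OF d _ K(1,2)])
      (auto intro!: continuous_intros C1c_deriv_continuous[OF f] C1c_continuous[OF f] gc Dg simp: K(3))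
qed

lemma C1c_cmult:
  fixes f :: "real^'n \<Rightarrow> real"
  assumes f: "f \<in> C1c \<Omega>"
  shows "(\<lambda>x. c * f x) \<in> C1c \<Omega>"
    and "frechet_derivative (\<lambda>x. c * f x) (at x) v = c * frechet_derivative f (at x) v"
  using C1c_mult[OF f, of "\<lambda>_. c" "\<lambda>_ _. 0"] by (simp_all add: mult.commute)

lemma C1c_sum_scaleR:
  fixes f :: "'j \<Rightarrow> real^'n \<Rightarrow> real" and b :: "'j \<Rightarrow> 'b::real_normed_vector"
  assumes f: "\<And>j. j \<in> J \<Longrightarrow> f j \<in> C1c \<Omega>" and "finite J"
  shows "(\<lambda>x. \<Sum>j\<in>J. f j x *\<^sub>R b j) \<in> C1c \<Omega>"
    and "frechet_derivative (\<lambda>x. \<Sum>j\<in>J. f j x *\<^sub>R b j) (at x) v = (\<Sum>j\<in>J. frechet_derivative (f j) (at x) v *\<^sub>R b j)"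
proof -
  have d: "((\<lambda>x. \<Sum>j\<in>J. f j x *\<^sub>R b j) has_derivative (\<lambda>v. \<Sum>j\<in>J. frechet_derivative (f j) (at x) v *\<^sub>R b j)) (at x)" for x
    by (intro has_derivative_sum has_derivative_scaleR_left C1c_has_derivative[OF f])
  show "frechet_derivative (\<lambda>x. \<Sum>j\<in>J. f j x *\<^sub>R b j) (at x) v = (\<Sum>j\<in>J. frechet_derivative (f j) (at x) v *\<^sub>R b j)"
    by (rule fun_cong[OF frechet_derivative_at[OF d], symmetric])
  have "\<exists>K. compact K \<and> K \<subseteq> \<Omega> \<and> (\<forall>x. x \<notin> K \<longrightarrow> f j x = 0)" if "j \<in> J" for j
    using f[OF that] unfolding C1c_def by blast
  then obtain K where K: "\<And>j. j \<in> J \<Longrightarrow> compact (K j) \<and> K j \<subseteq> \<Omega> \<and> (\<forall>x. x \<notin> K j \<longrightarrow> f j x = 0)" by metis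
  show "(\<lambda>x. \<Sum>j\<in>J. f j x *\<^sub>R b j) \<in> C1c \<Omega>"
  proof (rule C1cI[OF d])
    show "compact (\<Union>j\<in>J. K j)" using K \<open>finite J\<close> by (intro compact_UN) auto
    show "(\<Union>j\<in>J. K j) \<subseteq> \<Omega>" using K by auto
    show "(\<Sum>j\<in>J. f j x *\<^sub>R b j) = 0" if "x \<notin> (\<Union>j\<in>J. K j)" for x
      using K that by (intro sum.neutral) auto
    show "continuous_on UNIV (\<lambda>x. \<Sum>j\<in>J. frechet_derivative (f j) (at x) (axis i 1) *\<^sub>R b j)" for i
      by (intro continuous_intros C1c_deriv_continuous[OF f])
  qed
qed

text \<open>Dominated convergence: the quotients are bounded by the Lipschitz constant of \<psi>,
  and for t \<le> 1 they vanish outside a ball of radius R + norm v. For a step function u this lets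
  a derivative of \<psi> be replaced by a shift of u.\<close>

lemma difference_quotient_limit:
  fixes \<psi> :: "real^'n \<Rightarrow> real"
  assumes \<psi>: "\<psi> \<in> C1c \<Omega>" and [measurable]: "u \<in> borel_measurable borel" and M: "\<And>x. \<bar>u x\<bar> \<le> M"
    and t: "t \<longlonglongrightarrow> 0" "\<And>n. 0 < t n" "\<And>n. t n \<le> (1::real)"
  shows "(\<lambda>n. LINT x|lborel. u x * ((\<psi> (x + t n *\<^sub>R v) - \<psi> x) / t n))
    \<longlonglongrightarrow> (LINT x|lborel. u x * frechet_derivative \<psi> (at x) v)"
proof -
  obtain B where B: "0 \<le> B" "\<And>x v. norm (frechet_derivative \<psi> (at x) v) \<le> B * norm v"
    using C1c_deriv_bounded[OF \<psi>] by metis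
  obtain K where K: "compact K" "\<And>x. x \<notin> K \<Longrightarrow> \<psi> x = 0" using C1c_support[OF \<psi>] by metis
  obtain R where R: "K \<subseteq> cball 0 R" using bounded_subset_ballD[OF compact_imp_bounded[OF K(1)], of 0] ball_subset_cball by (metis order_trans)
  have M0: "0 \<le> M" using M[of undefined] by linarith
  have [measurable]: "\<psi> \<in> borel_measurable borel" by (rule C1c_measurable[OF \<psi>])
  have [measurable]: "(\<lambda>x. frechet_derivative \<psi> (at x) v) \<in> borel_measurable borel"
    by (rule C1c_deriv_measurable[OF \<psi>])
  define w where "w x = (M * (B * norm v)) * indicator (cball (0::real^'n) (R + norm v)) x" for x
  show ?thesis
  proof (rule integral_dominated_convergence[where w=w])
    show "integrable lborel w" unfolding w_def
      by (intro integrable_mult_right integrable_real_indicator) (auto simp: emeasure_bounded_finite[unfolded infinity_ennreal_def])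
    show "AE x in lborel. norm (u x * ((\<psi> (x + t n *\<^sub>R v) - \<psi> x) / t n)) \<le> w x" for n
    proof (rule AE_I2)
      fix x
      show "norm (u x * ((\<psi> (x + t n *\<^sub>R v) - \<psi> x) / t n)) \<le> w x"
      proof (cases "x \<in> cball 0 (R + norm v)")
        case True
        have "norm (\<psi> (x + t n *\<^sub>R v) - \<psi> x) \<le> B * norm (t n *\<^sub>R v)" by (rule C1c_lipschitz[OF \<psi> B])
        then have "\<bar>(\<psi> (x + t n *\<^sub>R v) - \<psi> x) / t n\<bar> \<le> B * norm v" using t(2)[of n]
          by (simp add: field_simps)
        then have "\<bar>u x\<bar> * \<bar>(\<psi> (x + t n *\<^sub>R v) - \<psi> x) / t n\<bar> \<le> M * (B * norm v)"
          using M[of x] M0 by (intro mult_mono) auto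
        then show ?thesis using True by (simp add: w_def abs_mult)
      next
        case False
        have "t n * norm v \<le> norm v" using mult_right_mono[OF t(3)[of n] norm_ge_zero[of v]] by simp
        then have "norm (x + t n *\<^sub>R v) > R"
          using False norm_triangle_ineq4[of "x + t n *\<^sub>R v" "t n *\<^sub>R v"] t(2)[of n] by auto
        then have "\<psi> (x + t n *\<^sub>R v) = 0" using K(2) R by fastforce
        moreover have "norm x > R + norm v" using False by simp
        then have "norm x > R" using norm_ge_zero[of v] by linarith
        then have "\<psi> x = 0" using K(2) R by fastforce
        ultimately show ?thesis by (simp add: w_def M0 B)
      qed
    qed
    show "AE x in lborel. (\<lambda>n. u x * ((\<psi> (x + t n *\<^sub>R v) - \<psi> x) / t n)) \<longlonglongrightarrow> u x * frechet_derivative \<psi> (at x) v"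
    proof (rule AE_I2, rule tendsto_mult_left)
      fix x
      define g where "g = (\<lambda>s. \<psi> (x + s *\<^sub>R v))"
      have "(g has_derivative (\<lambda>s. frechet_derivative \<psi> (at x) (s *\<^sub>R v))) (at 0)"
        unfolding g_def
        by (rule has_derivative_compose[of "\<lambda>s. x + s *\<^sub>R v" "\<lambda>s. s *\<^sub>R v" 0 UNIV \<psi>, unfolded o_def])
          (use C1c_has_derivative[OF \<psi>, of x] in \<open>auto intro!: derivative_eq_intros\<close>)
      moreover have "frechet_derivative \<psi> (at x) (s *\<^sub>R v) = s * frechet_derivative \<psi> (at x) v" for s
        using linear_cmul[OF has_derivative_linear[OF C1c_has_derivative[OF \<psi>]]] by simp
      ultimately have "(g has_field_derivative frechet_derivative \<psi> (at x) v) (at 0)"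
        by (simp add: has_field_derivative_def mult_commute_abs)
      then have lim: "((\<lambda>s. (g s - g 0) / (s - 0)) \<longlongrightarrow> frechet_derivative \<psi> (at x) v) (at 0)"
        by (simp add: has_field_derivative_iff)
      have "filterlim t (at 0) sequentially"
        using t by (auto simp: filterlim_at less_imp_neq[symmetric] intro!: always_eventually)
      from filterlim_compose[OF lim this]
      show "(\<lambda>n. (\<psi> (x + t n *\<^sub>R v) - \<psi> x) / t n) \<longlonglongrightarrow> frechet_derivative \<psi> (at x) v"
        by (simp add: g_def)
    qed
  qed simp_all
qed

text \<open>The integrals of the difference quotients are zero by translation invariance, and the
  derivative inherits this in the limit.\<close>

lemma C1c_integral_deriv_zero:
  fixes \<psi> :: "real^'n \<Rightarrow> real"
  assumes \<psi>: "\<psi> \<in> C1c \<Omega>"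
  shows "(LINT x|lborel. frechet_derivative \<psi> (at x) v) = 0"
proof -
  define t where "t n = inverse (real (Suc n))" for n
  have t: "t \<longlonglongrightarrow> 0" "\<And>n. 0 < t n" "\<And>n. t n \<le> 1"
    unfolding t_def using LIMSEQ_inverse_real_of_nat by (auto simp: field_simps)
  have "(\<lambda>n. LINT x|lborel. 1 * ((\<psi> (x + t n *\<^sub>R v) - \<psi> x) / t n))
    \<longlonglongrightarrow> (LINT x|lborel. 1 * frechet_derivative \<psi> (at x) v)"
    by (rule difference_quotient_limit[OF \<psi> _ _ t, of _ 1]) auto
  moreover have "(LINT x|lborel. 1 * ((\<psi> (x + t n *\<^sub>R v) - \<psi> x) / t n)) = 0" for n
  proof -
    have "(LINT x|lborel. 1 * ((\<psi> (x + t n *\<^sub>R v) - \<psi> x) / t n))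
      = ((LINT x|lborel. \<psi> (x + t n *\<^sub>R v)) - (LINT x|lborel. \<psi> x)) / t n"
      using C1c_integrable[OF \<psi>] lborel_integrable_translate[OF C1c_integrable[OF \<psi>]] by simp
    then show ?thesis using lborel_integral_translate[OF C1c_measurable[OF \<psi>]] by simp
  qed
  ultimately have "(\<lambda>n. 0) \<longlonglongrightarrow> (LINT x|lborel. 1 * frechet_derivative \<psi> (at x) v)" by (simp only:)
  then have "0 = (LINT x|lborel. 1 * frechet_derivative \<psi> (at x) v)" by (rule LIMSEQ_unique[OF tendsto_const])
  then show ?thesis by simp
qed

subsection \<open>Mollification\<close>

text \<open>Squaring the truncated paraboloid makes it continuously differentiable, which is all
  that \<open>C1c\<close> demands; the polynomial form gives an explicit gradient
  (\<open>bump_grad\<close>) and an explicit second order remainder.\<close>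

definition bump :: "real \<Rightarrow> 'a::real_inner \<Rightarrow> real" where
  "bump e x = (max 0 (e\<^sup>2 - x \<bullet> x))\<^sup>2"

definition bump_grad :: "real \<Rightarrow> 'a::real_inner \<Rightarrow> 'a" where
  "bump_grad e x = (- 4 * max 0 (e\<^sup>2 - x \<bullet> x)) *\<^sub>R x"

lemma lborel_norm_integral_le:
  fixes f :: "'a \<Rightarrow> 'b::{banach,second_countable_topology}"
  assumes f: "integrable M f" and g: "integrable M g" and "\<And>x. norm (f x) \<le> g x"
  shows "norm (LINT x|M. f x) \<le> (LINT x|M. g x)"
  using integral_norm_bound[of M f] integral_mono[OF integrable_norm[OF f] g] assms(3) by (meson order_trans)

lemma bump_outside:
  assumes "0 < e" "e \<le> norm x"
  shows "bump e x = 0" "bump_grad e x = 0"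
proof -
  have "e\<^sup>2 \<le> x \<bullet> x" using assms by (simp add: power_mono flip: power2_norm_eq_inner)
  then show "bump e x = 0" "bump_grad e x = 0" by (auto simp: bump_def bump_grad_def max_def)
qed

lemma bump_nonneg: "0 \<le> bump e x"
  by (simp add: bump_def)

lemma max_bump_le: "max 0 (e\<^sup>2 - x \<bullet> x) \<le> e\<^sup>2"
  by simp

lemma bump_le: "bump e x \<le> (e\<^sup>2)\<^sup>2"
  unfolding bump_def by (rule power_mono) auto

lemma bump_grad_le:
  assumes "0 < e"
  shows "norm (bump_grad e x) \<le> 4 * e ^ 3"
proof (cases "e \<le> norm x")
  case True
  then show ?thesis using bump_outside(2)[OF assms True] assms by simp
next
  case False
  have "norm (bump_grad e x) = (4 * max 0 (e\<^sup>2 - x \<bullet> x)) * norm x"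
    by (simp add: bump_grad_def abs_mult)
  also have "\<dots> \<le> (4 * e\<^sup>2) * e" using False by (intro mult_mono) auto
  finally show ?thesis by (simp add: power2_eq_square power3_eq_cube)
qed

text \<open>The square of max 0 s has the 2-Lipschitz derivative 2 max 0 s, so an increment u of s
  leaves a remainder of at most u^2. Here u has a part linear in v, which produces the gradient, and
  the part - v \<bullet> v, whose contribution is the summand 2 e^2. The condition norm v \<le> 1
  bounds u by a multiple of norm v and makes all terms vanish once norm x > e + 1.\<close>

lemma bump_taylor:
  assumes e: "0 < e" and v: "norm v \<le> 1"
  shows "\<bar>bump e (x + v) - bump e x - bump_grad e x \<bullet> v\<bar> \<le> ((2 * e + 3)\<^sup>2 + 2 * e\<^sup>2) * (norm v)\<^sup>2"
proof (cases "norm x \<le> e + 1")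
  case True
  define s where "s = e\<^sup>2 - x \<bullet> x"
  define u where "u = - (2 * (x \<bullet> v) + v \<bullet> v)"
  have su: "e\<^sup>2 - (x + v) \<bullet> (x + v) = s + u"
    by (simp add: s_def u_def inner_add_left inner_add_right inner_commute)
  have q: "\<bar>(max 0 (s + u))\<^sup>2 - (max 0 s)\<^sup>2 - 2 * max 0 s * u\<bar> \<le> u\<^sup>2"
  proof -
    consider "0 \<le> s" "0 \<le> s + u" | "0 \<le> s" "s + u < 0" | "s < 0" "0 \<le> s + u" | "s < 0" "s + u < 0" by linarith
    then show ?thesis
    proof cases
      case 1 then show ?thesis by (simp add: max_def power2_eq_square algebra_simps)
    next
      case 2
      have "0 \<le> (s + u)\<^sup>2" by simp
      moreover have "s * (s + 2 * u) \<le> 0" using 2 by (intro mult_nonneg_nonpos) auto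
      ultimately show ?thesis using 2 by (simp add: max_def power2_eq_square algebra_simps abs_if)
    next
      case 3
      have "(s + u)\<^sup>2 \<le> u\<^sup>2" using 3 by (intro power_mono) auto
      then show ?thesis using 3 by (simp add: max_def)
    next
      case 4 then show ?thesis by (simp add: max_def)
    qed
  qed
  have "\<bar>u\<bar> \<le> (2 * e + 3) * norm v"
  proof -
    have "\<bar>x \<bullet> v\<bar> \<le> (e + 1) * norm v"
      using Cauchy_Schwarz_ineq2[of x v] mult_right_mono[OF True norm_ge_zero[of v]] by linarith
    moreover have "v \<bullet> v \<le> norm v"
      using v mult_left_mono[OF v norm_ge_zero[of v]] by (simp add: power2_norm_eq_inner[symmetric] power2_eq_square)
    moreover have "0 \<le> v \<bullet> v" by simp
    ultimately have "\<bar>u\<bar> \<le> 2 * ((e + 1) * norm v) + norm v" unfolding u_def by linarith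
    then show ?thesis by (simp add: algebra_simps)
  qed
  then have u2: "u\<^sup>2 \<le> (2 * e + 3)\<^sup>2 * (norm v)\<^sup>2"
    using power_mono[of "\<bar>u\<bar>" "(2 * e + 3) * norm v" 2] by (simp add: power_mult_distrib)
  have "bump e (x + v) - bump e x - bump_grad e x \<bullet> v
      = ((max 0 (s + u))\<^sup>2 - (max 0 s)\<^sup>2 - 2 * max 0 s * u) - 2 * max 0 s * (v \<bullet> v)"
    unfolding bump_def bump_grad_def su by (simp add: s_def u_def algebra_simps)
  moreover have "\<bar>2 * max 0 s * (v \<bullet> v)\<bar> \<le> 2 * e\<^sup>2 * (norm v)\<^sup>2"
    using max_bump_le[of e x] unfolding s_def power2_norm_eq_inner
    by (auto simp: abs_mult intro!: mult_right_mono)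
  ultimately show ?thesis using q u2 unfolding distrib_right by linarith
next
  case False
  have "norm (x + v) \<ge> norm x - norm v" using norm_triangle_ineq4[of "x + v" v] by simp
  then have "norm (x + v) \<ge> e" "norm x \<ge> e" using False v by auto
  then show ?thesis using bump_outside[OF e, of x] bump_outside[OF e, of "x + v"] by simp
qed

lemma bump_continuous: "continuous_on S (bump e)" "continuous_on S (bump_grad e)"
  unfolding bump_def bump_grad_def by (intro continuous_intros)+

definition bump_mass :: "'a::euclidean_space itself \<Rightarrow> real \<Rightarrow> real" where
  "bump_mass T e = (LINT x|(lborel :: 'a measure). bump e x)"

lemma bump_integrable:
  assumes "0 < e"
  shows "integrable lborel (bump e :: 'a::euclidean_space \<Rightarrow> real)"
proof (rule integrable_lborel_bounded_support[where K="cball 0 e" and B="(e\<^sup>2)\<^sup>2"])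
  show "bump e \<in> borel_measurable borel"
    by (rule borel_measurable_continuous_onI) (rule bump_continuous)
  show "norm (bump e x) \<le> (e\<^sup>2)\<^sup>2" for x :: 'a using bump_le[of e x] bump_nonneg[of e x] by simp
  show "bump e x = 0" if "x \<notin> cball 0 e" for x :: 'a using bump_outside(1)[OF assms, of x] that by simp
qed simp

text \<open>On the ball of radius e/2 the difference e^2 - x \<bullet> x is at least (3/4) e^2; its
  square gives the factor 9/16. A lower bound of the right order suffices, since the mass enters as
  a divisor.\<close>

lemma bump_mass_lower:
  assumes e: "0 < e"
  shows "(9/16) * e ^ 4 * measure lborel (ball (0::'a::euclidean_space) (e/2)) \<le> bump_mass TYPE('a) e"
proof -
  have "(LINT x|lborel. ((9/16) * e ^ 4) * indicat_real (ball (0::'a) (e/2)) x) \<le> bump_mass TYPE('a) e"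
    unfolding bump_mass_def
  proof (rule integral_mono)
    show "integrable lborel (\<lambda>x::'a. (9/16) * e ^ 4 * indicat_real (ball 0 (e/2)) x)"
      by (intro integrable_mult_right integrable_real_indicator)
        (auto simp: emeasure_bounded_finite[unfolded infinity_ennreal_def])
    show "integrable lborel (bump e :: 'a \<Rightarrow> real)" by (rule bump_integrable[OF e])
    fix x :: 'a
    show "(9/16) * e ^ 4 * indicat_real (ball 0 (e/2)) x \<le> bump e x"
    proof (cases "norm x < e/2")
      case True
      have "x \<bullet> x \<le> (e/2)\<^sup>2" using True by (simp add: power_mono flip: power2_norm_eq_inner)
      then have "(3/4) * e\<^sup>2 \<le> e\<^sup>2 - x \<bullet> x" by (simp add: power2_eq_square)
      then have "(3/4) * e\<^sup>2 \<le> max 0 (e\<^sup>2 - x \<bullet> x)" by linarith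
      then have "((3/4) * e\<^sup>2)\<^sup>2 \<le> bump e x" unfolding bump_def by (intro power_mono) auto
      then show ?thesis using True by (simp add: power_mult_distrib power2_eq_square power4_eq_xxxx)
    qed (simp add: bump_nonneg)
  qed
  then show ?thesis by (simp add: measure_def)
qed

lemma content_ball_pos: "0 < r \<Longrightarrow> 0 < measure lborel (ball (0::'a::euclidean_space) r)"
  by (simp add: content_ball)

lemma bump_mass_pos: "0 < e \<Longrightarrow> 0 < bump_mass TYPE('a::euclidean_space) e"
proof -
  assume e: "0 < e"
  have "0 < (9/16) * e ^ 4 * measure lborel (ball (0::'a) (e/2))"
    using e content_ball_pos[of "e/2"] by (intro mult_pos_pos) auto
  then show ?thesis using bump_mass_lower[OF e, where 'a='a] by linarith
qed

definition mol :: "real \<Rightarrow> 'a::euclidean_space \<Rightarrow> real" where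
  "mol e x = bump e x / bump_mass TYPE('a) e"

definition mol_grad :: "real \<Rightarrow> 'a::euclidean_space \<Rightarrow> 'a" where
  "mol_grad e x = bump_grad e x /\<^sub>R bump_mass TYPE('a) e"

lemma mol_nonneg: "0 < e \<Longrightarrow> 0 \<le> mol e (x::'a::euclidean_space)"
  using bump_mass_pos[of e, where 'a='a] by (simp add: mol_def bump_nonneg)

lemma mol_outside: "0 < e \<Longrightarrow> e \<le> norm x \<Longrightarrow> mol e x = 0" "0 < e \<Longrightarrow> e \<le> norm x \<Longrightarrow> mol_grad e x = 0"
  by (simp_all add: mol_def mol_grad_def bump_outside)

lemma mol_integrable: "0 < e \<Longrightarrow> integrable lborel (mol e :: 'a::euclidean_space \<Rightarrow> real)"
  unfolding mol_def using bump_integrable by auto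

lemma mol_integral: "0 < e \<Longrightarrow> (LINT x|lborel. mol e (x::'a::euclidean_space)) = 1"
  using bump_mass_pos[of e, where 'a='a] by (simp add: mol_def bump_mass_def)

lemma mol_continuous: "continuous_on S (mol e)" "continuous_on S (mol_grad e)"
  unfolding mol_def mol_grad_def divide_inverse
  by (intro continuous_intros bump_continuous)+

lemma mol_measurable [measurable]:
  "mol e \<in> borel_measurable borel" "mol_grad e \<in> borel_measurable borel"
  by (intro borel_measurable_continuous_onI mol_continuous)+

text \<open>The last bound is a Taylor estimate uniform in the position x; it is what allows a
  convolution with an integrable function to be differentiated.\<close>

lemma mol_bounds:
  fixes e :: real
  assumes "0 < e"
  obtains B where "0 \<le> B" "\<And>x::'a::euclidean_space. mol e x \<le> B" "\<And>x::'a. norm (mol_grad e x) \<le> B"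
    "\<And>(x::'a) v. norm v \<le> 1 \<Longrightarrow> \<bar>mol e (x + v) - mol e x - mol_grad e x \<bullet> v\<bar> \<le> B * (norm v)\<^sup>2"
proof -
  define Z where "Z = bump_mass TYPE('a) e"
  have Z: "0 < Z" unfolding Z_def by (rule bump_mass_pos[OF assms])
  define B where "B = ((e\<^sup>2)\<^sup>2 + 4 * e ^ 3 + ((2 * e + 3)\<^sup>2 + 2 * e\<^sup>2)) / Z"
  show ?thesis
  proof
    show "0 \<le> B" using Z assms by (simp add: B_def)
    show "mol e x \<le> B" for x :: 'a
      using Z bump_le[of e x] assms unfolding mol_def B_def Z_def[symmetric]
      by (intro divide_right_mono) (auto intro!: order_trans[OF bump_le[of e x]])
    have gr: "4 * e ^ 3 \<le> (e\<^sup>2)\<^sup>2 + 4 * e ^ 3 + ((2 * e + 3)\<^sup>2 + 2 * e\<^sup>2)" by simp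
    show "norm (mol_grad e x) \<le> B" for x :: 'a
    proof -
      have "norm (mol_grad e x) = norm (bump_grad e x) / Z"
        using Z by (simp add: mol_grad_def Z_def divide_inverse mult.commute)
      also have "\<dots> \<le> B" unfolding B_def
        using Z order_trans[OF bump_grad_le[OF assms, of x] gr] by (intro divide_right_mono) auto
      finally show ?thesis .
    qed
    show "\<bar>mol e (x + v) - mol e x - mol_grad e x \<bullet> v\<bar> \<le> B * (norm v)\<^sup>2" if "norm v \<le> 1" for x v :: 'a
    proof -
      have "mol e (x + v) - mol e x - mol_grad e x \<bullet> v = (bump e (x + v) - bump e x - bump_grad e x \<bullet> v) / Z"
        by (simp add: mol_def mol_grad_def Z_def divide_inverse algebra_simps)
      then have "\<bar>mol e (x + v) - mol e x - mol_grad e x \<bullet> v\<bar> = \<bar>bump e (x + v) - bump e x - bump_grad e x \<bullet> v\<bar> / Z"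
        using Z by simp
      also have "\<dots> \<le> ((2 * e + 3)\<^sup>2 + 2 * e\<^sup>2) * (norm v)\<^sup>2 / Z"
        using bump_taylor[OF assms that, of x] Z by (intro divide_right_mono) auto
      also have "\<dots> = ((2 * e + 3)\<^sup>2 + 2 * e\<^sup>2) / Z * (norm v)\<^sup>2" by simp
      also have "\<dots> \<le> B * (norm v)\<^sup>2"
        unfolding B_def using Z assms by (intro mult_right_mono divide_right_mono) auto
      finally show ?thesis .
    qed
  qed
qed

text \<open>The gradient is at most 4 e^3 / Z on the ball of radius e, which has 2^d times the
  volume of the ball of radius e/2 that bounds the mass Z from below. The constant is 4 * 16/9 =
  64/9, rounded up to 8; it reappears in the gradient bound of the boundary cutoff.\<close>

lemma mol_grad_integral_bound:
  fixes e :: real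
  assumes e: "0 < e"
  shows "integrable lborel (mol_grad e :: 'a::euclidean_space \<Rightarrow> 'a)"
    and "(LINT x|lborel. norm (mol_grad e (x::'a))) \<le> 8 * 2 ^ DIM('a) / e"
proof -
  define Z where "Z = bump_mass TYPE('a) e"
  have Z: "0 < Z" unfolding Z_def by (rule bump_mass_pos[OF assms])
  obtain B where B: "\<And>x::'a. norm (mol_grad e x) \<le> B" using mol_bounds[OF e, where 'a='a] by metis
  show int: "integrable lborel (mol_grad e :: 'a \<Rightarrow> 'a)"
    by (rule integrable_lborel_bounded_support[where K="cball 0 e" and B=B]) (use B mol_outside(2)[OF e, where 'a='a] in \<open>auto simp: not_le less_imp_le\<close>)
  have "(LINT x|lborel. norm (mol_grad e (x::'a))) \<le> (LINT x|lborel. (4 * e ^ 3 / Z) * indicat_real (ball (0::'a) e) x)"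
  proof (rule integral_mono)
    show "integrable lborel (\<lambda>x::'a. norm (mol_grad e x))" using int by (rule integrable_norm)
    show "integrable lborel (\<lambda>x::'a. 4 * e ^ 3 / Z * indicat_real (ball 0 e) x)"
      by (intro integrable_mult_right integrable_real_indicator)
        (auto simp: emeasure_bounded_finite[unfolded infinity_ennreal_def])
    fix x :: 'a
    show "norm (mol_grad e x) \<le> 4 * e ^ 3 / Z * indicat_real (ball 0 e) x"
    proof (cases "norm x < e")
      case True
      have "norm (mol_grad e x) = norm (bump_grad e x) / Z"
        using Z by (simp add: mol_grad_def Z_def divide_inverse mult.commute)
      also have "\<dots> \<le> 4 * e ^ 3 / Z" using bump_grad_le[OF e] Z by (intro divide_right_mono) auto
      finally show ?thesis using True by simp
    qed (simp add: mol_outside[OF e])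
  qed
  also have "\<dots> = (4 * e ^ 3 / Z) * measure lborel (ball (0::'a) e)" by (simp add: measure_def)
  also have "measure lborel (ball (0::'a) e) = 2 ^ DIM('a) * measure lborel (ball (0::'a) (e/2))"
    using e by (simp add: content_ball power_divide)
  also have "(4 * e ^ 3 / Z) * (2 ^ DIM('a) * measure lborel (ball (0::'a) (e/2))) \<le> 8 * 2 ^ DIM('a) / e"
  proof -
    define c where "c = measure lborel (ball (0::'a) (e/2))"
    have c: "0 < c" unfolding c_def using content_ball_pos e by auto
    have "(9/16) * e ^ 4 * c \<le> Z" unfolding c_def Z_def by (rule bump_mass_lower[OF e])
    then have "(9/16) * (e ^ 4 * c) \<le> Z" by (simp only: mult.assoc)
    moreover have "0 < e ^ 4 * c" using c e by simp
    ultimately have "4 * (e ^ 4 * c) \<le> 8 * Z" by linarith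
    then have "e * (4 * e ^ 3 * c) \<le> 8 * Z" by (simp add: power4_eq_xxxx power3_eq_cube ac_simps)
    then have "(4 * e ^ 3 / Z) * c \<le> 8 / e" using Z e by (simp add: field_simps)
    then have "2 ^ DIM('a) * ((4 * e ^ 3 / Z) * c) \<le> 2 ^ DIM('a) * (8 / e)" by (intro mult_left_mono) auto
    then show ?thesis unfolding c_def by (simp add: ac_simps)
  qed
  finally show "(LINT x|lborel. norm (mol_grad e (x::'a))) \<le> 8 * 2 ^ DIM('a) / e" .
qed

section \<open>Convolution with the mollifier\<close>

lemma kernel_integrable:
  fixes f :: "'a::euclidean_space \<Rightarrow> 'b::{banach,second_countable_topology}" and g :: "'a \<Rightarrow> real"
  assumes f: "integrable lborel f" and [measurable]: "g \<in> borel_measurable borel" and B: "\<And>x. \<bar>g x\<bar> \<le> B"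
  shows "integrable lborel (\<lambda>y. g (x - y) *\<^sub>R f y)"
proof (rule Bochner_Integration.integrable_bound[OF integrable_scaleR_right[OF integrable_norm[OF f], of B]])
  have [measurable]: "f \<in> borel_measurable borel" using f by auto
  show "(\<lambda>y. g (x - y) *\<^sub>R f y) \<in> borel_measurable lborel" by simp
  show "AE y in lborel. norm (g (x - y) *\<^sub>R f y) \<le> norm (B *\<^sub>R norm (f y))"
  proof (rule AE_I2)
    fix y
    have "\<bar>g (x - y)\<bar> * norm (f y) \<le> \<bar>B\<bar> * norm (f y)"
      using B[of "x - y"] by (intro mult_right_mono) auto
    then show "norm (g (x - y) *\<^sub>R f y) \<le> norm (B *\<^sub>R norm (f y))" by (simp add: abs_mult)
  qed
qed

lemma kernel_continuous:
  fixes f :: "'a::euclidean_space \<Rightarrow> 'b::{banach,second_countable_topology}" and g :: "'a \<Rightarrow> real"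
  assumes f: "integrable lborel f" and g: "continuous_on UNIV g" and B: "\<And>x. \<bar>g x\<bar> \<le> B"
  shows "continuous_on UNIV (\<lambda>x. LINT y|lborel. g (x - y) *\<^sub>R f y)"
proof -
  have [measurable]: "g \<in> borel_measurable borel" using g by (rule borel_measurable_continuous_onI)
  have [measurable]: "f \<in> borel_measurable borel" using f by auto
  have "(\<lambda>n. LINT y|lborel. g (X n - y) *\<^sub>R f y) \<longlonglongrightarrow> (LINT y|lborel. g (x - y) *\<^sub>R f y)"
    if "X \<longlonglongrightarrow> x" for X x
  proof (rule integral_dominated_convergence[where w="\<lambda>y. B *\<^sub>R norm (f y)"])
    show "integrable lborel (\<lambda>y. B *\<^sub>R norm (f y))" by (intro integrable_scaleR_right integrable_norm f)
    show "AE y in lborel. (\<lambda>n. g (X n - y) *\<^sub>R f y) \<longlonglongrightarrow> g (x - y) *\<^sub>R f y"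
    proof (rule AE_I2, rule tendsto_scaleR[OF _ tendsto_const])
      fix y
      show "(\<lambda>n. g (X n - y)) \<longlonglongrightarrow> g (x - y)"
        by (rule continuous_on_tendsto_compose[OF g]) (auto intro!: tendsto_intros that)
    qed
    show "AE y in lborel. norm (g (X n - y) *\<^sub>R f y) \<le> B *\<^sub>R norm (f y)" for n
      using B by (intro AE_I2) (auto intro!: mult_right_mono)
  qed simp_all
  then show ?thesis by (auto simp: continuous_on_sequentially o_def)
qed

definition conv :: "real \<Rightarrow> ('a::euclidean_space \<Rightarrow> 'b::{banach,second_countable_topology}) \<Rightarrow> 'a \<Rightarrow> 'b" where
  "conv e f x = (LINT y|lborel. mol e (x - y) *\<^sub>R f y)"

lemma mol_abs_bound:
  assumes "0 < e" "\<And>x::'a::euclidean_space. mol e x \<le> B" shows "\<bar>mol e (x::'a)\<bar> \<le> B"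
  using assms mol_nonneg[OF assms(1), of x] by auto

lemma mol_grad_inner_bound:
  assumes "\<And>x::'a::euclidean_space. norm (mol_grad e x) \<le> B"
  shows "\<bar>mol_grad e x \<bullet> (v::'a)\<bar> \<le> B * norm v"
  using Cauchy_Schwarz_ineq2[of "mol_grad e x" v] mult_right_mono[OF assms[of x] norm_ge_zero[of v]] by linarith

text \<open>Integrating the uniform quadratic remainder of the kernel against the norm of f leaves a
  remainder of at most B times the L1 norm of f times the square of norm v.\<close>

lemma conv_has_derivative:
  fixes f :: "'a::euclidean_space \<Rightarrow> 'b::{banach,second_countable_topology}"
  assumes e: "0 < e" and f: "integrable lborel f"
  shows "(conv e f has_derivative (\<lambda>v. LINT y|lborel. (mol_grad e (x - y) \<bullet> v) *\<^sub>R f y)) (at x)"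
proof -
  obtain B where B: "0 \<le> B" "\<And>x::'a. mol e x \<le> B" "\<And>x::'a. norm (mol_grad e x) \<le> B"
    "\<And>(x::'a) v. norm v \<le> 1 \<Longrightarrow> \<bar>mol e (x + v) - mol e x - mol_grad e x \<bullet> v\<bar> \<le> B * (norm v)\<^sup>2"
    using mol_bounds[OF e, where 'a='a] by metis
  have i1: "integrable lborel (\<lambda>y. mol e (x - y) *\<^sub>R f y)" for x
    by (rule kernel_integrable[OF f]) (auto intro: mol_abs_bound[OF e B(2)])
  have i2: "integrable lborel (\<lambda>y. (mol_grad e (x - y) \<bullet> v) *\<^sub>R f y)" for x v
    by (rule kernel_integrable[OF f, of "\<lambda>z. mol_grad e z \<bullet> v" "B * norm v"])
      (auto intro: mol_grad_inner_bound[OF B(3)])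
  define C where "C = (LINT y|lborel. norm (f y))"
  have C: "0 \<le> C" unfolding C_def by simp
  show ?thesis
  proof (rule has_derivativeI_sandwich[of 1 _ _ _ _ "\<lambda>y. B * C * norm (y - x)"])
    show "bounded_linear (\<lambda>v. LINT y|lborel. (mol_grad e (x - y) \<bullet> v) *\<^sub>R f y)"
    proof (rule bounded_linear_intro[where K="B * C"])
      show "(LINT y|lborel. (mol_grad e (x - y) \<bullet> (v + w)) *\<^sub>R f y)
        = (LINT y|lborel. (mol_grad e (x - y) \<bullet> v) *\<^sub>R f y) + (LINT y|lborel. (mol_grad e (x - y) \<bullet> w) *\<^sub>R f y)" for v w
        by (subst Bochner_Integration.integral_add[OF i2 i2, symmetric]) (simp add: inner_add_right scaleR_add_left)
      show "(LINT y|lborel. (mol_grad e (x - y) \<bullet> (r *\<^sub>R v)) *\<^sub>R f y)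
        = r *\<^sub>R (LINT y|lborel. (mol_grad e (x - y) \<bullet> v) *\<^sub>R f y)" for r v
        by (simp flip: integral_scaleR_right)
      fix v
      have "norm (LINT y|lborel. (mol_grad e (x - y) \<bullet> v) *\<^sub>R f y) \<le> (LINT y|lborel. norm v * B * norm (f y))"
        by (rule lborel_norm_integral_le[OF i2])
          (use f mol_grad_inner_bound[OF B(3)] in \<open>auto intro!: mult_right_mono simp: mult.commute[of B]\<close>)
      then show "norm (LINT y|lborel. (mol_grad e (x - y) \<bullet> v) *\<^sub>R f y) \<le> norm v * (B * C)"
        by (simp add: C_def mult.assoc)
    qed
    fix y :: 'a assume "y \<noteq> x" "dist y x < 1"
    define v where "v = y - x"
    have v: "y = x + v" "norm v \<le> 1" "norm v > 0" using \<open>y \<noteq> x\<close> \<open>dist y x < 1\<close> by (auto simp: v_def dist_norm)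
    have "norm (conv e f y - conv e f x - (LINT z|lborel. (mol_grad e (x - z) \<bullet> (y - x)) *\<^sub>R f z))
      = norm (LINT z|lborel. mol e (y - z) *\<^sub>R f z - mol e (x - z) *\<^sub>R f z - (mol_grad e (x - z) \<bullet> (y - x)) *\<^sub>R f z)"
      unfolding conv_def by (simp add: i1 i2)
    also have "\<dots> \<le> (LINT z|lborel. B * (norm v)\<^sup>2 * norm (f z))"
    proof (rule lborel_norm_integral_le)
      fix z
      have "norm (mol e (y - z) *\<^sub>R f z - mol e (x - z) *\<^sub>R f z - (mol_grad e (x - z) \<bullet> (y - x)) *\<^sub>R f z)
        = \<bar>mol e ((x - z) + v) - mol e (x - z) - mol_grad e (x - z) \<bullet> v\<bar> * norm (f z)"
        unfolding norm_scaleR[symmetric] by (simp add: v algebra_simps)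
      also have "\<dots> \<le> B * (norm v)\<^sup>2 * norm (f z)" by (intro mult_right_mono B(4) v) auto
      finally show "norm (mol e (y - z) *\<^sub>R f z - mol e (x - z) *\<^sub>R f z - (mol_grad e (x - z) \<bullet> (y - x)) *\<^sub>R f z)
        \<le> B * (norm v)\<^sup>2 * norm (f z)" .
    qed (use f i1 i2 in auto)
    also have "\<dots> = B * C * norm v * norm v" by (simp add: C_def power2_eq_square)
    finally show "norm (conv e f y - conv e f x - (LINT z|lborel. (mol_grad e (x - z) \<bullet> (y - x)) *\<^sub>R f z)) / norm (y - x)
        \<le> B * C * norm (y - x)"
      using v(3) by (simp add: v(1) divide_le_eq)
  next
    have "((\<lambda>y. B * C * norm (y - x)) \<longlongrightarrow> B * C * norm (x - x)) (at x)" by (intro tendsto_intros)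
    then show "((\<lambda>y. B * C * norm (y - x)) \<longlongrightarrow> 0) (at x)" by simp
  qed simp
qed

lemma conv_deriv_continuous:
  fixes f :: "'a::euclidean_space \<Rightarrow> 'b::{banach,second_countable_topology}"
  assumes e: "0 < e" and f: "integrable lborel f"
  shows "continuous_on UNIV (\<lambda>x. LINT y|lborel. (mol_grad e (x - y) \<bullet> v) *\<^sub>R f y)"
proof -
  obtain B where B: "\<And>x::'a. norm (mol_grad e x) \<le> B" using mol_bounds[OF e, where 'a='a] by metis
  show ?thesis
    by (rule kernel_continuous[OF f, of "\<lambda>z. mol_grad e z \<bullet> v" "B * norm v"])
      (auto intro!: mol_grad_inner_bound[OF B] continuous_intros mol_continuous)
qed

lemma conv_frechet:
  fixes f :: "'a::euclidean_space \<Rightarrow> 'b::{banach,second_countable_topology}"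
  assumes e: "0 < e" and f: "integrable lborel f"
  shows "frechet_derivative (conv e f) (at x) v = (LINT y|lborel. (mol_grad e (x - y) \<bullet> v) *\<^sub>R f y)"
  by (rule fun_cong[OF frechet_derivative_at[OF conv_has_derivative[OF assms]], symmetric])

text \<open>Hypothesis \<open>f0\<close> says that K contains the open e-neighbourhood of the set
  where f is nonzero, outside of which the convolution vanishes.\<close>

lemma conv_C1c:
  fixes f :: "real^'n \<Rightarrow> 'b::{banach,second_countable_topology}"
  assumes e: "0 < e" and f: "integrable lborel f" and K: "compact K" "K \<subseteq> \<Omega>"
    and f0: "\<And>x y. norm (x - y) < e \<Longrightarrow> x \<notin> K \<Longrightarrow> f y = 0"
  shows "conv e f \<in> C1c \<Omega>"
proof (rule C1cI[OF conv_has_derivative[OF e f] conv_deriv_continuous[OF e f] K])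
  fix x assume "x \<notin> K"
  have "mol e (x - y) *\<^sub>R f y = 0" for y
    using f0[OF _ \<open>x \<notin> K\<close>, of y] mol_outside(1)[OF e, of "x - y"] by (cases "norm (x - y) < e") auto
  then show "conv e f x = 0" unfolding conv_def by (simp only: integral_zero)
qed

lemma conv_alt:
  fixes f :: "'a::euclidean_space \<Rightarrow> 'b::{banach,second_countable_topology}"
  assumes [measurable]: "f \<in> borel_measurable borel"
  shows "conv e f x = (LINT y|lborel. mol e y *\<^sub>R f (x - y))"
  unfolding conv_def
  using lborel_integral_reflect[of "\<lambda>y. mol e (x - y) *\<^sub>R f y" x] by simp

lemma conv_norm_le:
  fixes f :: "'a::euclidean_space \<Rightarrow> 'b::{banach,second_countable_topology}"
  assumes e: "0 < e" and [measurable]: "f \<in> borel_measurable borel" and B: "\<And>x. norm (f x) \<le> B"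
  shows "norm (conv e f x) \<le> B"
proof -
  have B0: "0 \<le> B" using B[of undefined] norm_ge_zero order_trans by blast
  have "norm (conv e f x) \<le> (LINT y|lborel. mol e (y::'a) * B)"
  unfolding conv_alt[OF assms(2)]
  proof (rule lborel_norm_integral_le)
    have im: "integrable lborel (\<lambda>y::'a. mol e y * B)" using mol_integrable[OF e] by auto
    then show "integrable lborel (\<lambda>y::'a. mol e y * B)" .
    show "integrable lborel (\<lambda>y. mol e y *\<^sub>R f (x - y))"
      by (rule Bochner_Integration.integrable_bound[OF im])
        (use B B0 mol_nonneg[OF e, where 'a='a] in \<open>auto simp: abs_mult intro!: AE_I2 mult_left_mono\<close>)
    show "norm (mol e y *\<^sub>R f (x - y)) \<le> mol e y * B" for y
      using B mol_nonneg[OF e, of y] by (auto intro!: mult_left_mono)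
  qed
  then show ?thesis using mol_integral[OF e, where 'a='a] by simp
qed

lemma conv_close:
  fixes f :: "'a::euclidean_space \<Rightarrow> 'b::{banach,second_countable_topology}"
  assumes e: "0 < e" and [measurable]: "f \<in> borel_measurable borel" and B: "\<And>x. norm (f x) \<le> B"
    and d: "\<And>y. norm y < e \<Longrightarrow> norm (f (x - y) - f x) \<le> d"
  shows "norm (conv e f x - f x) \<le> d"
proof -
  have B0: "0 \<le> B" using B[of undefined] norm_ge_zero order_trans by blast
  have im: "integrable lborel (\<lambda>y::'a. mol e y * C)" for C using mol_integrable[OF e] by auto
  have i: "integrable lborel (\<lambda>y. mol e y *\<^sub>R f (x - y))"
    by (rule Bochner_Integration.integrable_bound[OF im[of B]])
      (use B B0 mol_nonneg[OF e, where 'a='a] in \<open>auto simp: abs_mult intro!: AE_I2 mult_left_mono\<close>)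
  have i': "integrable lborel (\<lambda>y. mol e y *\<^sub>R f x)" using mol_integrable[OF e] by auto
  have "conv e f x - f x = (LINT y|lborel. mol e y *\<^sub>R (f (x - y) - f x))"
    unfolding conv_alt[OF assms(2)] using i i' mol_integral[OF e, where 'a='a]
    by (simp add: scaleR_diff_right mol_integrable[OF e])
  also have "norm \<dots> \<le> (LINT y|lborel. mol e (y::'a) * d)"
  proof (rule lborel_norm_integral_le)
    show "integrable lborel (\<lambda>y. mol e y *\<^sub>R (f (x - y) - f x))"
      unfolding scaleR_diff_right by (rule Bochner_Integration.integrable_diff[OF i i'])
    show "norm (mol e y *\<^sub>R (f (x - y) - f x)) \<le> mol e y * d" for y
      using d[of y] mol_nonneg[OF e, of y] mol_outside(1)[OF e, of y]
      by (cases "norm y < e") (auto intro!: mult_left_mono)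
  qed (rule im)
  finally show ?thesis using mol_integral[OF e, where 'a='a] by simp
qed

section \<open>Approximation by test functions\<close>

lemma compact_thicken:
  fixes K :: "'a::euclidean_space set"
  assumes "compact K"
  shows "compact (\<Union>x\<in>K. cball x e)"
proof -
  have eq: "(\<Union>x\<in>K. cball x e) = {x + y |x y. x \<in> K \<and> y \<in> cball 0 e}"
  proof (intro set_eqI iffI)
    fix z assume "z \<in> (\<Union>x\<in>K. cball x e)"
    then obtain x where "x \<in> K" "dist x z \<le> e" by auto
    then show "z \<in> {x + y |x y. x \<in> K \<and> y \<in> cball 0 e}"
      by (intro CollectI exI[of _ x] exI[of _ "z - x"]) (auto simp: dist_norm norm_minus_commute)
  next
    fix z assume "z \<in> {x + y |x y. x \<in> K \<and> y \<in> cball 0 e}"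
    then obtain x y where "x \<in> K" "norm y \<le> e" "z = x + y" by auto
    then show "z \<in> (\<Union>x\<in>K. cball x e)" by (intro UN_I[of x]) (auto simp: dist_norm)
  qed
  show ?thesis unfolding eq by (rule compact_sums[OF assms compact_cball])
qed

text \<open>Mollification below the modulus of continuity: the radius is small enough for the
  thickened K to stay in \<Omega>, so compact support is retained, and the mollifier has integral 1,
  so the bound B survives.\<close>

lemma C1c_approx_continuous:
  fixes f :: "real^'n \<Rightarrow> real"
  assumes f: "continuous_on UNIV f" and K: "compact K" "K \<subseteq> \<Omega>" "\<And>x. x \<notin> K \<Longrightarrow> f x = 0"
    and "open \<Omega>" and d: "0 < d" and B: "\<And>x. \<bar>f x\<bar> \<le> B"
  obtains \<eta> where "\<eta> \<in> C1c \<Omega>" "\<And>x. \<bar>\<eta> x - f x\<bar> \<le> d" "\<And>x. \<bar>\<eta> x\<bar> \<le> B"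
proof -
  obtain e0 where e0: "0 < e0" "(\<Union>x\<in>K. cball x e0) \<subseteq> \<Omega>"
    using compact_subset_open_imp_cball_epsilon_subset[OF K(1) \<open>open \<Omega>\<close> K(2)] by blast
  have "uniformly_continuous_on (\<Union>x\<in>K. cball x 1) f"
    by (rule compact_uniformly_continuous[OF continuous_on_subset[OF f] compact_thicken[OF K(1)]]) auto
  then obtain e1 where e1: "0 < e1"
    "\<And>x y. x \<in> (\<Union>x\<in>K. cball x 1) \<Longrightarrow> y \<in> (\<Union>x\<in>K. cball x 1) \<Longrightarrow> dist y x < e1 \<Longrightarrow> dist (f y) (f x) < d"
    unfolding uniformly_continuous_on_def using d by metis
  \<comment> \<open>The bound 1 keeps x and x - y in the 1-neighbourhood of K on which uniform
    continuity is known.\<close>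
  define e where "e = min e0 (min e1 1)"
  have e: "0 < e" "e \<le> e0" "e \<le> e1" "e \<le> 1" using e0 e1 by (auto simp: e_def)
  have close: "\<bar>f (x - y) - f x\<bar> \<le> d" if "norm y < e" for x y
  proof (cases "x \<in> K \<or> x - y \<in> K")
    case True
    have "x \<in> (\<Union>x\<in>K. cball x 1)" "x - y \<in> (\<Union>x\<in>K. cball x 1)"
    proof -
      from True obtain z where z: "z \<in> K" "z = x \<or> z = x - y" by auto
      show "x \<in> (\<Union>x\<in>K. cball x 1)"
        by (rule UN_I[OF z(1)]) (use that e(4) z(2) in \<open>auto simp: dist_norm\<close>)
      show "x - y \<in> (\<Union>x\<in>K. cball x 1)"
        by (rule UN_I[OF z(1)]) (use that e(4) z(2) in \<open>auto simp: dist_norm\<close>)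
    qed
    then have "dist (f (x - y)) (f x) < d" by (rule e1(2)) (use that e in \<open>auto simp: dist_norm\<close>)
    then show ?thesis by (simp add: dist_norm)
  next
    case False
    then show ?thesis using K(3) d by auto
  qed
  have [measurable]: "f \<in> borel_measurable borel" using f by (rule borel_measurable_continuous_onI)
  have int: "integrable lborel f"
    by (rule integrable_lborel_bounded_support[of f B K]) (use B K compact_imp_bounded in auto)
  show ?thesis
  proof
    show "conv e f \<in> C1c \<Omega>"
    proof (rule conv_C1c[OF e(1) int])
      show "compact (\<Union>x\<in>K. cball x e)" by (rule compact_thicken[OF K(1)])
      show "(\<Union>x\<in>K. cball x e) \<subseteq> \<Omega>" using e0(2) e(2) by fastforce
      fix x y assume "norm (x - y) < e" "x \<notin> (\<Union>x\<in>K. cball x e)"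
      then have "y \<notin> K" by (auto simp: dist_norm norm_minus_commute)
      then show "f y = 0" by (rule K(3))
    qed
    show "\<bar>conv e f x - f x\<bar> \<le> d" for x
      using conv_close[OF e(1), of f B x d] B close by simp
    show "\<bar>conv e f x\<bar> \<le> B" for x
      using conv_norm_le[OF e(1), of f B x] B by simp
  qed
qed

text \<open>A measurable function is an almost everywhere limit of continuous functions; clamping
  these to [-1, 1], cutting them off near the boundary of U and mollifying with an error 1/(n+1)
  gives test functions. Applied to a sign function, this turns an inequality for test functions into
  an estimate of an L1 norm.\<close>

lemma C1c_approx_AE:
  fixes f :: "real^'n \<Rightarrow> real"
  assumes f: "f \<in> borel_measurable lebesgue" and f1: "\<And>x. \<bar>f x\<bar> \<le> 1" and U: "open U" "bounded U"
  obtains \<eta> where "\<And>n. \<eta> n \<in> C1c U" "\<And>n x. \<bar>\<eta> n x\<bar> \<le> 1"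
    "AE x in lborel. x \<in> U \<longrightarrow> (\<lambda>n::nat. \<eta> n x) \<longlonglongrightarrow> f x"
proof -
  have "f measurable_on UNIV" by (rule lebesgue_measurable_imp_measurable_on[OF f]) simp
  then obtain N g where N: "negligible N" and g: "\<And>n. continuous_on UNIV (g n)"
    and lim: "\<And>x. x \<notin> N \<Longrightarrow> (\<lambda>n. g n x) \<longlonglongrightarrow> f x"
    unfolding measurable_on_def by auto
  have "U \<noteq> UNIV" using U(2) not_bounded_UNIV by metis
  then have Uc: "closed (- U)" "- U \<noteq> {}" using U(1) by auto
  \<comment> \<open>Zero at distance at most 1/(n+1) from the complement of U, one from distance
    2/(n+1) on.\<close>
  define \<kappa> where "\<kappa> n x = max 0 (min 1 (real (Suc n) * infdist x (- U) - 1))" for n x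
  define c where "c n x = max (-1) (min 1 (g n x)) * \<kappa> n x" for n x
  define K where "K n = {x. 1 / real (Suc n) \<le> infdist x (- U)}" for n
  have KU: "K n \<subseteq> U" for n
  proof
    fix x assume "x \<in> K n"
    then have "0 < infdist x (- U)" unfolding K_def by (smt (verit) mem_Collect_eq of_nat_0_less_iff zero_less_Suc zero_less_divide_1_iff)
    then show "x \<in> U" using in_closed_iff_infdist_zero[OF Uc] by force
  qed
  have KK: "compact (K n)" for n
  proof -
    have "closed (K n)" unfolding K_def by (intro closed_Collect_le continuous_intros)
    then show ?thesis using bounded_subset[OF U(2) KU] compact_eq_bounded_closed by blast
  qed
  have cc: "continuous_on UNIV (c n)" for n
    unfolding c_def \<kappa>_def by (intro continuous_intros g)
  have c0: "c n x = 0" if "x \<notin> K n" for n x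
  proof -
    have "real (Suc n) * infdist x (- U) < 1" using that by (simp add: K_def not_le field_simps)
    then show ?thesis by (simp add: c_def \<kappa>_def)
  qed
  have c1: "\<bar>c n x\<bar> \<le> 1" for n x
    unfolding c_def abs_mult by (rule mult_le_one) (auto simp: \<kappa>_def)
  have "\<exists>\<eta>. \<eta> \<in> C1c U \<and> (\<forall>x. \<bar>\<eta> x - c n x\<bar> \<le> 1 / real (Suc n)) \<and> (\<forall>x. \<bar>\<eta> x\<bar> \<le> 1)" for n
    using C1c_approx_continuous[OF cc KK KU c0 U(1) _ c1, of n n "1 / real (Suc n)"]
    by (metis of_nat_0_less_iff zero_less_Suc zero_less_divide_1_iff)
  then obtain \<eta> where \<eta>: "\<And>n. \<eta> n \<in> C1c U" "\<And>n x. \<bar>\<eta> n x - c n x\<bar> \<le> 1 / real (Suc n)" "\<And>n x. \<bar>\<eta> n x\<bar> \<le> 1"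
    by metis
  have "(\<lambda>n. \<eta> n x) \<longlonglongrightarrow> f x" if x: "x \<in> U" "x \<notin> N" for x
  proof -
    have pos: "0 < infdist x (- U)"
      using in_closed_iff_infdist_zero[OF Uc, of x] infdist_nonneg[of x "- U"] x by force
    obtain n0 where n0: "2 / infdist x (- U) < real n0" using reals_Archimedean2 by blast
    have "\<kappa> n x = 1" if "n0 \<le> n" for n
    proof -
      have "2 / infdist x (- U) \<le> real (Suc n)" using n0 that by linarith
      then have "2 \<le> real (Suc n) * infdist x (- U)" using pos by (simp add: divide_le_eq)
      then show ?thesis by (simp add: \<kappa>_def)
    qed
    then have "\<forall>\<^sub>F n in sequentially. max (-1) (min 1 (g n x)) = c n x"
      unfolding c_def eventually_sequentially by (intro exI[of _ n0]) auto
    moreover have "(\<lambda>n. max (-1) (min 1 (g n x))) \<longlonglongrightarrow> max (-1) (min 1 (f x))"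
      by (intro tendsto_intros lim x)
    ultimately have "(\<lambda>n. c n x) \<longlonglongrightarrow> max (-1) (min 1 (f x))" by (rule Lim_transform_eventually[rotated])
    also have "max (-1) (min 1 (f x)) = f x" using f1[of x] by auto
    finally have c: "(\<lambda>n. c n x) \<longlonglongrightarrow> f x" .
    have "(\<lambda>n. \<eta> n x - c n x) \<longlonglongrightarrow> 0"
    proof (rule Lim_null_comparison[of _ "\<lambda>n. 1 / real (Suc n)"])
      show "(\<lambda>n. 1 / real (Suc n)) \<longlonglongrightarrow> 0" using LIMSEQ_inverse_real_of_nat by (simp add: divide_inverse)
    qed (use \<eta>(2) in auto)
    from tendsto_add[OF this c] show ?thesis by simp
  qed
  moreover have "AE x in lborel. x \<notin> N"
    using N AE_not_in negligible_iff_null_sets AE_completion_iff by metis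
  ultimately have "AE x in lborel. x \<in> U \<longrightarrow> (\<lambda>n. \<eta> n x) \<longlonglongrightarrow> f x" by (auto elim: eventually_mono)
  with \<eta> show ?thesis using that by blast
qed

section \<open>Averages along segments\<close>

definition segment_average :: "(real^'n \<Rightarrow> real) \<Rightarrow> real^'n \<Rightarrow> real^'n \<Rightarrow> real" where
  "segment_average \<eta> v x = integral {0..1} (\<lambda>s. \<eta> (x - s *\<^sub>R v))"

text \<open>The Leibniz rule asks for the derivative as a continuous map into the bounded linear
  maps, whereas \<open>C1c\<close> provides continuous partial derivatives; in finite dimension the
  two agree.\<close>

lemma C1c_Blinfun_continuous:
  fixes \<eta> :: "real^'n \<Rightarrow> real"
  assumes \<eta>: "\<eta> \<in> C1c U"
  shows "continuous_on UNIV (\<lambda>x. Blinfun (frechet_derivative \<eta> (at x)))"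
    and "blinfun_apply (Blinfun (frechet_derivative \<eta> (at x))) = frechet_derivative \<eta> (at x)"
proof -
  show *: "blinfun_apply (Blinfun (frechet_derivative \<eta> (at x))) = frechet_derivative \<eta> (at x)" for x
    by (rule bounded_linear_Blinfun_apply[OF has_derivative_bounded_linear[OF C1c_has_derivative[OF \<eta>]]])
  show "continuous_on UNIV (\<lambda>x. Blinfun (frechet_derivative \<eta> (at x)))"
  proof (rule continuous_on_blinfun_componentwise)
    show "continuous_on UNIV (\<lambda>x. blinfun_apply (Blinfun (frechet_derivative \<eta> (at x))) i)" for i
      unfolding * by (rule C1c_deriv_continuous[OF \<eta>])
  qed
qed

text \<open>The average is the convolution with the uniform measure on the segment from 0 to v. The
  fundamental theorem of calculus integrates its derivative along v and leaves the difference of the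
  end values: a finite difference of \<eta> becomes a derivative of a test function. The hypothesis
  \<open>seg\<close> keeps the support inside \<Omega> while it is swept along v.\<close>

lemma segment_average_C1c:
  fixes \<eta> :: "real^'n \<Rightarrow> real"
  assumes \<eta>: "\<eta> \<in> C1c U" and seg: "\<And>x. x \<in> U \<Longrightarrow> closed_segment x (x + v) \<subseteq> \<Omega>"
  shows "segment_average \<eta> v \<in> C1c \<Omega>"
    and "frechet_derivative (segment_average \<eta> v) (at x) v = \<eta> x - \<eta> (x - v)"
proof -
  define D where "D x = Blinfun (frechet_derivative \<eta> (at x))" for x
  have Dc: "continuous_on UNIV D" unfolding D_def by (rule C1c_Blinfun_continuous[OF \<eta>])
  have Da: "blinfun_apply (D x) = frechet_derivative \<eta> (at x)" for x
    unfolding D_def by (rule C1c_Blinfun_continuous[OF \<eta>])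
  have Dc2: "continuous_on (UNIV \<times> cbox 0 1) (\<lambda>(x, s). D (x - s *\<^sub>R v))"
    unfolding split_beta by (intro continuous_on_compose2[OF Dc] continuous_intros) auto
  have Dint: "(\<lambda>s. D (x - s *\<^sub>R v)) integrable_on cbox 0 1" for x
    by (intro integrable_continuous continuous_on_compose2[OF Dc] continuous_intros) auto
  have d: "(segment_average \<eta> v has_derivative (\<lambda>h. integral {0..1} (\<lambda>s. frechet_derivative \<eta> (at (x - s *\<^sub>R v)) h))) (at x)" for x
  proof -
    have "((\<lambda>x. integral (cbox 0 1) ((\<lambda>x s. \<eta> (x - s *\<^sub>R v)) x)) has_derivative
        blinfun_apply (integral (cbox 0 1) ((\<lambda>x s. D (x - s *\<^sub>R v)) x))) (at x within UNIV)"
    proof (rule leibniz_rule[where U=UNIV])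
      show "((\<lambda>x. \<eta> (x - s *\<^sub>R v)) has_derivative blinfun_apply (D (x - s *\<^sub>R v))) (at x within UNIV)" for x s
        unfolding Da
        by (rule has_derivative_compose[of "\<lambda>x. x - s *\<^sub>R v" "\<lambda>x. x" x UNIV \<eta>, unfolded o_def])
          (use C1c_has_derivative[OF \<eta>, of "x - s *\<^sub>R v"] in \<open>auto intro!: derivative_eq_intros\<close>)
      show "(\<lambda>s. \<eta> (x - s *\<^sub>R v)) integrable_on cbox 0 1" for x
        by (intro integrable_continuous continuous_on_compose2[OF C1c_continuous[OF \<eta>, of UNIV]] continuous_intros) auto
    qed (use Dc2 in auto)
    moreover have "blinfun_apply (integral (cbox 0 1) (\<lambda>s. D (x - s *\<^sub>R v)))
      = (\<lambda>h. integral {0..1} (\<lambda>s. frechet_derivative \<eta> (at (x - s *\<^sub>R v)) h))"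
      using blinfun_apply_integral[OF Dint] by (auto simp: Da)
    ultimately show ?thesis by (simp add: segment_average_def[abs_def])
  qed
  have ftc: "((\<lambda>s. frechet_derivative \<eta> (at (x - s *\<^sub>R v)) v) has_integral (- \<eta> (x - 1 *\<^sub>R v)) - (- \<eta> (x - 0 *\<^sub>R v))) {0..1}"
  proof (rule fundamental_theorem_of_calculus)
    fix s :: real
    have "((\<lambda>s. \<eta> (x - s *\<^sub>R v)) has_derivative (\<lambda>r. frechet_derivative \<eta> (at (x - s *\<^sub>R v)) (- (r *\<^sub>R v)))) (at s within {0..1})"
      by (rule has_derivative_compose[of "\<lambda>s. x - s *\<^sub>R v" "\<lambda>r. - (r *\<^sub>R v)" s "{0..1}" \<eta>, unfolded o_def])
        (use C1c_has_derivative[OF \<eta>, of "x - s *\<^sub>R v"] in \<open>auto intro!: derivative_eq_intros\<close>)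
    then have "((\<lambda>s. - \<eta> (x - s *\<^sub>R v)) has_derivative (\<lambda>r. - frechet_derivative \<eta> (at (x - s *\<^sub>R v)) (- (r *\<^sub>R v)))) (at s within {0..1})"
      by (rule has_derivative_minus)
    moreover have "- frechet_derivative \<eta> (at (x - s *\<^sub>R v)) (- (r *\<^sub>R v)) = r *\<^sub>R frechet_derivative \<eta> (at (x - s *\<^sub>R v)) v" for r
      using has_derivative_linear[OF C1c_has_derivative[OF \<eta>, of "x - s *\<^sub>R v"]]
      by (simp add: linear_neg linear_cmul)
    ultimately show "((\<lambda>s. - \<eta> (x - s *\<^sub>R v)) has_vector_derivative frechet_derivative \<eta> (at (x - s *\<^sub>R v)) v) (at s within {0..1})"
      by (simp add: has_vector_derivative_def)
  qed simp
  show "frechet_derivative (segment_average \<eta> v) (at x) v = \<eta> x - \<eta> (x - v)"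
    unfolding fun_cong[OF frechet_derivative_at[OF d[of x]], of v, symmetric] integral_unique[OF ftc] by simp
  obtain K where K: "compact K" "K \<subseteq> U" "\<And>x. x \<notin> K \<Longrightarrow> \<eta> x = 0" using C1c_support[OF \<eta>] by metis
  define K' where "K' = (\<lambda>(x, s). x + s *\<^sub>R v) ` (K \<times> {0..1::real})"
  show "segment_average \<eta> v \<in> C1c \<Omega>"
  proof (rule C1cI[OF d])
    show "compact K'" unfolding K'_def split_beta
      by (intro compact_continuous_image compact_Times K continuous_intros) auto
    show "K' \<subseteq> \<Omega>"
    proof
      fix y assume "y \<in> K'"
      then obtain x s where xs: "x \<in> K" "0 \<le> s" "s \<le> 1" "y = x + s *\<^sub>R v" by (auto simp: K'_def)
      have "y \<in> closed_segment x (x + v)"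
        unfolding in_segment using xs by (intro exI[of _ s]) (simp add: algebra_simps)
      then show "y \<in> \<Omega>" using seg[of x] xs K by auto
    qed
    fix x assume "x \<notin> K'"
    have "\<eta> (x - s *\<^sub>R v) = 0" if "s \<in> {0..1}" for s
    proof (rule K(3), rule notI)
      assume "x - s *\<^sub>R v \<in> K"
      then have "(\<lambda>(x, s). x + s *\<^sub>R v) (x - s *\<^sub>R v, s) \<in> K'" unfolding K'_def using that by (intro imageI) auto
      then show False using \<open>x \<notin> K'\<close> by simp
    qed
    then have "integral {0..1} (\<lambda>s. \<eta> (x - s *\<^sub>R v)) = integral {0..1::real} (\<lambda>s. 0)"
      by (intro integral_cong) auto
    then show "segment_average \<eta> v x = 0" by (simp add: segment_average_def)
  next
    fix i
    have "continuous_on UNIV (\<lambda>x. integral (cbox 0 1) ((\<lambda>x s. frechet_derivative \<eta> (at (x - s *\<^sub>R v)) (axis i 1)) x))"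
      by (rule integral_continuous_on_param)
        (unfold split_beta, intro continuous_on_compose2[OF C1c_deriv_continuous[OF \<eta>, of UNIV]] continuous_intros, auto)
    then show "continuous_on UNIV (\<lambda>x. integral {0..1} (\<lambda>s. frechet_derivative \<eta> (at (x - s *\<^sub>R v)) (axis i 1)))"
      by simp
  qed
qed

lemma segment_average_le:
  fixes \<eta> :: "real^'n \<Rightarrow> real"
  assumes \<eta>: "\<eta> \<in> C1c U" and "\<And>x. \<bar>\<eta> x\<bar> \<le> 1"
  shows "\<bar>segment_average \<eta> v x\<bar> \<le> 1"
proof -
  have "(\<lambda>s. \<eta> (x - s *\<^sub>R v)) integrable_on cbox 0 1"
    by (intro integrable_continuous continuous_on_compose2[OF C1c_continuous[OF \<eta>, of UNIV]] continuous_intros) auto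
  then have "((\<lambda>s. \<eta> (x - s *\<^sub>R v)) has_integral segment_average \<eta> v x) (cbox 0 1)"
    by (simp add: segment_average_def has_integral_integral)
  from has_integral_bound[OF _ this, of 1] show ?thesis using assms(2) by simp
qed

lemma divergence_sum_scaleR:
  fixes f :: "'j \<Rightarrow> real^'n \<Rightarrow> real" and b :: "'j \<Rightarrow> real^'n"
  assumes f: "\<And>j. j \<in> J \<Longrightarrow> f j \<in> C1c \<Omega>" and "finite J"
  shows "divergence (\<lambda>x. \<Sum>j\<in>J. f j x *\<^sub>R b j) x = (\<Sum>j\<in>J. frechet_derivative (f j) (at x) (b j))"
proof -
  have "divergence (\<lambda>x. \<Sum>j\<in>J. f j x *\<^sub>R b j) x = (\<Sum>i\<in>UNIV. \<Sum>j\<in>J. frechet_derivative (f j) (at x) (axis i 1) * b j $ i)"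
  proof -
    have "frechet_derivative (\<lambda>x. \<Sum>j\<in>J. f j x *\<^sub>R b j) (at x) v
      = (\<Sum>j\<in>J. frechet_derivative (f j) (at x) v *\<^sub>R b j)" for v
      by (rule C1c_sum_scaleR(2)[OF assms])
    then show ?thesis unfolding divergence_def by (simp add: sum_component)
  qed
  also have "\<dots> = (\<Sum>j\<in>J. \<Sum>i\<in>UNIV. b j $ i * frechet_derivative (f j) (at x) (axis i 1))"
    by (subst sum.swap) (simp add: mult.commute)
  also have "\<dots> = (\<Sum>j\<in>J. frechet_derivative (f j) (at x) (b j))"
  proof (rule sum.cong)
    fix j assume "j \<in> J"
    then show "(\<Sum>i\<in>UNIV. b j $ i * frechet_derivative (f j) (at x) (axis i 1)) = frechet_derivative (f j) (at x) (b j)"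
      using C1c_deriv_expand[OF f, of j x "b j"] by simp
  qed simp
  finally show ?thesis .
qed

lemma C1c_outside:
  assumes "\<phi> \<in> C1c U" "x \<notin> U"
  shows "\<phi> x = 0"
proof -
  from assms(1) have "\<exists>K. compact K \<and> K \<subseteq> U \<and> (\<forall>x. x \<notin> K \<longrightarrow> \<phi> x = 0)" unfolding C1c_def by simp
  with assms(2) show ?thesis by blast
qed

lemma integrable_indicator_bounded:
  "bounded A \<Longrightarrow> A \<in> sets borel \<Longrightarrow> integrable lborel (\<lambda>x::'a::euclidean_space. c * indicator A x :: real)"
  by (intro integrable_mult_right integrable_real_indicator)
    (auto simp: emeasure_bounded_finite[unfolded infinity_ennreal_def])

lemma C1c_scaleR:
  fixes \<phi> :: "real^'n \<Rightarrow> 'b::real_normed_vector"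
  assumes \<phi>: "\<phi> \<in> C1c \<Omega>"
  shows "(\<lambda>x. c *\<^sub>R \<phi> x) \<in> C1c \<Omega>"
    and "frechet_derivative (\<lambda>x. c *\<^sub>R \<phi> x) (at x) v = c *\<^sub>R frechet_derivative \<phi> (at x) v"
proof -
  have d: "((\<lambda>x. c *\<^sub>R \<phi> x) has_derivative (\<lambda>v. c *\<^sub>R frechet_derivative \<phi> (at x) v)) (at x)" for x
    by (intro has_derivative_scaleR_right C1c_has_derivative[OF \<phi>])
  show "frechet_derivative (\<lambda>x. c *\<^sub>R \<phi> x) (at x) v = c *\<^sub>R frechet_derivative \<phi> (at x) v"
    by (rule fun_cong[OF frechet_derivative_at[OF d], symmetric])
  obtain K where K: "compact K" "K \<subseteq> \<Omega>" "\<And>x. x \<notin> K \<Longrightarrow> \<phi> x = 0" using C1c_support[OF \<phi>] by metis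
  show "(\<lambda>x. c *\<^sub>R \<phi> x) \<in> C1c \<Omega>"
    by (rule C1cI[OF d _ K(1,2)]) (auto intro!: continuous_intros C1c_deriv_continuous[OF \<phi>] simp: K(3))
qed

lemma divergence_eq:
  fixes \<phi> :: "real^'n \<Rightarrow> real^'n"
  assumes "\<phi> \<in> C1c \<Omega>"
  shows "divergence \<phi> x = (\<Sum>i\<in>UNIV. frechet_derivative (\<lambda>x. \<phi> x $ i) (at x) (axis i 1))"
  unfolding divergence_def C1c_component(2)[OF assms] ..

lemma divergence_continuous:
  fixes \<phi> :: "real^'n \<Rightarrow> real^'n"
  assumes "\<phi> \<in> C1c \<Omega>"
  shows "continuous_on S (divergence \<phi>)"
proof -
  have "continuous_on S (\<lambda>x. \<Sum>i\<in>UNIV. frechet_derivative \<phi> (at x) (axis i 1) $ i)"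
    by (intro continuous_intros C1c_deriv_continuous[OF assms])
  then show ?thesis by (simp add: divergence_def[abs_def])
qed

lemma divergence_measurable:
  fixes \<phi> :: "real^'n \<Rightarrow> real^'n"
  assumes "\<phi> \<in> C1c \<Omega>"
  shows "divergence \<phi> \<in> borel_measurable borel"
  using divergence_continuous[OF assms] by (rule borel_measurable_continuous_onI)

subsection \<open>Functions of bounded variation\<close>

text \<open>The function is a Borel representative extended by zero, so that it can be integrated
  and translated on the whole space. T is an upper bound of the variation rather than its value, so
  that one T can serve a whole family of functions.\<close>

locale bv_function =
  fixes \<Omega> :: "(real^'n) set" and u :: "real^'n \<Rightarrow> real" and M T :: real
  assumes open_dom: "open \<Omega>" and bounded_dom: "bounded \<Omega>"
    and u_borel [measurable]: "u \<in> borel_measurable borel"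
    and u_bound: "\<And>x. \<bar>u x\<bar> \<le> M" and u_zero: "\<And>x. x \<notin> \<Omega> \<Longrightarrow> u x = 0"
    and variation_le: "\<And>\<phi>. \<phi> \<in> C1c \<Omega> \<Longrightarrow> (\<And>x. norm (\<phi> x) \<le> 1) \<Longrightarrow>
      (LINT x|lborel. u x * divergence \<phi> x) \<le> T"
begin

lemma M_nonneg: "0 \<le> M"
  using u_bound[of undefined] by linarith

lemma dom_borel [measurable]: "\<Omega> \<in> sets borel"
  using open_dom by auto

lemma T_nonneg: "0 \<le> T"
proof -
  have "((\<lambda>x. 0) :: real^'n \<Rightarrow> real^'n) \<in> C1c \<Omega>"
    by (rule C1cI[where D="\<lambda>_ _. 0" and K="{}"]) auto
  from variation_le[OF this] show ?thesis by (simp add: divergence_def)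
qed

lemma u_integrable: "integrable lborel u"
  by (rule integrable_lborel_bounded_support[OF u_borel _ bounded_dom]) (use u_bound u_zero in auto)

lemma u_mult_integrable:
  assumes [measurable]: "f \<in> borel_measurable borel" and "\<And>x. \<bar>f x\<bar> \<le> B"
  shows "integrable lborel (\<lambda>x. u x * f x)"
proof (rule integrable_lborel_bounded_support[where B="M * B" and K=\<Omega>])
  show "norm (u x * f x) \<le> M * B" for x
    unfolding real_norm_def abs_mult by (rule mult_mono[OF u_bound assms(2) M_nonneg]) simp
qed (use bounded_dom u_zero in auto)

lemma variation_le_scaled:
  assumes \<phi>: "\<phi> \<in> C1c \<Omega>" and L: "0 \<le> L" "\<And>x. norm (\<phi> x) \<le> L"
  shows "(LINT x|lborel. u x * divergence \<phi> x) \<le> L * T"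
proof (cases "L = 0")
  case True
  then have "\<phi> = (\<lambda>_. 0)" using L by auto
  then show ?thesis by (simp add: divergence_def True)
next
  case False
  then have L0: "0 < L" using L by simp
  have "(LINT x|lborel. u x * divergence (\<lambda>x. (1/L) *\<^sub>R \<phi> x) x) \<le> T"
    by (rule variation_le[OF C1c_scaleR(1)[OF \<phi>]]) (use L0 L in \<open>simp add: divide_le_eq\<close>)
  moreover have "u x * divergence (\<lambda>x. (1/L) *\<^sub>R \<phi> x) x = (1/L) * (u x * divergence \<phi> x)" for x
    unfolding divergence_def C1c_scaleR(2)[OF \<phi>] by (simp add: sum_distrib_left)
  ultimately have "(1/L) * (LINT x|lborel. u x * divergence \<phi> x) \<le> T" by simp
  then show ?thesis using L0 by (simp add: field_simps)
qed

text \<open>Testing \<open>Du\<close> against \<open>\<Sum>\<^sub>j v\<^sub>j \<integral>\<^sub>0\<^sup>1 \<eta>\<^sub>j(x - s v\<^sub>j) ds\<close>, whose divergence is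
  \<open>\<Sum>\<^sub>j (\<eta>\<^sub>j(x) - \<eta>\<^sub>j(x - v\<^sub>j))\<close>, and letting \<open>\<eta>\<^sub>j\<close> tend to the sign of \<open>u(x) - u(x + v\<^sub>j)\<close>.\<close>

lemma translation_sum_le:
  assumes J: "finite J" and U: "\<And>j. j \<in> J \<Longrightarrow> open (U j)"
    and seg: "\<And>j x. j \<in> J \<Longrightarrow> x \<in> U j \<Longrightarrow> closed_segment x (x + v j) \<subseteq> \<Omega>"
    and L: "0 \<le> L" "\<And>c. (\<And>j. j \<in> J \<Longrightarrow> \<bar>c j\<bar> \<le> 1) \<Longrightarrow> norm (\<Sum>j\<in>J. c j *\<^sub>R v j) \<le> L"
  shows "(\<Sum>j\<in>J. LINT x|lborel. indicator (U j) x * \<bar>u (x + v j) - u x\<bar>) \<le> L * T"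
proof -
  have Usub: "U j \<subseteq> \<Omega>" if "j \<in> J" for j
    using seg[OF that] by (meson ends_in_segment(1) subset_iff)
  define f where "f j x = sgn (u x - u (x + v j))" for j x
  have [measurable]: "f j \<in> borel_measurable borel" for j unfolding f_def by measurable
  have ex: "\<exists>\<eta>. (\<forall>n. \<eta> n \<in> C1c (U j)) \<and> (\<forall>n x. \<bar>\<eta> n x\<bar> \<le> 1) \<and>
    (AE x in lborel. x \<in> U j \<longrightarrow> (\<lambda>n::nat. \<eta> n x) \<longlonglongrightarrow> f j x)" if "j \<in> J" for j
  proof -
    have "f j \<in> borel_measurable lebesgue" by (intro measurable_completion) simp
    moreover have "\<bar>f j x\<bar> \<le> 1" for x by (simp add: f_def sgn_if)
    ultimately show ?thesis
      by (rule C1c_approx_AE[OF _ _ U[OF that] bounded_subset[OF bounded_dom Usub[OF that]]]) blast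
  qed
  have "\<exists>\<eta>. \<forall>j\<in>J. (\<forall>n. \<eta> j n \<in> C1c (U j)) \<and> (\<forall>n x. \<bar>\<eta> j n x\<bar> \<le> 1) \<and>
    (AE x in lborel. x \<in> U j \<longrightarrow> (\<lambda>n::nat. \<eta> j n x) \<longlonglongrightarrow> f j x)"
    by (rule bchoice) (use ex in blast)
  then obtain \<eta> where H: "\<forall>j\<in>J. (\<forall>n. \<eta> j n \<in> C1c (U j)) \<and> (\<forall>n x. \<bar>\<eta> j n x\<bar> \<le> 1) \<and>
    (AE x in lborel. x \<in> U j \<longrightarrow> (\<lambda>n::nat. \<eta> j n x) \<longlonglongrightarrow> f j x)" by (rule exE)
  then have \<eta>: "\<And>j n. j \<in> J \<Longrightarrow> \<eta> j n \<in> C1c (U j)" "\<And>j n x. j \<in> J \<Longrightarrow> \<bar>\<eta> j n x\<bar> \<le> 1"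
    "\<And>j. j \<in> J \<Longrightarrow> AE x in lborel. x \<in> U j \<longrightarrow> (\<lambda>n::nat. \<eta> j n x) \<longlonglongrightarrow> f j x"
    by simp_all
  have \<eta>0: "\<eta> j n x = 0" if j: "j \<in> J" and x: "x \<notin> U j" for j n x
    using C1c_outside[OF \<eta>(1)[OF j] x] .
  have [measurable]: "\<eta> j n \<in> borel_measurable borel" if "j \<in> J" for j n
    using C1c_measurable[OF \<eta>(1)[OF that]] .
  define I where "I n = (\<Sum>j\<in>J. LINT x|lborel. (u x - u (x + v j)) * \<eta> j n x)" for n
  have "I n \<le> L * T" for n
  proof -
    \<comment> \<open>All directions enter a single test field. Its norm is controlled through
      \<open>L(2)\<close> as a whole and not direction by direction; for the coordinate axes this
      yields sqrt d where separate estimates would yield d.\<close>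
    define \<phi> where "\<phi> x = (\<Sum>j\<in>J. segment_average (\<eta> j n) (v j) x *\<^sub>R v j)" for x
    have sa: "segment_average (\<eta> j n) (v j) \<in> C1c \<Omega>" if "j \<in> J" for j
      using segment_average_C1c(1)[OF \<eta>(1)[OF that] seg[OF that]] .
    have "(LINT x|lborel. u x * divergence \<phi> x) \<le> L * T"
    proof (rule variation_le_scaled[OF _ L(1)])
      show "\<phi> \<in> C1c \<Omega>" unfolding \<phi>_def by (rule C1c_sum_scaleR(1)[OF sa J])
      show "norm (\<phi> x) \<le> L" for x
        unfolding \<phi>_def by (rule L(2)) (rule segment_average_le[OF \<eta>(1) \<eta>(2)])
    qed
    moreover have "(LINT x|lborel. u x * divergence \<phi> x) = I n"
    proof -
      have d: "divergence \<phi> x = (\<Sum>j\<in>J. \<eta> j n x - \<eta> j n (x - v j))" for x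
      proof -
        have "divergence \<phi> x = (\<Sum>j\<in>J. frechet_derivative (segment_average (\<eta> j n) (v j)) (at x) (v j))"
          unfolding \<phi>_def by (rule divergence_sum_scaleR[OF sa J])
        also have "\<dots> = (\<Sum>j\<in>J. \<eta> j n x - \<eta> j n (x - v j))"
        proof (rule sum.cong)
          fix j assume j: "j \<in> J"
          show "frechet_derivative (segment_average (\<eta> j n) (v j)) (at x) (v j) = \<eta> j n x - \<eta> j n (x - v j)"
            using segment_average_C1c(2)[OF \<eta>(1)[OF j] seg[OF j]] .
        qed simp
        finally show ?thesis .
      qed
      have i1: "integrable lborel (\<lambda>x. u x * \<eta> j n x)" if "j \<in> J" for j
        by (rule u_mult_integrable[where B=1]) (use \<eta>(2) that in auto)
      have i2: "integrable lborel (\<lambda>x. u x * \<eta> j n (x - v j))" if "j \<in> J" for j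
        by (rule u_mult_integrable[where B=1]) (use \<eta>(2) that in auto)
      have i3: "integrable lborel (\<lambda>x. u (x + v j) * \<eta> j n x)" if "j \<in> J" for j
        using lborel_integrable_translate[OF i2[OF that], of "v j"] by simp
      have t: "(LINT x|lborel. u x * \<eta> j n (x - v j)) = (LINT x|lborel. u (x + v j) * \<eta> j n x)" if "j \<in> J" for j
        using lborel_integral_translate[of "\<lambda>x. u x * \<eta> j n (x - v j)" "v j"] that by simp
      have "(LINT x|lborel. u x * divergence \<phi> x) = (LINT x|lborel. (\<Sum>j\<in>J. u x * \<eta> j n x - u x * \<eta> j n (x - v j)))"
        unfolding d by (simp add: sum_distrib_left right_diff_distrib)
      also have "\<dots> = (\<Sum>j\<in>J. LINT x|lborel. u x * \<eta> j n x - u x * \<eta> j n (x - v j))"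
        by (rule Bochner_Integration.integral_sum) (use i1 i2 in auto)
      also have "\<dots> = I n" unfolding I_def
      proof (rule sum.cong)
        fix j assume j: "j \<in> J"
        show "(LINT x|lborel. u x * \<eta> j n x - u x * \<eta> j n (x - v j)) = (LINT x|lborel. (u x - u (x + v j)) * \<eta> j n x)"
          using i1[OF j] i2[OF j] i3[OF j] t[OF j] by (simp add: left_diff_distrib)
      qed simp
      finally show ?thesis .
    qed
    ultimately show ?thesis by simp
  qed
  moreover have "I \<longlonglongrightarrow> (\<Sum>j\<in>J. LINT x|lborel. indicator (U j) x * \<bar>u (x + v j) - u x\<bar>)"
    unfolding I_def
  proof (rule tendsto_sum, rule integral_dominated_convergence[where w="\<lambda>x. (2 * M) * indicator \<Omega> x"])
    fix j assume j: "j \<in> J"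
    have [measurable]: "U j \<in> sets borel" using U[OF j] by auto
    show "(\<lambda>x. indicator (U j) x * \<bar>u (x + v j) - u x\<bar>) \<in> borel_measurable lborel" by measurable
    show "(\<lambda>x. (u x - u (x + v j)) * \<eta> j n x) \<in> borel_measurable lborel" for n using j by measurable
    show "integrable lborel (\<lambda>x. 2 * M * indicator \<Omega> x)"
      by (rule integrable_indicator_bounded[OF bounded_dom]) simp
    show "AE x in lborel. norm ((u x - u (x + v j)) * \<eta> j n x) \<le> 2 * M * indicator \<Omega> x" for n
    proof (rule AE_I2)
      fix x
      show "norm ((u x - u (x + v j)) * \<eta> j n x) \<le> 2 * M * indicator \<Omega> x"
      proof (cases "x \<in> U j")
        case True
        have "\<bar>u x - u (x + v j)\<bar> \<le> 2 * M" using u_bound[of x] u_bound[of "x + v j"] by linarith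
        then have "\<bar>u x - u (x + v j)\<bar> * \<bar>\<eta> j n x\<bar> \<le> 2 * M * 1"
          using \<eta>(2)[OF j, of n x] M_nonneg by (intro mult_mono) auto
        then show ?thesis using True Usub[OF j] by (auto simp: abs_mult)
      qed (use \<eta>0[OF j] M_nonneg in auto)
    qed
    show "AE x in lborel. (\<lambda>n. (u x - u (x + v j)) * \<eta> j n x) \<longlonglongrightarrow> indicator (U j) x * \<bar>u (x + v j) - u x\<bar>"
      using \<eta>(3)[OF j]
    proof (rule eventually_mono)
      fix x assume ae: "x \<in> U j \<longrightarrow> (\<lambda>n. \<eta> j n x) \<longlonglongrightarrow> f j x"
      show "(\<lambda>n. (u x - u (x + v j)) * \<eta> j n x) \<longlonglongrightarrow> indicator (U j) x * \<bar>u (x + v j) - u x\<bar>"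
      proof (cases "x \<in> U j")
        case True
        then have "(\<lambda>n. (u x - u (x + v j)) * \<eta> j n x) \<longlonglongrightarrow> (u x - u (x + v j)) * f j x"
          using ae by (intro tendsto_mult_left) auto
        moreover have "(u x - u (x + v j)) * f j x = \<bar>u (x + v j) - u x\<bar>"
          unfolding f_def by (simp add: sgn_if)
        ultimately show ?thesis using True by simp
      qed (use \<eta>0[OF j] in simp)
    qed
  qed
  ultimately show ?thesis by (intro LIMSEQ_le_const2[where X=I]) auto
qed

lemma translation_le:
  assumes "open U" and "\<And>x. x \<in> U \<Longrightarrow> closed_segment x (x + v) \<subseteq> \<Omega>"
  shows "(LINT x|lborel. indicator U x * \<bar>u (x + v) - u x\<bar>) \<le> norm v * T"
  using translation_sum_le[of "{()}" "\<lambda>_. U" "\<lambda>_. v" "norm v"] assms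
  by (auto simp: mult_left_le_one_le)

text \<open>By Fubini the mollification of G is an average of translates of G, and each translation
  moves onto u. So the difference is an average over norm y < e of the integrals of (u(x + y) -
  u(x)) G(x), which \<open>translation_le\<close> bounds by C T norm y. The rate comes from the
  variation of u; of G only its bound and its support enter.\<close>

lemma mollified_pairing_limit:
  assumes [measurable]: "G \<in> borel_measurable borel" and G: "\<And>x. \<bar>G x\<bar> \<le> C"
    and K: "compact K" "K \<subseteq> \<Omega>" "\<And>x. x \<notin> K \<Longrightarrow> G x = 0"
    and e: "0 < e" "(\<Union>x\<in>K. cball x (2 * e)) \<subseteq> \<Omega>"
  shows "\<bar>(LINT x|lborel. u x * conv e G x) - (LINT x|lborel. u x * G x)\<bar> \<le> C * e * T"
proof -
  define R where "R y = (LINT x|lborel. u x * G (x - y))" for y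
  have C: "0 \<le> C" using G[of undefined] by linarith
  \<comment> \<open>An open neighbourhood of K of width e: a translation of its points by less than
    e stays within 2 e of K, hence in \<Omega>.\<close>
  define U where "U = (\<Union>x\<in>K. ball x e)"
  have U: "open U" unfolding U_def by auto
  have [measurable]: "U \<in> sets borel" using U by auto
  have close: "\<bar>R y - (LINT x|lborel. u x * G x)\<bar> \<le> C * e * T" if y: "norm y < e" for y
  proof -
    have seg: "closed_segment x (x + y) \<subseteq> \<Omega>" if "x \<in> U" for x
    proof
      fix z assume "z \<in> closed_segment x (x + y)"
      then have "dist x z \<le> norm y" using segment_bound1[of z x "x + y"] by (simp add: dist_norm norm_minus_commute)
      moreover obtain k where "k \<in> K" "dist k x < e" using \<open>x \<in> U\<close> by (auto simp: U_def)
      ultimately have "dist k z \<le> 2 * e" using y dist_triangle[of k z x] by linarith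
      then show "z \<in> \<Omega>" using e(2) \<open>k \<in> K\<close> by (meson UN_I mem_cball subset_iff)
    qed
    have i: "integrable lborel (\<lambda>x. u x * G (x - y))" "integrable lborel (\<lambda>x. u x * G x)"
      by (rule u_mult_integrable[where B=C]; use G in auto)+
    have i2: "integrable lborel (\<lambda>x. u (x + y) * G x)"
      using lborel_integrable_translate[OF i(1), of y] by simp
    have "R y = (LINT x|lborel. u (x + y) * G x)"
      unfolding R_def using lborel_integral_translate[of "\<lambda>x. u x * G (x - y)" y] by simp
    then have "R y - (LINT x|lborel. u x * G x) = (LINT x|lborel. (u (x + y) - u x) * G x)"
      using i i2 by (simp add: left_diff_distrib)
    also have "norm \<dots> \<le> (LINT x|lborel. C * (indicator U x * \<bar>u (x + y) - u x\<bar>))"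
    proof (rule lborel_norm_integral_le)
      show "integrable lborel (\<lambda>x. (u (x + y) - u x) * G x)" using i i2 by (simp add: left_diff_distrib)
      have "integrable lborel (\<lambda>x. indicator U x *\<^sub>R \<bar>u (x + y) - u x\<bar>)"
        by (intro integrable_mult_indicator integrable_abs Bochner_Integration.integrable_diff
            lborel_integrable_translate u_integrable) simp
      then show "integrable lborel (\<lambda>x. C * (indicator U x * \<bar>u (x + y) - u x\<bar>))" by simp
      show "norm ((u (x + y) - u x) * G x) \<le> C * (indicator U x * \<bar>u (x + y) - u x\<bar>)" for x
      proof (cases "x \<in> K")
        case True
        then have "x \<in> U" unfolding U_def by (rule UN_I) (use e in simp)
        then show ?thesis using G[of x] mult_right_mono[OF G[of x], of "\<bar>u (x + y) - u x\<bar>"]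
          by (simp add: abs_mult mult.commute)
      qed (use K(3) C in auto)
    qed
    also have "\<dots> = C * (LINT x|lborel. indicator U x * \<bar>u (x + y) - u x\<bar>)" by simp
    also have "\<dots> \<le> C * (norm y * T)" by (intro mult_left_mono translation_le U seg C)
    also have "\<dots> \<le> C * (e * T)" using y T_nonneg C by (intro mult_left_mono mult_right_mono) auto
    finally show ?thesis by (simp add: mult.assoc)
  qed
  obtain B where B: "\<And>x::real^'n. mol e x \<le> B" using mol_bounds[OF e(1), where 'a="real^'n"] by metis
  have B0: "0 \<le> B" using B[of 0] mol_nonneg[OF e(1), of "0::real^'n"] by linarith
  have intp: "integrable (lborel \<Otimes>\<^sub>M lborel) (\<lambda>(x, y). mol e y * (u x * G (x - y)))"
    unfolding lborel_prod
  proof (rule integrable_lborel_bounded_support[where B="B * (M * C)" and K="\<Omega> \<times> cball 0 e"])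
    show "(\<lambda>(x, y). mol e y * (u x * G (x - y))) \<in> borel_measurable borel"
      unfolding borel_prod[symmetric] by measurable
    show "norm (case z of (x, y) \<Rightarrow> mol e y * (u x * G (x - y))) \<le> B * (M * C)" for z
    proof (cases z)
      case (Pair x y)
      have "\<bar>mol e y\<bar> * (\<bar>u x\<bar> * \<bar>G (x - y)\<bar>) \<le> B * (M * C)"
        by (intro mult_mono mol_abs_bound[OF e(1) B] u_bound G B0 M_nonneg mult_nonneg_nonneg C) auto
      then show ?thesis using Pair by (simp add: abs_mult)
    qed
    show "bounded (\<Omega> \<times> cball (0::real^'n) e)" by (intro bounded_Times bounded_dom bounded_cball)
    show "(case z of (x, y) \<Rightarrow> mol e y * (u x * G (x - y))) = 0" if "z \<notin> \<Omega> \<times> cball 0 e" for z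
      using that u_zero mol_outside(1)[OF e(1), of "snd z"] by (cases z) (auto simp: not_le)
  qed
  have "(LINT x|lborel. u x * conv e G x) = (LINT x|lborel. LINT y|lborel. mol e y * (u x * G (x - y)))"
    by (subst conv_alt) (auto simp flip: integral_mult_right_zero simp: ac_simps)
  also have "\<dots> = (LINT y|lborel. LINT x|lborel. mol e y * (u x * G (x - y)))"
    by (rule lborel_pair.Fubini_integral[OF intp, symmetric])
  also have "\<dots> = (LINT y|lborel. mol e y * R y)" by (simp add: R_def)
  finally have eq: "(LINT x|lborel. u x * conv e G x) = (LINT y|lborel. mol e y * R y)" .
  have iR: "integrable lborel (\<lambda>y. mol e y * R y)"
    using lborel_pair.integrable_snd[OF intp] by (simp add: R_def)
  define X where "X = (LINT x|lborel. u x * G x)"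
  have iX: "integrable lborel (\<lambda>y::real^'n. mol e y * X)" using mol_integrable[OF e(1)] by auto
  have "(LINT x|lborel. u x * conv e G x) - X = (LINT y|lborel. mol e y * R y) - (LINT y|lborel. mol e (y::real^'n) * X)"
    using eq mol_integral[OF e(1), where 'a="real^'n"] by simp
  also have "\<dots> = (LINT y|lborel. mol e y * R y - mol e y * X)"
    by (rule Bochner_Integration.integral_diff[OF iR iX, symmetric])
  also have "norm \<dots> \<le> (LINT y|lborel. mol e (y::real^'n) * (C * e * T))"
  proof (rule lborel_norm_integral_le)
    show "integrable lborel (\<lambda>y. mol e y * R y - mol e y * X)"
      by (rule Bochner_Integration.integrable_diff[OF iR iX])
    show "integrable lborel (\<lambda>y::real^'n. mol e y * (C * e * T))" using mol_integrable[OF e(1)] by auto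
    show "norm (mol e y * R y - mol e y * X) \<le> mol e y * (C * e * T)" for y
    proof (cases "norm y < e")
      case True
      have "norm (mol e y * R y - mol e y * X) = mol e y * \<bar>R y - X\<bar>"
        using mol_nonneg[OF e(1), of y] by (simp add: abs_mult flip: right_diff_distrib)
      also have "\<dots> \<le> mol e y * (C * e * T)"
        using close[OF True] mol_nonneg[OF e(1), of y] unfolding X_def by (intro mult_left_mono) auto
      finally show ?thesis .
    qed (simp add: mol_outside[OF e(1)])
  qed
  also have "\<dots> = C * e * T" using mol_integral[OF e(1), where 'a="real^'n"] by simp
  finally show ?thesis by (simp add: X_def)
qed

text \<open>Extends the inequality that defines T from C^1 fields to bounded fields \<Phi> of
  compact support with bounded weak divergence G. Hypothesis \<open>weak\<close> tests the weak
  divergence with reflected and translated mollifiers, which is what makes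
  \<open>divergence (conv e \<Phi>)\<close> equal to \<open>conv e G\<close>; then e tends to 0 by
  \<open>mollified_pairing_limit\<close>.\<close>

lemma weak_divergence_le:
  assumes [measurable]: "\<Phi> \<in> borel_measurable borel" "G \<in> borel_measurable borel"
    and \<Phi>1: "\<And>x. norm (\<Phi> x) \<le> 1" and G: "\<And>x. \<bar>G x\<bar> \<le> C"
    and K: "compact K" "K \<subseteq> \<Omega>" "\<And>x. x \<notin> K \<Longrightarrow> \<Phi> x = 0" "\<And>x. x \<notin> K \<Longrightarrow> G x = 0"
    and weak: "\<And>e x. 0 < e \<Longrightarrow> (LINT y|lborel. mol_grad e (x - y) \<bullet> \<Phi> y) = (LINT y|lborel. mol e (x - y) * G y)"
  shows "(LINT x|lborel. u x * G x) \<le> T"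
proof -
  obtain e0 where e0: "0 < e0" "(\<Union>x\<in>K. cball x e0) \<subseteq> \<Omega>"
    using compact_subset_open_imp_cball_epsilon_subset[OF K(1) open_dom K(2)] by blast
  have C: "0 \<le> C" using G[of undefined] by linarith
  have i\<Phi>: "integrable lborel \<Phi>"
    by (rule integrable_lborel_bounded_support[where K=K and B=1]) (use \<Phi>1 K compact_imp_bounded in auto)
  have le: "(LINT x|lborel. u x * G x) \<le> T + e * (C * T)" if e: "0 < e" "2 * e \<le> e0" for e
  proof -
    have sub: "(\<Union>x\<in>K. cball x (2 * e)) \<subseteq> \<Omega>" using e0(2) e(2) by fastforce
    have "conv e \<Phi> \<in> C1c \<Omega>"
    proof (rule conv_C1c[OF e(1) i\<Phi> compact_thicken[OF K(1)] sub])
      fix x y assume "norm (x - y) < e" "x \<notin> (\<Union>x\<in>K. cball x (2 * e))"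
      then have "y \<notin> K" using e by (force simp: dist_norm norm_minus_commute)
      then show "\<Phi> y = 0" by (rule K(3))
    qed
    then have "(LINT x|lborel. u x * divergence (conv e \<Phi>) x) \<le> T"
      by (rule variation_le) (rule conv_norm_le[OF e(1) _ \<Phi>1], simp)
    moreover have "divergence (conv e \<Phi>) x = conv e G x" for x
    proof -
      obtain B where B: "\<And>x::real^'n. norm (mol_grad e x) \<le> B" using mol_bounds[OF e(1), where 'a="real^'n"] by metis
      have i: "integrable lborel (\<lambda>y. (mol_grad e (x - y) \<bullet> v) *\<^sub>R \<Phi> y)" for v
        by (rule kernel_integrable[OF i\<Phi>, of "\<lambda>z. mol_grad e z \<bullet> v" "B * norm v"])
          (auto intro: mol_grad_inner_bound[OF B])
      have i': "integrable lborel (\<lambda>y. ((mol_grad e (x - y) \<bullet> v) *\<^sub>R \<Phi> y) $ i)" for v i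
        by (rule integrable_bounded_linear[OF bounded_linear_vec_nth i])
      have "divergence (conv e \<Phi>) x = (\<Sum>i\<in>UNIV. (LINT y|lborel. (mol_grad e (x - y) \<bullet> axis i 1) *\<^sub>R \<Phi> y) $ i)"
        unfolding divergence_def conv_frechet[OF e(1) i\<Phi>] ..
      also have "\<dots> = (\<Sum>i\<in>UNIV. LINT y|lborel. ((mol_grad e (x - y) \<bullet> axis i 1) *\<^sub>R \<Phi> y) $ i)"
        by (intro sum.cong refl integral_bounded_linear[OF bounded_linear_vec_nth i, symmetric])
      also have "\<dots> = (LINT y|lborel. (\<Sum>i\<in>UNIV. ((mol_grad e (x - y) \<bullet> axis i 1) *\<^sub>R \<Phi> y) $ i))"
        by (rule Bochner_Integration.integral_sum[symmetric]) (rule i')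
      also have "\<dots> = (LINT y|lborel. mol_grad e (x - y) \<bullet> \<Phi> y)"
      proof -
        have "mol_grad e (x - y) \<bullet> \<Phi> y = (\<Sum>i\<in>UNIV. mol_grad e (x - y) $ i * \<Phi> y $ i)" for y
          by (simp add: inner_vec_def)
        then show ?thesis by (simp add: inner_axis)
      qed
      also have "\<dots> = conv e G x" unfolding weak[OF e(1)] conv_def by simp
      finally show ?thesis .
    qed
    ultimately have "(LINT x|lborel. u x * conv e G x) \<le> T" by simp
    moreover have "\<bar>(LINT x|lborel. u x * conv e G x) - (LINT x|lborel. u x * G x)\<bar> \<le> C * e * T"
      by (rule mollified_pairing_limit[OF _ G K(1,2,4) e(1) sub]) simp
    ultimately show ?thesis by (simp add: algebra_simps)
  qed
  define e where "e n = e0 / 2 * inverse (real (Suc n))" for n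
  have "(\<lambda>n. T + e n * (C * T)) \<longlonglongrightarrow> T + (e0 / 2 * 0) * (C * T)"
    unfolding e_def by (intro tendsto_intros LIMSEQ_inverse_real_of_nat)
  moreover have "(LINT x|lborel. u x * G x) \<le> T + e n * (C * T)" for n
  proof (rule le)
    show "0 < e n" using e0 by (simp add: e_def)
    have "inverse (real (Suc n)) \<le> 1" by (simp add: field_simps)
    then have "e0 * inverse (real (Suc n)) \<le> e0 * 1" using e0 by (intro mult_left_mono) auto
    then show "2 * e n \<le> e0" by (simp add: e_def)
  qed
  ultimately show ?thesis by (intro LIMSEQ_le_const[where X="\<lambda>n. T + e n * (C * T)"]) auto
qed

end

subsection \<open>Cubical meshes\<close>

lemma mem_cube: "x \<in> cube a s \<longleftrightarrow> (\<forall>i. a $ i \<le> x $ i \<and> x $ i \<le> a $ i + s)"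
  by (simp add: cube_def mem_box_cart)

lemma interior_cube: "interior (cube a s) = box a (a + vec s)"
  by (simp add: cube_def interior_cbox)

lemma box_subset_cube: "box a (a + vec s) \<subseteq> cube a s"
  unfolding cube_def by (rule box_subset_cbox)

lemma cube_inj:
  fixes a b :: "real^'n"
  assumes "0 < s" "cube a s = cube b s"
  shows "a = b"
proof (rule vec_eq_iff[THEN iffD2], rule allI)
  fix i
  have "a \<in> cube a s" "b \<in> cube b s" using assms(1) by (auto simp: mem_cube)
  then have "a \<in> cube b s" "b \<in> cube a s" using assms(2) by auto
  then have "b $ i \<le> a $ i" "a $ i \<le> b $ i" unfolding mem_cube by blast+
  then show "a $ i = b $ i" by simp
qed

lemma open_null_empty:
  fixes S :: "'a::euclidean_space set"
  assumes "open S" "S \<in> null_sets lebesgue"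
  shows "S = {}"
  using assms open_not_negligible negligible_iff_null_sets by blast

text \<open>Suppose the lower face of cube b in direction i cuts strictly through the range of cube
  a. Moving a common point across cube a along axis i gives a segment with an inner point in both
  cubes; a face that contains an inner point of a segment contains its ends, but the lower end lies
  below cube b.\<close>

lemma face_offset_aux:
  fixes a b :: "real^'n"
  assumes s: "0 < s" and face: "(cube a s \<inter> cube b s) face_of cube a s"
    and p: "p \<in> cube a s \<inter> cube b s" and i: "a $ i < b $ i" "b $ i < a $ i + s"
  shows False
proof -
  define q where "q r = (\<chi> l. if l = i then r else p $ l)" for r
  \<comment> \<open>The midpoint of \<open>b $ i\<close> and \<open>a $ i + s\<close> lies in the
    range of both cubes and strictly inside that of cube a.\<close>
  define m where "m = (b $ i + a $ i + s) / 2"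
  have 1: "q (a $ i) \<in> cube a s" "q (a $ i + s) \<in> cube a s" "q m \<in> cube a s \<inter> cube b s"
    using p s i by (auto simp: mem_cube q_def m_def field_simps)
  have "q m \<in> open_segment (q (a $ i)) (q (a $ i + s))"
    unfolding in_segment
  proof
    have "q (a $ i) $ i \<noteq> q (a $ i + s) $ i" using s by (simp add: q_def)
    then show "q (a $ i) \<noteq> q (a $ i + s)" by metis
    define w where "w = (m - a $ i) / s"
    have "0 < w" "w < 1" using s i by (auto simp: w_def m_def field_simps)
    moreover have "q m = (1 - w) *\<^sub>R q (a $ i) + w *\<^sub>R q (a $ i + s)"
      using s by (simp add: vec_eq_iff q_def w_def field_simps)
    ultimately show "\<exists>u>0. u < 1 \<and> q m = (1 - u) *\<^sub>R q (a $ i) + u *\<^sub>R q (a $ i + s)" by blast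
  qed
  then have "q (a $ i) \<in> cube a s \<inter> cube b s" using face 1 unfolding face_of_def by blast
  then have "b $ i \<le> q (a $ i) $ i" by (simp add: mem_cube)
  then show False using i by (simp add: q_def)
qed

locale cubical_mesh =
  fixes \<Omega> :: "(real^'n) set" and \<tau> :: real and \<Q> :: "(real^'n) set set"
  assumes mesh: "is_mesh \<Omega> \<tau> \<Q>" and lipschitz: "lipschitz_domain \<Omega>" and bounded_domain: "bounded \<Omega>"
begin

definition corners :: "(real^'n) set" where
  "corners = {a. cube a \<tau> \<in> \<Q>}"

abbreviation cell :: "real^'n \<Rightarrow> (real^'n) set" where
  "cell a \<equiv> box a (a + vec \<tau>)"

lemma open_domain: "open \<Omega>"
  using lipschitz by (simp add: lipschitz_domain_def)

lemma size_pos: "0 < \<tau>"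
  using mesh by (simp add: is_mesh_def)

lemma Q_eq: "\<Q> = (\<lambda>a. cube a \<tau>) ` corners"
  using mesh by (auto simp: is_mesh_def corners_def)

lemma finite_corners: "finite corners"
proof (rule finite_imageD)
  show "finite ((\<lambda>a. cube a \<tau>) ` corners)" using mesh Q_eq by (simp add: is_mesh_def)
  show "inj_on (\<lambda>a. cube a \<tau>) corners" using cube_inj[OF size_pos] by (auto simp: inj_on_def)
qed

lemma cells_disjoint:
  assumes "a \<in> corners" "b \<in> corners" "x \<in> cell a" "x \<in> cell b"
  shows "a = b"
proof (rule ccontr)
  assume "a \<noteq> b"
  then have "cube a \<tau> \<noteq> cube b \<tau>" using cube_inj[OF size_pos] by blast
  then have "interior (cube a \<tau>) \<inter> interior (cube b \<tau>) = {}"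
    using mesh assms by (auto simp: is_mesh_def corners_def)
  then show False using assms by (auto simp: interior_cube)
qed

text \<open>A conforming mesh is locally a lattice: cubes that meet differ by at most \<tau> in each
  coordinate, and \<open>face_offset_aux\<close> in both orders excludes all nonzero offsets of
  modulus below \<tau>.\<close>

lemma offset:
  assumes a: "a \<in> corners" and b: "b \<in> corners" and ne: "cube a \<tau> \<inter> cube b \<tau> \<noteq> {}"
  shows "b $ i = a $ i - \<tau> \<or> b $ i = a $ i \<or> b $ i = a $ i + \<tau>"
proof (cases "a = b")
  case False
  then have "cube a \<tau> \<noteq> cube b \<tau>" using cube_inj[OF size_pos] by blast
  have m: "Q \<inter> R = {} \<or> ((Q \<inter> R) face_of Q \<and> (Q \<inter> R) face_of R)"
    if "Q \<in> \<Q>" "R \<in> \<Q>" "Q \<noteq> R" for Q R using mesh that unfolding is_mesh_def by blast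
  have f: "(cube a \<tau> \<inter> cube b \<tau>) face_of cube a \<tau>" "(cube b \<tau> \<inter> cube a \<tau>) face_of cube b \<tau>"
    using m[of "cube a \<tau>" "cube b \<tau>"] m[of "cube b \<tau>" "cube a \<tau>"] \<open>cube a \<tau> \<noteq> cube b \<tau>\<close> a b ne
    unfolding corners_def by blast+
  obtain p where p: "p \<in> cube a \<tau> \<inter> cube b \<tau>" using ne by blast
  then have p': "p \<in> cube b \<tau> \<inter> cube a \<tau>" by blast
  have "\<bar>b $ i - a $ i\<bar> \<le> \<tau>" using p by (auto simp: mem_cube abs_le_iff) (smt (verit))+
  moreover have "\<not> (a $ i < b $ i \<and> b $ i < a $ i + \<tau>)" using face_offset_aux[OF size_pos f(1) p] by blast
  moreover have "\<not> (b $ i < a $ i \<and> a $ i < b $ i + \<tau>)" using face_offset_aux[OF size_pos f(2) p'] by blast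
  ultimately show ?thesis by linarith
qed simp

text \<open>Finitely many pairs of disjoint compact cubes have a positive least distance. Hence a
  displacement shorter than \<delta> leads from a cell only into cells that touch it, and for those
  the offsets are known.\<close>

lemma gap:
  obtains \<delta> where "0 < \<delta>" "\<And>a b x y. a \<in> corners \<Longrightarrow> b \<in> corners \<Longrightarrow> x \<in> cube a \<tau> \<Longrightarrow> y \<in> cube b \<tau> \<Longrightarrow>
    dist x y < \<delta> \<Longrightarrow> cube a \<tau> \<inter> cube b \<tau> \<noteq> {}"
proof -
  have "\<exists>d>0. cube a \<tau> \<inter> cube b \<tau> = {} \<longrightarrow> (\<forall>x\<in>cube a \<tau>. \<forall>y\<in>cube b \<tau>. d \<le> dist x y)" for a b :: "real^'n"
    using separate_compact_closed[of "cube a \<tau>" "cube b \<tau>"]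
    by (cases "cube a \<tau> \<inter> cube b \<tau> = {}") (auto simp: cube_def intro: exI[of _ 1])
  then have "\<forall>p. \<exists>d>0. cube (fst p) \<tau> \<inter> cube (snd p) \<tau> = {} \<longrightarrow>
      (\<forall>x\<in>cube (fst p) \<tau>. \<forall>y\<in>cube (snd p :: real^'n) \<tau>. d \<le> dist x y)" by blast
  from choice[OF this] obtain d where dd: "\<forall>p. 0 < d p \<and> (cube (fst p) \<tau> \<inter> cube (snd p) \<tau> = {} \<longrightarrow>
      (\<forall>x\<in>cube (fst p) \<tau>. \<forall>y\<in>cube (snd p :: real^'n) \<tau>. d p \<le> dist x y))" by (rule exE)
  then have d: "\<And>a b. 0 < d (a, b)"
    "\<And>a b x y. cube a \<tau> \<inter> cube b \<tau> = {} \<Longrightarrow> x \<in> cube a \<tau> \<Longrightarrow> y \<in> cube b \<tau> \<Longrightarrow> d (a, b) \<le> dist x y"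
    by force+
  define D where "D = insert 1 (d ` (corners \<times> corners))"
  have fD: "finite D" "D \<noteq> {}" unfolding D_def using finite_corners by auto
  have "0 < Min D" using fD d(1) by (auto simp: D_def)
  moreover have "cube a \<tau> \<inter> cube b \<tau> \<noteq> {}"
    if "a \<in> corners" "b \<in> corners" "x \<in> cube a \<tau>" "y \<in> cube b \<tau>" "dist x y < Min D" for a b x y
  proof
    assume "cube a \<tau> \<inter> cube b \<tau> = {}"
    then have "d (a, b) \<le> dist x y" using d(2) that by blast
    moreover have "Min D \<le> d (a, b)" by (rule Min_le[OF fD(1)]) (use that in \<open>force simp: D_def\<close>)
    ultimately show False using that by linarith
  qed
  ultimately show ?thesis using that by blast
qed

lemma closed_cells: "closed (\<Union>\<Q>)"
proof (rule closed_Union)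
  show "finite \<Q>" using mesh by (simp add: is_mesh_def)
  have "\<forall>Q\<in>\<Q>. \<exists>a. Q = cube a \<tau>" using mesh by (simp add: is_mesh_def)
  then show "\<forall>Q\<in>\<Q>. closed Q" unfolding cube_def by (metis closed_cbox)
qed

lemma diff_null: "\<Omega> - \<Union>\<Q> \<in> null_sets lebesgue" "\<Union>\<Q> - \<Omega> \<in> null_sets lebesgue"
proof -
  have "(\<Union>\<Q> - \<Omega>) \<union> (\<Omega> - \<Union>\<Q>) \<in> null_sets lebesgue" using mesh unfolding is_mesh_def eq_up_to_null_def by blast
  moreover have "\<Omega> - \<Union>\<Q> \<in> sets lebesgue" "\<Union>\<Q> - \<Omega> \<in> sets lebesgue"
    using closed_cells open_domain by auto
  ultimately show "\<Omega> - \<Union>\<Q> \<in> null_sets lebesgue" "\<Union>\<Q> - \<Omega> \<in> null_sets lebesgue"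
    by (auto elim!: null_sets_subset)
qed

text \<open>The mesh fixes \<Omega> up to a null set only, so slits along shared faces have to be
  excluded. At a missing inner point the Lipschitz graph would leave a nonempty open set below it
  outside \<Omega> and inside the union of the cells, of positive measure. Consequently the relative
  interior of a face shared by two cells lies in \<Omega>.\<close>

lemma domain_eq: "\<Omega> = interior (\<Union>\<Q>)"
proof
  have "open (\<Omega> - \<Union>\<Q>)" using open_domain closed_cells by (rule open_Diff)
  then have "\<Omega> - \<Union>\<Q> = {}" using diff_null(1) by (rule open_null_empty)
  then have "\<Omega> \<subseteq> \<Union>\<Q>" by blast
  then show "\<Omega> \<subseteq> interior (\<Union>\<Q>)" using open_domain by (rule interior_maximal)
  show "interior (\<Union>\<Q>) \<subseteq> \<Omega>"
  proof
    fix x assume x: "x \<in> interior (\<Union>\<Q>)"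
    have null: "V = {}" if "open V" "V \<subseteq> interior (\<Union>\<Q>)" "V \<inter> \<Omega> = {}" for V
    proof (rule open_null_empty[OF that(1)])
      have "V \<subseteq> \<Union>\<Q> - \<Omega>" using that interior_subset by blast
      then show "V \<in> null_sets lebesgue" using diff_null(2) negligible_iff_null_sets negligible_subset by blast
    qed
    show "x \<in> \<Omega>"
    proof (rule ccontr)
      assume "x \<notin> \<Omega>"
      have "x \<in> closure \<Omega>"
      proof (rule ccontr)
        assume "x \<notin> closure \<Omega>"
        moreover have "interior (\<Union>\<Q>) - closure \<Omega> = {}"
          by (rule null) (use closure_subset in auto)
        ultimately show False using x by blast
      qed
      then have "x \<in> frontier \<Omega>" using \<open>x \<notin> \<Omega>\<close> open_domain by (simp add: frontier_def interior_open)
      then obtain \<nu> r L \<gamma> where *: "norm \<nu> = 1" "0 < r" "L-lipschitz_on UNIV (\<gamma> :: real^'n \<Rightarrow> real)"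
        "\<Omega> \<inter> ball x r = {y \<in> ball x r. \<gamma> (y - (y \<bullet> \<nu>) *\<^sub>R \<nu>) < y \<bullet> \<nu>}"
        using lipschitz unfolding lipschitz_domain_def by blast
      define V where "V = {y. y \<bullet> \<nu> < \<gamma> (y - (y \<bullet> \<nu>) *\<^sub>R \<nu>)} \<inter> (ball x r \<inter> interior (\<Union>\<Q>))"
      have c\<gamma>: "continuous_on UNIV \<gamma>" using *(3) by (rule lipschitz_on_continuous_on)
      have "open V" unfolding V_def
        by (intro open_Int open_Collect_less continuous_intros continuous_on_compose2[OF c\<gamma>]) auto
      moreover have "V \<inter> \<Omega> = {}"
      proof (rule ccontr)
        assume "V \<inter> \<Omega> \<noteq> {}"
        then obtain y where y: "y \<in> V" "y \<in> \<Omega>" by blast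
        then have "y \<in> \<Omega> \<inter> ball x r" by (simp add: V_def)
        then show False unfolding *(4) using y(1) by (simp add: V_def)
      qed
      moreover have "V \<subseteq> interior (\<Union>\<Q>)" unfolding V_def by blast
      ultimately have "V = {}" using null[of V] by simp
      obtain e where e: "0 < e" "ball x e \<subseteq> ball x r \<inter> interior (\<Union>\<Q>)"
        using x *(2) by (metis IntI centre_in_ball open_Int open_ball open_contains_ball open_interior)
      \<comment> \<open>A step from x against \<nu> lowers the height and leaves the argument of
        \<gamma> unchanged, so it ends strictly below the graph.\<close>
      define y where "y = x - (e/2) *\<^sub>R \<nu>"
      have nn: "\<nu> \<bullet> \<nu> = 1" using *(1) by (simp add: norm_eq_1)
      have "y \<in> ball x e" using e *(1) by (simp add: y_def dist_norm)
      then have "y \<in> ball x r \<inter> interior (\<Union>\<Q>)" using e by blast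
      moreover have "y - (y \<bullet> \<nu>) *\<^sub>R \<nu> = x - (x \<bullet> \<nu>) *\<^sub>R \<nu>"
        by (simp add: y_def inner_diff_left nn scaleR_diff_left)
      moreover have "\<not> \<gamma> (x - (x \<bullet> \<nu>) *\<^sub>R \<nu>) < x \<bullet> \<nu>"
      proof
        assume "\<gamma> (x - (x \<bullet> \<nu>) *\<^sub>R \<nu>) < x \<bullet> \<nu>"
        then have "x \<in> \<Omega> \<inter> ball x r" unfolding *(4) using *(2) by simp
        then show False using \<open>x \<notin> \<Omega>\<close> by blast
      qed
      moreover have "y \<bullet> \<nu> = x \<bullet> \<nu> - e/2" by (simp add: y_def inner_diff_left nn)
      ultimately have "y \<in> V" using e(1) by (simp add: V_def)
      then show False using \<open>V = {}\<close> by blast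
    qed
  qed
qed

lemma domain_subset: "x \<in> \<Omega> \<Longrightarrow> \<exists>a\<in>corners. x \<in> cube a \<tau>"
  using domain_eq interior_subset[of "\<Union>\<Q>"] Q_eq by blast

lemma cell_subset: "a \<in> corners \<Longrightarrow> cell a \<subseteq> \<Omega>"
proof -
  assume a: "a \<in> corners"
  have "cell a \<subseteq> \<Union>\<Q>" using a box_subset_cube Q_eq by blast
  then show ?thesis unfolding domain_eq by (rule interior_maximal) (rule open_box)
qed

lemma AE_cell: "AE x in lborel. x \<in> \<Omega> \<longrightarrow> (\<exists>a\<in>corners. x \<in> cell a)"
proof -
  have "AE x in lborel. x \<notin> cube a \<tau> - cell a" for a :: "real^'n"
  proof -
    have "cube a \<tau> - cell a \<in> null_sets lebesgue"
      unfolding negligible_iff_null_sets[symmetric] cube_def by (rule negligible_frontier_interval)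
    then have "AE x in lebesgue. x \<notin> cube a \<tau> - cell a" by (rule AE_not_in)
    then show ?thesis by (simp add: AE_completion_iff)
  qed
  then have "AE x in lborel. \<forall>a\<in>corners. x \<notin> cube a \<tau> - cell a"
    using finite_corners by (intro AE_finite_allI)
  then show ?thesis by (rule eventually_mono) (use domain_subset in blast)
qed

lemma AE_hyperplane: "AE x in lborel. (x::real^'n) $ k \<noteq> c"
proof -
  have "{x::real^'n. x $ k = c} \<in> null_sets lebesgue"
    unfolding negligible_iff_null_sets[symmetric] using negligible_hyperplane[of "axis k 1 :: real^'n" c]
    by (simp add: inner_axis' axis_eq_0_iff)
  then have "AE x in lebesgue. x \<notin> {x::real^'n. x $ k = c}" by (rule AE_not_in)
  then show ?thesis by (simp add: AE_completion_iff)
qed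

text \<open>In a coordinate l other than j the point z of cube b lies strictly inside the range of
  a, which forces the offset 0; in coordinate j it lies outside, which forces the offset towards
  z.\<close>

lemma neighbour:
  assumes a: "a \<in> corners" and b: "b \<in> corners" and ne: "cube a \<tau> \<inter> cube b \<tau> \<noteq> {}" and z: "z \<in> cube b \<tau>"
    and inside: "\<And>l. l \<noteq> j \<Longrightarrow> a $ l < z $ l \<and> z $ l < a $ l + \<tau>"
  shows "z $ j < a $ j \<Longrightarrow> b = a - axis j \<tau>" and "a $ j + \<tau> < z $ j \<Longrightarrow> b = a + axis j \<tau>"
proof -
  have o: "b $ l = a $ l - \<tau> \<or> b $ l = a $ l \<or> b $ l = a $ l + \<tau>" for l by (rule offset[OF a b ne])
  have zb: "b $ l \<le> z $ l" "z $ l \<le> b $ l + \<tau>" for l using z by (auto simp: mem_cube)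
  have l: "b $ l = a $ l" if "l \<noteq> j" for l using o[of l] zb[of l] inside[OF that] by linarith
  show "b = a - axis j \<tau>" if "z $ j < a $ j"
  proof -
    have "b $ j = a $ j - \<tau>" using o[of j] zb[of j] that size_pos by linarith
    then show ?thesis using l by (auto simp: vec_eq_iff axis_def)
  qed
  show "b = a + axis j \<tau>" if "a $ j + \<tau> < z $ j"
  proof -
    have "b $ j = a $ j + \<tau>" using o[of j] zb[of j] that size_pos by linarith
    then show ?thesis using l by (auto simp: vec_eq_iff axis_def)
  qed
qed

section \<open>Step functions and their variation\<close>

definition step_fun :: "(real^'n \<Rightarrow> real) \<Rightarrow> real^'n \<Rightarrow> real" where
  "step_fun c x = (\<Sum>a\<in>corners. c a * indicator (cell a) x)"

lemma step_fun_measurable [measurable]: "step_fun c \<in> borel_measurable borel"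
  unfolding step_fun_def[abs_def] by measurable

lemma step_fun_cell: "a \<in> corners \<Longrightarrow> x \<in> cell a \<Longrightarrow> step_fun c x = c a"
proof -
  assume a: "a \<in> corners" "x \<in> cell a"
  have "step_fun c x = (\<Sum>b\<in>corners. if b = a then c a else 0)"
    unfolding step_fun_def
  proof (rule sum.cong)
    fix b assume b: "b \<in> corners"
    show "c b * indicator (cell b) x = (if b = a then c a else 0)"
    proof (cases "b = a")
      case False
      then have "x \<notin> cell b" using cells_disjoint[OF b a(1) _ a(2)] by blast
      then show ?thesis using False by simp
    qed (use a(2) in simp)
  qed simp
  then show ?thesis using a finite_corners by simp
qed

lemma step_fun_outside: "x \<notin> \<Omega> \<Longrightarrow> step_fun c x = 0"
  unfolding step_fun_def using cell_subset by (intro sum.neutral) (auto simp: indicator_def)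

lemma step_fun_bound: "\<bar>step_fun c x\<bar> \<le> (\<Sum>a\<in>corners. \<bar>c a\<bar>)"
  unfolding step_fun_def by (rule order_trans[OF sum_abs]) (auto intro!: sum_mono simp: abs_mult indicator_def)

text \<open>Every face shared by two cells and orthogonal to axis k is counted once, from the cell
  above it. Multiplied by the face area \<tau>^(d-1) this is the variation in direction k.\<close>

definition jump_sum :: "(real^'n \<Rightarrow> real) \<Rightarrow> 'n \<Rightarrow> real" where
  "jump_sum c k = (\<Sum>a\<in>{a\<in>corners. a - axis k \<tau> \<in> corners}. \<bar>c (a - axis k \<tau>) - c a\<bar>)"

lemma jump_sum_nonneg: "0 \<le> jump_sum c k"
  unfolding jump_sum_def by (simp add: sum_nonneg)

lemma slab_content:
  fixes a :: "real^'n"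
  assumes "0 \<le> t"
  shows "measure lborel (cbox a (\<chi> l. if l = k then a $ l + t else a $ l + \<tau>)) = t * \<tau> ^ (CARD('n) - 1)"
proof -
  define b where "b = (\<chi> l. if l = k then a $ l + t else a $ l + \<tau>)"
  have "a \<in> cbox a b" using assms size_pos by (auto simp: mem_box_cart b_def)
  then have "measure lborel (cbox a b) = (\<Prod>l\<in>UNIV. b $ l - a $ l)" by (intro content_cbox_cart) blast
  also have "\<dots> = (b $ k - a $ k) * (\<Prod>l\<in>UNIV - {k}. b $ l - a $ l)" by (rule prod.remove) auto
  also have "(\<Prod>l\<in>UNIV - {k}. b $ l - a $ l) = (\<Prod>l\<in>UNIV - {k}. \<tau>)" by (rule prod.cong) (auto simp: b_def)
  also have "\<dots> = \<tau> ^ (CARD('n) - 1)" by (simp add: card_Diff_singleton)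
  finally show ?thesis by (simp add: b_def)
qed

text \<open>The derivative of \<psi> is approximated by difference quotients and the shift is moved
  to the step function. For a small shift t along axis k the shifted function differs from the
  original, on the support of \<psi>, only in slabs of thickness t above shared faces; their volume
  t \<tau>^(d-1) cancels the division by t. Faces on the boundary contribute nothing because \<psi>
  has compact support in \<Omega>.\<close>

lemma step_fun_partial_le:
  fixes \<psi> :: "real^'n \<Rightarrow> real"
  assumes \<psi>: "\<psi> \<in> C1c \<Omega>" and \<psi>1: "\<And>x. \<bar>\<psi> x\<bar> \<le> 1"
  shows "(LINT x|lborel. step_fun c x * frechet_derivative \<psi> (at x) (axis k 1)) \<le> \<tau> ^ (CARD('n) - 1) * jump_sum c k"
proof -
  obtain \<delta> where \<delta>: "0 < \<delta>" "\<And>a b x y. a \<in> corners \<Longrightarrow> b \<in> corners \<Longrightarrow> x \<in> cube a \<tau> \<Longrightarrow> y \<in> cube b \<tau> \<Longrightarrow>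
    dist x y < \<delta> \<Longrightarrow> cube a \<tau> \<inter> cube b \<tau> \<noteq> {}" using gap by blast
  obtain K where K: "compact K" "K \<subseteq> \<Omega>" "\<And>x. x \<notin> K \<Longrightarrow> \<psi> x = 0" using C1c_support[OF \<psi>] by metis
  obtain e where e: "0 < e" "(\<Union>x\<in>K. cball x e) \<subseteq> \<Omega>"
    using compact_subset_open_imp_cball_epsilon_subset[OF K(1) open_domain K(2)] by blast
  have [measurable]: "\<psi> \<in> borel_measurable borel" by (rule C1c_measurable[OF \<psi>])
  define N where "N = {a\<in>corners. a - axis k \<tau> \<in> corners}"
  have fN: "finite N" unfolding N_def using finite_corners by auto
  define S where "S t a = cbox a (\<chi> l. if l = k then a $ l + t else a $ l + \<tau>)" for t and a :: "real^'n"
  \<comment> \<open>The four bounds ensure, in this order, that a shifted point lies in a touching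
    cell, that it does not pass through that cell, that it stays in \<Omega>, and that
    \<open>difference_quotient_limit\<close> applies.\<close>
  define m where "m = min (min \<delta> \<tau>) (min e 1)"
  have m: "0 < m" "m \<le> \<delta>" "m \<le> \<tau>" "m \<le> e" "m \<le> 1" using \<delta> e size_pos by (auto simp: m_def)
  define B where "B = (\<Sum>a\<in>corners. \<bar>c a\<bar>)"
  have main: "(LINT x|lborel. step_fun c x * ((\<psi> (x + t *\<^sub>R axis k 1) - \<psi> x) / t)) \<le> \<tau> ^ (CARD('n) - 1) * jump_sum c k"
    if t: "0 < t" "t < m" for t
  proof -
    define v :: "real^'n" where "v = t *\<^sub>R axis k 1"
    have vk: "v $ k = t" "\<And>l. l \<noteq> k \<Longrightarrow> v $ l = 0" by (auto simp: v_def axis_def)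
    have nv: "norm v = t" using t by (simp add: v_def norm_axis_1)
    have i1: "integrable lborel (\<lambda>x. step_fun c x * f x)" if [measurable]: "f \<in> borel_measurable borel" and "\<And>x. \<bar>f x\<bar> \<le> 1" for f
    proof (rule integrable_lborel_bounded_support[where B=B and K=\<Omega>])
      show "norm (step_fun c x * f x) \<le> B" for x
        using mult_mono[OF step_fun_bound[of c x] that(2)[of x]] sum_nonneg[of corners "\<lambda>a. \<bar>c a\<bar>"]
        by (simp add: abs_mult B_def)
    qed (use bounded_domain step_fun_outside in auto)
    have i2: "integrable lborel (\<lambda>x. step_fun c x * \<psi> x)" by (rule i1) (use \<psi>1 in auto)
    have i3: "integrable lborel (\<lambda>x. step_fun c x * \<psi> (x + v))" by (rule i1) (use \<psi>1 in auto)
    have i4: "integrable lborel (\<lambda>x. step_fun c (x - v) * \<psi> x)"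
      using lborel_integrable_translate[OF i3, of "- v"] by simp
    have "(LINT x|lborel. step_fun c x * ((\<psi> (x + v) - \<psi> x) / t))
      = ((LINT x|lborel. step_fun c x * \<psi> (x + v)) - (LINT x|lborel. step_fun c x * \<psi> x)) / t"
      using i2 i3 by (simp add: right_diff_distrib diff_divide_distrib)
    also have "(LINT x|lborel. step_fun c x * \<psi> (x + v)) = (LINT x|lborel. step_fun c (x - v) * \<psi> x)"
      using lborel_integral_translate[of "\<lambda>x. step_fun c x * \<psi> (x + v)" "- v"] by simp
    also have "(LINT x|lborel. step_fun c (x - v) * \<psi> x) - (LINT x|lborel. step_fun c x * \<psi> x)
      = (LINT x|lborel. (step_fun c (x - v) - step_fun c x) * \<psi> x)"
      using i2 i4 by (simp add: left_diff_distrib)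
    also have "\<dots> \<le> (LINT x|lborel. (\<Sum>a\<in>N. \<bar>c (a - axis k \<tau>) - c a\<bar> * indicator (S t a) x))"
    proof (rule integral_mono_AE)
      show "integrable lborel (\<lambda>x. (step_fun c (x - v) - step_fun c x) * \<psi> x)"
        using i2 i4 by (simp add: left_diff_distrib)
      show "integrable lborel (\<lambda>x. \<Sum>a\<in>N. \<bar>c (a - axis k \<tau>) - c a\<bar> * indicator (S t a) x)"
        unfolding S_def by (intro Bochner_Integration.integrable_sum integrable_indicator_bounded) auto
      \<comment> \<open>For x on these hyperplanes the shifted point lies on a face, where the step
        function does not take the value of an adjacent cell.\<close>
      have "AE x in lborel. \<forall>a\<in>corners. x $ k \<noteq> a $ k + t"
        using finite_corners by (intro AE_finite_allI AE_hyperplane)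
      then show "AE x in lborel. (step_fun c (x - v) - step_fun c x) * \<psi> x
        \<le> (\<Sum>a\<in>N. \<bar>c (a - axis k \<tau>) - c a\<bar> * indicator (S t a) x)"
        using AE_cell
      proof eventually_elim
        case (elim x)
        have nn: "0 \<le> (\<Sum>a\<in>N. \<bar>c (a - axis k \<tau>) - c a\<bar> * indicator (S t a) x)" by (simp add: sum_nonneg)
        show ?case
        proof (cases "x \<in> K")
          case True
          then obtain a where a: "a \<in> corners" "x \<in> cell a" using elim K(2) by blast
          have xa: "a $ l < x $ l" "x $ l < a $ l + \<tau>" for l using a(2) by (auto simp: mem_box_cart)
          show ?thesis
          proof (cases "a $ k + t < x $ k")
            case True
            have "x - v \<in> cell a" unfolding mem_box_cart
            proof (intro allI)
              fix l show "a $ l < (x - v) $ l \<and> (x - v) $ l < (a + vec \<tau>) $ l"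
                using xa[of l] True t vk by (cases "l = k") auto
            qed
            then have "step_fun c (x - v) = step_fun c x" using a step_fun_cell by simp
            then show ?thesis using nn by simp
          next
            case False
            then have lt: "x $ k < a $ k + t" using elim a(1) by force
            have "x - v \<in> cball x e" using nv t m by (simp add: dist_norm)
            then have "x - v \<in> \<Omega>" using e(2) \<open>x \<in> K\<close> by blast
            then obtain b where b: "b \<in> corners" "x - v \<in> cube b \<tau>" using domain_subset by blast
            have "cube a \<tau> \<inter> cube b \<tau> \<noteq> {}"
              by (rule \<delta>(2)[OF a(1) b(1) _ b(2), of x]) (use a box_subset_cube[of a \<tau>] nv t m in \<open>auto simp: dist_norm\<close>)
            then have "b = a - axis k \<tau>"
              by (rule neighbour(1)[OF a(1) b(1) _ b(2)]) (use xa vk lt in auto)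
            then have aN: "a \<in> N" using a b by (simp add: N_def)
            have "x - v \<in> cell (a - axis k \<tau>)" unfolding mem_box_cart
            proof (intro allI)
              fix l show "(a - axis k \<tau>) $ l < (x - v) $ l \<and> (x - v) $ l < (a - axis k \<tau> + vec \<tau>) $ l"
                using xa[of l] lt t m vk by (cases "l = k") (auto simp: axis_def)
            qed
            then have "step_fun c (x - v) = c (a - axis k \<tau>)" using aN step_fun_cell by (simp add: N_def)
            then have "(step_fun c (x - v) - step_fun c x) * \<psi> x \<le> \<bar>c (a - axis k \<tau>) - c a\<bar>"
              using step_fun_cell[OF a] \<psi>1[of x] mult_left_mono[OF \<psi>1[of x], of "\<bar>c (a - axis k \<tau>) - c a\<bar>"]
              by (simp flip: abs_mult)
            also have "\<dots> = \<bar>c (a - axis k \<tau>) - c a\<bar> * indicator (S t a) x"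
            proof -
              have "x \<in> S t a" unfolding S_def mem_box_cart using xa lt by (auto intro: less_imp_le)
              then show ?thesis by simp
            qed
            also have "\<dots> \<le> (\<Sum>a\<in>N. \<bar>c (a - axis k \<tau>) - c a\<bar> * indicator (S t a) x)"
              by (rule member_le_sum[OF aN _ fN]) simp
            finally show ?thesis .
          qed
        qed (use K(3) nn in simp)
      qed
    qed
    also have "\<dots> = (\<Sum>a\<in>N. \<bar>c (a - axis k \<tau>) - c a\<bar> * (t * \<tau> ^ (CARD('n) - 1)))"
    proof -
      have "(LINT x|lborel. (\<Sum>a\<in>N. \<bar>c (a - axis k \<tau>) - c a\<bar> * indicator (S t a) x))
        = (\<Sum>a\<in>N. LINT x|lborel. \<bar>c (a - axis k \<tau>) - c a\<bar> * indicator (S t a) x)"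
        unfolding S_def by (intro Bochner_Integration.integral_sum integrable_indicator_bounded) auto
      also have "\<dots> = (\<Sum>a\<in>N. \<bar>c (a - axis k \<tau>) - c a\<bar> * measure lborel (S t a))"
        by (intro sum.cong) (auto simp: S_def)
      finally show ?thesis using slab_content[of t] t by (simp add: S_def)
    qed
    also have "\<dots> = t * (\<tau> ^ (CARD('n) - 1) * jump_sum c k)"
      unfolding jump_sum_def N_def[symmetric] by (simp add: sum_distrib_left sum_distrib_right ac_simps)
    finally have "(LINT x|lborel. step_fun c x * ((\<psi> (x + v) - \<psi> x) / t)) \<le> t * (\<tau> ^ (CARD('n) - 1) * jump_sum c k) / t"
      using t by (simp add: divide_right_mono)
    then show ?thesis using t unfolding v_def by simp
  qed
  \<comment> \<open>\<open>Suc (Suc n)\<close> rather than \<open>Suc n\<close> makes t n strictly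
    smaller than m from the start.\<close>
  define t where "t n = m * inverse (real (Suc (Suc n)))" for n
  have t: "t \<longlonglongrightarrow> 0" "\<And>n. 0 < t n" "\<And>n. t n < m" "\<And>n. t n \<le> 1"
  proof -
    have "(\<lambda>n. m * inverse (real (Suc (Suc n)))) \<longlonglongrightarrow> m * 0"
      by (intro tendsto_mult_left LIMSEQ_Suc[OF LIMSEQ_inverse_real_of_nat])
    then show "t \<longlonglongrightarrow> 0" by (simp add: t_def[abs_def])
    show "0 < t n" for n using m by (simp add: t_def)
    have "inverse (real (Suc (Suc n))) < 1" for n by (simp add: field_simps)
    then have "m * inverse (real (Suc (Suc n))) < m * 1" for n using m(1) by (intro mult_strict_left_mono)
    then show *: "t n < m" for n by (simp add: t_def)
    show "t n \<le> 1" for n using *[of n] m by linarith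
  qed
  have "(\<lambda>n. LINT x|lborel. step_fun c x * ((\<psi> (x + t n *\<^sub>R axis k 1) - \<psi> x) / t n))
    \<longlonglongrightarrow> (LINT x|lborel. step_fun c x * frechet_derivative \<psi> (at x) (axis k 1))"
    by (rule difference_quotient_limit[OF \<psi> step_fun_measurable step_fun_bound t(1,2,4)])
  then show ?thesis
    by (rule LIMSEQ_le_const2) (use main t in blast)
qed

text \<open>Each component of a field of norm at most 1 is bounded by 1. Every face is orthogonal to
  one axis and sees one component only, so the components can be estimated separately.\<close>

lemma step_fun_variation_le:
  assumes \<phi>: "\<phi> \<in> C1c \<Omega>" and \<phi>1: "\<And>x. norm (\<phi> x) \<le> 1"
  shows "(LINT x|lborel. step_fun c x * divergence \<phi> x) \<le> \<tau> ^ (CARD('n) - 1) * (\<Sum>k\<in>UNIV. jump_sum c k)"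
proof -
  have i: "integrable lborel (\<lambda>x. step_fun c x * frechet_derivative (\<lambda>x. \<phi> x $ k) (at x) (axis k 1))" for k
  proof (rule Bochner_Integration.integrable_bound)
    show "integrable lborel (\<lambda>x. (\<Sum>a\<in>corners. \<bar>c a\<bar>) * frechet_derivative (\<lambda>x. \<phi> x $ k) (at x) (axis k 1))"
      by (intro integrable_mult_right C1c_deriv_integrable[OF C1c_component(1)[OF \<phi>]])
    show "(\<lambda>x. step_fun c x * frechet_derivative (\<lambda>x. \<phi> x $ k) (at x) (axis k 1)) \<in> borel_measurable lborel"
      using C1c_deriv_measurable[OF C1c_component(1)[OF \<phi>]] by measurable
    show "AE x in lborel. norm (step_fun c x * frechet_derivative (\<lambda>x. \<phi> x $ k) (at x) (axis k 1))
      \<le> norm ((\<Sum>a\<in>corners. \<bar>c a\<bar>) * frechet_derivative (\<lambda>x. \<phi> x $ k) (at x) (axis k 1))"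
    proof (rule AE_I2)
      fix x
      have "\<bar>step_fun c x\<bar> \<le> \<bar>\<Sum>a\<in>corners. \<bar>c a\<bar>\<bar>" using step_fun_bound[of c x] by linarith
      then show "norm (step_fun c x * frechet_derivative (\<lambda>x. \<phi> x $ k) (at x) (axis k 1))
      \<le> norm ((\<Sum>a\<in>corners. \<bar>c a\<bar>) * frechet_derivative (\<lambda>x. \<phi> x $ k) (at x) (axis k 1))"
        by (simp add: abs_mult mult_right_mono)
    qed
  qed
  have "(LINT x|lborel. step_fun c x * divergence \<phi> x)
    = (LINT x|lborel. (\<Sum>k\<in>UNIV. step_fun c x * frechet_derivative (\<lambda>x. \<phi> x $ k) (at x) (axis k 1)))"
    by (simp add: divergence_eq[OF \<phi>] sum_distrib_left)
  also have "\<dots> = (\<Sum>k\<in>UNIV. LINT x|lborel. step_fun c x * frechet_derivative (\<lambda>x. \<phi> x $ k) (at x) (axis k 1))"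
    by (rule Bochner_Integration.integral_sum) (rule i)
  also have "\<dots> \<le> (\<Sum>k\<in>UNIV. \<tau> ^ (CARD('n) - 1) * jump_sum c k)"
  proof (rule sum_mono)
    fix k
    have "\<bar>\<phi> x $ k\<bar> \<le> 1" for x using component_le_norm_cart[of "\<phi> x" k] \<phi>1[of x] by linarith
    then show "(LINT x|lborel. step_fun c x * frechet_derivative (\<lambda>x. \<phi> x $ k) (at x) (axis k 1)) \<le> \<tau> ^ (CARD('n) - 1) * jump_sum c k"
      by (rule step_fun_partial_le[OF C1c_component(1)[OF \<phi>]])
  qed
  finally show ?thesis by (simp add: sum_distrib_left)
qed

end

subsection \<open>Sampling on a mesh\<close>

lemma norm_le_sqrt_card:
  fixes v :: "real^'n"
  assumes "0 \<le> r" "\<And>k. \<bar>v $ k\<bar> \<le> r"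
  shows "norm v \<le> sqrt (real CARD('n)) * r"
proof -
  have "norm v \<le> sqrt (\<Sum>k\<in>(UNIV::'n set). r\<^sup>2)"
    unfolding norm_vec_def L2_set_def
    by (intro real_sqrt_le_mono sum_mono) (use assms(2) in \<open>simp add: abs_le_square_iff[symmetric] assms(1)\<close>)
  also have "\<dots> = sqrt (real CARD('n)) * r" using assms(1) by (simp add: real_sqrt_mult)
  finally show ?thesis .
qed

text \<open>The open box is covered by the two closed cells, so \<open>domain_eq\<close> puts it
  into \<Omega>, common face included. This makes translations across a shared face
  admissible.\<close>

lemma (in cubical_mesh) double_cell_subset:
  assumes a: "a \<in> corners" "a - axis k \<tau> \<in> corners"
  shows "box (a - axis k \<tau>) (a + vec \<tau>) \<subseteq> \<Omega>"
proof -
  define W where "W = box (a - axis k \<tau>) (a + vec \<tau>)"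
  have "W \<subseteq> \<Union>\<Q>"
  proof
    fix z assume z: "z \<in> W"
    then have zl: "a $ l - (if l = k then \<tau> else 0) < z $ l" "z $ l < a $ l + \<tau>" for l
      by (auto simp: W_def mem_box_cart axis_def)
    have "z \<in> cube a \<tau> \<or> z \<in> cube (a - axis k \<tau>) \<tau>"
    proof (cases "a $ k \<le> z $ k")
      case True
      have "z \<in> cube a \<tau>" unfolding mem_cube using zl True by (metis diff_zero less_imp_le)
      then show ?thesis ..
    next
      case False
      have "z \<in> cube (a - axis k \<tau>) \<tau>" unfolding mem_cube
      proof
        fix l show "(a - axis k \<tau>) $ l \<le> z $ l \<and> z $ l \<le> (a - axis k \<tau>) $ l + \<tau>"
          using zl[of l] False by (auto simp: axis_def split: if_splits)
      qed
      then show ?thesis ..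
    qed
    then show "z \<in> \<Union>\<Q>" using a by (auto simp: corners_def)
  qed
  then show ?thesis unfolding W_def[symmetric] domain_eq by (rule interior_maximal) (simp add: W_def open_box)
qed

locale sampling = cubical_mesh \<Omega> \<tau> \<Q> + bv_function \<Omega> u M T
  for \<Omega> :: "(real^'n) set" and \<tau> \<Q> u M T
begin

abbreviation sample :: "real^'n \<Rightarrow> real^'n \<Rightarrow> real" where
  "sample y \<equiv> \<lambda>a. u (a + y)"

abbreviation C0 :: "(real^'n) set" where
  "C0 \<equiv> box 0 (vec \<tau>)"

lemma mem_C0: "a + y \<in> cell a \<longleftrightarrow> y \<in> C0"
  by (simp add: mem_box_cart)

lemma C0_content: "measure lborel C0 = \<tau> ^ CARD('n)"
proof -
  have "0 \<in> cbox 0 (vec \<tau> :: real^'n)" using size_pos by (simp add: mem_box_cart)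
  then have "cbox 0 (vec \<tau> :: real^'n) \<noteq> {}" by blast
  then have "measure lborel (cbox 0 (vec \<tau> :: real^'n)) = \<tau> ^ CARD('n)"
    by (subst content_cbox_cart) auto
  then show ?thesis by (simp only: measure_lborel_box_eq measure_lborel_cbox_eq)
qed

lemma diff_bound: "\<bar>u x - u y\<bar> \<le> 2 * M"
  using u_bound[of x] u_bound[of y] by linarith

text \<open>As y runs through \<open>C0\<close>, the sample point a + y runs through the cell of a;
  since the cells are disjoint, the sum over a becomes one integral over their union.\<close>

lemma integral_jump_sum:
  "integrable lborel (\<lambda>y. indicator C0 y * jump_sum (sample y) k)"
  "(LINT y|lborel. indicator C0 y * jump_sum (sample y) k)
    = (LINT x|lborel. indicator (\<Union>a\<in>{a\<in>corners. a - axis k \<tau> \<in> corners}. cell a) x * \<bar>u (x + (- axis k \<tau>)) - u x\<bar>)"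
proof -
  define N where "N = {a\<in>corners. a - axis k \<tau> \<in> corners}"
  have fN: "finite N" unfolding N_def using finite_corners by auto
  define f where "f x = \<bar>u (x + (- axis k \<tau>)) - u x\<bar>" for x
  have [measurable]: "f \<in> borel_measurable borel" unfolding f_def by measurable
  have f: "\<bar>f x\<bar> \<le> 2 * M" for x unfolding f_def using diff_bound by simp
  have i1: "integrable lborel (\<lambda>x. indicator (cell a) x * f x)" for a
    by (rule integrable_lborel_bounded_support[where B="2 * M" and K="cell a"])
      (use f M_nonneg in \<open>auto simp: indicator_def bounded_box\<close>)
  have ind: "indicator (cell a) (y + a) = (indicator C0 y :: real)" for a y :: "real^'n"
    using mem_C0[of a y] by (simp add: indicator_def add.commute)
  have i2: "integrable lborel (\<lambda>y. indicator C0 y * f (a + y))" for a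
    using lborel_integrable_translate[OF i1[of a], of a] unfolding ind by (simp add: add.commute)
  have e: "indicator C0 y * jump_sum (sample y) k = (\<Sum>a\<in>N. indicator C0 y * f (a + y))" for y
    unfolding jump_sum_def N_def[symmetric] f_def by (simp add: sum_distrib_left algebra_simps)
  show "integrable lborel (\<lambda>y. indicator C0 y * jump_sum (sample y) k)"
    unfolding e by (intro Bochner_Integration.integrable_sum i2)
  have "(LINT y|lborel. indicator C0 y * jump_sum (sample y) k) = (\<Sum>a\<in>N. LINT y|lborel. indicator C0 y * f (a + y))"
    unfolding e by (intro Bochner_Integration.integral_sum i2)
  also have "\<dots> = (\<Sum>a\<in>N. LINT x|lborel. indicator (cell a) x * f x)"
  proof (rule sum.cong)
    fix a
    have "(LINT x|lborel. indicator (cell a) (x + a) * f (x + a)) = (LINT x|lborel. indicator (cell a) x * f x)"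
      by (rule lborel_integral_translate) measurable
    then show "(LINT y|lborel. indicator C0 y * f (a + y)) = (LINT x|lborel. indicator (cell a) x * f x)"
      unfolding ind by (simp add: add.commute)
  qed simp
  also have "\<dots> = (LINT x|lborel. (\<Sum>a\<in>N. indicator (cell a) x * f x))"
    by (intro Bochner_Integration.integral_sum[symmetric] i1)
  also have "\<dots> = (LINT x|lborel. indicator (\<Union>a\<in>N. cell a) x * f x)"
  proof -
    have "disjoint_family_on cell N" unfolding disjoint_family_on_def N_def using cells_disjoint by blast
    then have "indicator (\<Union>a\<in>N. cell a) x = (\<Sum>a\<in>N. indicator (cell a) x :: real)" for x
      by (rule indicator_UN_disjoint[OF fN])
    then show ?thesis by (simp add: sum_distrib_right)
  qed
  finally show "(LINT y|lborel. indicator C0 y * jump_sum (sample y) k)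
    = (LINT x|lborel. indicator (\<Union>a\<in>{a\<in>corners. a - axis k \<tau> \<in> corners}. cell a) x * \<bar>u (x + (- axis k \<tau>)) - u x\<bar>)"
    by (simp add: N_def f_def)
qed

lemma neighbour_segment:
  assumes a: "a \<in> corners" "a - axis k \<tau> \<in> corners" and x: "x \<in> cell a"
  shows "closed_segment x (x + (- axis k \<tau>)) \<subseteq> \<Omega>"
proof -
  define W where "W = box (a - axis k \<tau>) (a + vec \<tau>)"
  have "W \<subseteq> \<Omega>" unfolding W_def by (rule double_cell_subset[OF a])
  moreover have "closed_segment x (x + (- axis k \<tau>)) \<subseteq> W"
  proof (rule closed_segment_subset)
    have xl: "a $ l < x $ l" "x $ l < a $ l + \<tau>" for l using x by (auto simp: mem_box_cart)
    show "x \<in> W" "x + (- axis k \<tau>) \<in> W" unfolding W_def mem_box_cart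
      using xl size_pos by (auto simp: axis_def) (smt (verit))+
    show "convex W" unfolding W_def by (rule convex_box)
  qed
  ultimately show ?thesis by blast
qed

text \<open>An instance of \<open>translation_sum_le\<close> with the vectors
  \<open>- axis k \<tau>\<close>: a combination with coefficients of modulus at most 1 has norm at
  most sqrt d \<tau>. The factors \<tau>^(d-1) and \<tau> combine to the volume of
  \<open>C0\<close>, so the average of the weighted jumps is at most sqrt d T.\<close>

lemma jump_sum_average_le:
  "(LINT y|lborel. indicator C0 y * (\<tau> ^ (CARD('n) - 1) * (\<Sum>k\<in>UNIV. jump_sum (sample y) k)))
    \<le> \<tau> ^ CARD('n) * (sqrt (real CARD('n)) * T)"
proof -
  define U where "U k = (\<Union>a\<in>{a\<in>corners. a - axis k \<tau> \<in> corners}. cell a)" for k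
  have "(LINT y|lborel. indicator C0 y * (\<tau> ^ (CARD('n) - 1) * (\<Sum>k\<in>UNIV. jump_sum (sample y) k)))
    = (LINT y|lborel. \<tau> ^ (CARD('n) - 1) * (\<Sum>k\<in>UNIV. indicator C0 y * jump_sum (sample y) k))"
    by (simp add: sum_distrib_left ac_simps)
  also have "\<dots> = \<tau> ^ (CARD('n) - 1) * (\<Sum>k\<in>UNIV. LINT y|lborel. indicator C0 y * jump_sum (sample y) k)"
    by (subst integral_mult_right_zero, subst Bochner_Integration.integral_sum) (auto intro: integral_jump_sum)
  also have "(\<Sum>k\<in>UNIV. LINT y|lborel. indicator C0 y * jump_sum (sample y) k)
    = (\<Sum>k\<in>UNIV. LINT x|lborel. indicator (U k) x * \<bar>u (x + (- axis k \<tau>)) - u x\<bar>)"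
    unfolding integral_jump_sum(2) U_def ..
  also have "\<dots> \<le> (sqrt (real CARD('n)) * \<tau>) * T"
  proof (rule translation_sum_le)
    show "open (U k)" for k unfolding U_def by (intro open_UN ballI open_box)
    show "closed_segment x (x + (- axis k \<tau>)) \<subseteq> \<Omega>" if "x \<in> U k" for k x
      using that neighbour_segment by (auto simp: U_def)
    show "0 \<le> sqrt (real CARD('n)) * \<tau>" using size_pos by simp
    fix c :: "'n \<Rightarrow> real" assume c: "\<And>k. k \<in> UNIV \<Longrightarrow> \<bar>c k\<bar> \<le> 1"
    show "norm (\<Sum>k\<in>UNIV. c k *\<^sub>R (- axis k \<tau>)) \<le> sqrt (real CARD('n)) * \<tau>"
    proof (rule norm_le_sqrt_card)
      show "0 \<le> \<tau>" using size_pos by simp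
      fix l
      have "(\<Sum>k\<in>UNIV. c k *\<^sub>R (- axis k \<tau>)) $ l = (\<Sum>k\<in>UNIV. if k = l then - c l * \<tau> else 0)"
        unfolding sum_component by (rule sum.cong) (auto simp: axis_def)
      then have "\<bar>(\<Sum>k\<in>UNIV. c k *\<^sub>R (- axis k \<tau>)) $ l\<bar> = \<bar>c l\<bar> * \<tau>" using size_pos by (simp add: abs_mult)
      also have "\<dots> \<le> \<tau>" using c[of l] size_pos mult_right_mono[of "\<bar>c l\<bar>" 1 \<tau>] by simp
      finally show "\<bar>(\<Sum>k\<in>UNIV. c k *\<^sub>R (- axis k \<tau>)) $ l\<bar> \<le> \<tau>" .
    qed
  qed simp
  finally have "(LINT y|lborel. indicator C0 y * (\<tau> ^ (CARD('n) - 1) * (\<Sum>k\<in>UNIV. jump_sum (sample y) k)))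
    \<le> \<tau> ^ (CARD('n) - 1) * ((sqrt (real CARD('n)) * \<tau>) * T)" using size_pos by simp
  moreover have "\<tau> ^ CARD('n) = \<tau> ^ (CARD('n) - 1) * \<tau>"
    by (metis One_nat_def Suc_pred power_Suc2 zero_less_card_finite)
  ultimately show ?thesis by (simp add: ac_simps)
qed

text \<open>Compares the positions y and y + v in the same cell. Integration over v yields the L1
  error of the sample at y (\<open>defect_eq\<close>), whereas integration over y yields a
  translation by the fixed vector v; Fubini passes from one to the other.\<close>

definition pair_defect :: "real^'n \<Rightarrow> real^'n \<Rightarrow> real" where
  "pair_defect y v = (\<Sum>a\<in>corners. indicator C0 y * indicator C0 (y + v) * \<bar>u (a + y) - u (a + (y + v))\<bar>)"

definition defect :: "real^'n \<Rightarrow> real" where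
  "defect y = (LINT x|lborel. \<bar>step_fun (sample y) x - u x\<bar>)"

lemma defect_eq:
  assumes y: "y \<in> C0"
  shows "(LINT v|lborel. pair_defect y v) = defect y"
proof -
  define g where "g a x = indicator (cell a) x * \<bar>u (a + y) - u x\<bar>" for a x
  have [measurable]: "g a \<in> borel_measurable borel" for a unfolding g_def by measurable
  have ig: "integrable lborel (g a)" for a
    by (rule integrable_lborel_bounded_support[where B="2 * M" and K="cell a"])
      (use diff_bound M_nonneg in \<open>auto simp: g_def indicator_def bounded_box\<close>)
  have eq: "pair_defect y v = (\<Sum>a\<in>corners. g a (v + (a + y)))" for v
    unfolding pair_defect_def g_def
  proof (rule sum.cong)
    fix a
    have "indicator (cell a) (v + (a + y)) = (indicator C0 (y + v) :: real)"
      using mem_C0[of a "y + v"] by (simp add: indicator_def ac_simps)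
    then show "indicator C0 y * indicator C0 (y + v) * \<bar>u (a + y) - u (a + (y + v))\<bar>
      = indicator (cell a) (v + (a + y)) * \<bar>u (a + y) - u (v + (a + y))\<bar>"
      using y by (simp add: ac_simps)
  qed simp
  have "(LINT v|lborel. pair_defect y v) = (\<Sum>a\<in>corners. LINT v|lborel. g a (v + (a + y)))"
    unfolding eq by (intro Bochner_Integration.integral_sum lborel_integrable_translate ig)
  also have "\<dots> = (\<Sum>a\<in>corners. LINT x|lborel. g a x)"
    by (intro sum.cong refl lborel_integral_translate) measurable
  also have "\<dots> = (LINT x|lborel. (\<Sum>a\<in>corners. g a x))"
    by (intro Bochner_Integration.integral_sum[symmetric] ig)
  also have "\<dots> = (LINT x|lborel. \<bar>step_fun (sample y) x - u x\<bar>)"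
  proof (rule integral_cong_AE)
    show "AE x in lborel. (\<Sum>a\<in>corners. g a x) = \<bar>step_fun (sample y) x - u x\<bar>"
      using AE_cell
    proof eventually_elim
      case (elim x)
      show ?case
      proof (cases "x \<in> \<Omega>")
        case True
        then obtain a where a: "a \<in> corners" "x \<in> cell a" using elim by blast
        have "(\<Sum>b\<in>corners. g b x) = (\<Sum>b\<in>corners. if b = a then \<bar>u (a + y) - u x\<bar> else 0)"
        proof (rule sum.cong)
          fix b assume b: "b \<in> corners"
          show "g b x = (if b = a then \<bar>u (a + y) - u x\<bar> else 0)"
          proof (cases "b = a")
            case False
            then have "x \<notin> cell b" using cells_disjoint[OF b a(1) _ a(2)] by blast
            then show ?thesis using False by (simp add: g_def)
          qed (use a(2) in \<open>simp add: g_def\<close>)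
        qed simp
        then show ?thesis using a finite_corners step_fun_cell[OF a] by simp
      next
        case False
        then have "x \<notin> cell a" if "a \<in> corners" for a using cell_subset[OF that] by blast
        then have "(\<Sum>a\<in>corners. g a x) = 0" unfolding g_def by (intro sum.neutral) auto
        then show ?thesis using False step_fun_outside u_zero by simp
      qed
    qed
  qed measurable
  finally show ?thesis by (simp add: defect_def)
qed

lemma pair_defect_zero:
  assumes "y \<notin> C0 \<or> v \<notin> box (- vec \<tau>) (vec \<tau>)"
  shows "pair_defect y v = 0"
proof -
  have "y \<notin> C0 \<or> y + v \<notin> C0"
  proof (rule ccontr)
    assume neg: "\<not> (y \<notin> C0 \<or> y + v \<notin> C0)"
    then have "0 < y $ i" "y $ i < \<tau>" "0 < y $ i + v $ i" "y $ i + v $ i < \<tau>" for i by (auto simp: mem_box_cart)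
    then have "- \<tau> < v $ i \<and> v $ i < \<tau>" for i by (smt (verit))
    then have "v \<in> box (- vec \<tau>) (vec \<tau>)" by (simp add: mem_box_cart)
    then show False using assms neg by blast
  qed
  then show ?thesis unfolding pair_defect_def by (intro sum.neutral) auto
qed

lemma pair_defect_measurable [measurable]: "(\<lambda>(y, v). pair_defect y v) \<in> borel_measurable (borel \<Otimes>\<^sub>M borel)"
  unfolding pair_defect_def by measurable

lemma pair_defect_integrable: "integrable (lborel \<Otimes>\<^sub>M lborel) (\<lambda>(y, v). pair_defect y v)"
  unfolding lborel_prod
proof (rule integrable_lborel_bounded_support[where B="real (card corners) * (2 * M)" and K="C0 \<times> box (- vec \<tau>) (vec \<tau>)"])
  show "(\<lambda>(y, v). pair_defect y v) \<in> borel_measurable borel"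
    using pair_defect_measurable unfolding borel_prod .
  show "norm (case z of (y, v) \<Rightarrow> pair_defect y v) \<le> real (card corners) * (2 * M)" for z
  proof (cases z)
    case (Pair y v)
    have "norm (pair_defect y v) \<le> (\<Sum>a\<in>corners. 2 * M)"
      unfolding pair_defect_def
    proof (rule sum_norm_le)
      fix a
      show "norm (indicator C0 y * indicator C0 (y + v) * \<bar>u (a + y) - u (a + (y + v))\<bar>) \<le> 2 * M"
        using diff_bound[of "a + y" "a + (y + v)"] M_nonneg by (auto simp: indicator_def)
    qed
    then show ?thesis using Pair by simp
  qed
  show "bounded (C0 \<times> box (- vec \<tau>) (vec \<tau> :: real^'n))" by (intro bounded_Times bounded_box)
  show "(case z of (y, v) \<Rightarrow> pair_defect y v) = 0" if "z \<notin> C0 \<times> box (- vec \<tau>) (vec \<tau>)" for z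
    using that pair_defect_zero by (cases z) auto
qed

text \<open>Both x and x + v lie in one cell, which is convex, so the segment stays in \<Omega> and
  \<open>translation_le\<close> applies with norm v \<le> sqrt d \<tau>.\<close>

lemma pair_defect_average_le:
  assumes v: "v \<in> box (- vec \<tau>) (vec \<tau>)"
  shows "(LINT y|lborel. pair_defect y v) \<le> sqrt (real CARD('n)) * \<tau> * T"
proof -
  define S where "S a = cell a \<inter> {x. x + v \<in> cell a}" for a
  have So: "open (S a)" for a
  proof -
    have "open ((\<lambda>x. x + v) -` cell a)" by (intro open_vimage open_box continuous_intros)
    then show ?thesis unfolding S_def vimage_def by (intro open_Int open_box)
  qed
  have [measurable]: "S a \<in> sets borel" for a using So by auto
  define f where "f x = \<bar>u (x + v) - u x\<bar>" for x
  have [measurable]: "f \<in> borel_measurable borel" unfolding f_def by measurable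
  have i1: "integrable lborel (\<lambda>x. indicator (S a) x * f x)" for a
    by (rule integrable_lborel_bounded_support[where B="2 * M" and K="cell a"])
      (use diff_bound M_nonneg in \<open>auto simp: indicator_def bounded_box f_def S_def\<close>)
  have eq: "pair_defect y v = (\<Sum>a\<in>corners. indicator (S a) (y + a) * f (y + a))" for y
    unfolding pair_defect_def
  proof (rule sum.cong)
    fix a
    have "indicator (S a) (y + a) = (indicator C0 y * indicator C0 (y + v) :: real)"
      using mem_C0[of a y] mem_C0[of a "y + v"] by (simp add: indicator_def S_def ac_simps)
    then show "indicator C0 y * indicator C0 (y + v) * \<bar>u (a + y) - u (a + (y + v))\<bar> = indicator (S a) (y + a) * f (y + a)"
      by (simp add: f_def ac_simps abs_minus_commute)
  qed simp
  have "(LINT y|lborel. pair_defect y v) = (\<Sum>a\<in>corners. LINT y|lborel. indicator (S a) (y + a) * f (y + a))"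
    unfolding eq using lborel_integrable_translate[OF i1] by (intro Bochner_Integration.integral_sum) blast
  also have "\<dots> = (\<Sum>a\<in>corners. LINT x|lborel. indicator (S a) x * f x)"
  proof (rule sum.cong)
    fix a show "(LINT y|lborel. indicator (S a) (y + a) * f (y + a)) = (LINT x|lborel. indicator (S a) x * f x)"
      by (rule lborel_integral_translate) measurable
  qed simp
  also have "\<dots> = (LINT x|lborel. (\<Sum>a\<in>corners. indicator (S a) x * f x))"
    by (intro Bochner_Integration.integral_sum[symmetric] i1)
  also have "\<dots> = (LINT x|lborel. indicator (\<Union>a\<in>corners. S a) x * f x)"
  proof -
    have "disjoint_family_on S corners" unfolding disjoint_family_on_def S_def using cells_disjoint by blast
    then have "indicator (\<Union>a\<in>corners. S a) x = (\<Sum>a\<in>corners. indicator (S a) x :: real)" for x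
      by (rule indicator_UN_disjoint[OF finite_corners])
    then show ?thesis by (simp add: sum_distrib_right)
  qed
  also have "\<dots> \<le> norm v * T"
    unfolding f_def
  proof (rule translation_le)
    show "open (\<Union>a\<in>corners. S a)" using So by auto
    fix x assume "x \<in> (\<Union>a\<in>corners. S a)"
    then obtain a where a: "a \<in> corners" "x \<in> cell a" "x + v \<in> cell a" by (auto simp: S_def)
    then have "closed_segment x (x + v) \<subseteq> cell a" by (intro closed_segment_subset convex_box)
    then show "closed_segment x (x + v) \<subseteq> \<Omega>" using cell_subset[OF a(1)] by blast
  qed
  also have "\<dots> \<le> (sqrt (real CARD('n)) * \<tau>) * T"
  proof (rule mult_right_mono[OF norm_le_sqrt_card T_nonneg])
    show "\<bar>v $ k\<bar> \<le> \<tau>" for k using v by (simp add: mem_box_cart abs_le_iff) (smt (verit))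
  qed (use size_pos in simp)
  finally show ?thesis .
qed

text \<open>The differences of two points of \<open>C0\<close> lie in a box of volume (2 \<tau>)^d;
  relative to the volume \<tau>^d of \<open>C0\<close> this is the factor 2^d.\<close>

lemma defect_average_le:
  "integrable lborel (\<lambda>y. indicator C0 y * defect y)"
  "(LINT y|lborel. indicator C0 y * defect y) \<le> \<tau> ^ CARD('n) * (2 ^ CARD('n) * sqrt (real CARD('n)) * \<tau> * T)"
proof -
  have eq: "indicator C0 y * defect y = (LINT v|lborel. pair_defect y v)" for y
    using defect_eq[of y] pair_defect_zero[of y] by (cases "y \<in> C0") auto
  show "integrable lborel (\<lambda>y. indicator C0 y * defect y)"
    unfolding eq using lborel_pair.integrable_fst[OF pair_defect_integrable] by simp
  define E where "E = (box (- vec \<tau>) (vec \<tau>) :: (real^'n) set)"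
  have "(LINT y|lborel. indicator C0 y * defect y) = (LINT v|lborel. LINT y|lborel. pair_defect y v)"
    unfolding eq using lborel_pair.Fubini_integral[OF pair_defect_integrable] by simp
  also have "\<dots> \<le> (LINT v|lborel. (sqrt (real CARD('n)) * \<tau> * T) * indicator E v)"
  proof (rule integral_mono)
    show "integrable lborel (\<lambda>v. LINT y|lborel. pair_defect y v)"
      using lborel_pair.integrable_snd[OF pair_defect_integrable] by simp
    show "integrable lborel (\<lambda>v. sqrt (real CARD('n)) * \<tau> * T * indicator E v)"
      by (rule integrable_indicator_bounded) (auto simp: E_def bounded_box)
    show "(LINT y|lborel. pair_defect y v) \<le> sqrt (real CARD('n)) * \<tau> * T * indicator E v" for v
      using pair_defect_average_le[of v] pair_defect_zero[of _ v] by (cases "v \<in> E") (auto simp: E_def)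
  qed
  also have "\<dots> = (sqrt (real CARD('n)) * \<tau> * T) * measure lborel E" by (simp add: E_def)
  also have "measure lborel E = (2 * \<tau>) ^ CARD('n)"
  proof -
    have "0 \<in> cbox (- vec \<tau>) (vec \<tau> :: real^'n)" using size_pos by (simp add: mem_box_cart)
    then have "cbox (- vec \<tau>) (vec \<tau> :: real^'n) \<noteq> {}" by blast
    then have "measure lborel (cbox (- vec \<tau>) (vec \<tau> :: real^'n)) = (2 * \<tau>) ^ CARD('n)"
      by (subst content_cbox_cart) auto
    then show ?thesis by (simp only: E_def measure_lborel_box_eq measure_lborel_cbox_eq)
  qed
  finally show "(LINT y|lborel. indicator C0 y * defect y) \<le> \<tau> ^ CARD('n) * (2 ^ CARD('n) * sqrt (real CARD('n)) * \<tau> * T)"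
    by (simp add: power_mult_distrib ac_simps)
qed

text \<open>A function whose integral over \<open>C0\<close> is at most \<kappa> times the volume of
  \<open>C0\<close> is at most \<kappa> somewhere. The two quantities are averaged as one weighted
  sum because a single y has to control both.\<close>

lemma good_sample:
  assumes \<delta>: "0 < \<delta>"
  obtains y where "y \<in> C0"
    "\<tau> ^ (CARD('n) - 1) * (\<Sum>k\<in>UNIV. jump_sum (sample y) k) + \<delta> / \<tau> * defect y
      \<le> sqrt (real CARD('n)) * T * (1 + \<delta> * 2 ^ CARD('n))"
proof -
  define \<kappa> where "\<kappa> = sqrt (real CARD('n)) * T * (1 + \<delta> * 2 ^ CARD('n))"
  define A where "A y = \<tau> ^ (CARD('n) - 1) * (\<Sum>k\<in>UNIV. jump_sum (sample y) k)" for y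
  have iA: "integrable lborel (\<lambda>y. indicator C0 y * A y)"
  proof -
    have "integrable lborel (\<lambda>y. \<tau> ^ (CARD('n) - 1) * (\<Sum>k\<in>UNIV. indicator C0 y * jump_sum (sample y) k))"
      by (intro integrable_mult_right Bochner_Integration.integrable_sum integral_jump_sum)
    then show ?thesis by (simp add: A_def sum_distrib_left ac_simps)
  qed
  have i\<kappa>: "integrable lborel (\<lambda>y. \<kappa> * indicator C0 y)"
    by (rule integrable_indicator_bounded) (auto simp: bounded_box)
  have "\<exists>y\<in>C0. A y + \<delta> / \<tau> * defect y \<le> \<kappa>"
  proof (rule ccontr)
    assume "\<not> ?thesis"
    then have gt: "\<kappa> < A y + \<delta> / \<tau> * defect y" if "y \<in> C0" for y using that by force
    \<comment> \<open>If the sum exceeded \<kappa> throughout \<open>C0\<close>, f would be a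
      nonnegative function with integral at most 0, hence zero almost everywhere, although it is
      positive on a set of positive measure.\<close>
    define f where "f y = indicator C0 y * A y + (\<delta> / \<tau>) * (indicator C0 y * defect y) - \<kappa> * indicator C0 y" for y
    have if': "integrable lborel f"
      unfolding f_def by (intro Bochner_Integration.integrable_diff Bochner_Integration.integrable_add iA i\<kappa>
          integrable_mult_right defect_average_le(1))
    have f0: "0 \<le> f y" for y using gt[of y] by (cases "y \<in> C0") (auto simp: f_def)
    have "(LINT y|lborel. f y) = (LINT y|lborel. indicator C0 y * A y)
        + (\<delta> / \<tau>) * (LINT y|lborel. indicator C0 y * defect y) - \<kappa> * \<tau> ^ CARD('n)"
      unfolding f_def using iA i\<kappa> defect_average_le(1) C0_content by simp
    also have "\<dots> \<le> \<tau> ^ CARD('n) * (sqrt (real CARD('n)) * T)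
      + (\<delta> / \<tau>) * (\<tau> ^ CARD('n) * (2 ^ CARD('n) * sqrt (real CARD('n)) * \<tau> * T)) - \<kappa> * \<tau> ^ CARD('n)"
      using jump_sum_average_le defect_average_le(2) \<delta> size_pos unfolding A_def
      by (intro diff_right_mono add_mono mult_left_mono) auto
    also have "\<dots> = 0" using size_pos by (simp add: \<kappa>_def algebra_simps)
    finally have "(LINT y|lborel. f y) = 0" using f0 Bochner_Integration.integral_nonneg[of lborel f] by (simp add: antisym)
    then have "AE y in lborel. f y = 0" using integral_nonneg_eq_0_iff_AE[OF if'] f0 by simp
    then have "AE y in lborel. y \<notin> C0"
      by (rule eventually_mono) (use gt in \<open>force simp: f_def\<close>)
    then have "emeasure lborel C0 = 0"
      by (subst (asm) AE_iff_measurable[OF _ refl]) auto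
    then have "measure lborel C0 = 0" by (simp add: measure_def)
    then show False using C0_content size_pos by simp
  qed
  then show ?thesis using that unfolding A_def \<kappa>_def by blast
qed

end

subsection \<open>Raviart--Thomas fields\<close>

lemma AE_lebesgue_on_iff:
  assumes "open \<Omega>"
  shows "(AE x in lebesgue_on \<Omega>. P x) \<longleftrightarrow> (AE x in lborel. x \<in> \<Omega> \<longrightarrow> P x)"
  using assms by (subst AE_restrict_space_iff) (auto simp: AE_completion_iff)

text \<open>The definitions integrate functions known up to null sets over
  \<open>lebesgue_on \<Omega>\<close>; this replaces them by Borel functions that vanish outside
  \<Omega>, for which translation invariance and Fubini on \<open>lborel\<close> are
  available.\<close>

lemma integral_lebesgue_on_borel:
  fixes f' :: "real^'n \<Rightarrow> real"
  assumes "open \<Omega>" and f: "f \<in> borel_measurable (lebesgue_on \<Omega>)" and f': "f' \<in> borel_measurable borel"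
    and ae: "AE x in lborel. x \<in> \<Omega> \<longrightarrow> f x = f' x" and z: "\<And>x. x \<notin> \<Omega> \<Longrightarrow> f' x = 0"
  shows "(LINT x|lebesgue_on \<Omega>. f x) = (LINT x|lborel. f' x)"
proof -
  have f'l: "f' \<in> borel_measurable lebesgue" using f' by (intro measurable_completion) simp
  have "(LINT x|lebesgue_on \<Omega>. f x) = (LINT x|lebesgue_on \<Omega>. f' x)"
    by (rule integral_cong_AE[OF f measurable_restrict_space1[OF f'l]])
      (use ae AE_lebesgue_on_iff[OF assms(1)] in simp)
  also have "\<dots> = (LINT x|lebesgue. indicator \<Omega> x *\<^sub>R f' x)"
    using assms(1) by (subst integral_restrict_space) auto
  also have "(\<lambda>x. indicator \<Omega> x *\<^sub>R f' x) = f'"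
  proof
    fix x show "indicator \<Omega> x *\<^sub>R f' x = f' x" using z[of x] by (cases "x \<in> \<Omega>") auto
  qed
  also have "(LINT x|lebesgue. f' x) = (LINT x|lborel. f' x)"
    using f' by (subst integral_completion) simp_all
  finally show ?thesis .
qed

lemma integrable_lebesgue_on_L2:
  fixes g :: "real^'n \<Rightarrow> real"
  assumes "open \<Omega>" "bounded \<Omega>" "g \<in> L2 \<Omega>"
  shows "integrable (lebesgue_on \<Omega>) g"
proof -
  have "emeasure (lebesgue_on \<Omega>) (space (lebesgue_on \<Omega>)) < \<infinity>"
    using assms by (simp add: space_restrict_space emeasure_restrict_space emeasure_bounded_finite[unfolded infinity_ennreal_def])
  then have "finite_measure (lebesgue_on \<Omega>)" by (intro finite_measureI) simp
  then have "integrable (lebesgue_on \<Omega>) (\<lambda>x. 1 :: real)" by (rule finite_measure.integrable_const)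
  then have "integrable (lebesgue_on \<Omega>) (\<lambda>x. 1 + (norm (g x))\<^sup>2)"
    using assms(3) by (intro Bochner_Integration.integrable_add) (auto simp: L2_def)
  then show ?thesis
  proof (rule Bochner_Integration.integrable_bound)
    show "g \<in> borel_measurable (lebesgue_on \<Omega>)" using assms(3) by (simp add: L2_def)
    have "\<bar>t\<bar> \<le> 1 + t\<^sup>2" for t :: real
    proof -
      have "0 \<le> (\<bar>t\<bar> - 1)\<^sup>2" by simp
      then have "2 * \<bar>t\<bar> \<le> 1 + t\<^sup>2" by (simp add: power2_eq_square algebra_simps abs_mult_self_eq)
      then show ?thesis by linarith
    qed
    then show "AE x in lebesgue_on \<Omega>. norm (g x) \<le> norm (1 + (norm (g x))\<^sup>2)"
      by (intro AE_I2) (simp add: abs_of_nonneg add_nonneg_nonneg)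
  qed
qed

text \<open>The fundamental lemma of the calculus of variations: test functions tending to the sign
  of k turn the vanishing pairings into a vanishing integral of the modulus of k over U.\<close>

lemma fundamental_lemma:
  fixes k :: "real^'n \<Rightarrow> real"
  assumes \<Omega>: "open \<Omega>" and k: "integrable (lebesgue_on \<Omega>) k" and U: "open U" "bounded U" "U \<subseteq> \<Omega>"
    and z: "\<And>\<psi>. \<psi> \<in> C1c U \<Longrightarrow> (LINT x|lebesgue_on \<Omega>. k x * \<psi> x) = 0"
  shows "AE x in lborel. x \<in> U \<longrightarrow> k x = 0"
proof -
  define f where "f x = sgn (indicator \<Omega> x * k x)" for x
  have km: "k \<in> borel_measurable (lebesgue_on \<Omega>)" using k by auto
  have "(\<lambda>x. indicator \<Omega> x *\<^sub>R k x) \<in> borel_measurable lebesgue"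
    using km \<Omega> by (subst (asm) borel_measurable_restrict_space_iff) auto
  then have fm: "f \<in> borel_measurable lebesgue" unfolding f_def by simp
  have "\<bar>f x\<bar> \<le> 1" for x by (simp add: f_def sgn_if)
  then obtain \<eta> where \<eta>: "\<And>n. \<eta> n \<in> C1c U" "\<And>n x. \<bar>\<eta> n x\<bar> \<le> 1"
    "AE x in lborel. x \<in> U \<longrightarrow> (\<lambda>n::nat. \<eta> n x) \<longlonglongrightarrow> f x"
    using C1c_approx_AE[OF fm _ U(1,2)] by blast
  have \<eta>m: "\<eta> n \<in> borel_measurable (lebesgue_on \<Omega>)" for n
    using C1c_measurable[OF \<eta>(1)] by (intro measurable_restrict_space1 measurable_completion) simp
  have Um: "(indicator U :: real^'n \<Rightarrow> real) \<in> borel_measurable (lebesgue_on \<Omega>)"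
    using U(1) by (intro measurable_restrict_space1 measurable_completion) simp
  have "(\<lambda>n. LINT x|lebesgue_on \<Omega>. k x * \<eta> n x) \<longlonglongrightarrow> (LINT x|lebesgue_on \<Omega>. indicator U x * \<bar>k x\<bar>)"
  proof (rule integral_dominated_convergence[where w="\<lambda>x. \<bar>k x\<bar>"])
    show "integrable (lebesgue_on \<Omega>) (\<lambda>x. \<bar>k x\<bar>)" using k by auto
    show "AE x in lebesgue_on \<Omega>. norm (k x * \<eta> n x) \<le> \<bar>k x\<bar>" for n
      using mult_left_mono[OF \<eta>(2), of "\<bar>k _\<bar>"] by (intro AE_I2) (simp add: abs_mult)
    have "AE x in lborel. x \<in> \<Omega> \<longrightarrow> (\<lambda>n. k x * \<eta> n x) \<longlonglongrightarrow> indicator U x * \<bar>k x\<bar>"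
      using \<eta>(3)
    proof (rule eventually_mono, intro impI)
      fix x assume ae: "x \<in> U \<longrightarrow> (\<lambda>n. \<eta> n x) \<longlonglongrightarrow> f x" and x: "x \<in> \<Omega>"
      show "(\<lambda>n. k x * \<eta> n x) \<longlonglongrightarrow> indicator U x * \<bar>k x\<bar>"
      proof (cases "x \<in> U")
        case True
        then have "(\<lambda>n. k x * \<eta> n x) \<longlonglongrightarrow> k x * f x" using ae by (intro tendsto_mult_left) auto
        then show ?thesis using True x by (simp add: f_def abs_sgn)
      qed (use C1c_outside[OF \<eta>(1)] in simp)
    qed
    then show "AE x in lebesgue_on \<Omega>. (\<lambda>n. k x * \<eta> n x) \<longlonglongrightarrow> indicator U x * \<bar>k x\<bar>"
      using AE_lebesgue_on_iff[OF \<Omega>] by simp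
  qed (use km \<eta>m Um in measurable)
  then have "(\<lambda>n::nat. 0) \<longlonglongrightarrow> (LINT x|lebesgue_on \<Omega>. indicator U x * \<bar>k x\<bar>)"
    unfolding z[OF \<eta>(1)] .
  then have "(LINT x|lebesgue_on \<Omega>. indicator U x * \<bar>k x\<bar>) = 0"
    unfolding LIMSEQ_const_iff by (rule sym)
  moreover have "integrable (lebesgue_on \<Omega>) (\<lambda>x. indicator U x * \<bar>k x\<bar>)"
  proof (rule Bochner_Integration.integrable_bound[OF k])
    show "(\<lambda>x. indicator U x * \<bar>k x\<bar>) \<in> borel_measurable (lebesgue_on \<Omega>)" using km Um by measurable
  qed (simp add: indicator_def)
  ultimately have "AE x in lebesgue_on \<Omega>. indicator U x * \<bar>k x\<bar> = 0"
    by (subst (asm) integral_nonneg_eq_0_iff_AE) auto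
  then have "AE x in lborel. x \<in> \<Omega> \<longrightarrow> indicator U x * \<bar>k x\<bar> = 0" using AE_lebesgue_on_iff[OF \<Omega>] by simp
  then show ?thesis by (rule eventually_mono) (use U(3) in auto)
qed

lemma gradient_component: "gradient \<psi> x $ i = frechet_derivative \<psi> (at x) (axis i 1)"
  by (simp add: gradient_def)

lemma gradient_measurable:
  fixes \<psi> :: "real^'n \<Rightarrow> real"
  assumes "\<psi> \<in> C1c \<Omega>"
  shows "gradient \<psi> \<in> borel_measurable borel"
proof -
  have "continuous_on UNIV (gradient \<psi>)"
    unfolding gradient_def by (intro continuous_on_vec_lambda C1c_deriv_continuous[OF assms])
  then show ?thesis by (rule borel_measurable_continuous_onI)
qed

lemma inner_gradient:
  fixes \<psi> :: "real^'n \<Rightarrow> real"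
  assumes "\<psi> \<in> C1c \<Omega>"
  shows "v \<bullet> gradient \<psi> x = frechet_derivative \<psi> (at x) v"
  by (subst C1c_deriv_expand[OF assms]) (simp add: inner_vec_def gradient_component)

lemma rt0_map_continuous: "continuous_on S (rt0_map a c)"
  unfolding rt0_map_def by (intro continuous_on_vec_lambda continuous_intros)

lemma rt0_integration_by_parts:
  fixes \<psi> :: "real^'n \<Rightarrow> real"
  assumes \<psi>: "\<psi> \<in> C1c U"
  shows "(LINT x|lborel. rt0_map a c x \<bullet> gradient \<psi> x) = - (LINT x|lborel. (\<Sum>i\<in>UNIV. c $ i) * \<psi> x)"
proof -
  have d: "((\<lambda>x. a $ i + c $ i * x $ i) has_derivative (\<lambda>v. c $ i * v $ i)) (at x)" for i and x :: "real^'n"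
    by (auto intro!: derivative_eq_intros bounded_linear_imp_has_derivative bounded_linear_vec_nth
        intro: has_derivative_mult_right)
  have m: "(\<lambda>x. \<psi> x * (a $ i + c $ i * x $ i)) \<in> C1c U"
    "frechet_derivative (\<lambda>x. \<psi> x * (a $ i + c $ i * x $ i)) (at x) v
      = frechet_derivative \<psi> (at x) v * (a $ i + c $ i * x $ i) + \<psi> x * (c $ i * v $ i)" for i x v
    by (rule C1c_mult[OF \<psi> d]; auto intro!: continuous_intros)+
  have i1: "integrable lborel (\<lambda>x. \<psi> x * (c $ i))" for i using C1c_integrable[OF \<psi>] by auto
  have eq: "frechet_derivative \<psi> (at x) (axis i 1) * (a $ i + c $ i * x $ i)
    = frechet_derivative (\<lambda>x. \<psi> x * (a $ i + c $ i * x $ i)) (at x) (axis i 1) - \<psi> x * (c $ i)" for i x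
    unfolding m(2) by simp
  have i2: "integrable lborel (\<lambda>x. frechet_derivative \<psi> (at x) (axis i 1) * (a $ i + c $ i * x $ i))" for i
    unfolding eq by (intro Bochner_Integration.integrable_diff i1 C1c_deriv_integrable[OF m(1)])
  have "(LINT x|lborel. rt0_map a c x \<bullet> gradient \<psi> x)
    = (LINT x|lborel. (\<Sum>i\<in>UNIV. frechet_derivative \<psi> (at x) (axis i 1) * (a $ i + c $ i * x $ i)))"
    by (simp add: inner_vec_def rt0_map_def gradient_component mult.commute)
  also have "\<dots> = (\<Sum>i\<in>UNIV. LINT x|lborel. frechet_derivative \<psi> (at x) (axis i 1) * (a $ i + c $ i * x $ i))"
    by (rule Bochner_Integration.integral_sum) (rule i2)
  also have "\<dots> = (\<Sum>i\<in>UNIV. - (LINT x|lborel. \<psi> x * (c $ i)))"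
    unfolding eq using i1 C1c_deriv_integrable[OF m(1)] C1c_integral_deriv_zero[OF m(1)] by simp
  also have "\<dots> = - (LINT x|lborel. (\<Sum>i\<in>UNIV. c $ i) * \<psi> x)"
    by (simp add: sum_distrib_right sum_negf mult.commute flip: sum_distrib_left)
  finally show ?thesis .
qed

context cubical_mesh
begin

text \<open>A Borel representative with value 0 on the faces, a null set where the tangential
  components of the polynomial pieces may disagree.\<close>

definition rt_field :: "(real^'n \<Rightarrow> real^'n) \<Rightarrow> (real^'n \<Rightarrow> real^'n) \<Rightarrow> real^'n \<Rightarrow> real^'n" where
  "rt_field A C x = (\<Sum>b\<in>corners. indicator (cell b) x *\<^sub>R rt0_map (A b) (C b) x)"

lemma rt_field_measurable [measurable]: "rt_field A C \<in> borel_measurable borel"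
proof -
  have [measurable]: "rt0_map a c \<in> borel_measurable borel" for a c :: "real^'n"
    by (rule borel_measurable_continuous_onI[OF rt0_map_continuous])
  show ?thesis unfolding rt_field_def[abs_def] by measurable
qed

lemma rt_field_cell:
  assumes "b \<in> corners" "x \<in> cell b"
  shows "rt_field A C x = rt0_map (A b) (C b) x"
proof -
  have "rt_field A C x = (\<Sum>d\<in>corners. if d = b then rt0_map (A b) (C b) x else 0)"
    unfolding rt_field_def
  proof (rule sum.cong)
    fix d assume d: "d \<in> corners"
    show "indicator (cell d) x *\<^sub>R rt0_map (A d) (C d) x = (if d = b then rt0_map (A b) (C b) x else 0)"
    proof (cases "d = b")
      case False
      then have "x \<notin> cell d" using cells_disjoint[OF d assms(1) _ assms(2)] by blast
      then show ?thesis using False by simp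
    qed (use assms in simp)
  qed simp
  then show ?thesis using assms finite_corners by simp
qed

lemma rt_field_outside: "(\<And>b. b \<in> corners \<Longrightarrow> x \<notin> cell b) \<Longrightarrow> rt_field A C x = 0"
  unfolding rt_field_def by (intro sum.neutral) auto

text \<open>\<open>A b\<close> and \<open>C b\<close> are the affine coefficients of a field on the cell with lower corner \<open>b\<close>.\<close>

definition admissible_coeffs :: "(real^'n \<Rightarrow> real^'n) \<Rightarrow> (real^'n \<Rightarrow> real^'n) \<Rightarrow> bool" where
  "admissible_coeffs A C \<longleftrightarrow> (\<forall>b\<in>corners.
     (\<forall>x\<in>cube b \<tau>. norm (rt0_map (A b) (C b) x) \<le> 1) \<and>
     (\<forall>x\<in>cube b \<tau> \<inter> frontier \<Omega>. \<forall>n. outer_unit_normal \<Omega> x n \<longrightarrow> rt0_map (A b) (C b) x \<bullet> n = 0))"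

text \<open>Along the edge from b in direction i the i-th component is affine with values in
  [-1, 1], so over the length \<tau> it changes by at most 2. Summed over i this becomes the
  divergence bound 2 d / \<tau>.\<close>

lemma coeff_bound:
  assumes "admissible_coeffs A C" "b \<in> corners"
  shows "\<bar>C b $ i\<bar> \<le> 2 / \<tau>"
proof -
  have le: "\<bar>rt0_map (A b) (C b) x $ i\<bar> \<le> 1" if "x \<in> cube b \<tau>" for x
  proof -
    have "norm (rt0_map (A b) (C b) x) \<le> 1" using assms that unfolding admissible_coeffs_def by blast
    then show ?thesis using component_le_norm_cart[of "rt0_map (A b) (C b) x" i] by linarith
  qed
  have "b \<in> cube b \<tau>" "b + axis i \<tau> \<in> cube b \<tau>" using size_pos by (auto simp: mem_cube axis_def)
  from this[THEN le] have "\<bar>C b $ i * \<tau>\<bar> \<le> 2" by (simp add: rt0_map_def axis_def distrib_left abs_le_iff)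
  then have "\<bar>C b $ i\<bar> * \<tau> \<le> 2" using size_pos by (simp add: abs_mult)
  then show ?thesis using size_pos by (simp add: field_simps)
qed

text \<open>Almost everywhere statements about a Raviart-Thomas function become statements about its
  coefficients: the pieces are continuous, so the norm bound extends to the closed cells, and
  testing inside a single cell identifies the weak divergence with the sum of the slopes. The weak
  identity on all of \<Omega> is kept as a conclusion, because it encodes the continuity of normal
  components across faces.\<close>

lemma rt_representation:
  assumes \<phi>: "\<phi> \<in> RT0_0 \<Omega> \<Q>" and \<phi>1: "Linf_norm \<Omega> \<phi> \<le> 1"
  obtains A C where "admissible_coeffs A C"
    "AE x in lborel. x \<in> \<Omega> \<longrightarrow> \<phi> x = rt_field A C x"
    "AE x in lborel. x \<in> \<Omega> \<longrightarrow> weak_div \<Omega> \<phi> x = step_fun (\<lambda>b. \<Sum>i\<in>UNIV. C b $ i) x"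
    "weak_div \<Omega> \<phi> \<in> borel_measurable (lebesgue_on \<Omega>)"
    "\<And>\<psi>. \<psi> \<in> C1c \<Omega> \<Longrightarrow> (LINT x|lborel. rt_field A C x \<bullet> gradient \<psi> x)
      = - (LINT x|lborel. step_fun (\<lambda>b. \<Sum>i\<in>UNIV. C b $ i) x * \<psi> x)"
proof -
  have \<phi>H: "\<phi> \<in> Hdiv \<Omega>" and cells: "\<forall>Q\<in>\<Q>. \<exists>a c. AE x in lebesgue_on Q. \<phi> x = rt0_map a c x"
    using \<phi> by (auto simp: RT0_0_def RT0_def)
  have \<phi>m: "\<phi> \<in> borel_measurable (lebesgue_on \<Omega>)" using \<phi>H by (simp add: Hdiv_def L2_def)
  define g where "g = weak_div \<Omega> \<phi>"
  from \<phi>H obtain g0 where "has_weak_div \<Omega> \<phi> g0" by (auto simp: Hdiv_def)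
  then have wd: "has_weak_div \<Omega> \<phi> g" unfolding g_def weak_div_def by (rule someI[of "has_weak_div \<Omega> \<phi>"])
  have gL2: "g \<in> L2 \<Omega>" using wd by (simp add: has_weak_div_def)
  have gm: "g \<in> borel_measurable (lebesgue_on \<Omega>)" using gL2 by (simp add: L2_def)
  have "\<forall>b\<in>corners. \<exists>p. AE x in lebesgue_on (cube b \<tau>). \<phi> x = rt0_map (fst p) (snd p) x"
    using cells unfolding corners_def by auto
  from bchoice[OF this] obtain p where
    p: "\<forall>b\<in>corners. AE x in lebesgue_on (cube b \<tau>). \<phi> x = rt0_map (fst (p b)) (snd (p b)) x" by (rule exE)
  define A where "A b = fst (p b)" for b
  define C where "C b = snd (p b)" for b
  have AC: "AE x in lebesgue_on (cube b \<tau>). \<phi> x = rt0_map (A b) (C b) x" if "b \<in> corners" for b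
    using p that by (simp add: A_def C_def)
  have AC': "AE x in lborel. x \<in> cube b \<tau> \<longrightarrow> \<phi> x = rt0_map (A b) (C b) x" if "b \<in> corners" for b
    using AC[OF that] by (subst (asm) AE_restrict_space_iff) (auto simp: cube_def AE_completion_iff)
  have all: "AE x in lborel. \<forall>b\<in>corners. x \<in> cube b \<tau> \<longrightarrow> \<phi> x = rt0_map (A b) (C b) x"
    using finite_corners AC' by (intro AE_finite_allI)
  have eq: "AE x in lborel. x \<in> \<Omega> \<longrightarrow> \<phi> x = rt_field A C x"
    using AE_cell all
  proof eventually_elim
    case (elim x)
    show ?case
    proof
      assume "x \<in> \<Omega>"
      then obtain b where b: "b \<in> corners" "x \<in> cell b" using elim by blast
      then show "\<phi> x = rt_field A C x" using elim rt_field_cell[OF b] box_subset_cube[of b \<tau>] by auto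
    qed
  qed
  have "AE x in lebesgue_on \<Omega>. ereal (norm (\<phi> x)) \<le> Linf_norm \<Omega> \<phi>"
    unfolding Linf_norm_def by (rule esssup_AE)
  then have "AE x in lebesgue_on \<Omega>. norm (\<phi> x) \<le> 1"
    by (rule eventually_mono) (use \<phi>1 in \<open>metis ereal_less_eq(3) one_ereal_def order_trans\<close>)
  then have n1: "AE x in lborel. x \<in> \<Omega> \<longrightarrow> norm (\<phi> x) \<le> 1" using AE_lebesgue_on_iff[OF open_domain] by simp
  have adm: "admissible_coeffs A C"
    unfolding admissible_coeffs_def
  proof (intro ballI conjI allI impI)
    fix b assume b: "b \<in> corners"
    fix x n assume "x \<in> cube b \<tau> \<inter> frontier \<Omega>" "outer_unit_normal \<Omega> x n"
    then show "rt0_map (A b) (C b) x \<bullet> n = 0" using \<phi> b AC[OF b] unfolding RT0_0_def corners_def by blast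
  next
    fix b x assume b: "b \<in> corners" and x: "x \<in> cube b \<tau>"
    \<comment> \<open>The open set where the bound fails is null, hence empty; since the bound is a
      closed condition, it then reaches the closed cube.\<close>
    define V where "V = cell b \<inter> {x. 1 < norm (rt0_map (A b) (C b) x)}"
    have "open V" unfolding V_def
      by (intro open_Int open_box open_Collect_less continuous_intros rt0_map_continuous)
    moreover have "V \<in> null_sets lebesgue"
    proof -
      have "AE x in lborel. x \<notin> V"
        using AC'[OF b] n1
        by eventually_elim (use cell_subset[OF b] box_subset_cube[of b \<tau>] in \<open>auto simp: V_def\<close>)
      then have "AE x in lebesgue. x \<notin> V" by (simp add: AE_completion_iff)
      then show ?thesis using \<open>open V\<close> AE_iff_null_sets[of V lebesgue] by auto
    qed
    ultimately have "V = {}" by (rule open_null_empty)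
    then have "cell b \<subseteq> {x. norm (rt0_map (A b) (C b) x) \<le> 1}" unfolding V_def by force
    then have "closure (cell b) \<subseteq> {x. norm (rt0_map (A b) (C b) x) \<le> 1}"
      by (rule closure_minimal) (intro closed_Collect_le continuous_intros rt0_map_continuous)
    moreover have "b + vec (\<tau> / 2) \<in> cell b" using size_pos by (simp add: mem_box_cart)
    then have "closure (cell b) = cube b \<tau>" unfolding cube_def by (intro closure_box) blast
    ultimately show "norm (rt0_map (A b) (C b) x) \<le> 1" using x by blast
  qed
  define D where "D b = (\<Sum>i\<in>UNIV. C b $ i)" for b
  have weak0: "(LINT x|lborel. rt_field A C x \<bullet> gradient \<psi> x) = - (LINT x|lebesgue_on \<Omega>. g x * \<psi> x)"
    if \<psi>: "\<psi> \<in> C1c \<Omega>" for \<psi>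
  proof -
    have "(LINT x|lebesgue_on \<Omega>. \<phi> x \<bullet> gradient \<psi> x) = - (LINT x|lebesgue_on \<Omega>. g x * \<psi> x)"
      using wd \<psi> unfolding has_weak_div_def by blast
    moreover have "(LINT x|lebesgue_on \<Omega>. \<phi> x \<bullet> gradient \<psi> x) = (LINT x|lborel. rt_field A C x \<bullet> gradient \<psi> x)"
    proof (rule integral_lebesgue_on_borel[OF open_domain])
      have [measurable]: "gradient \<psi> \<in> borel_measurable (lebesgue_on \<Omega>)"
        using gradient_measurable[OF \<psi>] by (intro measurable_restrict_space1 measurable_completion) simp
      show "(\<lambda>x. \<phi> x \<bullet> gradient \<psi> x) \<in> borel_measurable (lebesgue_on \<Omega>)" using \<phi>m by measurable
      show "(\<lambda>x. rt_field A C x \<bullet> gradient \<psi> x) \<in> borel_measurable borel"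
        using gradient_measurable[OF \<psi>] by measurable
      show "AE x in lborel. x \<in> \<Omega> \<longrightarrow> \<phi> x \<bullet> gradient \<psi> x = rt_field A C x \<bullet> gradient \<psi> x"
        using eq by eventually_elim auto
      show "rt_field A C x \<bullet> gradient \<psi> x = 0" if "x \<notin> \<Omega>" for x
        using rt_field_outside[of x A C] that cell_subset by (metis inner_zero_left subsetD)
    qed
    ultimately show ?thesis by simp
  qed
  have sm: "step_fun D \<in> borel_measurable (lebesgue_on \<Omega>)"
    by (intro measurable_restrict_space1 measurable_completion) simp
  have ig: "integrable (lebesgue_on \<Omega>) g" by (rule integrable_lebesgue_on_L2[OF open_domain bounded_domain gL2])
  have isf: "integrable (lebesgue_on \<Omega>) (step_fun D)"
  proof -
    have "integrable lborel (step_fun D)"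
      by (rule integrable_lborel_bounded_support[OF step_fun_measurable _ bounded_domain])
        (use step_fun_bound step_fun_outside in auto)
    then have "integrable lebesgue (step_fun D)" by (subst integrable_completion) auto
    then have "integrable lebesgue (\<lambda>x. indicator \<Omega> x *\<^sub>R step_fun D x)"
      using open_domain by (intro integrable_mult_indicator) auto
    then show ?thesis using open_domain by (subst integrable_restrict_space) auto
  qed
  have geq: "AE x in lborel. x \<in> \<Omega> \<longrightarrow> g x = step_fun D x"
  proof -
    \<comment> \<open>A test function supported in one cell sees a single polynomial, for which
      integration by parts is elementary.\<close>
    have "AE x in lborel. x \<in> cell b \<longrightarrow> g x - step_fun D x = 0" if b: "b \<in> corners" for b
    proof (rule fundamental_lemma[OF open_domain _ open_box bounded_box cell_subset[OF b]])
      show "integrable (lebesgue_on \<Omega>) (\<lambda>x. g x - step_fun D x)" using ig isf by auto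
      fix \<psi> :: "real^'n \<Rightarrow> real" assume \<psi>b: "\<psi> \<in> C1c (cell b)"
      have \<psi>: "\<psi> \<in> C1c \<Omega>" by (rule C1c_mono[OF \<psi>b cell_subset[OF b]])
      obtain Bd where Bd: "\<And>x. norm (\<psi> x) \<le> Bd" using C1c_bounded[OF \<psi>] by metis
      have \<psi>m: "\<psi> \<in> borel_measurable (lebesgue_on \<Omega>)"
        using C1c_measurable[OF \<psi>] by (intro measurable_restrict_space1 measurable_completion) simp
      have bi: "integrable (lebesgue_on \<Omega>) (\<lambda>x. q x * \<psi> x)" if q: "integrable (lebesgue_on \<Omega>) q" for q :: "real^'n \<Rightarrow> real"
      proof (rule Bochner_Integration.integrable_bound[OF integrable_mult_right[OF integrable_norm[OF q], of Bd]])
        show "(\<lambda>x. q x * \<psi> x) \<in> borel_measurable (lebesgue_on \<Omega>)" using q \<psi>m by measurable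
        show "AE x in lebesgue_on \<Omega>. norm (q x * \<psi> x) \<le> norm (Bd * norm (q x))"
        proof (rule AE_I2)
          fix x
          have "\<bar>\<psi> x\<bar> * \<bar>q x\<bar> \<le> \<bar>Bd\<bar> * \<bar>q x\<bar>" using Bd[of x] by (intro mult_right_mono) auto
          then show "norm (q x * \<psi> x) \<le> norm (Bd * norm (q x))" by (simp add: abs_mult mult.commute)
        qed
      qed
      have zero: "\<psi> x = 0" "gradient \<psi> x = 0" if "x \<notin> cell b" for x
      proof -
        show "\<psi> x = 0" by (rule C1c_outside[OF \<psi>b that])
        obtain K where "K \<subseteq> cell b" "\<And>x v. x \<notin> K \<Longrightarrow> frechet_derivative \<psi> (at x) v = 0"
          using C1c_support[OF \<psi>b] by metis
        then show "gradient \<psi> x = 0" using that by (auto simp: vec_eq_iff gradient_component)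
      qed
      have "(LINT x|lborel. rt_field A C x \<bullet> gradient \<psi> x) = (LINT x|lborel. rt0_map (A b) (C b) x \<bullet> gradient \<psi> x)"
        by (rule Bochner_Integration.integral_cong[OF refl]) (metis zero(2) inner_zero_right rt_field_cell[OF b])
      also have "\<dots> = - (LINT x|lborel. D b * \<psi> x)"
        unfolding D_def by (rule rt0_integration_by_parts[OF \<psi>])
      also have "(LINT x|lborel. D b * \<psi> x) = (LINT x|lebesgue_on \<Omega>. step_fun D x * \<psi> x)"
      proof (rule integral_lebesgue_on_borel[OF open_domain, symmetric])
        show "(\<lambda>x. step_fun D x * \<psi> x) \<in> borel_measurable (lebesgue_on \<Omega>)" using sm \<psi>m by measurable
        show "(\<lambda>x. D b * \<psi> x) \<in> borel_measurable borel" using C1c_measurable[OF \<psi>] by measurable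
        show "AE x in lborel. x \<in> \<Omega> \<longrightarrow> step_fun D x * \<psi> x = D b * \<psi> x"
          by (intro AE_I2) (metis zero(1) mult_zero_right step_fun_cell[OF b])
        show "D b * \<psi> x = 0" if "x \<notin> \<Omega>" for x using C1c_outside[OF \<psi> that] by simp
      qed
      finally have "(LINT x|lebesgue_on \<Omega>. g x * \<psi> x) = (LINT x|lebesgue_on \<Omega>. step_fun D x * \<psi> x)"
        using weak0[OF \<psi>] by simp
      then show "(LINT x|lebesgue_on \<Omega>. (g x - step_fun D x) * \<psi> x) = 0"
        using bi[OF ig] bi[OF isf] by (simp add: left_diff_distrib)
    qed
    then have "AE x in lborel. \<forall>b\<in>corners. x \<in> cell b \<longrightarrow> g x - step_fun D x = 0"
      using finite_corners by (intro AE_finite_allI)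
    with AE_cell show ?thesis by eventually_elim auto
  qed
  have weak: "(LINT x|lborel. rt_field A C x \<bullet> gradient \<psi> x) = - (LINT x|lborel. step_fun D x * \<psi> x)"
    if \<psi>: "\<psi> \<in> C1c \<Omega>" for \<psi>
  proof -
    have "(LINT x|lebesgue_on \<Omega>. g x * \<psi> x) = (LINT x|lborel. step_fun D x * \<psi> x)"
    proof (rule integral_lebesgue_on_borel[OF open_domain])
      have \<psi>m: "\<psi> \<in> borel_measurable (lebesgue_on \<Omega>)"
        using C1c_measurable[OF \<psi>] by (intro measurable_restrict_space1 measurable_completion) simp
      show "(\<lambda>x. g x * \<psi> x) \<in> borel_measurable (lebesgue_on \<Omega>)" using gm \<psi>m by measurable
      show "(\<lambda>x. step_fun D x * \<psi> x) \<in> borel_measurable borel" using C1c_measurable[OF \<psi>] by measurable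
      show "AE x in lborel. x \<in> \<Omega> \<longrightarrow> g x * \<psi> x = step_fun D x * \<psi> x" using geq by eventually_elim auto
      show "step_fun D x * \<psi> x = 0" if "x \<notin> \<Omega>" for x using step_fun_outside[OF that] by simp
    qed
    then show ?thesis using weak0[OF \<psi>] by simp
  qed
  show ?thesis
    using that[OF adm eq] geq gm weak unfolding g_def D_def by blast
qed

end

subsection \<open>Cutting off at the boundary\<close>

lemma mol_has_derivative:
  assumes e: "0 < e"
  shows "(mol e has_derivative (\<lambda>v. mol_grad e x \<bullet> v)) (at (x::'a::euclidean_space))"
proof -
  obtain B where B: "\<And>(x::'a) v. norm v \<le> 1 \<Longrightarrow> \<bar>mol e (x + v) - mol e x - mol_grad e x \<bullet> v\<bar> \<le> B * (norm v)\<^sup>2"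
    using mol_bounds[OF e, where 'a='a] by metis
  show ?thesis
  proof (rule has_derivativeI_sandwich[of 1 _ _ _ _ "\<lambda>y. B * norm (y - x)"])
    show "bounded_linear (\<lambda>v. mol_grad e x \<bullet> v)" by (rule bounded_linear_inner_right)
    fix y assume y: "y \<noteq> x" "dist y x < 1"
    have "\<bar>mol e (x + (y - x)) - mol e x - mol_grad e x \<bullet> (y - x)\<bar> \<le> B * (norm (y - x))\<^sup>2"
      by (rule B) (use y in \<open>simp add: dist_norm\<close>)
    then show "norm (mol e y - mol e x - mol_grad e x \<bullet> (y - x)) / norm (y - x) \<le> B * norm (y - x)"
      using y by (simp add: divide_le_eq power2_eq_square ac_simps)
  next
    have "((\<lambda>y. B * norm (y - x)) \<longlongrightarrow> B * norm (x - x)) (at x)" by (intro tendsto_intros)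
    then show "((\<lambda>y. B * norm (y - x)) \<longlongrightarrow> 0) (at x)" by simp
  qed simp
qed

lemma derivative_zero_along:
  fixes f :: "'a::real_normed_vector \<Rightarrow> 'b::real_normed_vector"
  assumes f: "(f has_derivative D) (at x)" and e: "0 < e" and c: "\<And>s. \<bar>s\<bar> < e \<Longrightarrow> f (x + s *\<^sub>R v) = f x"
  shows "D v = 0"
proof -
  have f0: "(f has_derivative D) (at (x + 0 *\<^sub>R v))" using f by simp
  have g: "((\<lambda>s::real. x + s *\<^sub>R v) has_derivative (\<lambda>s. s *\<^sub>R v)) (at 0)" by (auto intro!: derivative_eq_intros)
  have "((\<lambda>s. f (x + s *\<^sub>R v)) has_derivative (\<lambda>s. D (s *\<^sub>R v))) (at 0)"
    by (rule has_derivative_compose[OF g f0])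
  moreover have "((\<lambda>s. f (x + s *\<^sub>R v)) has_derivative (\<lambda>s. 0)) (at 0)"
  proof (rule has_derivative_transform_within_open[of "\<lambda>s. f x" _ _ UNIV "{-e<..<e}"])
    show "f x = f (x + s *\<^sub>R v)" if "s \<in> {-e<..<e}" for s using c[of s] that by (simp add: abs_less_iff)
  qed (use e in auto)
  ultimately have "(\<lambda>s. D (s *\<^sub>R v)) = (\<lambda>s. 0)" by (rule has_derivative_unique)
  from fun_cong[OF this, of 1] show ?thesis by simp
qed

lemma infdist_ge:
  assumes "A \<noteq> {}" "\<And>a. a \<in> A \<Longrightarrow> d \<le> dist x a"
  shows "d \<le> infdist x A"
  unfolding infdist_notempty[OF assms(1)] by (rule cINF_greatest[OF assms(1)]) (rule assms(2))

lemma compact_inner_parallel: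
  fixes S :: "'a::euclidean_space set"
  assumes "open S" "bounded S" "0 < d"
  shows "compact {x. d \<le> infdist x (- S)}" and "{x. d \<le> infdist x (- S)} \<subseteq> S"
proof -
  have "S \<noteq> UNIV" using assms(2) not_bounded_UNIV by metis
  then have Sc: "closed (- S)" "- S \<noteq> {}" using assms(1) by auto
  show sub: "{x. d \<le> infdist x (- S)} \<subseteq> S"
    using in_closed_iff_infdist_zero[OF Sc] assms(3) by force
  have "closed {x. d \<le> infdist x (- S)}" by (intro closed_Collect_le continuous_intros)
  then show "compact {x. d \<le> infdist x (- S)}"
    using bounded_subset[OF assms(2) sub] compact_eq_bounded_closed by blast
qed

lemma mem_cube_around: "(y::real^'n) \<in> cbox (x - vec r) (x + vec r) \<longleftrightarrow> (\<forall>l. \<bar>y $ l - x $ l\<bar> \<le> r)"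
  unfolding mem_box_cart by (auto simp: abs_le_iff algebra_simps)

lemma norm_axis: "norm (axis j c :: real^'n) = \<bar>c\<bar>"
proof -
  have "(axis j c :: real^'n) = c *\<^sub>R axis j 1" by (auto simp: vec_eq_iff axis_def)
  then show ?thesis by (simp add: norm_axis_1)
qed

section \<open>The cutoff function\<close>

context cubical_mesh
begin

text \<open>Distance from the complement is measured in the maximum norm, so that membership can be
  checked coordinate by coordinate. The radii are layered in units of the mollification radius
  \<delta>: 3 for the indicator, 4 for points where the cutoff is 1, 5 for points where it is
  locally constant, 6 in \<open>near_face\<close>.\<close>

definition inner_set :: "real \<Rightarrow> (real^'n) set" where
  "inner_set \<delta> = {x. cbox (x - vec (3 * \<delta>)) (x + vec (3 * \<delta>)) \<subseteq> \<Omega>}"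

definition cutoff :: "real \<Rightarrow> real^'n \<Rightarrow> real" where
  "cutoff \<delta> = conv \<delta> (indicator (inner_set \<delta>))"

text \<open>The complement is the sum of a closed set and a compact cube, hence closed.\<close>

lemma inner_set_borel [measurable]: "inner_set \<delta> \<in> sets borel"
proof -
  have "- inner_set \<delta> = (\<Union>y\<in>- \<Omega>. \<Union>z\<in>cbox (- vec (3 * \<delta>)) (vec (3 * \<delta>)). {y + z})"
  proof (intro set_eqI iffI)
    fix x assume "x \<in> - inner_set \<delta>"
    then obtain y where y: "y \<notin> \<Omega>" "y \<in> cbox (x - vec (3 * \<delta>)) (x + vec (3 * \<delta>))" by (auto simp: inner_set_def)
    then have "x - y \<in> cbox (- vec (3 * \<delta>)) (vec (3 * \<delta>))" by (simp add: mem_box_cart) (smt (verit))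
    moreover have "x = y + (x - y)" by simp
    ultimately show "x \<in> (\<Union>y\<in>- \<Omega>. \<Union>z\<in>cbox (- vec (3 * \<delta>)) (vec (3 * \<delta>)). {y + z})" using y(1) by blast
  next
    fix x assume "x \<in> (\<Union>y\<in>- \<Omega>. \<Union>z\<in>cbox (- vec (3 * \<delta>)) (vec (3 * \<delta>)). {y + z})"
    then obtain y z where yz: "y \<notin> \<Omega>" "z \<in> cbox (- vec (3 * \<delta>)) (vec (3 * \<delta>))" "x = y + z" by blast
    then have "y \<in> cbox (x - vec (3 * \<delta>)) (x + vec (3 * \<delta>))" by (simp add: mem_box_cart) (smt (verit))
    then show "x \<in> - inner_set \<delta>" using yz(1) by (auto simp: inner_set_def)
  qed
  moreover have "closed (\<Union>y\<in>- \<Omega>. \<Union>z\<in>cbox (- vec (3 * \<delta>)) (vec (3 * \<delta>)). {y + z})"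
    using open_domain by (intro closed_compact_sums) auto
  ultimately show ?thesis by (metis borel_closed borel_comp double_complement)
qed

lemma inner_set_subset: "0 \<le> \<delta> \<Longrightarrow> inner_set \<delta> \<subseteq> \<Omega>"
proof
  fix x assume "0 \<le> \<delta>" "x \<in> inner_set \<delta>"
  moreover have "x \<in> cbox (x - vec (3 * \<delta>)) (x + vec (3 * \<delta>))" using \<open>0 \<le> \<delta>\<close> by (simp add: mem_cube_around)
  ultimately show "x \<in> \<Omega>" by (auto simp: inner_set_def)
qed

lemma inner_indicator_integrable: "0 \<le> \<delta> \<Longrightarrow> integrable lborel (indicator (inner_set \<delta>) :: real^'n \<Rightarrow> real)"
  by (rule integrable_lborel_bounded_support[where B=1 and K=\<Omega>])
    (use inner_set_subset bounded_domain in \<open>auto simp: indicator_def\<close>)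

lemma cutoff_C1c:
  assumes \<delta>: "0 < \<delta>"
  shows "cutoff \<delta> \<in> C1c \<Omega>"
  unfolding cutoff_def
proof (rule conv_C1c[OF \<delta> inner_indicator_integrable compact_inner_parallel[OF open_domain bounded_domain \<delta>]])
  fix x y assume xy: "norm (x - y) < \<delta>" "x \<notin> {x. \<delta> \<le> infdist x (- \<Omega>)}"
  have "y \<notin> inner_set \<delta>"
  proof
    assume y: "y \<in> inner_set \<delta>"
    have ne: "- \<Omega> \<noteq> {}" using bounded_domain not_bounded_UNIV by (metis double_complement compl_bot_eq)
    have "\<delta> \<le> infdist x (- \<Omega>)"
    proof (rule infdist_ge[OF ne])
      fix a assume "a \<in> - \<Omega>"
      then have "a \<notin> cbox (y - vec (3 * \<delta>)) (y + vec (3 * \<delta>))" using y by (auto simp: inner_set_def)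
      then obtain l where "3 * \<delta> < \<bar>a $ l - y $ l\<bar>" unfolding mem_cube_around by (auto simp: not_le)
      then have "3 * \<delta> < norm (a - y)" using component_le_norm_cart[of "a - y" l] by simp
      moreover have "norm (a - y) \<le> norm (a - x) + norm (x - y)" using norm_triangle_ineq[of "a - x" "x - y"] by simp
      ultimately show "\<delta> \<le> dist x a" using xy(1) \<delta> by (simp add: dist_norm norm_minus_commute)
    qed
    then show False using xy by simp
  qed
  then show "indicator (inner_set \<delta>) y = (0::real)" by simp
qed (use \<delta> in simp)

lemma cutoff_le_1: "0 < \<delta> \<Longrightarrow> \<bar>cutoff \<delta> x\<bar> \<le> 1"
  unfolding cutoff_def using conv_norm_le[of \<delta> "indicator (inner_set \<delta>) :: real^'n \<Rightarrow> real" 1 x]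
  by (simp add: indicator_def)

lemma cutoff_eq_1:
  assumes \<delta>: "0 < \<delta>" and sub: "cbox (x - vec (4 * \<delta>)) (x + vec (4 * \<delta>)) \<subseteq> \<Omega>"
  shows "cutoff \<delta> x = 1"
proof -
  have in_inner: "x - y \<in> inner_set \<delta>" if y: "norm y < \<delta>" for y
  proof -
    have "z \<in> \<Omega>" if z: "z \<in> cbox ((x - y) - vec (3 * \<delta>)) ((x - y) + vec (3 * \<delta>))" for z
    proof -
      have "\<bar>z $ l - x $ l\<bar> \<le> 4 * \<delta>" for l
      proof -
        have "\<bar>z $ l - (x - y) $ l\<bar> \<le> 3 * \<delta>" using z unfolding mem_cube_around by blast
        moreover have "\<bar>y $ l\<bar> < \<delta>" using y component_le_norm_cart[of y l] by linarith
        ultimately show ?thesis by simp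
      qed
      then show ?thesis using sub mem_cube_around by blast
    qed
    then show ?thesis by (auto simp: inner_set_def)
  qed
  have "norm (conv \<delta> (indicator (inner_set \<delta>)) x - (indicator (inner_set \<delta>) x :: real)) \<le> 0"
    by (rule conv_close[OF \<delta>, where B=1]) (use in_inner in_inner[of 0] \<delta> in \<open>auto simp: indicator_def\<close>)
  then show ?thesis using in_inner[of 0] \<delta> by (simp add: cutoff_def)
qed

lemma cutoff_deriv_0:
  assumes \<delta>: "0 < \<delta>" and sub: "cbox (x - vec (5 * \<delta>)) (x + vec (5 * \<delta>)) \<subseteq> \<Omega>"
  shows "frechet_derivative (cutoff \<delta>) (at x) v = 0"
proof (rule derivative_zero_along[OF C1c_has_derivative[OF cutoff_C1c[OF \<delta>]]])
  show "0 < \<delta> / (norm v + 1)" using \<delta> by (simp add: add_nonneg_pos)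
  fix s assume s: "\<bar>s\<bar> < \<delta> / (norm v + 1)"
  have "\<bar>s\<bar> * (norm v + 1) < \<delta>" using s by (simp add: pos_less_divide_eq add_nonneg_pos)
  then have sv: "norm (s *\<^sub>R v) < \<delta>" using abs_ge_zero[of s] by (simp add: distrib_left)
  have "cbox ((x + s *\<^sub>R v) - vec (4 * \<delta>)) ((x + s *\<^sub>R v) + vec (4 * \<delta>)) \<subseteq> \<Omega>"
  proof
    fix z assume z: "z \<in> cbox ((x + s *\<^sub>R v) - vec (4 * \<delta>)) ((x + s *\<^sub>R v) + vec (4 * \<delta>))"
    have "\<bar>z $ l - x $ l\<bar> \<le> 5 * \<delta>" for l
    proof -
      have "\<bar>z $ l - (x + s *\<^sub>R v) $ l\<bar> \<le> 4 * \<delta>" using z unfolding mem_cube_around by blast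
      moreover have "\<bar>(s *\<^sub>R v) $ l\<bar> < \<delta>" using sv component_le_norm_cart[of "s *\<^sub>R v" l] by linarith
      ultimately show ?thesis by simp
    qed
    then show "z \<in> \<Omega>" using sub mem_cube_around by blast
  qed
  moreover have "cbox (x - vec (4 * \<delta>)) (x + vec (4 * \<delta>)) \<subseteq> \<Omega>"
  proof
    fix z assume "z \<in> cbox (x - vec (4 * \<delta>)) (x + vec (4 * \<delta>))"
    then have *: "\<bar>z $ l - x $ l\<bar> \<le> 4 * \<delta>" for l unfolding mem_cube_around by blast
    have "\<bar>z $ l - x $ l\<bar> \<le> 5 * \<delta>" for l using *[of l] \<delta> by linarith
    then show "z \<in> \<Omega>" using sub mem_cube_around by blast
  qed
  ultimately show "cutoff \<delta> (x + s *\<^sub>R v) = cutoff \<delta> x" using cutoff_eq_1[OF \<delta>] by simp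
qed

text \<open>The indicator is at most 1, so the gradient is bounded by the L1 norm of the gradient of
  the mollifier.\<close>

lemma cutoff_grad_bound:
  assumes \<delta>: "0 < \<delta>"
  shows "\<bar>frechet_derivative (cutoff \<delta>) (at x) v\<bar> \<le> 8 * 2 ^ CARD('n) / \<delta> * norm v"
proof -
  have ii: "integrable lborel (indicator (inner_set \<delta>) :: real^'n \<Rightarrow> real)" using inner_indicator_integrable \<delta> by simp
  obtain B where B: "\<And>x::real^'n. norm (mol_grad \<delta> x) \<le> B" using mol_bounds[OF \<delta>, where 'a="real^'n"] by metis
  have in1: "integrable lborel (\<lambda>y::real^'n. norm (mol_grad \<delta> y))"
    by (rule integrable_norm[OF mol_grad_integral_bound(1)[OF \<delta>]])
  have "norm (LINT y|lborel. (mol_grad \<delta> (x - y) \<bullet> v) *\<^sub>R (indicator (inner_set \<delta>) y :: real))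
    \<le> (LINT y|lborel. norm (mol_grad \<delta> (x - y)) * norm v)"
  proof (rule lborel_norm_integral_le)
    show "integrable lborel (\<lambda>y. (mol_grad \<delta> (x - y) \<bullet> v) *\<^sub>R (indicator (inner_set \<delta>) y :: real))"
      by (rule kernel_integrable[OF ii, of "\<lambda>z. mol_grad \<delta> z \<bullet> v" "B * norm v"])
        (auto intro: mol_grad_inner_bound[OF B])
    show "integrable lborel (\<lambda>y. norm (mol_grad \<delta> (x - y)) * norm v)"
      using lborel_integrable_reflect[OF in1, of x] by auto
    show "norm ((mol_grad \<delta> (x - y) \<bullet> v) *\<^sub>R (indicator (inner_set \<delta>) y :: real)) \<le> norm (mol_grad \<delta> (x - y)) * norm v" for y
      using Cauchy_Schwarz_ineq2[of "mol_grad \<delta> (x - y)" v] by (simp add: indicator_def)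
  qed
  also have "\<dots> = (LINT y|lborel. norm (mol_grad \<delta> (y::real^'n))) * norm v"
    using lborel_integral_reflect[of "\<lambda>y. norm (mol_grad \<delta> (y::real^'n))" x] by simp
  also have "\<dots> \<le> 8 * 2 ^ CARD('n) / \<delta> * norm v"
    using mol_grad_integral_bound(2)[OF \<delta>, where 'a="real^'n"] by (intro mult_right_mono) auto
  finally show ?thesis unfolding cutoff_def conv_frechet[OF \<delta> ii] by simp
qed

text \<open>If membership in \<open>inner_set\<close> does not depend on coordinate k near x, the
  convolution is constant along axis k. The radius 2 \<delta> is the sum of the mollification radius
  and of a displacement shorter than \<delta>.\<close>

lemma cutoff_flat:
  assumes \<delta>: "0 < \<delta>"
    and flat: "\<And>y y'. y \<in> cbox (x - vec (2 * \<delta>)) (x + vec (2 * \<delta>)) \<Longrightarrow> y' \<in> cbox (x - vec (2 * \<delta>)) (x + vec (2 * \<delta>)) \<Longrightarrow>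
      (\<And>l. l \<noteq> k \<Longrightarrow> y $ l = y' $ l) \<Longrightarrow> y \<in> inner_set \<delta> \<longleftrightarrow> y' \<in> inner_set \<delta>"
  shows "frechet_derivative (cutoff \<delta>) (at x) (axis k 1) = 0"
proof (rule derivative_zero_along[OF C1c_has_derivative[OF cutoff_C1c[OF \<delta>]] \<delta>])
  fix s :: real assume s: "\<bar>s\<bar> < \<delta>"
  have "mol \<delta> y *\<^sub>R (indicator (inner_set \<delta>) (x + s *\<^sub>R axis k 1 - y) :: real)
    = mol \<delta> y *\<^sub>R (indicator (inner_set \<delta>) (x - y) :: real)" for y
  proof (cases "norm y < \<delta>")
    case True
    then have yl: "\<bar>y $ l\<bar> < \<delta>" for l using component_le_norm_cart[of y l] by linarith
    have "x + s *\<^sub>R axis k 1 - y \<in> inner_set \<delta> \<longleftrightarrow> x - y \<in> inner_set \<delta>"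
    proof (rule flat)
      show "x + s *\<^sub>R axis k 1 - y \<in> cbox (x - vec (2 * \<delta>)) (x + vec (2 * \<delta>))" unfolding mem_cube_around
      proof
        fix l show "\<bar>(x + s *\<^sub>R axis k 1 - y) $ l - x $ l\<bar> \<le> 2 * \<delta>" using yl[of l] s by (cases "l = k") (auto simp: axis_def)
      qed
      show "x - y \<in> cbox (x - vec (2 * \<delta>)) (x + vec (2 * \<delta>))" unfolding mem_cube_around
      proof
        fix l show "\<bar>(x - y) $ l - x $ l\<bar> \<le> 2 * \<delta>" using yl[of l] by simp
      qed
    qed (simp add: axis_def)
    then show ?thesis by (simp add: indicator_def)
  qed (simp add: mol_outside[OF \<delta>])
  then show "cutoff \<delta> (x + s *\<^sub>R axis k 1) = cutoff \<delta> x"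
    unfolding cutoff_def by (subst (1 2) conv_alt) (auto intro!: Bochner_Integration.integral_cong)
qed

section \<open>Faces on the boundary of the domain\<close>

definition gap_size :: real where
  "gap_size = (SOME d. 0 < d \<and> (\<forall>a\<in>corners. \<forall>b\<in>corners. \<forall>x\<in>cube a \<tau>. \<forall>y\<in>cube b \<tau>. dist x y < d \<longrightarrow> cube a \<tau> \<inter> cube b \<tau> \<noteq> {}))"

lemma gap_size:
  shows "0 < gap_size"
    and "a \<in> corners \<Longrightarrow> b \<in> corners \<Longrightarrow> x \<in> cube a \<tau> \<Longrightarrow> y \<in> cube b \<tau> \<Longrightarrow> dist x y < gap_size \<Longrightarrow> cube a \<tau> \<inter> cube b \<tau> \<noteq> {}"
proof -
  have "\<exists>d. 0 < d \<and> (\<forall>a\<in>corners. \<forall>b\<in>corners. \<forall>x\<in>cube a \<tau>. \<forall>y\<in>cube b \<tau>. dist x y < d \<longrightarrow> cube a \<tau> \<inter> cube b \<tau> \<noteq> {})"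
    using gap by metis
  from someI_ex[OF this] show "0 < gap_size"
    "a \<in> corners \<Longrightarrow> b \<in> corners \<Longrightarrow> x \<in> cube a \<tau> \<Longrightarrow> y \<in> cube b \<tau> \<Longrightarrow> dist x y < gap_size \<Longrightarrow> cube a \<tau> \<inter> cube b \<tau> \<noteq> {}"
    unfolding gap_size_def[symmetric] by blast+
qed

text \<open>The sign \<open>s\<close> selects one of the two faces of the cell at \<open>b\<close> that are orthogonal to the axis \<open>j\<close>,
  and \<open>face_coord b j s\<close> is the coordinate of that face.\<close>

definition face_coord :: "real^'n \<Rightarrow> 'n \<Rightarrow> real \<Rightarrow> real" where
  "face_coord b j s = b $ j + (if s = 1 then \<tau> else 0)"

text \<open>A point of \<Omega> on or beyond the face could be pushed outwards a little further
  within the open set \<Omega>. It would then lie in a cell that touches the cell of b, by the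
  choice of \<open>gap_size\<close>, and that is the cell across the face, by
  \<open>neighbour\<close>; but no such cell exists.\<close>

lemma beyond_boundary_face:
  assumes b: "b \<in> corners" and s: "s = 1 \<or> s = -1" and no: "b + axis j (s * \<tau>) \<notin> corners"
    and inside: "\<And>l. l \<noteq> j \<Longrightarrow> b $ l < z $ l \<and> z $ l < b $ l + \<tau>"
    and z: "0 \<le> s * (z $ j - face_coord b j s)" "\<bar>z $ j - face_coord b j s\<bar> < gap_size"
  shows "z \<notin> \<Omega>"
proof
  define f where "f = face_coord b j s"
  assume "z \<in> \<Omega>"
  then obtain r where r: "0 < r" "ball z r \<subseteq> \<Omega>" using open_domain open_contains_ball by blast
  \<comment> \<open>The push keeps z' in the ball around z and within \<open>gap_size\<close> of the
    face; it is positive, so that even a point on the face ends strictly beyond it.\<close>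
  define t where "t = min (r/2) ((gap_size - \<bar>z $ j - f\<bar>) / 2)"
  have t: "0 < t" "t < r" "\<bar>z $ j - f\<bar> + t < gap_size" using r z(2) by (auto simp: t_def f_def min_def field_simps)
  define z' where "z' = z + axis j (s * t)"
  have z'l: "z' $ l = (if l = j then z $ j + s * t else z $ l)" for l by (auto simp: z'_def axis_def)
  have "dist z z' = \<bar>s * t\<bar>" unfolding z'_def dist_norm by (simp add: norm_axis)
  also have "\<dots> = t" using s t by auto
  finally have "z' \<in> \<Omega>" using r(2) t by auto
  then obtain b' where b': "b' \<in> corners" "z' \<in> cube b' \<tau>" using domain_subset by blast
  define p where "p = (\<chi> l. if l = j then f else z $ l)"
  have pc: "p \<in> cube b \<tau>" unfolding mem_cube p_def using inside size_pos by (auto simp: f_def face_coord_def less_imp_le)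
  have "p - z' = axis j (f - z' $ j)" by (auto simp: vec_eq_iff p_def z'l axis_def)
  then have "dist p z' = \<bar>f - z' $ j\<bar>" by (simp add: dist_norm norm_axis)
  also have "\<dots> < gap_size" using s t z'l[of j] by auto
  finally have "cube b \<tau> \<inter> cube b' \<tau> \<noteq> {}" by (rule gap_size(2)[OF b b'(1) pc b'(2)])
  note nb = neighbour[OF b b'(1) this b'(2), of j]
  have ins: "\<And>l. l \<noteq> j \<Longrightarrow> b $ l < z' $ l \<and> z' $ l < b $ l + \<tau>" using inside z'l by simp
  have "b' = b + axis j (s * \<tau>)"
  proof (cases "s = 1")
    case True
    then have "b $ j + \<tau> < z' $ j" using z(1) t(1) z'l[of j] by (simp add: face_coord_def)
    then show ?thesis using nb(2)[OF ins] True by simp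
  next
    case False
    then have "s = -1" using s by simp
    then have "z' $ j < b $ j" using z(1) t(1) z'l[of j] by (simp add: face_coord_def)
    then have "b' = b - axis j \<tau>" using nb(1)[OF ins] by simp
    also have "\<dots> = b + axis j (s * \<tau>)" using \<open>s = -1\<close> by (auto simp: vec_eq_iff axis_def)
    finally show ?thesis .
  qed
  then show False using b'(1) no by simp
qed

text \<open>Near a point in the relative interior of a boundary face, \<Omega> is exactly the side
  of the cell: inside by \<open>cell_subset\<close>, nothing beyond by
  \<open>beyond_boundary_face\<close>. The axis direction is therefore an outer unit normal, with
  the same radius for every cone parameter \<epsilon>. This turns the boundary condition of
  \<open>RT0_0\<close> into a statement on one component.\<close>

lemma boundary_face_normal:
  assumes b: "b \<in> corners" and s: "s = 1 \<or> s = -1" and no: "b + axis j (s * \<tau>) \<notin> corners"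
    and inside: "\<And>l. l \<noteq> j \<Longrightarrow> b $ l < p $ l \<and> p $ l < b $ l + \<tau>" and pj: "p $ j = face_coord b j s"
  shows "p \<in> cube b \<tau>" "p \<in> frontier \<Omega>" "outer_unit_normal \<Omega> p (axis j s)"
proof -
  define f where "f = face_coord b j s"
  show pc: "p \<in> cube b \<tau>" unfolding mem_cube
  proof
    fix l show "b $ l \<le> p $ l \<and> p $ l \<le> b $ l + \<tau>"
      using inside[of l] pj size_pos by (cases "l = j") (auto simp: face_coord_def)
  qed
  have "p \<notin> \<Omega>" using beyond_boundary_face[OF b s no inside] pj gap_size(1) by simp
  moreover have "p \<in> closure \<Omega>"
  proof -
    have "b + vec (\<tau> / 2) \<in> cell b" using size_pos by (simp add: mem_box_cart)
    then have "closure (cell b) = cube b \<tau>" unfolding cube_def by (intro closure_box) blast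
    then show ?thesis using pc closure_mono[OF cell_subset[OF b]] by blast
  qed
  ultimately show fr: "p \<in> frontier \<Omega>" using open_domain by (simp add: frontier_def interior_open)
  define m where "m = min gap_size \<tau>"
  have m: "0 < m" "m \<le> gap_size" "m \<le> \<tau>" using gap_size(1) size_pos by (auto simp: m_def)
  \<comment> \<open>A box of half width m in direction j and as wide as the cell in the others; its
    points lie in the cell of b, on the face, or just beyond it.\<close>
  define B where "B = box (\<chi> l. if l = j then f - m else b $ l) (\<chi> l. if l = j then f + m else b $ l + \<tau>)"
  have "p \<in> B" unfolding B_def mem_box_cart using inside pj m by (auto simp: f_def)
  then obtain d where d: "0 < d" "ball p d \<subseteq> B" using open_contains_ball[of B] by (auto simp: B_def open_box)
  show "outer_unit_normal \<Omega> p (axis j s)"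
    unfolding outer_unit_normal_def
  proof (intro conjI allI impI)
    show "p \<in> frontier \<Omega>" by (rule fr)
    show "norm (axis j s :: real^'n) = 1" using s by (auto simp: norm_axis)
    fix \<epsilon> :: real assume \<epsilon>: "0 < \<epsilon>"
    show "\<exists>\<delta>>0. \<forall>y\<in>ball p \<delta>. ((y - p) \<bullet> axis j s < - \<epsilon> * norm (y - p) \<longrightarrow> y \<in> \<Omega>) \<and>
        (\<epsilon> * norm (y - p) < (y - p) \<bullet> axis j s \<longrightarrow> y \<notin> \<Omega>)"
    proof (intro exI[of _ d] conjI ballI impI d(1))
      fix y assume "y \<in> ball p d"
      then have "y \<in> B" using d(2) by blast
      then have yl: "(if l = j then f - m else b $ l) < y $ l \<and> y $ l < (if l = j then f + m else b $ l + \<tau>)" for l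
        unfolding B_def mem_box_cart by simp
      have ins: "\<And>l. l \<noteq> j \<Longrightarrow> b $ l < y $ l \<and> y $ l < b $ l + \<tau>" using yl by (metis (full_types))
      have yj: "\<bar>y $ j - f\<bar> < m" using yl[of j] by (simp add: abs_less_iff)
      have ip: "(y - p) \<bullet> axis j s = s * (y $ j - f)" using pj by (simp add: inner_axis f_def)
      have nn: "0 \<le> \<epsilon> * norm (y - p)" using \<epsilon> by simp
      show "y \<in> \<Omega>" if "(y - p) \<bullet> axis j s < - \<epsilon> * norm (y - p)"
      proof -
        have neg: "s * (y $ j - f) < 0" using that nn ip by simp
        have "b $ l < y $ l \<and> y $ l < b $ l + \<tau>" for l
        proof (cases "l = j")
          case True
          show ?thesis using s
          proof
            assume "s = 1" then show ?thesis using neg yj m True by (simp add: f_def face_coord_def)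
          next
            assume "s = -1" then show ?thesis using neg yj m True by (simp add: f_def face_coord_def)
          qed
        qed (rule ins)
        then have "y \<in> cell b" by (simp add: mem_box_cart)
        then show ?thesis using cell_subset[OF b] by blast
      qed
      show "y \<notin> \<Omega>" if "\<epsilon> * norm (y - p) < (y - p) \<bullet> axis j s"
        by (rule beyond_boundary_face[OF b s no ins]) (use that nn ip yj m in \<open>auto simp: f_def\<close>)
    qed
  qed
qed

text \<open>The width 6 \<delta> exceeds the radius 5 \<delta> of \<open>cutoff_deriv_0\<close>, so
  that the cube of that radius around a point of the cell that is near no face stays in the open
  cell.\<close>

definition near_face :: "real \<Rightarrow> real^'n \<Rightarrow> real^'n \<Rightarrow> 'n \<Rightarrow> bool" where
  "near_face \<delta> b x l \<longleftrightarrow> x $ l < b $ l + 6 * \<delta> \<or> b $ l + \<tau> - 6 * \<delta> < x $ l"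

text \<open>Far from all faces, or near a face shared with another cell, the cutoff is locally
  constant. Near a boundary face it varies with the normal coordinate j only; the j-th component of
  the field vanishes on the face and has slope at most 2 / \<tau>, so it is at most 12 \<delta> /
  \<tau>. Against the gradient bound 8 * 2^d / \<delta> the \<delta> cancels, which gives the
  constant.\<close>

lemma cutoff_grad_near_face:
  assumes adm: "admissible_coeffs A C" and \<delta>: "0 < \<delta>" "12 * \<delta> < \<tau>" "12 * \<delta> < gap_size"
    and b: "b \<in> corners" and x: "x \<in> cell b"
    and one: "\<And>i l. near_face \<delta> b x i \<Longrightarrow> near_face \<delta> b x l \<Longrightarrow> i = l"
  shows "\<bar>frechet_derivative (cutoff \<delta>) (at x) (rt_field A C x)\<bar> \<le> 12 * (8 * 2 ^ CARD('n)) / \<tau>"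
proof (cases "\<exists>j. near_face \<delta> b x j")
  case False
  have "cbox (x - vec (5 * \<delta>)) (x + vec (5 * \<delta>)) \<subseteq> cell b"
  proof
    fix z assume "z \<in> cbox (x - vec (5 * \<delta>)) (x + vec (5 * \<delta>))"
    then have zl: "\<bar>z $ l - x $ l\<bar> \<le> 5 * \<delta>" for l unfolding mem_cube_around by blast
    have "b $ l < z $ l \<and> z $ l < b $ l + \<tau>" for l
      using zl[of l] False \<delta>(1) unfolding near_face_def by (smt (verit))
    then show "z \<in> cell b" by (simp add: mem_box_cart)
  qed
  then have "frechet_derivative (cutoff \<delta>) (at x) (rt_field A C x) = 0"
    using cell_subset[OF b] by (intro cutoff_deriv_0[OF \<delta>(1)]) blast
  then show ?thesis using size_pos by simp
next
  case True
  then obtain j where j: "near_face \<delta> b x j" by blast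
  have xl: "b $ l < x $ l" "x $ l < b $ l + \<tau>" for l using x by (auto simp: mem_box_cart)
  have far: "b $ l + 6 * \<delta> \<le> x $ l \<and> x $ l \<le> b $ l + \<tau> - 6 * \<delta>" if "l \<noteq> j" for l
  proof -
    have "\<not> near_face \<delta> b x l" using one[OF j] that by blast
    then show ?thesis unfolding near_face_def by (simp add: not_less)
  qed
  \<comment> \<open>The side on which x is near the face: -1 for the lower, 1 for the upper one. In
    both cases the sign makes \<open>s * (x $ j - f)\<close> negative inside the cell.\<close>
  define s :: real where "s = (if x $ j < b $ j + 6 * \<delta> then -1 else 1)"
  have s: "s = 1 \<or> s = -1" by (auto simp: s_def)
  define f where "f = face_coord b j s"
  have xf: "s * (x $ j - f) < 0" "\<bar>x $ j - f\<bar> < 6 * \<delta>"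
    using j xl[of j] by (auto simp: s_def f_def face_coord_def near_face_def split: if_splits)
  have xf': "- 6 * \<delta> < s * (x $ j - f)" using xf(2) s by auto
  show ?thesis
  proof (cases "b + axis j (s * \<tau>) \<in> corners")
    case True
    define a where "a = (if s = 1 then b + axis j \<tau> else b)"
    have a: "a \<in> corners" "a - axis j \<tau> \<in> corners"
    proof -
      have "b + axis j (- \<tau>) = b - axis j \<tau>" by (auto simp: vec_eq_iff axis_def)
      then show "a \<in> corners" "a - axis j \<tau> \<in> corners" using s True b unfolding a_def by auto
    qed
    have "cbox (x - vec (5 * \<delta>)) (x + vec (5 * \<delta>)) \<subseteq> box (a - axis j \<tau>) (a + vec \<tau>)"
    proof
      fix z assume "z \<in> cbox (x - vec (5 * \<delta>)) (x + vec (5 * \<delta>))"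
      then have zl: "\<bar>z $ l - x $ l\<bar> \<le> 5 * \<delta>" for l unfolding mem_cube_around by blast
      show "z \<in> box (a - axis j \<tau>) (a + vec \<tau>)" unfolding mem_box_cart
      proof
        fix l
        show "(a - axis j \<tau>) $ l < z $ l \<and> z $ l < (a + vec \<tau>) $ l"
        proof (cases "l = j")
          case l: True
          show ?thesis using s
          proof
            assume "s = 1"
            then show ?thesis using l zl[of j] xf xl[of j] \<delta> by (simp add: a_def f_def face_coord_def axis_def) (smt (verit))
          next
            assume "s = -1"
            then show ?thesis using l zl[of j] xf xl[of j] \<delta> by (simp add: a_def f_def face_coord_def axis_def) (smt (verit))
          qed
        next
          case False
          then show ?thesis using zl[of l] far[OF False] \<delta>(1) by (auto simp: a_def axis_def)
        qed
      qed
    qed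
    then have "frechet_derivative (cutoff \<delta>) (at x) (rt_field A C x) = 0"
      using double_cell_subset[OF a] by (intro cutoff_deriv_0[OF \<delta>(1)]) blast
    then show ?thesis using size_pos by simp
  next
    case no: False
    \<comment> \<open>Near x the set \<open>inner_set\<close> is a half-space bounded by the plane
      at depth 3 \<delta> behind the face. The depths of x, y and z add up to at most (6 + 2 + 3)
      \<delta>, which is below 12 \<delta> < \<tau>, so the opposite face is not reached.\<close>
    have inner_iff: "y \<in> inner_set \<delta> \<longleftrightarrow> s * (y $ j - f) < - 3 * \<delta>"
      if y: "y \<in> cbox (x - vec (2 * \<delta>)) (x + vec (2 * \<delta>))" for y
    proof -
      have yl: "\<bar>y $ l - x $ l\<bar> \<le> 2 * \<delta>" for l using y unfolding mem_cube_around by blast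
      have sy: "\<bar>s * (y $ j - f) - s * (x $ j - f)\<bar> \<le> 2 * \<delta>"
        using yl[of j] s by auto
      show ?thesis
      proof
        assume lt: "s * (y $ j - f) < - 3 * \<delta>"
        have "z \<in> \<Omega>" if z: "z \<in> cbox (y - vec (3 * \<delta>)) (y + vec (3 * \<delta>))" for z
        proof -
          have zl: "\<bar>z $ l - y $ l\<bar> \<le> 3 * \<delta>" for l using z unfolding mem_cube_around by blast
          have sz: "\<bar>s * (z $ j - f) - s * (y $ j - f)\<bar> \<le> 3 * \<delta>" using zl[of j] s by auto
          have "b $ l < z $ l \<and> z $ l < b $ l + \<tau>" for l
          proof (cases "l = j")
            case True
            have "s * (z $ j - f) < 0" "- 12 * \<delta> < s * (z $ j - f)" using sz sy lt xf' \<delta>(1) by linarith+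
            then show ?thesis using s True \<delta>(2) by (auto simp: f_def face_coord_def)
          next
            case False
            then show ?thesis using zl[of l] yl[of l] far[OF False] \<delta>(1) by linarith
          qed
          then have "z \<in> cell b" by (simp add: mem_box_cart)
          then show ?thesis using cell_subset[OF b] by blast
        qed
        then show "y \<in> inner_set \<delta>" by (auto simp: inner_set_def)
      next
        assume yi: "y \<in> inner_set \<delta>"
        show "s * (y $ j - f) < - 3 * \<delta>"
        proof (rule ccontr)
          assume ge: "\<not> ?thesis"
          define z where "z = y + axis j (3 * \<delta> * s)"
          have zl: "z $ l = (if l = j then y $ j + 3 * \<delta> * s else y $ l)" for l by (simp add: z_def axis_def)
          have "z \<in> cbox (y - vec (3 * \<delta>)) (y + vec (3 * \<delta>))"
            unfolding mem_cube_around using zl \<delta>(1) s by (auto simp: abs_mult)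
          then have "z \<in> \<Omega>" using yi by (auto simp: inner_set_def)
          moreover have "z \<notin> \<Omega>"
          proof (rule beyond_boundary_face[OF b s no])
            show "b $ l < z $ l \<and> z $ l < b $ l + \<tau>" if "l \<noteq> j" for l
              using zl[of l] yl[of l] far[OF that] that \<delta>(1) by auto
            have e: "s * (z $ j - f) = s * (y $ j - f) + 3 * \<delta>" using zl[of j] s by auto
            then show "0 \<le> s * (z $ j - face_coord b j s)" using ge unfolding f_def by linarith
            have "s * (z $ j - f) < 6 * \<delta>" "0 \<le> s * (z $ j - f)" using e ge sy xf(1) \<delta>(1) by linarith+
            then show "\<bar>z $ j - face_coord b j s\<bar> < gap_size" using s \<delta> unfolding f_def by auto
          qed
          ultimately show False by blast
        qed
      qed
    qed
    have flat: "frechet_derivative (cutoff \<delta>) (at x) (axis k 1) = 0" if "k \<noteq> j" for k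
    proof (rule cutoff_flat[OF \<delta>(1)])
      fix y y' assume "y \<in> cbox (x - vec (2 * \<delta>)) (x + vec (2 * \<delta>))" "y' \<in> cbox (x - vec (2 * \<delta>)) (x + vec (2 * \<delta>))"
        and "\<And>l. l \<noteq> k \<Longrightarrow> y $ l = y' $ l"
      then show "y \<in> inner_set \<delta> \<longleftrightarrow> y' \<in> inner_set \<delta>" using inner_iff that by simp
    qed
    have xjB: "\<bar>rt_field A C x $ j\<bar> \<le> 2 / \<tau> * (6 * \<delta>)"
    proof -
      \<comment> \<open>The projection of x to the boundary face, where the normal component of the
        polynomial is zero.\<close>
      define p where "p = (\<chi> l. if l = j then f else x $ l)"
      have pin: "\<And>l. l \<noteq> j \<Longrightarrow> b $ l < p $ l \<and> p $ l < b $ l + \<tau>" using xl by (simp add: p_def)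
      have pj: "p $ j = face_coord b j s" by (simp add: p_def f_def)
      have "rt0_map (A b) (C b) p \<bullet> axis j s = 0"
        using adm b boundary_face_normal[OF b s no pin pj] unfolding admissible_coeffs_def by blast
      then have "A b $ j + C b $ j * f = 0" using s pj by (auto simp: inner_axis rt0_map_def f_def)
      then have "rt_field A C x $ j = C b $ j * (x $ j - f)"
        unfolding rt_field_cell[OF b x] by (simp add: rt0_map_def algebra_simps)
      then show ?thesis
        using mult_mono[OF coeff_bound[OF adm b, of j], of "\<bar>x $ j - f\<bar>" "6 * \<delta>"] xf(2) size_pos by (simp add: abs_mult)
    qed
    have "frechet_derivative (cutoff \<delta>) (at x) (rt_field A C x)
      = (\<Sum>k\<in>UNIV. rt_field A C x $ k * frechet_derivative (cutoff \<delta>) (at x) (axis k 1))"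
      using C1c_deriv_expand[OF cutoff_C1c[OF \<delta>(1)], of x "rt_field A C x"] by simp
    also have "\<dots> = (\<Sum>k\<in>UNIV. if k = j then rt_field A C x $ j * frechet_derivative (cutoff \<delta>) (at x) (axis j 1) else 0)"
      by (rule sum.cong) (use flat in auto)
    finally have "\<bar>frechet_derivative (cutoff \<delta>) (at x) (rt_field A C x)\<bar>
      = \<bar>rt_field A C x $ j\<bar> * \<bar>frechet_derivative (cutoff \<delta>) (at x) (axis j 1)\<bar>" by (simp add: abs_mult)
    also have "\<dots> \<le> (2 / \<tau> * (6 * \<delta>)) * (8 * 2 ^ CARD('n) / \<delta> * 1)"
      using cutoff_grad_bound[OF \<delta>(1), of x "axis j 1"] size_pos \<delta>(1)
      by (intro mult_mono xjB) (auto simp: norm_axis_1)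
    also have "\<dots> = 12 * (8 * 2 ^ CARD('n)) / \<tau>" using \<delta>(1) by simp
    finally show ?thesis .
  qed
qed

end

section \<open>Uniform bounds, the limit of the cutoff, and the edges\<close>

context cubical_mesh
begin

lemma rt_field_le:
  assumes adm: "admissible_coeffs A C"
  shows "norm (rt_field A C x) \<le> 1"
proof (cases "\<exists>b\<in>corners. x \<in> cell b")
  case True
  then obtain b where b: "b \<in> corners" "x \<in> cell b" by blast
  then have "x \<in> cube b \<tau>" using box_subset_cube[of b \<tau>] by blast
  then show ?thesis using adm b unfolding rt_field_cell[OF b] admissible_coeffs_def by blast
next
  case False
  then have "rt_field A C x = 0" by (intro rt_field_outside) blast
  then show ?thesis by simp
qed

lemma rt_div_le:
  assumes adm: "admissible_coeffs A C"
  shows "\<bar>step_fun (\<lambda>b. \<Sum>i\<in>UNIV. C b $ i) x\<bar> \<le> 2 * real CARD('n) / \<tau>"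
proof (cases "\<exists>b\<in>corners. x \<in> cell b")
  case True
  then obtain b where b: "b \<in> corners" "x \<in> cell b" by blast
  have "\<bar>\<Sum>i\<in>UNIV. C b $ i\<bar> \<le> (\<Sum>i\<in>(UNIV::'n set). 2 / \<tau>)"
    by (rule order_trans[OF sum_abs]) (intro sum_mono coeff_bound[OF adm b(1)])
  then show ?thesis using step_fun_cell[OF b] by (simp add: mult.commute)
next
  case False
  then have "step_fun (\<lambda>b. \<Sum>i\<in>UNIV. C b $ i) x = 0"
    unfolding step_fun_def by (intro sum.neutral) auto
  then show ?thesis using size_pos by simp
qed

lemma deriv_rt_field_measurable:
  assumes \<psi>: "\<psi> \<in> C1c U"
  shows "(\<lambda>x. frechet_derivative \<psi> (at x) (rt_field A C x) :: real) \<in> borel_measurable borel"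
proof -
  have [measurable]: "(\<lambda>x. rt_field A C x $ i) \<in> borel_measurable borel" for i
    by (rule measurable_compose[OF rt_field_measurable, where g="\<lambda>x. x $ i"])
      (intro borel_measurable_continuous_onI continuous_intros)
  have [measurable]: "(\<lambda>x. frechet_derivative \<psi> (at x) (axis i 1)) \<in> borel_measurable borel" for i
    by (rule C1c_deriv_measurable[OF \<psi>])
  have "(\<lambda>x. frechet_derivative \<psi> (at x) (rt_field A C x))
    = (\<lambda>x. \<Sum>i\<in>UNIV. rt_field A C x $ i *\<^sub>R frechet_derivative \<psi> (at x) (axis i 1))"
    by (rule ext) (rule C1c_deriv_expand[OF \<psi>])
  also have "\<dots> \<in> borel_measurable borel" by measurable
  finally show ?thesis .
qed

lemma small_box_subset:
  assumes "x \<in> \<Omega>"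
  obtains r where "0 < r" "\<And>\<delta>. 0 < \<delta> \<Longrightarrow> \<delta> < r \<Longrightarrow> cbox (x - vec (5 * \<delta>)) (x + vec (5 * \<delta>)) \<subseteq> \<Omega>"
proof -
  obtain e where e: "0 < e" "ball x e \<subseteq> \<Omega>" using open_domain open_contains_ball assms by blast
  define c where "c = sqrt (real CARD('n)) * 5 + 1"
  have c: "0 < c" unfolding c_def by (simp add: add_nonneg_pos)
  show ?thesis
  proof
    show "0 < e / c" using e c by simp
    fix \<delta> assume \<delta>: "0 < \<delta>" "\<delta> < e / c"
    show "cbox (x - vec (5 * \<delta>)) (x + vec (5 * \<delta>)) \<subseteq> \<Omega>"
    proof
      fix z assume z: "z \<in> cbox (x - vec (5 * \<delta>)) (x + vec (5 * \<delta>))"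
      have "norm (z - x) \<le> sqrt (real CARD('n)) * (5 * \<delta>)"
        by (rule norm_le_sqrt_card) (use z \<delta> in \<open>auto simp: mem_cube_around\<close>)
      also have "\<dots> < \<delta> * c" using \<delta> by (simp add: c_def algebra_simps)
      also have "\<dots> < e" using \<delta> c by (simp add: pos_less_divide_eq)
      finally show "z \<in> \<Omega>" using e(2) by (auto simp: dist_norm norm_minus_commute)
    qed
  qed
qed

text \<open>At a fixed point of \<Omega> both sequences are eventually constant, since small cubes
  around it lie in \<Omega>.\<close>

lemma cutoff_tendsto:
  assumes d: "d \<longlonglongrightarrow> 0" "\<And>n. 0 < d n"
  shows "x \<in> \<Omega> \<Longrightarrow> (\<lambda>n. cutoff (d n) x) \<longlonglongrightarrow> 1"
    and "x \<in> \<Omega> \<Longrightarrow> (\<lambda>n. frechet_derivative (cutoff (d n)) (at x) v) \<longlonglongrightarrow> 0"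
proof -
  assume "x \<in> \<Omega>"
  then obtain r where r: "0 < r" "\<And>\<delta>. 0 < \<delta> \<Longrightarrow> \<delta> < r \<Longrightarrow> cbox (x - vec (5 * \<delta>)) (x + vec (5 * \<delta>)) \<subseteq> \<Omega>"
    using small_box_subset by blast
  have ev: "\<forall>\<^sub>F n in sequentially. d n < r" using order_tendstoD(2)[OF d(1) r(1)] .
  have "\<forall>\<^sub>F n in sequentially. 1 = cutoff (d n) x"
    using ev
  proof (rule eventually_mono)
    fix n assume n: "d n < r"
    have "cbox (x - vec (4 * d n)) (x + vec (4 * d n)) \<subseteq> cbox (x - vec (5 * d n)) (x + vec (5 * d n))"
    proof
      fix z assume "z \<in> cbox (x - vec (4 * d n)) (x + vec (4 * d n))"
      then have z: "\<bar>z $ l - x $ l\<bar> \<le> 4 * d n" for l unfolding mem_cube_around by blast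
      have "\<bar>z $ l - x $ l\<bar> \<le> 5 * d n" for l using z[of l] d(2)[of n] by linarith
      then show "z \<in> cbox (x - vec (5 * d n)) (x + vec (5 * d n))" unfolding mem_cube_around by blast
    qed
    then have "cbox (x - vec (4 * d n)) (x + vec (4 * d n)) \<subseteq> \<Omega>" using r(2)[OF d(2) n] by (rule order_trans)
    then show "1 = cutoff (d n) x" using cutoff_eq_1[OF d(2)] by simp
  qed
  then show "(\<lambda>n. cutoff (d n) x) \<longlonglongrightarrow> 1" by (rule Lim_transform_eventually[OF tendsto_const])
  have "\<forall>\<^sub>F n in sequentially. 0 = frechet_derivative (cutoff (d n)) (at x) v"
    using ev by (rule eventually_mono) (simp add: cutoff_deriv_0[OF d(2) r(2)[OF d(2)]])
  then show "(\<lambda>n. frechet_derivative (cutoff (d n)) (at x) v) \<longlonglongrightarrow> 0"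
    by (rule Lim_transform_eventually[OF tendsto_const])
qed

text \<open>Where \<open>near_face\<close> holds for two different axes, the estimate of \<open>cutoff_grad_near_face\<close> fails;
  these points lie in finitely many boxes of volume \<open>O(\<delta>\<^sup>2)\<close>.\<close>

definition edge_box :: "real \<Rightarrow> (real^'n) \<times> ('n \<times> 'n) \<times> real \<times> real \<Rightarrow> (real^'n) set" where
  "edge_box \<delta> = (\<lambda>(b, (j, l), p, q).
     cbox (\<chi> i. if i = j then b $ i + p - 6 * \<delta> else if i = l then b $ i + q - 6 * \<delta> else b $ i)
          (\<chi> i. if i = j then b $ i + p + 6 * \<delta> else if i = l then b $ i + q + 6 * \<delta> else b $ i + \<tau>))"

text \<open>The offsets 0 and \<tau> select the lower or upper face for each of the two axes. In
  dimension 1 there are no two different axes and the set is empty.\<close>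

definition edges :: "((real^'n) \<times> ('n \<times> 'n) \<times> real \<times> real) set" where
  "edges = corners \<times> {(j, l). j \<noteq> l} \<times> {0, \<tau>} \<times> {0, \<tau>}"

lemma finite_edges: "finite edges"
  unfolding edges_def using finite_corners by (intro finite_cartesian_product) auto

lemma edge_box_borel [measurable]: "edge_box \<delta> t \<in> sets borel"
  unfolding edge_box_def split_beta by simp

lemma bounded_edge_box: "bounded (edge_box \<delta> t)"
  unfolding edge_box_def split_beta by simp

lemma edge_box_content:
  assumes t: "t \<in> edges" and \<delta>: "0 < \<delta>"
  shows "measure lborel (edge_box \<delta> t) = (12 * \<delta>)\<^sup>2 * \<tau> ^ (CARD('n) - 2)"
proof -
  obtain b j l p q where tt: "t = (b, (j, l), p, q)" "j \<noteq> l" using t by (auto simp: edges_def)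
  define lo where "lo = (\<chi> i. if i = j then b $ i + p - 6 * \<delta> else if i = l then b $ i + q - 6 * \<delta> else b $ i)"
  define hi where "hi = (\<chi> i. if i = j then b $ i + p + 6 * \<delta> else if i = l then b $ i + q + 6 * \<delta> else b $ i + \<tau>)"
  have "lo \<in> cbox lo hi" using \<delta> size_pos by (auto simp: mem_box_cart lo_def hi_def)
  then have "measure lborel (cbox lo hi) = (\<Prod>i\<in>UNIV. hi $ i - lo $ i)" by (intro content_cbox_cart) blast
  also have "\<dots> = (hi $ j - lo $ j) * (\<Prod>i\<in>UNIV - {j}. hi $ i - lo $ i)" by (rule prod.remove) auto
  also have "(\<Prod>i\<in>UNIV - {j}. hi $ i - lo $ i) = (hi $ l - lo $ l) * (\<Prod>i\<in>UNIV - {j} - {l}. hi $ i - lo $ i)"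
    by (rule prod.remove) (use tt in auto)
  also have "(\<Prod>i\<in>UNIV - {j} - {l}. hi $ i - lo $ i) = (\<Prod>i\<in>UNIV - {j} - {l}. \<tau>)"
    by (rule prod.cong) (auto simp: lo_def hi_def)
  also have "\<dots> = \<tau> ^ (CARD('n) - 2)" using tt by (simp add: card_Diff_singleton numeral_2_eq_2)
  finally have "measure lborel (cbox lo hi) = (12 * \<delta>)\<^sup>2 * \<tau> ^ (CARD('n) - 2)"
    using tt by (simp add: lo_def hi_def power2_eq_square)
  moreover have "edge_box \<delta> t = cbox lo hi" unfolding tt(1) edge_box_def lo_def hi_def by simp
  ultimately show ?thesis by simp
qed

lemma two_near_faces:
  assumes b: "b \<in> corners" and x: "x \<in> cell b" and jl: "near_face \<delta> b x j" "near_face \<delta> b x l" "j \<noteq> l" and \<delta>: "0 < \<delta>"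
  shows "\<exists>t\<in>edges. x \<in> edge_box \<delta> t"
proof -
  define p where "p = (if x $ j < b $ j + 6 * \<delta> then 0 else \<tau>)"
  define q where "q = (if x $ l < b $ l + 6 * \<delta> then 0 else \<tau>)"
  have xi: "b $ i < x $ i" "x $ i < b $ i + \<tau>" for i using x by (auto simp: mem_box_cart)
  have "x \<in> edge_box \<delta> (b, (j, l), p, q)"
    unfolding edge_box_def prod.case mem_box_cart
  proof
    fix i
    show "(\<chi> i. if i = j then b $ i + p - 6 * \<delta> else if i = l then b $ i + q - 6 * \<delta> else b $ i) $ i \<le> x $ i \<and>
      x $ i \<le> (\<chi> i. if i = j then b $ i + p + 6 * \<delta> else if i = l then b $ i + q + 6 * \<delta> else b $ i + \<tau>) $ i"
      using xi[of i] xi[of j] xi[of l] jl \<delta> by (auto simp: near_face_def p_def q_def)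
  qed
  moreover have "(b, (j, l), p, q) \<in> edges" using b jl(3) by (auto simp: edges_def p_def q_def)
  ultimately show ?thesis by blast
qed

end

section \<open>Testing with Raviart-Thomas fields\<close>

context sampling
begin

text \<open>The product of cutoff and field is bounded with compact support, and the product rule
  gives its weak divergence. This is verified by inserting the function
  \<open>cutoff \<delta> y * mol e (x - y)\<close> of y into the weak identity of the field; the
  cutoff factor makes it an admissible test function for every x. Then
  \<open>weak_divergence_le\<close> applies.\<close>

lemma cutoff_variation_le:
  assumes adm: "admissible_coeffs A C" and \<delta>: "0 < \<delta>"
    and weak: "\<And>\<psi>. \<psi> \<in> C1c \<Omega> \<Longrightarrow> (LINT x|lborel. rt_field A C x \<bullet> gradient \<psi> x)
      = - (LINT x|lborel. step_fun D x * \<psi> x)"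
  shows "(LINT x|lborel. u x * (cutoff \<delta> x * step_fun D x + frechet_derivative (cutoff \<delta>) (at x) (rt_field A C x))) \<le> T"
proof -
  define F where "F x = frechet_derivative (cutoff \<delta>) (at x) (rt_field A C x)" for x
  define c where "c = 8 * 2 ^ CARD('n) / \<delta>"
  define S where "S = (\<Sum>b\<in>corners. \<bar>D b\<bar>)"
  have c0: "0 \<le> c" unfolding c_def using \<delta> by simp
  have \<chi>: "cutoff \<delta> \<in> C1c \<Omega>" by (rule cutoff_C1c[OF \<delta>])
  have [measurable]: "cutoff \<delta> \<in> borel_measurable borel" by (rule C1c_measurable[OF \<chi>])
  have [measurable]: "F \<in> borel_measurable borel"
    unfolding F_def[abs_def] by (rule deriv_rt_field_measurable[OF \<chi>])
  have F: "\<bar>F x\<bar> \<le> c" for x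
  proof -
    have "\<bar>F x\<bar> \<le> c * norm (rt_field A C x)" unfolding F_def c_def by (rule cutoff_grad_bound[OF \<delta>])
    also have "\<dots> \<le> c * 1" by (rule mult_left_mono[OF rt_field_le[OF adm] c0])
    finally show ?thesis by simp
  qed
  obtain K where K: "compact K" "K \<subseteq> \<Omega>" "\<And>x. x \<notin> K \<Longrightarrow> cutoff \<delta> x = 0"
    "\<And>x v. x \<notin> K \<Longrightarrow> frechet_derivative (cutoff \<delta>) (at x) v = 0" using C1c_support[OF \<chi>] by metis
  have bK: "bounded K" using compact_imp_bounded K(1) by blast
  define G where "G x = cutoff \<delta> x * step_fun D x + F x" for x
  have "(LINT x|lborel. u x * G x) \<le> T"
  proof (rule weak_divergence_le[where \<Phi>="\<lambda>x. cutoff \<delta> x *\<^sub>R rt_field A C x" and C="S + c" and K=K])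
    show "(\<lambda>x. cutoff \<delta> x *\<^sub>R rt_field A C x) \<in> borel_measurable borel" by measurable
    show "G \<in> borel_measurable borel" unfolding G_def by measurable
    show "norm (cutoff \<delta> x *\<^sub>R rt_field A C x) \<le> 1" for x
      using mult_le_one[OF cutoff_le_1[OF \<delta>, of x] norm_ge_zero rt_field_le[OF adm, of x]] by simp
    show "\<bar>G x\<bar> \<le> S + c" for x
    proof -
      have "\<bar>cutoff \<delta> x * step_fun D x\<bar> \<le> 1 * S"
        unfolding abs_mult S_def by (rule mult_mono[OF cutoff_le_1[OF \<delta>] step_fun_bound]) auto
      then show ?thesis unfolding G_def using F[of x] by linarith
    qed
    show "cutoff \<delta> x *\<^sub>R rt_field A C x = 0" "G x = 0" if "x \<notin> K" for x
      using K(3,4)[OF that] by (simp_all add: G_def F_def)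
    fix e :: real and x :: "real^'n" assume e: "0 < e"
    obtain B where B: "0 \<le> B" "\<And>x::real^'n. mol e x \<le> B" "\<And>x::real^'n. norm (mol_grad e x) \<le> B"
      using mol_bounds[OF e, where 'a="real^'n"] by metis
    have md: "((\<lambda>y. mol e (x - y)) has_derivative (\<lambda>v. - (mol_grad e (x - y) \<bullet> v))) (at y)" for y
    proof -
      have g: "((\<lambda>y. x - y) has_derivative (\<lambda>v. - v)) (at y)" by (auto intro!: derivative_eq_intros)
      from has_derivative_compose[OF g mol_has_derivative[OF e]] show ?thesis by simp
    qed
    define \<psi> where "\<psi> y = cutoff \<delta> y * mol e (x - y)" for y
    have mc: "continuous_on UNIV (\<lambda>y. - (mol_grad e (x - y) \<bullet> v))" for v
      by (intro continuous_intros continuous_on_compose2[OF mol_continuous(2)[of UNIV]]) auto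
    have \<psi>: "\<psi> \<in> C1c \<Omega>" "frechet_derivative \<psi> (at y) v
      = frechet_derivative (cutoff \<delta>) (at y) v * mol e (x - y) + cutoff \<delta> y * (- (mol_grad e (x - y) \<bullet> v))" for y v
      unfolding \<psi>_def by (rule C1c_mult[OF \<chi> md mc])+
    have i1: "integrable lborel (\<lambda>y. mol e (x - y) * F y)"
    proof (rule integrable_lborel_bounded_support[where B="B * c", OF _ _ bK])
      show "norm (mol e (x - y) * F y) \<le> B * c" for y
        unfolding real_norm_def abs_mult by (rule mult_mono[OF mol_abs_bound[OF e B(2)] F B(1)]) simp
      show "(\<lambda>y. mol e (x - y) * F y) \<in> borel_measurable borel" by measurable
      show "mol e (x - y) * F y = 0" if "y \<notin> K" for y using K(4)[OF that] by (simp add: F_def)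
    qed
    have i2: "integrable lborel (\<lambda>y. mol_grad e (x - y) \<bullet> (cutoff \<delta> y *\<^sub>R rt_field A C y))"
    proof (rule integrable_lborel_bounded_support[where B="B", OF _ _ bK])
      fix y
      have "norm (cutoff \<delta> y *\<^sub>R rt_field A C y) \<le> 1"
        using mult_le_one[OF cutoff_le_1[OF \<delta>, of y] norm_ge_zero rt_field_le[OF adm, of y]] by simp
      then show "norm (mol_grad e (x - y) \<bullet> (cutoff \<delta> y *\<^sub>R rt_field A C y)) \<le> B"
        using mol_grad_inner_bound[OF B(3), of "x - y" "cutoff \<delta> y *\<^sub>R rt_field A C y"]
          mult_left_mono[of "norm (cutoff \<delta> y *\<^sub>R rt_field A C y)" 1 B] B(1) by simp
    qed (use K(3) in auto)
    have i3: "integrable lborel (\<lambda>y. mol e (x - y) * (cutoff \<delta> y * step_fun D y))"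
    proof (rule integrable_lborel_bounded_support[where B="B * (1 * S)", OF _ _ bK])
      show "norm (mol e (x - y) * (cutoff \<delta> y * step_fun D y)) \<le> B * (1 * S)" for y
        unfolding real_norm_def abs_mult S_def
        by (intro mult_mono mol_abs_bound[OF e B(2)] cutoff_le_1[OF \<delta>] step_fun_bound B(1)) auto
    qed (use K(3) in auto)
    have eq: "rt_field A C y \<bullet> gradient \<psi> y = mol e (x - y) * F y - mol_grad e (x - y) \<bullet> (cutoff \<delta> y *\<^sub>R rt_field A C y)" for y
      unfolding inner_gradient[OF \<psi>(1)] \<psi>(2) by (simp add: F_def)
    have "(LINT y|lborel. rt_field A C y \<bullet> gradient \<psi> y)
      = (LINT y|lborel. mol e (x - y) * F y) - (LINT y|lborel. mol_grad e (x - y) \<bullet> (cutoff \<delta> y *\<^sub>R rt_field A C y))"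
      unfolding eq by (rule Bochner_Integration.integral_diff[OF i1 i2])
    moreover have "(LINT y|lborel. step_fun D y * \<psi> y) = (LINT y|lborel. mol e (x - y) * (cutoff \<delta> y * step_fun D y))"
      by (simp add: \<psi>_def ac_simps)
    ultimately have "(LINT y|lborel. mol_grad e (x - y) \<bullet> (cutoff \<delta> y *\<^sub>R rt_field A C y))
      = (LINT y|lborel. mol e (x - y) * (cutoff \<delta> y * step_fun D y)) + (LINT y|lborel. mol e (x - y) * F y)"
      using weak[OF \<psi>(1)] by simp
    also have "\<dots> = (LINT y|lborel. mol e (x - y) * G y)"
      unfolding G_def distrib_left by (rule Bochner_Integration.integral_add[OF i3 i1, symmetric])
    finally show "(LINT y|lborel. mol_grad e (x - y) \<bullet> (cutoff \<delta> y *\<^sub>R rt_field A C y)) = (LINT y|lborel. mol e (x - y) * G y)" .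
  qed (use K in auto)
  then show ?thesis unfolding G_def F_def .
qed

text \<open>The extra term F can be of order 1 / \<delta> near edges, whose boxes have volume of
  order \<delta>^2; elsewhere it is bounded by c1, and at every point it tends to 0. The two effects
  are separated by bounding the modulus of F by P + (c0 / \<delta>) E: dominated convergence handles
  P, an explicit integral handles E.\<close>

lemma rt_pairing_le:
  assumes adm: "admissible_coeffs A C"
    and weak: "\<And>\<psi>. \<psi> \<in> C1c \<Omega> \<Longrightarrow> (LINT x|lborel. rt_field A C x \<bullet> gradient \<psi> x)
      = - (LINT x|lborel. step_fun D x * \<psi> x)"
  shows "(LINT x|lborel. u x * step_fun D x) \<le> T"
proof -
  define c0 where "c0 = 8 * (2::real) ^ CARD('n)"
  define c1 where "c1 = 12 * c0 / \<tau>"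
  have c: "0 \<le> c0" "0 \<le> c1" using size_pos by (auto simp: c0_def c1_def)
  define F where "F \<delta> x = frechet_derivative (cutoff \<delta>) (at x) (rt_field A C x)" for \<delta> x
  define m where "m = min \<tau> gap_size / 24"
  have m: "0 < m" "12 * m < \<tau>" "12 * m < gap_size" using size_pos gap_size(1) by (auto simp: m_def)
  define d where "d n = m * inverse (real (Suc n))" for n
  have d0: "d \<longlonglongrightarrow> 0"
  proof -
    have "(\<lambda>n. m * inverse (real (Suc n))) \<longlonglongrightarrow> m * 0" by (intro tendsto_mult_left LIMSEQ_inverse_real_of_nat)
    then show ?thesis by (simp add: d_def[abs_def])
  qed
  have dpos: "0 < d n" for n using m by (simp add: d_def)
  have dle: "d n \<le> m" for n
  proof -
    have "inverse (real (Suc n)) \<le> 1" by (simp add: field_simps)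
    then have "m * inverse (real (Suc n)) \<le> m * 1" using m(1) by (intro mult_left_mono) auto
    then show ?thesis by (simp add: d_def)
  qed
  have \<chi>: "cutoff (d n) \<in> C1c \<Omega>" for n by (rule cutoff_C1c[OF dpos])
  have [measurable]: "cutoff (d n) \<in> borel_measurable borel" for n by (rule C1c_measurable[OF \<chi>])
  have [measurable]: "F (d n) \<in> borel_measurable borel" for n
    unfolding F_def[abs_def] by (rule deriv_rt_field_measurable[OF \<chi>])
  have Fb: "\<bar>F (d n) x\<bar> \<le> c0 / d n" for n x
  proof -
    have "\<bar>F (d n) x\<bar> \<le> c0 / d n * norm (rt_field A C x)" unfolding F_def c0_def by (rule cutoff_grad_bound[OF dpos])
    also have "\<dots> \<le> c0 / d n * 1" using c dpos[of n] by (intro mult_left_mono[OF rt_field_le[OF adm]]) auto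
    finally show ?thesis by simp
  qed
  have Fz: "F \<delta> x = 0" if "0 < \<delta>" "x \<notin> \<Omega>" for \<delta> x
  proof -
    have "rt_field A C x = 0" using that(2) cell_subset by (intro rt_field_outside) blast
    then show ?thesis unfolding F_def
      using linear_0[OF has_derivative_linear[OF C1c_has_derivative[OF cutoff_C1c[OF that(1)]]]] by simp
  qed
  define E where "E n x = (\<Sum>t\<in>edges. indicator (edge_box (d n) t) x :: real)" for n x
  have [measurable]: "E n \<in> borel_measurable borel" for n unfolding E_def by measurable
  have En: "0 \<le> E n x" for n x unfolding E_def by (simp add: sum_nonneg)
  have iE: "integrable lborel (E n)" for n
    unfolding E_def using integrable_indicator_bounded[OF bounded_edge_box edge_box_borel, of 1]
    by (intro Bochner_Integration.integrable_sum) simp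
  have intE: "(LINT x|lborel. E n x) = real (card edges) * ((12 * d n)\<^sup>2 * \<tau> ^ (CARD('n) - 2))" for n
  proof -
    have "(LINT x|lborel. E n x) = (\<Sum>t\<in>edges. LINT x|lborel. indicator (edge_box (d n) t) x)"
      unfolding E_def using integrable_indicator_bounded[OF bounded_edge_box edge_box_borel, of 1]
      by (intro Bochner_Integration.integral_sum) simp
    also have "\<dots> = (\<Sum>t\<in>edges. measure lborel (edge_box (d n) t))" by simp
    also have "\<dots> = (\<Sum>t\<in>edges. (12 * d n)\<^sup>2 * \<tau> ^ (CARD('n) - 2))"
      by (intro sum.cong refl edge_box_content dpos)
    finally show ?thesis by simp
  qed
  \<comment> \<open>Truncation at c1 provides an integrable majorant that does not depend on n;
    almost everywhere it changes the modulus of F only in the edge boxes.\<close>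
  define P where "P n x = min c1 \<bar>F (d n) x\<bar>" for n x
  have [measurable]: "P n \<in> borel_measurable borel" for n unfolding P_def by measurable
  have Pdom: "\<bar>P n x\<bar> \<le> c1 * indicator \<Omega> x" for n x
    using c Fz[OF dpos, of x n] by (cases "x \<in> \<Omega>") (auto simp: P_def)
  have iP: "integrable lborel (P n)" for n
    by (rule integrable_lborel_bounded_support[where B=c1 and K=\<Omega>])
      (use Pdom c bounded_domain in \<open>auto simp: P_def Fz[OF dpos]\<close>)
  have split: "AE x in lborel. \<bar>F (d n) x\<bar> \<le> P n x + c0 / d n * E n x" for n
    using AE_cell
  proof eventually_elim
    case (elim x)
    have n0: "0 \<le> c0 / d n * E n x" using c dpos[of n] En by simp
    show ?case
    proof (cases "x \<in> \<Omega>")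
      case True
      then obtain b where b: "b \<in> corners" "x \<in> cell b" using elim by blast
      show ?thesis
      proof (cases "\<forall>i l. near_face (d n) b x i \<longrightarrow> near_face (d n) b x l \<longrightarrow> i = l")
        case one: True
        have "\<bar>F (d n) x\<bar> \<le> c1"
          unfolding F_def c1_def c0_def
          by (rule cutoff_grad_near_face[OF adm dpos _ _ b]) (use m dle[of n] one in auto)
        then show ?thesis using n0 by (simp add: P_def)
      next
        case False
        then obtain i l where il: "near_face (d n) b x i" "near_face (d n) b x l" "i \<noteq> l" by blast
        obtain t where t: "t \<in> edges" "x \<in> edge_box (d n) t" using two_near_faces[OF b il dpos] by blast
        have "1 \<le> E n x"
          unfolding E_def using member_le_sum[OF t(1), of "\<lambda>t. indicator (edge_box (d n) t) x :: real"] finite_edges t(2)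
          by simp
        then have "c0 / d n * 1 \<le> c0 / d n * E n x" using c dpos[of n] by (intro mult_left_mono) auto
        moreover have "0 \<le> P n x" using c by (simp add: P_def)
        ultimately show ?thesis using Fb[of n x] by linarith
      qed
    next
      case False
      then show ?thesis using Fz[OF dpos] n0 c by (simp add: P_def)
    qed
  qed
  have iuF: "integrable lborel (\<lambda>x. u x * F (d n) x)" for n by (rule u_mult_integrable[OF _ Fb]) simp
  have bound: "\<bar>LINT x|lborel. u x * F (d n) x\<bar> \<le> M * (LINT x|lborel. P n x)
      + M * (c0 * (real (card edges) * (144 * \<tau> ^ (CARD('n) - 2)))) * d n" for n
  proof -
    have "\<bar>LINT x|lborel. u x * F (d n) x\<bar> \<le> (LINT x|lborel. \<bar>u x * F (d n) x\<bar>)"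
      using integral_norm_bound[of lborel "\<lambda>x. u x * F (d n) x"] by simp
    also have "\<dots> \<le> (LINT x|lborel. M * (P n x + c0 / d n * E n x))"
    proof (rule integral_mono_AE)
      show "integrable lborel (\<lambda>x. \<bar>u x * F (d n) x\<bar>)" using iuF by auto
      show "integrable lborel (\<lambda>x. M * (P n x + c0 / d n * E n x))" using iP iE by auto
      show "AE x in lborel. \<bar>u x * F (d n) x\<bar> \<le> M * (P n x + c0 / d n * E n x)"
        using split[of n]
        by (rule eventually_mono) (auto simp: abs_mult intro!: mult_mono u_bound M_nonneg)
    qed
    also have "\<dots> = M * (LINT x|lborel. P n x) + M * (c0 / d n * (LINT x|lborel. E n x))"
      using iP iE by (simp add: distrib_left)
    also have "c0 / d n * (LINT x|lborel. E n x) = (c0 * (real (card edges) * (144 * \<tau> ^ (CARD('n) - 2)))) * d n"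
      unfolding intE using dpos[of n] by (simp add: power2_eq_square field_simps)
    finally show ?thesis by (simp add: mult.assoc)
  qed
  have Plim: "(\<lambda>n. LINT x|lborel. P n x) \<longlonglongrightarrow> (LINT x|(lborel :: (real^'n) measure). (0::real))"
  proof (rule integral_dominated_convergence[where w="\<lambda>x. c1 * indicator \<Omega> x"])
    show "integrable lborel (\<lambda>x. c1 * indicator \<Omega> x)"
      by (rule integrable_indicator_bounded[OF bounded_domain]) simp
    show "AE x in lborel. norm (P n x) \<le> c1 * indicator \<Omega> x" for n using Pdom by simp
    show "AE x in lborel. (\<lambda>n. P n x) \<longlonglongrightarrow> 0"
    proof (rule AE_I2)
      fix x
      show "(\<lambda>n. P n x) \<longlonglongrightarrow> 0"
      proof (cases "x \<in> \<Omega>")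
        case True
        have "(\<lambda>n. min c1 \<bar>F (d n) x\<bar>) \<longlonglongrightarrow> min c1 \<bar>0\<bar>"
          unfolding F_def by (intro tendsto_intros cutoff_tendsto(2)[OF d0 dpos True])
        then show ?thesis using c by (simp add: P_def)
      next
        case False
        then show ?thesis using Fz[OF dpos] c by (simp add: P_def)
      qed
    qed
  qed simp_all
  have uF: "(\<lambda>n. LINT x|lborel. u x * F (d n) x) \<longlonglongrightarrow> 0"
  proof (rule Lim_null_comparison)
    show "\<forall>\<^sub>F n in sequentially. norm (LINT x|lborel. u x * F (d n) x) \<le> M * (LINT x|lborel. P n x)
      + M * (c0 * (real (card edges) * (144 * \<tau> ^ (CARD('n) - 2)))) * d n"
      using bound by simp
    have "(\<lambda>n. M * (LINT x|lborel. P n x) + M * (c0 * (real (card edges) * (144 * \<tau> ^ (CARD('n) - 2)))) * d n)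
      \<longlonglongrightarrow> M * (LINT x|(lborel :: (real^'n) measure). (0::real)) + M * (c0 * (real (card edges) * (144 * \<tau> ^ (CARD('n) - 2)))) * 0"
      by (intro tendsto_intros Plim d0)
    then show "(\<lambda>n. M * (LINT x|lborel. P n x) + M * (c0 * (real (card edges) * (144 * \<tau> ^ (CARD('n) - 2)))) * d n) \<longlonglongrightarrow> 0"
      by simp
  qed
  define S where "S = (\<Sum>b\<in>corners. \<bar>D b\<bar>)"
  have ug: "(\<lambda>n. LINT x|lborel. u x * (cutoff (d n) x * step_fun D x)) \<longlonglongrightarrow> (LINT x|lborel. u x * step_fun D x)"
  proof (rule integral_dominated_convergence[where w="\<lambda>x. (M * (1 * S)) * indicator \<Omega> x"])
    show "integrable lborel (\<lambda>x. (M * (1 * S)) * indicator \<Omega> x)"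
      by (rule integrable_indicator_bounded[OF bounded_domain]) simp
    show "AE x in lborel. norm (u x * (cutoff (d n) x * step_fun D x)) \<le> (M * (1 * S)) * indicator \<Omega> x" for n
    proof (rule AE_I2)
      fix x
      have "\<bar>u x\<bar> * (\<bar>cutoff (d n) x\<bar> * \<bar>step_fun D x\<bar>) \<le> M * (1 * S)"
        unfolding S_def by (intro mult_mono u_bound cutoff_le_1[OF dpos] step_fun_bound M_nonneg) auto
      then show "norm (u x * (cutoff (d n) x * step_fun D x)) \<le> (M * (1 * S)) * indicator \<Omega> x"
        using u_zero[of x] by (cases "x \<in> \<Omega>") (auto simp: abs_mult)
    qed
    show "AE x in lborel. (\<lambda>n. u x * (cutoff (d n) x * step_fun D x)) \<longlonglongrightarrow> u x * step_fun D x"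
    proof (rule AE_I2)
      fix x
      show "(\<lambda>n. u x * (cutoff (d n) x * step_fun D x)) \<longlonglongrightarrow> u x * step_fun D x"
      proof (cases "x \<in> \<Omega>")
        case True
        have "(\<lambda>n. u x * (cutoff (d n) x * step_fun D x)) \<longlonglongrightarrow> u x * (1 * step_fun D x)"
          by (intro tendsto_intros cutoff_tendsto(1)[OF d0 dpos True])
        then show ?thesis by simp
      qed (simp add: u_zero)
    qed
  qed simp_all
  have iug: "integrable lborel (\<lambda>x. u x * (cutoff (d n) x * step_fun D x))" for n
  proof (rule u_mult_integrable)
    show "\<bar>cutoff (d n) x * step_fun D x\<bar> \<le> 1 * S" for x
      unfolding abs_mult S_def by (rule mult_mono[OF cutoff_le_1[OF dpos] step_fun_bound]) auto
  qed simp
  have "(LINT x|lborel. u x * (cutoff (d n) x * step_fun D x)) + (LINT x|lborel. u x * F (d n) x) \<le> T" for n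
    using cutoff_variation_le[OF adm dpos weak] iug iuF unfolding F_def by (simp add: distrib_left)
  moreover have "(\<lambda>n. (LINT x|lborel. u x * (cutoff (d n) x * step_fun D x)) + (LINT x|lborel. u x * F (d n) x))
    \<longlonglongrightarrow> (LINT x|lborel. u x * step_fun D x) + 0"
    by (rule tendsto_add[OF ug uF])
  ultimately have "(LINT x|lborel. u x * step_fun D x) + 0 \<le> T" by (intro LIMSEQ_le_const2) auto
  then show ?thesis by simp
qed

text \<open>Split v = u + (v - u): the pairing with u is at most T by \<open>rt_pairing_le\<close>,
  and the rest costs the divergence bound 2 d / \<tau> times the L1 distance. Here \<tau> is the
  size of the mesh that carries the Raviart-Thomas fields, in the application the size h of the TV
  mesh, so an L1 error o(h) is harmless.\<close>

lemma TVh_le: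
  assumes [measurable]: "v \<in> borel_measurable borel" and v: "\<And>x. \<bar>v x\<bar> \<le> B" "\<And>x. x \<notin> \<Omega> \<Longrightarrow> v x = 0"
  shows "TVh \<Omega> \<Q> v \<le> ereal (T + 2 * real CARD('n) / \<tau> * (LINT x|lborel. \<bar>v x - u x\<bar>))"
  unfolding TVh_def
proof (rule SUP_least, clarify)
  fix \<phi> assume \<phi>: "\<phi> \<in> RT0_0 \<Omega> \<Q>" "Linf_norm \<Omega> \<phi> \<le> 1"
  obtain A C where AC: "admissible_coeffs A C"
    and "AE x in lborel. x \<in> \<Omega> \<longrightarrow> \<phi> x = rt_field A C x"
    and AC': "AE x in lborel. x \<in> \<Omega> \<longrightarrow> weak_div \<Omega> \<phi> x = step_fun (\<lambda>b. \<Sum>i\<in>UNIV. C b $ i) x"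
    "weak_div \<Omega> \<phi> \<in> borel_measurable (lebesgue_on \<Omega>)"
    "\<And>\<psi>. \<psi> \<in> C1c \<Omega> \<Longrightarrow> (LINT x|lborel. rt_field A C x \<bullet> gradient \<psi> x)
      = - (LINT x|lborel. step_fun (\<lambda>b. \<Sum>i\<in>UNIV. C b $ i) x * \<psi> x)"
    by (rule rt_representation[OF \<phi>]) (rule that)
  define D where "D b = (\<Sum>i\<in>UNIV. C b $ i)" for b
  define k where "k = 2 * real CARD('n) / \<tau>"
  have gk: "\<bar>step_fun D x\<bar> \<le> k" for x unfolding D_def k_def by (rule rt_div_le[OF AC])
  have vm: "v \<in> borel_measurable (lebesgue_on \<Omega>)"
    by (intro measurable_restrict_space1 measurable_completion) simp
  have "(LINT x|lebesgue_on \<Omega>. v x * weak_div \<Omega> \<phi> x) = (LINT x|lborel. v x * step_fun D x)"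
  proof (rule integral_lebesgue_on_borel[OF open_domain])
    show "(\<lambda>x. v x * weak_div \<Omega> \<phi> x) \<in> borel_measurable (lebesgue_on \<Omega>)" using vm AC'(2) by measurable
    show "AE x in lborel. x \<in> \<Omega> \<longrightarrow> v x * weak_div \<Omega> \<phi> x = v x * step_fun D x"
      using AC'(1) unfolding D_def by eventually_elim auto
  qed (use v in auto)
  also have "\<dots> = (LINT x|lborel. u x * step_fun D x) + (LINT x|lborel. (v x - u x) * step_fun D x)"
  proof -
    have i1: "integrable lborel (\<lambda>x. u x * step_fun D x)" by (rule u_mult_integrable[OF _ gk]) simp
    have i2: "integrable lborel (\<lambda>x. v x * step_fun D x)"
    proof (rule integrable_lborel_bounded_support[where B="B * k" and K=\<Omega>])
      have "0 \<le> B" using v(1)[of undefined] by linarith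
      then show "norm (v x * step_fun D x) \<le> B * k" for x
        unfolding real_norm_def abs_mult by (intro mult_mono v(1) gk) auto
    qed (use v bounded_domain in auto)
    have "(LINT x|lborel. (v x - u x) * step_fun D x) = (LINT x|lborel. v x * step_fun D x) - (LINT x|lborel. u x * step_fun D x)"
      unfolding left_diff_distrib by (rule Bochner_Integration.integral_diff[OF i2 i1])
    then show ?thesis by simp
  qed
  also have "\<dots> \<le> T + k * (LINT x|lborel. \<bar>v x - u x\<bar>)"
  proof (rule add_mono)
    show "(LINT x|lborel. u x * step_fun D x) \<le> T"
      by (rule rt_pairing_le[OF AC]) (unfold D_def[abs_def], rule AC'(3))
    have iv: "integrable lborel v"
      by (rule integrable_lborel_bounded_support[where B=B and K=\<Omega>]) (use v bounded_domain in auto)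
    have id: "integrable lborel (\<lambda>x. v x - u x)" by (rule Bochner_Integration.integrable_diff[OF iv u_integrable])
    have "norm (LINT x|lborel. (v x - u x) * step_fun D x) \<le> (LINT x|lborel. k * \<bar>v x - u x\<bar>)"
    proof (rule lborel_norm_integral_le)
      show ik: "integrable lborel (\<lambda>x. k * \<bar>v x - u x\<bar>)" using id by auto
      have le: "norm ((v x - u x) * step_fun D x) \<le> k * \<bar>v x - u x\<bar>" for x
        using mult_left_mono[OF gk[of x], of "\<bar>v x - u x\<bar>"] by (simp add: abs_mult mult.commute)
      then show "norm ((v x - u x) * step_fun D x) \<le> k * \<bar>v x - u x\<bar>" for x .
      show "integrable lborel (\<lambda>x. (v x - u x) * step_fun D x)"
      proof (rule Bochner_Integration.integrable_bound[OF ik])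
        show "AE x in lborel. norm ((v x - u x) * step_fun D x) \<le> norm (k * \<bar>v x - u x\<bar>)"
          by (rule AE_I2) (rule order_trans[OF le], simp)
      qed measurable
    qed
    then show "(LINT x|lborel. (v x - u x) * step_fun D x) \<le> k * (LINT x|lborel. \<bar>v x - u x\<bar>)" by simp
  qed
  finally show "ereal (LINT x|lebesgue_on \<Omega>. v x * weak_div \<Omega> \<phi> x) \<le> ereal (T + 2 * real CARD('n) / \<tau> * (LINT x|lborel. \<bar>v x - u x\<bar>))"
    by (simp add: k_def)
qed

end

subsection \<open>Schoenberg's space-filling curve\<close>

text \<open>Schoenberg's even function of period 2: 0 on [0, 1/3], 1 on [2/3, 1] and linear in
  between. Written through the distance to the even integers it is visibly continuous and
  periodic.\<close>

definition zigzag :: "real \<Rightarrow> real" where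
  "zigzag t = max 0 (min 1 (3 * infdist t (range (\<lambda>k. 2 * real_of_int k)) - 1))"

lemma zigzag_continuous: "continuous_on S zigzag"
  unfolding zigzag_def by (intro continuous_intros)

lemma zigzag_bounds: "0 \<le> zigzag t" "zigzag t \<le> 1"
  by (auto simp: zigzag_def)

lemma zigzag_eq_0:
  assumes "0 \<le> r" "r \<le> 1/3"
  shows "zigzag (2 * real_of_int k + r) = 0"
proof -
  have "infdist (2 * real_of_int k + r) (range (\<lambda>k. 2 * real_of_int k)) \<le> dist (2 * real_of_int k + r) (2 * real_of_int k)"
    by (rule infdist_le) auto
  also have "\<dots> \<le> 1/3" using assms by (simp add: dist_real_def)
  finally show ?thesis by (simp add: zigzag_def)
qed

lemma zigzag_eq_1:
  assumes "2/3 \<le> r" "r \<le> 1"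
  shows "zigzag (2 * real_of_int k + r) = 1"
proof -
  have "2/3 \<le> infdist (2 * real_of_int k + r) (range (\<lambda>k. 2 * real_of_int k))"
  proof (rule infdist_ge)
    fix a assume "a \<in> range (\<lambda>k. 2 * real_of_int k)"
    then obtain l where l: "a = 2 * real_of_int l" by auto
    define j where "j = k - l"
    have d: "dist (2 * real_of_int k + r) a = \<bar>2 * real_of_int j + r\<bar>"
      by (simp add: l j_def dist_real_def algebra_simps)
    consider "j = 0" | "1 \<le> j" | "j \<le> -1" by linarith
    then show "2/3 \<le> dist (2 * real_of_int k + r) a"
    proof cases
      case 1 then show ?thesis using assms d by simp
    next
      case 2
      then have "1 \<le> real_of_int j" by simp
      then show ?thesis using assms d by simp
    next
      case 3
      then have "real_of_int j \<le> -1" by simp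
      then show ?thesis using assms d by simp
    qed
  qed auto
  then show ?thesis by (simp add: zigzag_def)
qed

text \<open>Multiplication by 3^n shifts the ternary expansion: the digits before position n
  contribute an even integer, digit 2 * b n contributes 0 or 2/3, and the tail r is at most 1/3. So
  \<open>3 ^ n * t\<close> lies, up to a multiple of the period, in the interval where
  \<open>zigzag\<close> takes the value b n.\<close>

lemma ternary_digit:
  fixes b :: "nat \<Rightarrow> real"
  assumes b: "\<And>m. b m = 0 \<or> b m = 1"
  defines "t \<equiv> \<Sum>m. 2 * b m / 3 ^ Suc m"
  shows "0 \<le> t" "t \<le> 1" "zigzag (3 ^ n * t) = b n"
proof -
  define f where "f m = 2 * b m / 3 ^ Suc m" for m
  have "(\<lambda>m. (2/3) * (1/3::real) ^ m) sums ((2/3) * (1 / (1 - 1/3)))"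
    by (intro sums_mult geometric_sums) simp
  then have g1: "(\<lambda>m. (2/3) * (1/3::real) ^ m) sums 1" by simp
  have fg: "0 \<le> f m" "f m \<le> (2/3) * (1/3) ^ m" for m
  proof -
    have "(1/3::real) ^ m = 1 / 3 ^ m" by (simp add: power_one_over)
    then show "0 \<le> f m" "f m \<le> (2/3) * (1/3) ^ m" using b[of m] by (auto simp: f_def)
  qed
  have sf: "summable f"
    by (rule summable_comparison_test[OF _ sums_summable[OF g1]]) (use fg in \<open>auto intro!: exI[of _ 0]\<close>)
  have t: "t = suminf f" by (simp add: t_def f_def[abs_def])
  show "0 \<le> t" unfolding t by (rule suminf_nonneg[OF sf fg(1)])
  have "suminf f \<le> suminf (\<lambda>m. (2/3) * (1/3::real) ^ m)" by (rule suminf_le[OF fg(2) sf sums_summable[OF g1]])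
  then show "t \<le> 1" unfolding t using sums_unique[OF g1] by simp
  define r where "r = (\<Sum>i. 2 * b (i + Suc n) / 3 ^ Suc (Suc i))"
  define h where "h i = 2 * b (i + Suc n) / 3 ^ Suc (Suc i)" for i
  have hg: "0 \<le> h i" "h i \<le> (1/3) * ((2/3) * (1/3) ^ i)" for i
  proof -
    have "(1/3::real) ^ i = 1 / 3 ^ i" by (simp add: power_one_over)
    then show "0 \<le> h i" "h i \<le> (1/3) * ((2/3) * (1/3) ^ i)" using b[of "i + Suc n"] by (auto simp: h_def)
  qed
  have sg: "(\<lambda>m. (1/3) * ((2/3) * (1/3::real) ^ m)) sums ((1/3) * 1)" by (rule sums_mult[OF g1])
  have sh: "summable h"
    by (rule summable_comparison_test[OF _ sums_summable[OF sg]]) (use hg in \<open>auto intro!: exI[of _ 0]\<close>)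
  have r: "0 \<le> r" "r \<le> 1/3"
  proof -
    have rh: "r = suminf h" by (simp add: r_def h_def[abs_def])
    show "0 \<le> r" unfolding rh by (rule suminf_nonneg[OF sh hg(1)])
    have "suminf h \<le> suminf (\<lambda>m. (1/3) * ((2/3) * (1/3::real) ^ m))" by (rule suminf_le[OF hg(2) sh sums_summable[OF sg]])
    then show "r \<le> 1/3" unfolding rh using sums_unique[OF sg] by simp
  qed
  have "3 ^ n * f (i + Suc n) = h i" for i by (simp add: f_def h_def power_add)
  then have "3 ^ n * (\<Sum>i. f (i + Suc n)) = suminf h"
    using suminf_mult[OF summable_ignore_initial_segment[OF sf, of "Suc n"], of "3 ^ n"] by simp
  moreover have "suminf f = (\<Sum>i. f (i + Suc n)) + sum f {..<Suc n}"
    by (rule suminf_split_initial_segment[OF sf])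
  ultimately have e1: "3 ^ n * t = r + 3 ^ n * sum f {..<n} + 3 ^ n * f n"
    by (simp add: t r_def h_def[abs_def] distrib_left)
  have e2: "3 ^ n * f n = 2 * b n / 3" by (simp add: f_def)
  have "\<exists>k::int. 3 ^ n * sum f {..<n} = 2 * real_of_int k"
  proof -
    have "3 ^ n * f m = 2 * real_of_int (\<lfloor>b m\<rfloor> * 3 ^ (n - Suc m))" if "m < n" for m
    proof -
      have "(3::real) ^ n = 3 ^ (n - Suc m) * 3 ^ Suc m"
        by (metis Suc_leI le_add_diff_inverse2 power_add that)
      then show ?thesis using b[of m] by (auto simp: f_def)
    qed
    then have "3 ^ n * sum f {..<n} = 2 * real_of_int (\<Sum>m<n. \<lfloor>b m\<rfloor> * 3 ^ (n - Suc m))"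
      by (simp add: sum_distrib_left)
    then show ?thesis by blast
  qed
  then obtain k :: int where e3: "3 ^ n * sum f {..<n} = 2 * real_of_int k" by blast
  have k: "3 ^ n * t = 2 * real_of_int k + (r + 2 * b n / 3)" using e1 e2 e3 by linarith
  show "zigzag (3 ^ n * t) = b n"
    using b[of n]
  proof
    assume "b n = 0"
    then show ?thesis unfolding k using r zigzag_eq_0[of r k] by simp
  next
    assume "b n = 1"
    then show ?thesis unfolding k using r zigzag_eq_1[of "r + 2/3" k] by simp
  qed
qed

text \<open>The digits are differences of the floors of 2^k y, so the partial sums telescope to the
  floor of 2^n y divided by 2^n. The condition y < 1 makes the first floor vanish.\<close>

lemma binary_expansion:
  fixes y :: real
  assumes "0 \<le> y" "y < 1"
  obtains c :: "nat \<Rightarrow> real" where "\<And>k. c k = 0 \<or> c k = 1" "(\<lambda>k. c k / 2 ^ Suc k) sums y"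
proof -
  define F where "F n = real_of_int \<lfloor>2 ^ n * y\<rfloor>" for n :: nat
  define c where "c k = F (Suc k) - 2 * F k" for k
  have "c k = 0 \<or> c k = 1" for k
  proof -
    define z where "z = 2 ^ k * y"
    have "2 * \<lfloor>z\<rfloor> \<le> \<lfloor>2 * z\<rfloor>" by (simp add: le_floor_iff)
    moreover have "\<lfloor>2 * z\<rfloor> < 2 * \<lfloor>z\<rfloor> + 2" unfolding floor_less_iff using real_of_int_floor_add_one_gt[of z]
      by (simp only: of_int_add of_int_mult of_int_numeral)
    ultimately have "\<lfloor>2 * z\<rfloor> = 2 * \<lfloor>z\<rfloor> \<or> \<lfloor>2 * z\<rfloor> = 2 * \<lfloor>z\<rfloor> + 1" by linarith
    then show ?thesis by (auto simp: c_def F_def z_def mult.assoc)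
  qed
  moreover have "(\<lambda>k. c k / 2 ^ Suc k) sums y"
    unfolding sums_def
  proof -
    have F0: "F 0 = 0" using assms by (simp add: F_def floor_eq_iff)
    have "(\<Sum>k<n. c k / 2 ^ Suc k) = F n / 2 ^ n" for n
      by (induction n) (auto simp: F0 c_def field_simps)
    moreover have "(\<lambda>n. F n / 2 ^ n) \<longlonglongrightarrow> y"
    proof -
      have "(\<lambda>n. F n / 2 ^ n - y) \<longlonglongrightarrow> 0"
      proof (rule Lim_null_comparison)
        show "\<forall>\<^sub>F n in sequentially. norm (F n / 2 ^ n - y) \<le> (1/2) ^ n"
        proof (rule always_eventually, rule allI)
          fix n
          have "F n \<le> 2 ^ n * y" "2 ^ n * y < F n + 1" unfolding F_def using floor_correct by auto
          then have "\<bar>F n - 2 ^ n * y\<bar> \<le> 1" by linarith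
          then have "\<bar>F n - 2 ^ n * y\<bar> / 2 ^ n \<le> 1 / 2 ^ n" by (simp add: divide_right_mono)
          moreover have "F n / 2 ^ n - y = (F n - 2 ^ n * y) / 2 ^ n" by (simp add: field_simps)
          then have "\<bar>F n - 2 ^ n * y\<bar> / 2 ^ n = \<bar>F n / 2 ^ n - y\<bar>" by simp
          ultimately show "norm (F n / 2 ^ n - y) \<le> (1/2) ^ n" by (simp add: power_one_over)
        qed
        show "(\<lambda>n. (1/2::real) ^ n) \<longlonglongrightarrow> 0" by (rule LIMSEQ_power_zero) simp
      qed
      from tendsto_add[OF this tendsto_const[of y]] show ?thesis by simp
    qed
    ultimately show "(\<lambda>n. \<Sum>k<n. c k / 2 ^ Suc k) \<longlonglongrightarrow> y" by simp
  qed
  ultimately show ?thesis using that by blast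
qed

text \<open>Coordinate i reads the ternary digits at the positions N k + \<iota> i through
  \<open>zigzag\<close> and uses them as binary digits. These positions are disjoint for different
  i, so the binary expansions of the coordinates of any point can be interleaved into one parameter
  t.\<close>

lemma space_filling_curve:
  obtains S :: "real \<Rightarrow> real^'n" where "continuous_on UNIV S"
    "\<forall>x. (\<forall>i. 0 \<le> x $ i \<and> x $ i < 1) \<longrightarrow> x \<in> S ` {0..1}"
proof -
  define N where "N = CARD('n)"
  have N0: "0 < N" unfolding N_def by simp
  obtain \<iota> :: "'n \<Rightarrow> nat" where \<iota>: "bij_betw \<iota> UNIV {0..<N}"
    using ex_bij_betw_finite_nat[of "UNIV :: 'n set"] unfolding N_def by auto
  define S :: "real \<Rightarrow> real^'n" where "S t = (\<chi> i. \<Sum>k. zigzag (3 ^ (N * k + \<iota> i) * t) / 2 ^ Suc k)" for t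
  have halves: "(\<lambda>k. 1 / 2 ^ Suc k :: real) sums 1" by (rule power_half_series[unfolded power_one_over])
  have "continuous_on UNIV S"
    unfolding S_def
  proof (rule continuous_on_vec_lambda)
    fix i
    have "uniform_limit UNIV (\<lambda>n t. \<Sum>k<n. zigzag (3 ^ (N * k + \<iota> i) * t) / 2 ^ Suc k)
      (\<lambda>t. \<Sum>k. zigzag (3 ^ (N * k + \<iota> i) * t) / 2 ^ Suc k) sequentially"
      by (rule Weierstrass_m_test[OF _ sums_summable[OF halves]])
        (use zigzag_bounds in \<open>auto intro!: divide_right_mono\<close>)
    then show "continuous_on UNIV (\<lambda>t. \<Sum>k. zigzag (3 ^ (N * k + \<iota> i) * t) / 2 ^ Suc k)"
      by (rule uniform_limit_theorem[rotated])
        (auto intro!: always_eventually continuous_intros continuous_on_compose2[OF zigzag_continuous[of UNIV]])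
  qed
  moreover have "x \<in> S ` {0..1}" if x: "\<And>i. 0 \<le> x $ i \<and> x $ i < 1" for x
  proof -
    have "\<forall>i. \<exists>c. (\<forall>k::nat. c k = (0::real) \<or> c k = 1) \<and> (\<lambda>k. c k / 2 ^ Suc k) sums (x $ i)"
      using binary_expansion x by metis
    from choice[OF this] obtain c where "\<forall>i. (\<forall>k::nat. c i k = (0::real) \<or> c i k = 1) \<and> (\<lambda>k. c i k / 2 ^ Suc k) sums (x $ i)"
      by (rule exE)
    then have c: "\<And>i k. c i k = 0 \<or> c i k = 1" "\<And>i. (\<lambda>k. c i k / 2 ^ Suc k) sums (x $ i)" by auto
    \<comment> \<open>Position m belongs to the coordinate with index m mod N and holds its digit
      number m div N.\<close>
    define b where "b m = c (inv \<iota> (m mod N)) (m div N)" for m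
    define t where "t = (\<Sum>m. 2 * b m / 3 ^ Suc m)"
    have bb: "\<And>m. b m = 0 \<or> b m = 1" unfolding b_def by (rule c(1))
    note tt = ternary_digit[of b, OF bb, folded t_def]
    have "S t = x"
    proof (rule vec_eq_iff[THEN iffD2], rule allI)
      fix i
      have lt: "\<iota> i < N" using \<iota> bij_betw_apply[OF \<iota>, of i] by simp
      have "inj \<iota>" using \<iota> by (simp add: bij_betw_def)
      then have "b (N * k + \<iota> i) = c i k" for k using lt N0 by (simp add: b_def)
      then have "S t $ i = (\<Sum>k. c i k / 2 ^ Suc k)" by (simp add: S_def tt(3))
      then show "S t $ i = x $ i" using sums_unique[OF c(2)[of i]] by simp
    qed
    then show ?thesis using tt(1,2) by force
  qed
  ultimately show ?thesis using that by blast
qed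

lemma space_filling_curve_bounded:
  fixes B :: "(real^'n) set"
  assumes "bounded B"
  obtains S :: "real \<Rightarrow> real^'n" where "continuous_on UNIV S" "B \<subseteq> S ` {0..1}"
proof -
  obtain S :: "real \<Rightarrow> real^'n" where S: "continuous_on UNIV S"
    "\<forall>x. (\<forall>i. 0 \<le> x $ i \<and> x $ i < 1) \<longrightarrow> x \<in> S ` {0..1}" by (rule space_filling_curve)
  obtain R where R: "0 < R" "\<And>x. x \<in> B \<Longrightarrow> norm x \<le> R" using assms by (auto simp: bounded_pos)
  define S' where "S' t = (4 * R) *\<^sub>R S t - vec (2 * R)" for t
  show ?thesis
  proof
    show "continuous_on UNIV S'" unfolding S'_def by (intro continuous_intros S(1))
    show "B \<subseteq> S' ` {0..1}"
    proof
      fix x assume "x \<in> B"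
      define y where "y = (1 / (4 * R)) *\<^sub>R (x + vec (2 * R))"
      have "0 \<le> y $ i \<and> y $ i < 1" for i
        using component_le_norm_cart[of x i] R(2)[OF \<open>x \<in> B\<close>] R(1) by (auto simp: y_def field_simps)
      then obtain t where t: "t \<in> {0..1}" "y = S t" using S(2) by blast
      have "S' t = x" using R(1) by (simp add: S'_def t(2)[symmetric] y_def)
      then show "x \<in> S' ` {0..1}" using t(1) by blast
    qed
  qed
qed

subsection \<open>Weak compactness and the derivative measure\<close>

text \<open>The densities are transported to the line by a measurable right inverse of a space-filling
  curve; there Helly's selection theorem applies, and the curve maps the limit back. The missing
  mass is put on a box away from the curve, which the right inverse maps to the point 2.\<close>

lemma weak_compactness:
  fixes g :: "nat \<Rightarrow> real^'n \<Rightarrow> real"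
  assumes int: "\<And>n. integrable lborel (g n)" and nn: "\<And>n x. 0 \<le> g n x"
    and B: "bounded B" "\<And>n x. x \<notin> B \<Longrightarrow> g n x = 0" and C: "\<And>n. (LINT x|lborel. g n x) \<le> C"
  obtains r \<nu> where "strict_mono (r :: nat \<Rightarrow> nat)" "finite_measure \<nu>" "sets \<nu> = sets borel"
    "\<And>\<psi> b. continuous_on UNIV \<psi> \<Longrightarrow> (\<And>x. \<bar>\<psi> x\<bar> \<le> b) \<Longrightarrow>
      (\<lambda>n. LINT x|lborel. \<psi> x * g (r n) x) \<longlonglongrightarrow> (LINT x|\<nu>. \<psi> x :: real)"
proof -
  have [measurable]: "g n \<in> borel_measurable borel" for n using int[of n] by auto
  \<comment> \<open>At least 1, so that division by c is possible also if C is not positive.\<close>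
  define c where "c = max C 1"
  have c: "0 < c" "\<And>n. (LINT x|lborel. g n x) \<le> c" using C by (auto simp: c_def intro: max.coboundedI1)
  obtain S :: "real \<Rightarrow> real^'n" where S: "continuous_on UNIV S" "B \<subseteq> S ` {0..1}"
    using space_filling_curve_bounded[OF B(1)] by metis
  have [measurable]: "S \<in> borel_measurable borel" using S(1) by (rule borel_measurable_continuous_onI)
  define K where "K = S ` {0..1}"
  have cK: "compact (S ` ({0..1} \<inter> {..y}))" for y
    by (rule compact_continuous_image[OF continuous_on_subset[OF S(1)]]) (auto intro: compact_Int_closed)
  have "compact K" unfolding K_def
    by (rule compact_continuous_image[OF continuous_on_subset[OF S(1)]]) auto
  then obtain R where R: "\<And>x. x \<in> K \<Longrightarrow> norm x < R"
    using bounded_pos_less compact_imp_bounded by metis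
  \<comment> \<open>The least parameter is chosen because its sublevel sets below 2 are then images
    of compact parameter sets, which gives measurability. The value 2 lies outside the parameter
    interval.\<close>
  define T where "T x = (if x \<in> K then Inf {t\<in>{0..1}. S t = x} else 2)" for x
  have TK: "T x \<in> {0..1} \<and> S (T x) = x" and Tle: "\<And>t. t \<in> {0..1} \<Longrightarrow> S t = x \<Longrightarrow> T x \<le> t" if x: "x \<in> K" for x
  proof -
    define A where "A = {t\<in>{0..1}. S t = x}"
    have ne: "A \<noteq> {}" using x by (auto simp: A_def K_def)
    have "A = {0..1} \<inter> {t. S t = x}" by (auto simp: A_def)
    moreover have "closed {t. S t = x}" by (rule closed_Collect_eq[OF S(1)]) auto
    ultimately have cl: "closed A" by auto
    have bb: "bdd_below A" by (rule bdd_belowI[of _ 0]) (auto simp: A_def)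
    have "Inf A \<in> A" by (rule closed_contains_Inf[OF ne bb cl])
    then show "T x \<in> {0..1} \<and> S (T x) = x" using x by (auto simp: T_def A_def)
    fix t assume "t \<in> {0..1}" "S t = x"
    then have "Inf A \<le> t" by (intro cInf_lower[OF _ bb]) (simp add: A_def)
    then show "T x \<le> t" using x by (simp add: T_def A_def)
  qed
  have T2: "T x = 2" if "x \<notin> K" for x using that by (simp add: T_def)
  have Tr: "0 \<le> T x" "T x \<le> 2" for x
    using TK[of x] T2[of x] by (cases "x \<in> K"; force)+
  have Tm [measurable]: "T \<in> borel_measurable borel"
  proof (rule borel_measurableI_le)
    fix y
    show "{x\<in>space borel. T x \<le> y} \<in> sets borel"
    proof (cases "2 \<le> y")
      case True
      then have "{x\<in>space borel. T x \<le> y} = UNIV" using Tr(2) order_trans by auto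
      then show ?thesis by simp
    next
      case False
      have "{x\<in>space borel. T x \<le> y} = S ` ({0..1} \<inter> {..y})"
      proof (intro set_eqI iffI)
        fix x assume "x \<in> {x\<in>space borel. T x \<le> y}"
        then have le: "T x \<le> y" by simp
        then have "x \<in> K" using False T2[of x] by force
        then show "x \<in> S ` ({0..1} \<inter> {..y})" using TK[of x] le by (intro image_eqI[of _ _ "T x"]) auto
      next
        fix x assume "x \<in> S ` ({0..1} \<inter> {..y})"
        then obtain t where t: "t \<in> {0..1}" "t \<le> y" "x = S t" by auto
        then have "x \<in> K" by (auto simp: K_def)
        then have "T x \<le> t" using Tle t by blast
        then show "x \<in> {x\<in>space borel. T x \<le> y}" using t by simp
      qed
      then show ?thesis using compact_imp_closed[OF cK] by auto
    qed
  qed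
  \<comment> \<open>A box of volume 1 beyond the radius R and therefore off the curve; it receives
    the mass that completes \<open>g n x / c\<close> to a probability density.\<close>
  define Q where "Q = cbox (vec R) (vec R + vec 1 :: real^'n)"
  have QK: "x \<notin> K" if "x \<in> Q" for x
  proof
    assume "x \<in> K"
    have "R \<le> x $ i" for i using that by (simp add: Q_def mem_box_cart)
    then show False using R[OF \<open>x \<in> K\<close>] component_le_norm_cart[of x undefined] by (smt (verit))
  qed
  have mQ: "measure lborel Q = 1"
  proof -
    have "vec R \<in> Q" by (simp add: Q_def mem_box_cart)
    then show ?thesis unfolding Q_def by (subst content_cbox_cart) auto
  qed
  have iQ: "integrable lborel (\<lambda>x. k * indicator Q x :: real)" for k
    by (rule integrable_indicator_bounded) (auto simp: Q_def)
  have [measurable]: "Q \<in> sets borel" by (simp add: Q_def)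
  define G where "G n x = g n x / c + (1 - (LINT x|lborel. g n x) / c) * indicator Q x" for n x
  have G: "G n \<in> borel_measurable borel" "0 \<le> G n x" "integrable lborel (G n)" "(LINT x|lborel. G n x) = 1" for n x
  proof -
    show "G n \<in> borel_measurable borel" unfolding G_def by measurable
    have "(LINT x|lborel. g n x) / c \<le> 1" using c by simp
    then show "0 \<le> G n x" unfolding G_def using nn[of n x] c(1) by (intro add_nonneg_nonneg mult_nonneg_nonneg) auto
    have ig: "integrable lborel (\<lambda>x. g n x / c)" using int[of n] by auto
    then show "integrable lborel (G n)" unfolding G_def by (intro Bochner_Integration.integrable_add iQ)
    show "(LINT x|lborel. G n x) = 1"
      unfolding G_def using ig iQ int[of n] mQ by (subst Bochner_Integration.integral_add) auto
  qed
  have [measurable]: "G n \<in> borel_measurable borel" for n by (rule G(1))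
  define P where "P n = density lborel (\<lambda>x. ennreal (G n x))" for n
  have prob: "prob_space (P n)" for n
  proof (rule prob_spaceI)
    have "emeasure (P n) (space (P n)) = (\<integral>\<^sup>+x. ennreal (G n x) \<partial>lborel)"
      unfolding P_def by (simp add: emeasure_density)
    also have "\<dots> = ennreal (LINT x|lborel. G n x)"
      by (rule nn_integral_eq_integral[OF G(3)]) (simp add: G(2))
    finally show "emeasure (P n) (space (P n)) = 1" using G(4) by simp
  qed
  define D where "D n = distr (P n) borel T" for n
  have [measurable]: "T \<in> borel_measurable (P n)" for n unfolding P_def by simp
  have real: "real_distribution (D n)" for n
    unfolding real_distribution_def real_distribution_axioms_def D_def
    by (intro conjI prob_space.prob_space_distr[OF prob]) auto
  \<comment> \<open>All images lie in [0, 2], so no mass escapes.\<close>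
  have "tight D"
    unfolding tight_def
  proof (intro conjI allI impI real)
    fix \<epsilon> :: real assume \<epsilon>: "0 < \<epsilon>"
    have "measure (D n) {-1<..3} = 1" for n
    proof -
      have "T -` {-1<..3} \<inter> space (P n) = space (P n)" using Tr by (auto intro: order_trans less_le_trans[of "-1" 0])  (smt (verit))+
      then have "measure (D n) {-1<..3} = measure (P n) (space (P n))"
        unfolding D_def by (subst measure_distr) auto
      then show ?thesis using prob_space.prob_space[OF prob] by simp
    qed
    then show "\<exists>a b. a < b \<and> (\<forall>n. 1 - \<epsilon> < measure (D n) {a<..b})" using \<epsilon> by (intro exI[of _ "-1"] exI[of _ 3]) auto
  qed
  from tight_imp_convergent_subsubsequence[OF this strict_mono_id]
  obtain r :: "nat \<Rightarrow> nat" and M where r: "strict_mono r" and M: "real_distribution M" and w: "weak_conv_m (D \<circ> id \<circ> r) M"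
    by blast
  interpret M: real_distribution M by fact
  have w': "weak_conv_m (\<lambda>n. D (r n)) M" using w by (simp add: o_def)
  \<comment> \<open>Continuous, 1 on the parameter interval and 0 at 2: the added mass is removed by
    a continuous factor, through which weak convergence can pass.\<close>
  define cut where "cut t = max 0 (min 1 (2 - t))" for t :: real
  have cut: "0 \<le> cut t" "cut t \<le> 1" for t by (auto simp: cut_def)
  have [measurable]: "cut \<in> borel_measurable borel" unfolding cut_def by measurable
  define \<nu> where "\<nu> = distr (density M (\<lambda>t. ennreal (c * cut t))) borel S"
  have fin: "finite_measure (density M (\<lambda>t. ennreal (c * cut t)))"
  proof (rule finite_measureI)
    have "emeasure (density M (\<lambda>t. ennreal (c * cut t))) (space (density M (\<lambda>t. ennreal (c * cut t))))
      = (\<integral>\<^sup>+t. ennreal (c * cut t) \<partial>M)"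
      by (simp add: emeasure_density)
    also have "\<dots> \<le> (\<integral>\<^sup>+t. ennreal c \<partial>M)"
      by (intro nn_integral_mono ennreal_leI) (use cut c in \<open>simp add: mult_left_le\<close>)
    also have "\<dots> = ennreal c" using M.emeasure_space_1 by simp
    finally show "emeasure (density M (\<lambda>t. ennreal (c * cut t))) (space (density M (\<lambda>t. ennreal (c * cut t)))) \<noteq> \<infinity>"
      by (auto simp: top_unique)
  qed
  show ?thesis
  proof
    show "strict_mono r" by (rule r)
    show "finite_measure \<nu>" unfolding \<nu>_def by (rule finite_measure.finite_measure_distr[OF fin]) simp
    show "sets \<nu> = sets borel" by (simp add: \<nu>_def)
    fix \<psi> :: "real^'n \<Rightarrow> real" and b assume \<psi>: "continuous_on UNIV \<psi>" "\<And>x. \<bar>\<psi> x\<bar> \<le> b"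
    have [measurable]: "\<psi> \<in> borel_measurable borel" using \<psi>(1) by (rule borel_measurable_continuous_onI)
    define h where "h t = \<psi> (S t) * cut t" for t
    have hc: "continuous_on UNIV h" unfolding h_def cut_def
      by (intro continuous_intros continuous_on_compose2[OF \<psi>(1)] S(1)) auto
    have hb: "norm (h t) \<le> b" for t
      unfolding h_def real_norm_def abs_mult
      using mult_mono[OF \<psi>(2)[of "S t"], of "\<bar>cut t\<bar>" 1] cut[of t] abs_ge_zero[of "\<psi> (S t)"] \<psi>(2)[of "S t"] by simp
    have [measurable]: "h \<in> borel_measurable borel" using hc by (rule borel_measurable_continuous_onI)
    have "(\<lambda>n. integral\<^sup>L (D (r n)) h) \<longlonglongrightarrow> integral\<^sup>L M h"
      by (rule weak_conv_imp_integral_bdd_continuous_conv[OF real M w' _ hb])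
        (use hc in \<open>simp add: continuous_on_eq_continuous_at\<close>)
    then have "(\<lambda>n. c * integral\<^sup>L (D (r n)) h) \<longlonglongrightarrow> c * integral\<^sup>L M h" by (rule tendsto_mult_left)
    moreover have "c * integral\<^sup>L (D n) h = (LINT x|lborel. \<psi> x * g n x)" for n
    proof -
      have "integral\<^sup>L (D n) h = (LINT x|P n. h (T x))" unfolding D_def by (rule integral_distr) measurable
      also have "\<dots> = (LINT x|lborel. G n x *\<^sub>R h (T x))"
        unfolding P_def by (rule integral_density) (auto simp: G(2))
      also have "\<dots> = (LINT x|lborel. \<psi> x * g n x / c)"
      proof (rule Bochner_Integration.integral_cong[OF refl])
        fix x
        show "G n x *\<^sub>R h (T x) = \<psi> x * g n x / c"
        proof (cases "x \<in> K")
          case True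
          then have "x \<notin> Q" using QK by blast
          moreover have "cut (T x) = 1" using TK[OF True] by (simp add: cut_def)
          ultimately show ?thesis using TK[OF True] by (simp add: h_def G_def)
        next
          case False
          then have "g n x = 0" using B(2) S(2) by (auto simp: K_def)
          then show ?thesis using T2[OF False] by (simp add: h_def cut_def)
        qed
      qed
      finally show ?thesis using c(1) by simp
    qed
    moreover have "c * integral\<^sup>L M h = (LINT x|\<nu>. \<psi> x)"
    proof -
      have "(LINT x|\<nu>. \<psi> x) = (LINT t|density M (\<lambda>t. ennreal (c * cut t)). \<psi> (S t))"
        unfolding \<nu>_def by (rule integral_distr) measurable
      also have "\<dots> = (LINT t|M. (c * cut t) *\<^sub>R \<psi> (S t))"
        by (rule integral_density) (use c cut in auto)
      also have "\<dots> = (LINT t|M. c * h t)" by (simp add: h_def ac_simps)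
      finally show ?thesis by simp
    qed
    ultimately show "(\<lambda>n. LINT x|lborel. \<psi> x * g (r n) x) \<longlonglongrightarrow> (LINT x|\<nu>. \<psi> x)" by simp
  qed
qed

section \<open>Approximation of functions vanishing at the boundary; densities\<close>

lemma C1c_diff:
  fixes f g :: "real^'n \<Rightarrow> real"
  assumes f: "f \<in> C1c \<Omega>" and g: "g \<in> C1c \<Omega>"
  shows "(\<lambda>x. f x - g x) \<in> C1c \<Omega>"
    and "frechet_derivative (\<lambda>x. f x - g x) (at x) v = frechet_derivative f (at x) v - frechet_derivative g (at x) v"
proof -
  have d: "((\<lambda>x. f x - g x) has_derivative (\<lambda>v. frechet_derivative f (at x) v - frechet_derivative g (at x) v)) (at x)" for x
    by (intro has_derivative_diff C1c_has_derivative[OF f] C1c_has_derivative[OF g])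
  show "frechet_derivative (\<lambda>x. f x - g x) (at x) v = frechet_derivative f (at x) v - frechet_derivative g (at x) v"
    by (rule fun_cong[OF frechet_derivative_at[OF d], symmetric])
  obtain K where K: "compact K" "K \<subseteq> \<Omega>" "\<And>x. x \<notin> K \<Longrightarrow> f x = 0" using C1c_support[OF f] by metis
  obtain K' where K': "compact K'" "K' \<subseteq> \<Omega>" "\<And>x. x \<notin> K' \<Longrightarrow> g x = 0" using C1c_support[OF g] by metis
  show "(\<lambda>x. f x - g x) \<in> C1c \<Omega>"
    by (rule C1cI[OF d _ compact_Un[OF K(1) K'(1)]])
      (use K K' in \<open>auto intro!: continuous_intros C1c_deriv_continuous[OF f] C1c_deriv_continuous[OF g]\<close>)
qed

lemma C1c_axis:
  fixes \<psi> :: "real^'n \<Rightarrow> real"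
  assumes \<psi>: "\<psi> \<in> C1c \<Omega>"
  shows "(\<lambda>x. \<psi> x *\<^sub>R axis i 1 :: real^'n) \<in> C1c \<Omega>"
    and "divergence (\<lambda>x. \<psi> x *\<^sub>R axis i 1) x = frechet_derivative \<psi> (at x) (axis i 1)"
  using C1c_sum_scaleR(1)[of "{()}" "\<lambda>_. \<psi>" \<Omega> "\<lambda>_. axis i 1"] divergence_sum_scaleR[of "{()}" "\<lambda>_. \<psi>" \<Omega> "\<lambda>_. axis i 1"] \<psi>
  by simp_all

text \<open>Subtracting from \<psi> its truncation to [- \<epsilon>/2, \<epsilon>/2] leaves a
  continuous function that vanishes where the modulus of \<psi> is small, hence has compact support,
  and is within \<epsilon>/2 of \<psi>. The other half of \<epsilon> is spent on
  mollification.\<close>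

lemma C0_approx:
  fixes \<psi> :: "real^'n \<Rightarrow> real"
  assumes \<Omega>: "open \<Omega>" and \<psi>: "\<psi> \<in> C0 \<Omega>" and \<epsilon>: "0 < \<epsilon>"
  obtains \<eta> where "\<eta> \<in> C1c \<Omega>" "\<And>x. x \<in> \<Omega> \<Longrightarrow> \<bar>\<psi> x - \<eta> x\<bar> \<le> \<epsilon>"
proof -
  define e where "e = \<epsilon> / 2"
  have e: "0 < e" using \<epsilon> by (simp add: e_def)
  define K where "K = {x\<in>\<Omega>. e \<le> \<bar>\<psi> x\<bar>}"
  have K: "compact K" "K \<subseteq> \<Omega>" using \<psi> e by (auto simp: C0_def K_def)
  define c where "c x = (if x \<in> \<Omega> then \<psi> x - max (- e) (min e (\<psi> x)) else 0)" for x
  have c0: "c x = 0" if "x \<notin> K" for x using that by (auto simp: c_def K_def)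
  have "continuous_on \<Omega> (\<lambda>x. \<psi> x - max (- e) (min e (\<psi> x)))"
    using \<psi> unfolding C0_def by (intro continuous_intros) auto
  then have c1: "continuous_on \<Omega> c" by (rule continuous_on_eq) (simp add: c_def)
  have c2: "continuous_on (- K) c" by (rule continuous_on_eq[of _ "\<lambda>_. 0"]) (use c0 in auto)
  \<comment> \<open>\<Omega> and the complement of K are open and cover the space, so continuity can
    be checked on each of them.\<close>
  have "continuous_on (\<Omega> \<union> - K) c"
    by (rule continuous_on_open_Un[OF \<Omega> _ c1 c2]) (use compact_imp_closed[OF K(1)] in auto)
  moreover have "\<Omega> \<union> - K = UNIV" using K(2) by blast
  ultimately have cc: "continuous_on UNIV c" by simp
  have "compact (c ` K)" by (rule compact_continuous_image[OF continuous_on_subset[OF cc] K(1)]) simp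
  from compact_imp_bounded[OF this] obtain B where B: "\<And>x. x \<in> K \<Longrightarrow> norm (c x) \<le> B"
    unfolding bounded_iff by blast
  have B': "\<bar>c x\<bar> \<le> max B 0" for x using B[of x] c0[of x] by (cases "x \<in> K") auto
  obtain \<eta> where \<eta>: "\<eta> \<in> C1c \<Omega>" "\<And>x. \<bar>\<eta> x - c x\<bar> \<le> e"
    using C1c_approx_continuous[OF cc K c0 \<Omega> e B'] by metis
  have "\<bar>\<psi> x - \<eta> x\<bar> \<le> \<epsilon>" if "x \<in> \<Omega>" for x
  proof -
    have "\<bar>\<psi> x - c x\<bar> \<le> e" using that e by (auto simp: c_def)
    then show ?thesis using \<eta>(2)[of x] unfolding e_def by linarith
  qed
  with \<eta>(1) show ?thesis using that by blast
qed

lemma finite_measure_sum: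
  assumes I: "finite I" and \<nu>: "\<And>i. i \<in> I \<Longrightarrow> finite_measure (\<nu> i)" "\<And>i. i \<in> I \<Longrightarrow> sets (\<nu> i) = sets X"
  obtains N where "finite_measure N" "sets N = sets X" "\<And>A. A \<in> sets X \<Longrightarrow> emeasure N A = (\<Sum>i\<in>I. emeasure (\<nu> i) A)"
proof -
  define f where "f A = (\<Sum>i\<in>I. emeasure (\<nu> i) A)" for A
  define N where "N = measure_of (space X) (sets X) f"
  have s: "sets N = sets X" by (simp add: N_def)
  have e: "emeasure N A = f A" if "A \<in> sets X" for A
  proof (rule emeasure_measure_of[OF N_def])
    show "sets X \<subseteq> Pow (space X)" by (rule sets.space_closed)
    show "positive (sets N) f" by (simp add: positive_def f_def)
    show "countably_additive (sets N) f"
    proof (rule countably_additiveI)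
      fix A :: "nat \<Rightarrow> _" assume A: "range A \<subseteq> sets N" "disjoint_family A"
      have "(\<Sum>n. f (A n)) = (\<Sum>i\<in>I. \<Sum>n. emeasure (\<nu> i) (A n))"
        unfolding f_def by (rule suminf_sum) auto
      also have "\<dots> = (\<Sum>i\<in>I. emeasure (\<nu> i) (\<Union>n. A n))"
        by (intro sum.cong refl suminf_emeasure) (use A s \<nu>(2) in auto)
      finally show "(\<Sum>n. f (A n)) = f (\<Union> (range A))" by (simp add: f_def)
    qed
  qed (use that s in simp)
  have "finite_measure N"
  proof (rule finite_measureI)
    have "space N = space X" using s by (rule sets_eq_imp_space_eq)
    then have "emeasure N (space N) = f (space X)" using e by simp
    also have "\<dots> < \<infinity>" unfolding f_def
    proof (subst ennreal_sum_less_top[OF I, folded infinity_ennreal_def], intro ballI)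
      fix i assume "i \<in> I"
      then have "space (\<nu> i) = space X" using \<nu>(2) sets_eq_imp_space_eq by blast
      then show "emeasure (\<nu> i) (space X) < \<infinity>"
        using finite_measure.emeasure_finite[OF \<nu>(1)[OF \<open>i \<in> I\<close>]] by (simp add: less_top)
    qed
    finally show "emeasure N (space N) \<noteq> \<infinity>" by simp
  qed
  then show ?thesis using that s e unfolding f_def by blast
qed

text \<open>Domination gives absolute continuity; finiteness of \<nu> makes the density finite
  almost everywhere, so it can be replaced by a real function.\<close>

lemma real_density:
  assumes N: "finite_measure N" and \<nu>: "finite_measure \<nu>" "sets \<nu> = sets N"
    and le: "\<And>A. A \<in> sets N \<Longrightarrow> emeasure \<nu> A \<le> emeasure N A"
  obtains F :: "'a \<Rightarrow> real" where "F \<in> borel_measurable N" "\<And>x. 0 \<le> F x" "integrable N F"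
    "\<And>\<psi>. \<psi> \<in> borel_measurable N \<Longrightarrow> (LINT x|\<nu>. \<psi> x) = (LINT x|N. F x * \<psi> x :: real)"
proof -
  interpret N: finite_measure N by fact
  interpret \<nu>: finite_measure \<nu> by fact
  have "absolutely_continuous N \<nu>"
    unfolding absolutely_continuous_def
  proof
    fix A assume "A \<in> null_sets N"
    then have "A \<in> sets N" "emeasure N A = 0" by auto
    then show "A \<in> null_sets \<nu>" using le[of A] \<nu>(2) by auto
  qed
  from N.Radon_Nikodym[OF this \<nu>(2)] obtain f where f[measurable]: "f \<in> borel_measurable N" and d: "density N f = \<nu>" by blast
  have fin: "(\<integral>\<^sup>+x. f x \<partial>N) \<noteq> \<infinity>"
  proof -
    have "emeasure \<nu> (space \<nu>) = (\<integral>\<^sup>+x. f x \<partial>N)" unfolding d[symmetric] by (simp add: emeasure_density)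
    then show ?thesis using \<nu>.emeasure_finite[of "space \<nu>"] by simp
  qed
  have ae: "AE x in N. f x \<noteq> \<infinity>" by (rule nn_integral_PInf_AE[OF f fin])
  define F where "F x = enn2real (f x)" for x
  have [measurable]: "F \<in> borel_measurable N" unfolding F_def by measurable
  have eq: "AE x in N. f x = ennreal (F x)"
    using ae by (rule eventually_mono) (simp add: F_def less_top)
  have d': "density N (\<lambda>x. ennreal (F x)) = \<nu>"
    unfolding d[symmetric] by (rule density_cong) (use eq in \<open>auto elim: eventually_mono\<close>)
  show ?thesis
  proof
    show "F \<in> borel_measurable N" by measurable
    show "0 \<le> F x" for x by (simp add: F_def)
    show "integrable N F"
    proof (rule integrableI_nonneg)
      have "(\<integral>\<^sup>+x. ennreal (F x) \<partial>N) = (\<integral>\<^sup>+x. f x \<partial>N)"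
        by (rule nn_integral_cong_AE) (use eq in \<open>auto elim: eventually_mono\<close>)
      then show "(\<integral>\<^sup>+x. ennreal (F x) \<partial>N) < \<infinity>" using fin by (simp add: less_top)
    qed (auto simp: F_def)
    fix \<psi> :: "'a \<Rightarrow> real" assume "\<psi> \<in> borel_measurable N"
    then have "(LINT x|density N (\<lambda>x. ennreal (F x)). \<psi> x) = (LINT x|N. F x *\<^sub>R \<psi> x)"
      by (rule integral_density) (auto simp: F_def)
    then show "(LINT x|\<nu>. \<psi> x) = (LINT x|N. F x * \<psi> x)" unfolding d' by simp
  qed
qed

section \<open>Partial derivatives as limits of mollified gradients\<close>

context bv_function
begin

lemma partial_le:
  assumes \<psi>: "\<psi> \<in> C1c \<Omega>" and s: "\<And>x. \<bar>\<psi> x\<bar> \<le> s"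
  shows "\<bar>LINT x|lborel. u x * frechet_derivative \<psi> (at x) (axis i 1)\<bar> \<le> s * T"
proof -
  have s0: "0 \<le> s" using s[of undefined] by linarith
  have le: "(LINT x|lborel. u x * frechet_derivative \<eta> (at x) (axis i 1)) \<le> s * T"
    if \<eta>: "\<eta> \<in> C1c \<Omega>" and "\<And>x. \<bar>\<eta> x\<bar> \<le> s" for \<eta>
    using variation_le_scaled[OF C1c_axis(1)[OF \<eta>, of i] s0] that(2) unfolding C1c_axis(2)[OF \<eta>]
    by (simp add: norm_axis_1)
  have "(LINT x|lborel. u x * frechet_derivative (\<lambda>x. -1 * \<psi> x) (at x) (axis i 1)) \<le> s * T"
    by (rule le[OF C1c_cmult(1)[OF \<psi>]]) (use s in simp)
  then have "- (LINT x|lborel. u x * frechet_derivative \<psi> (at x) (axis i 1)) \<le> s * T"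
    unfolding C1c_cmult(2)[OF \<psi>] by simp
  then show ?thesis using le[OF \<psi> s] by linarith
qed

text \<open>The margin 2 e leaves room for mollification: a function that vanishes outside
  \<open>core e\<close> has a convolution supported at distance at least e from the complement of
  \<Omega>.\<close>

definition core :: "real \<Rightarrow> (real^'n) set" where
  "core e = {y. 2 * e < infdist y (- \<Omega>)}"

text \<open>The i-th partial derivative of \<open>conv e u\<close>, restricted to
  \<open>core e\<close>; as \<open>mol_grad\<close> is odd, the argument x - y comes with a minus
  sign. The restriction keeps out the jump of u at the boundary of \<Omega>, which comes from the
  extension by zero and does not belong to the derivative in \<Omega>.\<close>

definition mol_partial :: "'n \<Rightarrow> real \<Rightarrow> real^'n \<Rightarrow> real" where
  "mol_partial i e y = indicator (core e) y * - (LINT x|lborel. u x * (mol_grad e (x - y) \<bullet> axis i 1))"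

lemma complement_nonempty: "- \<Omega> \<noteq> {}" "closed (- \<Omega>)"
proof -
  have "\<Omega> \<noteq> UNIV" using bounded_dom not_bounded_UNIV by metis
  then show "- \<Omega> \<noteq> {}" by auto
qed (use open_dom in auto)

lemma core_borel [measurable]: "core e \<in> sets borel"
proof -
  have "open (core e)" unfolding core_def by (intro open_Collect_less continuous_intros)
  then show ?thesis by auto
qed

lemma core_subset: "0 < e \<Longrightarrow> core e \<subseteq> \<Omega>"
  using in_closed_iff_infdist_zero[OF complement_nonempty(2,1)] by (force simp: core_def)

lemma kernel_bound:
  assumes e: "0 < e"
  obtains B where "0 \<le> B" "\<And>z::real^'n. \<bar>mol_grad e z \<bullet> axis i 1\<bar> \<le> B"
proof -
  obtain B where B: "0 \<le> B" "\<And>x::real^'n. norm (mol_grad e x) \<le> B" using mol_bounds[OF e, where 'a="real^'n"] by metis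
  show ?thesis using that[OF B(1)] mol_grad_inner_bound[OF B(2), of _ "axis i 1"] by (simp add: norm_axis_1)
qed

lemma mol_partial_props:
  assumes e: "0 < e"
  shows "mol_partial i e \<in> borel_measurable borel" "integrable lborel (mol_partial i e)"
    and "y \<notin> core e \<Longrightarrow> mol_partial i e y = 0"
proof -
  obtain B where B: "0 \<le> B" "\<And>z::real^'n. \<bar>mol_grad e z \<bullet> axis i 1\<bar> \<le> B" using kernel_bound[OF e] by metis
  define R where "R y = (LINT x|lborel. u x * (mol_grad e (x - y) \<bullet> axis i 1))" for y
  have gc: "continuous_on UNIV (\<lambda>z::real^'n. mol_grad e (- z) \<bullet> axis i 1)"
    by (intro continuous_intros continuous_on_compose2[OF mol_continuous(2)[of UNIV]]) auto
  have "continuous_on UNIV (\<lambda>y. LINT x|lborel. (mol_grad e (- (y - x)) \<bullet> axis i 1) *\<^sub>R u x)"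
    by (rule kernel_continuous[OF u_integrable gc]) (rule B(2))
  then have "continuous_on UNIV R" by (simp add: R_def[abs_def] mult.commute)
  then have [measurable]: "R \<in> borel_measurable borel" by (rule borel_measurable_continuous_onI)
  have eq: "mol_partial i e = (\<lambda>y. indicator (core e) y * - R y)" by (simp add: mol_partial_def R_def fun_eq_iff)
  show m: "mol_partial i e \<in> borel_measurable borel" unfolding eq by measurable
  show z: "mol_partial i e y = 0" if "y \<notin> core e" for y using that by (simp add: eq)
  have Rb: "\<bar>R y\<bar> \<le> (LINT x|lborel. \<bar>u x\<bar> * B)" for y
  proof -
    have "norm (R y) \<le> (LINT x|lborel. \<bar>u x\<bar> * B)"
      unfolding R_def
    proof (rule lborel_norm_integral_le)
      show "integrable lborel (\<lambda>x. u x * (mol_grad e (x - y) \<bullet> axis i 1))"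
        by (rule u_mult_integrable[OF _ B(2)]) simp
      show "integrable lborel (\<lambda>x. \<bar>u x\<bar> * B)" using u_integrable by auto
      show "norm (u x * (mol_grad e (x - y) \<bullet> axis i 1)) \<le> \<bar>u x\<bar> * B" for x
        using B(2)[of "x - y"] by (auto simp: abs_mult intro!: mult_left_mono)
    qed
    then show ?thesis by simp
  qed
  show "integrable lborel (mol_partial i e)"
  proof (rule integrable_lborel_bounded_support[OF m _ bounded_dom])
    show "norm (mol_partial i e y) \<le> (LINT x|lborel. \<bar>u x\<bar> * B)" for y
      using Rb[of y] order_trans[OF abs_ge_zero Rb[of y]] by (auto simp: eq indicator_def)
    show "mol_partial i e y = 0" if "y \<notin> \<Omega>" for y using z core_subset[OF e] that by blast
  qed
qed

text \<open>Fubini moves the mollifier from u to \<eta>, so the pairing with the mollified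
  derivative is the distributional derivative of u tested with \<open>conv e \<eta>\<close>.\<close>

lemma mol_partial_pairing:
  assumes e: "0 < e" and \<eta>m[measurable]: "\<eta> \<in> borel_measurable borel" and \<eta>: "\<And>x. \<bar>\<eta> x\<bar> \<le> b" "\<And>x. x \<notin> core e \<Longrightarrow> \<eta> x = 0"
  shows "conv e \<eta> \<in> C1c \<Omega>"
    and "(LINT y|lborel. \<eta> y * mol_partial i e y)
      = - (LINT x|lborel. u x * frechet_derivative (conv e \<eta>) (at x) (axis i 1))"
proof -
  have \<eta>z: "\<eta> x = 0" if "x \<notin> \<Omega>" for x using \<eta>(2) core_subset[OF e] that by blast
  have i\<eta>: "integrable lborel \<eta>"
    by (rule integrable_lborel_bounded_support[OF \<eta>m _ bounded_dom]) (use \<eta> \<eta>z in auto)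
  have b0: "0 \<le> b" using \<eta>(1)[of undefined] by linarith
  show "conv e \<eta> \<in> C1c \<Omega>"
  proof (rule conv_C1c[OF e i\<eta> compact_inner_parallel[OF open_dom bounded_dom e]])
    fix x y assume xy: "norm (x - y) < e" "x \<notin> {x. e \<le> infdist x (- \<Omega>)}"
    have "infdist y (- \<Omega>) \<le> infdist x (- \<Omega>) + dist y x" by (rule infdist_triangle)
    then have "y \<notin> core e" using xy by (simp add: core_def dist_norm norm_minus_commute)
    then show "\<eta> y = 0" by (rule \<eta>(2))
  qed
  obtain B where B: "0 \<le> B" "\<And>z::real^'n. \<bar>mol_grad e z \<bullet> axis i 1\<bar> \<le> B" using kernel_bound[OF e] by metis
  have intp: "integrable (lborel \<Otimes>\<^sub>M lborel) (\<lambda>(x, y). u x * ((mol_grad e (x - y) \<bullet> axis i 1) * \<eta> y))"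
    unfolding lborel_prod
  proof (rule integrable_lborel_bounded_support[where B="M * (B * b)" and K="\<Omega> \<times> \<Omega>"])
    show "(\<lambda>(x, y). u x * ((mol_grad e (x - y) \<bullet> axis i 1) * \<eta> y)) \<in> borel_measurable borel"
      unfolding borel_prod[symmetric] by measurable
    show "norm (case z of (x, y) \<Rightarrow> u x * ((mol_grad e (x - y) \<bullet> axis i 1) * \<eta> y)) \<le> M * (B * b)" for z
    proof (cases z)
      case (Pair x y)
      have "\<bar>u x\<bar> * (\<bar>mol_grad e (x - y) \<bullet> axis i 1\<bar> * \<bar>\<eta> y\<bar>) \<le> M * (B * b)"
        by (intro mult_mono u_bound B \<eta>(1) M_nonneg mult_nonneg_nonneg b0) auto
      then show ?thesis using Pair by (simp add: abs_mult)
    qed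
    show "bounded (\<Omega> \<times> \<Omega>)" by (intro bounded_Times bounded_dom)
    show "(case z of (x, y) \<Rightarrow> u x * ((mol_grad e (x - y) \<bullet> axis i 1) * \<eta> y)) = 0" if "z \<notin> \<Omega> \<times> \<Omega>" for z
      using that u_zero \<eta>z by (cases z) auto
  qed
  have "(LINT x|lborel. u x * frechet_derivative (conv e \<eta>) (at x) (axis i 1))
    = (LINT x|lborel. LINT y|lborel. u x * ((mol_grad e (x - y) \<bullet> axis i 1) * \<eta> y))"
    unfolding conv_frechet[OF e i\<eta>] by simp
  also have "\<dots> = (LINT y|lborel. LINT x|lborel. u x * ((mol_grad e (x - y) \<bullet> axis i 1) * \<eta> y))"
    by (rule lborel_pair.Fubini_integral[OF intp, symmetric])
  also have "\<dots> = (LINT y|lborel. - (\<eta> y * mol_partial i e y))"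
  proof (rule Bochner_Integration.integral_cong[OF refl])
    fix y
    have "(LINT x|lborel. u x * ((mol_grad e (x - y) \<bullet> axis i 1) * \<eta> y))
      = (LINT x|lborel. u x * (mol_grad e (x - y) \<bullet> axis i 1)) * \<eta> y"
      by (simp flip: mult.assoc)
    then show "(LINT x|lborel. u x * ((mol_grad e (x - y) \<bullet> axis i 1) * \<eta> y)) = - (\<eta> y * mol_partial i e y)"
      using \<eta>(2)[of y] by (cases "y \<in> core e") (auto simp: mol_partial_def)
  qed
  finally show "(LINT y|lborel. \<eta> y * mol_partial i e y)
      = - (LINT x|lborel. u x * frechet_derivative (conv e \<eta>) (at x) (axis i 1))" by simp
qed

text \<open>Pairing with the sign of \<open>mol_partial\<close> gives the L1 norm, and the mollified
  sign is a test function bounded by 1. This is the uniform mass bound that compactness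
  requires.\<close>

lemma mol_partial_mass:
  assumes e: "0 < e"
  shows "(LINT y|lborel. \<bar>mol_partial i e y\<bar>) \<le> T"
proof -
  define \<eta> where "\<eta> y = sgn (mol_partial i e y)" for y
  have [measurable]: "mol_partial i e \<in> borel_measurable borel" by (rule mol_partial_props(1)[OF e])
  have \<eta>: "\<eta> \<in> borel_measurable borel" "\<And>x. \<bar>\<eta> x\<bar> \<le> 1" "\<And>x. x \<notin> core e \<Longrightarrow> \<eta> x = 0"
  proof -
    show "\<eta> \<in> borel_measurable borel" unfolding \<eta>_def by measurable
  qed (use mol_partial_props(3)[OF e] in \<open>auto simp: \<eta>_def sgn_if\<close>)
  have "(LINT y|lborel. \<bar>mol_partial i e y\<bar>) = (LINT y|lborel. \<eta> y * mol_partial i e y)"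
    by (rule Bochner_Integration.integral_cong[OF refl]) (simp add: \<eta>_def sgn_if)
  also have "\<dots> = - (LINT x|lborel. u x * frechet_derivative (conv e \<eta>) (at x) (axis i 1))"
    by (rule mol_partial_pairing(2)[OF e \<eta>])
  also have "\<dots> \<le> 1 * T"
  proof -
    have "\<bar>conv e \<eta> x\<bar> \<le> 1" for x using conv_norm_le[OF e \<eta>(1), of 1 x] \<eta>(2) by simp
    from partial_le[OF mol_partial_pairing(1)[OF e \<eta>] this, of i] show ?thesis by linarith
  qed
  finally show ?thesis by simp
qed

text \<open>Once the mollifier has been moved to \<psi>, the error is the derivative of u tested
  with the difference of \<psi> and \<open>conv e \<psi>\<close>, a test function of size at most L
  e; \<open>partial_le\<close> bounds it by L e T. Only the uniform smallness of that difference
  enters, not that of its derivatives.\<close>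

lemma mol_partial_limit:
  assumes \<psi>: "\<psi> \<in> C1c \<Omega>" and d: "d \<longlonglongrightarrow> 0" "\<And>n. 0 < d n"
  shows "(\<lambda>n. LINT y|lborel. \<psi> y * mol_partial i (d n) y) \<longlonglongrightarrow> - (LINT x|lborel. u x * frechet_derivative \<psi> (at x) (axis i 1))"
proof -
  obtain K where K: "compact K" "K \<subseteq> \<Omega>" "\<And>x. x \<notin> K \<Longrightarrow> \<psi> x = 0" using C1c_support[OF \<psi>] by metis
  obtain r where r: "0 < r" "(\<Union>x\<in>K. cball x r) \<subseteq> \<Omega>"
    using compact_subset_open_imp_cball_epsilon_subset[OF K(1) open_dom K(2)] by blast
  obtain L where L: "0 \<le> L" "\<And>x v. norm (frechet_derivative \<psi> (at x) v) \<le> L * norm v"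
    using C1c_deriv_bounded[OF \<psi>] by metis
  obtain b where b: "\<And>x. norm (\<psi> x) \<le> b" using C1c_bounded[OF \<psi>] by metis
  have m: "\<psi> \<in> borel_measurable borel" by (rule C1c_measurable[OF \<psi>])
  define X where "X = (LINT x|lborel. u x * frechet_derivative \<psi> (at x) (axis i 1))"
  have close: "\<bar>(LINT y|lborel. \<psi> y * mol_partial i e y) - (- X)\<bar> \<le> L * T * e" if e: "0 < e" "2 * e < r" for e
  proof -
    have z: "\<psi> y = 0" if "y \<notin> core e" for y
    proof (rule K(3), rule notI)
      assume "y \<in> K"
      have "r \<le> infdist y (- \<Omega>)"
      proof (rule infdist_ge[OF complement_nonempty(1)])
        fix a assume "a \<in> - \<Omega>"
        then have "a \<notin> cball y r" using r(2) \<open>y \<in> K\<close> by blast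
        then show "r \<le> dist y a" by simp
      qed
      then show False using that e(2) by (simp add: core_def)
    qed
    have bb: "\<bar>\<psi> x\<bar> \<le> b" for x using b[of x] by simp
    note P = mol_partial_pairing[OF e(1) m bb z]
    have df: "(\<lambda>x. \<psi> x - conv e \<psi> x) \<in> C1c \<Omega>" by (rule C1c_diff(1)[OF \<psi> P(1)])
    have "\<bar>LINT x|lborel. u x * frechet_derivative (\<lambda>x. \<psi> x - conv e \<psi> x) (at x) (axis i 1)\<bar> \<le> (L * e) * T"
    proof (rule partial_le[OF df])
      fix x
      have "norm (conv e \<psi> x - \<psi> x) \<le> L * e"
      proof (rule conv_close[OF e(1) m b])
        fix y :: "real^'n" assume "norm y < e"
        have "norm (\<psi> (x + - y) - \<psi> x) \<le> L * norm (- y)" by (rule C1c_lipschitz[OF \<psi> L])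
        also have "\<dots> \<le> L * e" using \<open>norm y < e\<close> L(1) by (intro mult_left_mono) auto
        finally show "norm (\<psi> (x - y) - \<psi> x) \<le> L * e" by simp
      qed
      then show "\<bar>\<psi> x - conv e \<psi> x\<bar> \<le> L * e" by (simp add: abs_minus_commute)
    qed
    moreover have "(LINT x|lborel. u x * frechet_derivative (\<lambda>x. \<psi> x - conv e \<psi> x) (at x) (axis i 1))
      = X - (LINT x|lborel. u x * frechet_derivative (conv e \<psi>) (at x) (axis i 1))"
    proof -
      have ii: "integrable lborel (\<lambda>x. u x * frechet_derivative f (at x) (axis i 1))" if f: "f \<in> C1c \<Omega>" for f :: "real^'n \<Rightarrow> real"
      proof -
        obtain L' where L': "\<And>x v. norm (frechet_derivative f (at x) v) \<le> L' * norm v"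
          using C1c_deriv_bounded[OF f] by metis
        show ?thesis
          by (rule u_mult_integrable[OF C1c_deriv_measurable[OF f], of "axis i 1" L'])
            (use L'[of _ "axis i 1"] in \<open>simp add: norm_axis_1\<close>)
      qed
      have "frechet_derivative (\<lambda>x. \<psi> x - conv e \<psi> x) (at x) (axis i 1)
        = frechet_derivative \<psi> (at x) (axis i 1) - frechet_derivative (conv e \<psi>) (at x) (axis i 1)" for x
        by (rule C1c_diff(2)[OF \<psi> P(1)])
      then show ?thesis unfolding X_def
        using Bochner_Integration.integral_diff[OF ii[OF \<psi>] ii[OF P(1)]] by (simp add: right_diff_distrib)
    qed
    moreover have "(LINT y|lborel. \<psi> y * mol_partial i e y)
      = - (LINT x|lborel. u x * frechet_derivative (conv e \<psi>) (at x) (axis i 1))" by (rule P(2))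
    ultimately show ?thesis by (simp add: ac_simps)
  qed
  have "(\<lambda>n. (LINT y|lborel. \<psi> y * mol_partial i (d n) y) - (- X)) \<longlonglongrightarrow> 0"
  proof (rule Lim_null_comparison)
    have "\<forall>\<^sub>F n in sequentially. d n < r / 2" using order_tendstoD(2)[OF d(1), of "r/2"] r(1) by simp
    then show "\<forall>\<^sub>F n in sequentially. norm ((LINT y|lborel. \<psi> y * mol_partial i (d n) y) - (- X)) \<le> L * T * d n"
      by (rule eventually_mono) (use close[OF d(2)] in \<open>simp del: minus_diff_minus\<close>)
    have "(\<lambda>n. L * T * d n) \<longlonglongrightarrow> L * T * 0" by (intro tendsto_mult_left d(1))
    then show "(\<lambda>n. L * T * d n) \<longlonglongrightarrow> 0" by simp
  qed
  from tendsto_add[OF this tendsto_const[of "- X"]] show ?thesis by (simp add: X_def)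
qed

text \<open>\<open>weak_compactness\<close> is about nonnegative densities, so the positive and
  negative parts are treated one after the other, the second along a subsequence of the
  first.\<close>

lemma partial_signed_measure:
  obtains \<nu>1 \<nu>2 where "finite_measure \<nu>1" "sets \<nu>1 = sets borel" "finite_measure \<nu>2" "sets \<nu>2 = sets borel"
    "\<forall>\<psi>\<in>C1c \<Omega>. - (LINT x|lborel. u x * frechet_derivative \<psi> (at x) (axis i 1)) = (LINT x|\<nu>1. \<psi> x) - (LINT x|\<nu>2. \<psi> x)"
proof -
  define d where "d n = inverse (real (Suc n))" for n
  have d: "d \<longlonglongrightarrow> 0" "\<And>n. 0 < d n" unfolding d_def using LIMSEQ_inverse_real_of_nat by auto
  define f where "f n = mol_partial i (d n)" for n
  have [measurable]: "f n \<in> borel_measurable borel" for n unfolding f_def by (rule mol_partial_props(1)[OF d(2)])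
  have fi: "integrable lborel (f n)" for n unfolding f_def by (rule mol_partial_props(2)[OF d(2)])
  have fz: "f n x = 0" if "x \<notin> \<Omega>" for n x
    unfolding f_def using mol_partial_props(3)[OF d(2)] core_subset[OF d(2)] that by blast
  have fm: "(LINT x|lborel. \<bar>f n x\<bar>) \<le> T" for n unfolding f_def by (rule mol_partial_mass[OF d(2)])
  define p where "p n x = max 0 (f n x)" for n x
  define q where "q n x = max 0 (- f n x)" for n x
  have pi: "integrable lborel (p n)" "integrable lborel (q n)" for n
    unfolding p_def q_def using fi by (auto intro!: integrable_max)
  have pm: "(LINT x|lborel. p n x) \<le> T" "(LINT x|lborel. q n x) \<le> T" for n
    by (rule order_trans[OF integral_mono fm[of n]]; use pi fi in \<open>auto simp: p_def q_def\<close>)+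
  obtain r1 \<nu>1 where r1: "strict_mono (r1 :: nat \<Rightarrow> nat)" "finite_measure \<nu>1" "sets \<nu>1 = sets borel"
    "\<And>\<psi> b. continuous_on UNIV \<psi> \<Longrightarrow> (\<And>x. \<bar>\<psi> x\<bar> \<le> b) \<Longrightarrow>
      (\<lambda>n. LINT x|lborel. \<psi> x * p (r1 n) x) \<longlonglongrightarrow> (LINT x|\<nu>1. \<psi> x :: real)"
    by (rule weak_compactness[of p \<Omega> T]) (use pi pm fz bounded_dom in \<open>auto simp: p_def\<close>)
  obtain r2 \<nu>2 where r2: "strict_mono (r2 :: nat \<Rightarrow> nat)" "finite_measure \<nu>2" "sets \<nu>2 = sets borel"
    "\<And>\<psi> b. continuous_on UNIV \<psi> \<Longrightarrow> (\<And>x. \<bar>\<psi> x\<bar> \<le> b) \<Longrightarrow>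
      (\<lambda>n. LINT x|lborel. \<psi> x * q (r1 (r2 n)) x) \<longlonglongrightarrow> (LINT x|\<nu>2. \<psi> x :: real)"
    by (rule weak_compactness[of "\<lambda>n. q (r1 n)" \<Omega> T]) (use pi pm fz bounded_dom in \<open>auto simp: q_def\<close>)
  have "- (LINT x|lborel. u x * frechet_derivative \<psi> (at x) (axis i 1)) = (LINT x|\<nu>1. \<psi> x) - (LINT x|\<nu>2. \<psi> x)"
    if \<psi>: "\<psi> \<in> C1c \<Omega>" for \<psi>
  proof -
    obtain b where b: "\<And>x. norm (\<psi> x) \<le> b" using C1c_bounded[OF \<psi>] by metis
    have b': "\<bar>\<psi> x\<bar> \<le> b" for x using b[of x] by simp
    have [measurable]: "\<psi> \<in> borel_measurable borel" by (rule C1c_measurable[OF \<psi>])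
    have bi: "integrable lborel (\<lambda>x. \<psi> x * k x)" if k: "integrable lborel k" for k
    proof (rule Bochner_Integration.integrable_bound[OF integrable_mult_right[OF integrable_norm[OF k], of b]])
      show "(\<lambda>x. \<psi> x * k x) \<in> borel_measurable lborel" using k by measurable
      show "AE x in lborel. norm (\<psi> x * k x) \<le> norm (b * norm (k x))"
      proof (rule AE_I2)
        fix x
        have "\<bar>\<psi> x\<bar> * \<bar>k x\<bar> \<le> \<bar>b\<bar> * \<bar>k x\<bar>" using b'[of x] by (intro mult_right_mono) auto
        then show "norm (\<psi> x * k x) \<le> norm (b * norm (k x))" by (simp add: abs_mult)
      qed
    qed
    have l1: "(\<lambda>n. LINT x|lborel. \<psi> x * p (r1 (r2 n)) x) \<longlonglongrightarrow> (LINT x|\<nu>1. \<psi> x)"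
      using LIMSEQ_subseq_LIMSEQ[OF r1(4)[OF C1c_continuous[OF \<psi>] b'] r2(1)] by (simp add: o_def)
    have l2: "(\<lambda>n. LINT x|lborel. \<psi> x * q (r1 (r2 n)) x) \<longlonglongrightarrow> (LINT x|\<nu>2. \<psi> x)"
      by (rule r2(4)[OF C1c_continuous[OF \<psi>] b'])
    have "(LINT x|lborel. \<psi> x * p n x) - (LINT x|lborel. \<psi> x * q n x) = (LINT x|lborel. \<psi> x * f n x)" for n
    proof -
      have "(LINT x|lborel. \<psi> x * p n x) - (LINT x|lborel. \<psi> x * q n x) = (LINT x|lborel. \<psi> x * p n x - \<psi> x * q n x)"
        by (rule Bochner_Integration.integral_diff[OF bi[OF pi(1)] bi[OF pi(2)], symmetric])
      also have "\<dots> = (LINT x|lborel. \<psi> x * f n x)"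
        by (rule Bochner_Integration.integral_cong[OF refl]) (simp add: p_def q_def max_def)
      finally show ?thesis .
    qed
    then have "(\<lambda>n. LINT x|lborel. \<psi> x * f (r1 (r2 n)) x) \<longlonglongrightarrow> (LINT x|\<nu>1. \<psi> x) - (LINT x|\<nu>2. \<psi> x)"
      using tendsto_diff[OF l1 l2] by simp
    moreover have "(\<lambda>n. LINT x|lborel. \<psi> x * f (r1 (r2 n)) x)
      \<longlonglongrightarrow> - (LINT x|lborel. u x * frechet_derivative \<psi> (at x) (axis i 1))"
      using LIMSEQ_subseq_LIMSEQ[OF mol_partial_limit[OF \<psi> d, of i] strict_mono_o[OF r1(1) r2(1)]]
      by (simp add: o_def f_def)
    ultimately show ?thesis using LIMSEQ_unique by blast
  qed
  then show ?thesis using that r1(2,3) r2(2,3) by blast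
qed

end

lemma integral_test_eq:
  fixes u :: "real^'n \<Rightarrow> real"
  assumes \<Omega>: "open \<Omega>" and [measurable]: "u \<in> borel_measurable borel" and u_zero: "\<And>x. x \<notin> \<Omega> \<Longrightarrow> u x = 0"
    and w: "w \<in> borel_measurable (lebesgue_on \<Omega>)" "AE x in lborel. x \<in> \<Omega> \<longrightarrow> w x = u x" and \<phi>: "\<phi> \<in> C1c \<Omega>"
  shows "(LINT x|lebesgue_on \<Omega>. w x * divergence \<phi> x) = (LINT x|lborel. u x * divergence \<phi> x)"
proof (rule integral_lebesgue_on_borel[OF \<Omega>])
  have [measurable]: "divergence \<phi> \<in> borel_measurable borel" by (rule divergence_measurable[OF \<phi>])
  have "divergence \<phi> \<in> borel_measurable (lebesgue_on \<Omega>)"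
    by (intro measurable_restrict_space1 measurable_completion) simp
  then show "(\<lambda>x. w x * divergence \<phi> x) \<in> borel_measurable (lebesgue_on \<Omega>)" using w(1) by measurable
  show "(\<lambda>x. u x * divergence \<phi> x) \<in> borel_measurable borel" by measurable
  show "AE x in lborel. x \<in> \<Omega> \<longrightarrow> w x * divergence \<phi> x = u x * divergence \<phi> x"
    using w(2) by eventually_elim auto
qed (simp add: u_zero)

section \<open>Polar decomposition and pairing estimates\<close>

context bv_function
begin

text \<open>The total measure is the sum of the positive and negative parts of all components; normalising
  the vector of Radon--Nikodym densities with respect to it gives the polar decomposition.\<close>

lemma derivative_measure_exists:
  assumes w: "w \<in> borel_measurable (lebesgue_on \<Omega>)" "AE x in lborel. x \<in> \<Omega> \<longrightarrow> w x = u x"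
  shows "is_derivative_measure \<Omega> w (derivative_measure \<Omega> w)"
proof -
  define X where "X = restrict_space (borel :: (real^'n) measure) \<Omega>"
  have spX: "space X = \<Omega>" by (simp add: X_def space_restrict_space)
  have "\<forall>i. \<exists>p. finite_measure (fst p) \<and> sets (fst p) = sets borel \<and> finite_measure (snd p) \<and> sets (snd p) = sets borel
    \<and> (\<forall>\<psi>\<in>C1c \<Omega>. - (LINT x|lborel. u x * frechet_derivative \<psi> (at x) (axis i 1)) = (LINT x|fst p. \<psi> x) - (LINT x|snd p. \<psi> x))"
  proof
    fix i
    obtain \<nu>1 \<nu>2 where "finite_measure \<nu>1" "sets \<nu>1 = sets borel" "finite_measure \<nu>2" "sets \<nu>2 = sets borel"
    "\<forall>\<psi>\<in>C1c \<Omega>. - (LINT x|lborel. u x * frechet_derivative \<psi> (at x) (axis i 1)) = (LINT x|\<nu>1. \<psi> x) - (LINT x|\<nu>2. \<psi> x)"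
      by (rule partial_signed_measure)
    then show "\<exists>p. finite_measure (fst p) \<and> sets (fst p) = sets borel \<and> finite_measure (snd p) \<and> sets (snd p) = sets borel
    \<and> (\<forall>\<psi>\<in>C1c \<Omega>. - (LINT x|lborel. u x * frechet_derivative \<psi> (at x) (axis i 1)) = (LINT x|fst p. \<psi> x) - (LINT x|snd p. \<psi> x))"
      by (intro exI[of _ "(\<nu>1, \<nu>2)"]) simp
  qed
  from choice[OF this] obtain p where
    p: "\<forall>i. finite_measure (fst (p i)) \<and> sets (fst (p i)) = sets borel \<and> finite_measure (snd (p i)) \<and> sets (snd (p i)) = sets borel
    \<and> (\<forall>\<psi>\<in>C1c \<Omega>. - (LINT x|lborel. u x * frechet_derivative \<psi> (at x) (axis i 1)) = (LINT x|fst (p i). \<psi> x) - (LINT x|snd (p i). \<psi> x))"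
    by (rule exE)
  define \<nu>0 where "\<nu>0 = (\<lambda>(i, s). if s then fst (p i) else snd (p i))"
  \<comment> \<open>A weak limit may charge the boundary of \<Omega>; restriction to \<Omega>
    removes this and leaves the integrals of test functions unchanged, as they vanish outside
    \<Omega>.\<close>
  define \<nu> where "\<nu> t = restrict_space (\<nu>0 t) \<Omega>" for t
  have \<nu>0: "finite_measure (\<nu>0 t)" "sets (\<nu>0 t) = sets borel" for t
    using p by (auto simp: \<nu>0_def split: prod.split)
  have \<nu>: "finite_measure (\<nu> t)" "sets (\<nu> t) = sets X" for t
  proof -
    show "finite_measure (\<nu> t)" unfolding \<nu>_def
      by (rule finite_measure_restrict_space[OF \<nu>0(1)]) (simp add: \<nu>0(2))
    show "sets (\<nu> t) = sets X" unfolding \<nu>_def X_def by (rule sets_restrict_space_cong[OF \<nu>0(2)])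
  qed
  have int\<nu>: "(LINT x|\<nu> t. \<psi> x) = (LINT x|\<nu>0 t. \<psi> x)" if \<psi>: "\<psi> \<in> C1c \<Omega>" for t and \<psi> :: "real^'n \<Rightarrow> real"
  proof -
    have "space (\<nu>0 t) = UNIV" using sets_eq_imp_space_eq[OF \<nu>0(2)] by simp
    then have "(LINT x|\<nu> t. \<psi> x) = (LINT x|\<nu>0 t. indicator \<Omega> x *\<^sub>R \<psi> x)"
      unfolding \<nu>_def by (intro integral_restrict_space) (simp add: \<nu>0(2))
    also have "(\<lambda>x. indicator \<Omega> x *\<^sub>R \<psi> x) = \<psi>"
    proof
      fix x show "indicator \<Omega> x *\<^sub>R \<psi> x = \<psi> x" using C1c_outside[OF \<psi>, of x] by (cases "x \<in> \<Omega>") auto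
    qed
    finally show ?thesis .
  qed
  have rep: "- (LINT x|lborel. u x * frechet_derivative \<psi> (at x) (axis i 1)) = (LINT x|\<nu> (i, True). \<psi> x) - (LINT x|\<nu> (i, False). \<psi> x)"
    if \<psi>: "\<psi> \<in> C1c \<Omega>" for i \<psi>
    using p \<psi> unfolding int\<nu>[OF \<psi>] by (simp add: \<nu>0_def)
  obtain N where N: "finite_measure N" "sets N = sets X"
    "\<And>A. A \<in> sets X \<Longrightarrow> emeasure N A = (\<Sum>t\<in>UNIV. emeasure (\<nu> t) A)"
    using finite_measure_sum[of "UNIV :: ('n \<times> bool) set" \<nu> X] \<nu> by (metis finite_class.finite_UNIV)
  interpret N: finite_measure N by (rule N(1))
  have spN: "space N = \<Omega>" using sets_eq_imp_space_eq[OF N(2)] spX by simp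
  have "\<forall>t. \<exists>F. F \<in> borel_measurable N \<and> (\<forall>x. 0 \<le> F x) \<and> integrable N F \<and>
    (\<forall>\<psi>. \<psi> \<in> borel_measurable N \<longrightarrow> (LINT x|\<nu> t. \<psi> x) = (LINT x|N. F x * \<psi> x :: real))"
  proof
    fix t
    have le: "emeasure (\<nu> t) A \<le> emeasure N A" if "A \<in> sets N" for A
      using N(2,3) that member_le_sum[of t UNIV "\<lambda>t. emeasure (\<nu> t) A"] by simp
    obtain F :: "real^'n \<Rightarrow> real" where "F \<in> borel_measurable N" "\<And>x. 0 \<le> F x" "integrable N F"
      "\<And>\<psi>. \<psi> \<in> borel_measurable N \<Longrightarrow> (LINT x|\<nu> t. \<psi> x) = (LINT x|N. F x * \<psi> x :: real)"
      using real_density[OF N(1) \<nu>(1)[of t] _ le] \<nu>(2)[of t] N(2) by metis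
    then show "\<exists>F. F \<in> borel_measurable N \<and> (\<forall>x. 0 \<le> F x) \<and> integrable N F \<and>
      (\<forall>\<psi>. \<psi> \<in> borel_measurable N \<longrightarrow> (LINT x|\<nu> t. \<psi> x) = (LINT x|N. F x * \<psi> x :: real))" by blast
  qed
  from choice[OF this] obtain F where "\<forall>t. F t \<in> borel_measurable N \<and> (\<forall>x. 0 \<le> F t x) \<and> integrable N (F t) \<and>
    (\<forall>\<psi>. \<psi> \<in> borel_measurable N \<longrightarrow> (LINT x|\<nu> t. \<psi> x) = (LINT x|N. F t x * \<psi> x :: real))" by (rule exE)
  then have F: "\<And>t. F t \<in> borel_measurable N" "\<And>t. integrable N (F t)"
    "\<And>t \<psi>. \<psi> \<in> borel_measurable N \<Longrightarrow> (LINT x|\<nu> t. \<psi> x) = (LINT x|N. F t x * \<psi> x)" by auto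
  define v :: "real^'n \<Rightarrow> real^'n" where "v x = (\<Sum>i\<in>UNIV. (F (i, True) x - F (i, False) x) *\<^sub>R axis i 1)" for x
  have vi: "v x $ i = F (i, True) x - F (i, False) x" for x i
  proof -
    have "v x $ i = (\<Sum>j\<in>UNIV. if j = i then F (i, True) x - F (i, False) x else 0)"
      unfolding v_def sum_component by (rule sum.cong) (auto simp: axis_def)
    then show ?thesis by simp
  qed
  have iv: "integrable N v"
    unfolding v_def by (intro Bochner_Integration.integrable_sum integrable_scaleR_left Bochner_Integration.integrable_diff F(2))
  then have [measurable]: "v \<in> borel_measurable N" by auto
  \<comment> \<open>With this density the set where v = 0 is null for \<mu>, so dividing v by its
    norm gives a unit vector almost everywhere.\<close>
  define \<mu> where "\<mu> = density N (\<lambda>x. ennreal (norm (v x)))"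
  define \<sigma> where "\<sigma> x = v x /\<^sub>R norm (v x)" for x
  have [measurable]: "\<sigma> \<in> borel_measurable N" unfolding \<sigma>_def by measurable
  have "is_derivative_measure \<Omega> w (\<mu>, \<sigma>)"
    unfolding is_derivative_measure_def prod.case
  proof (intro conjI ballI)
    show "space \<mu> = \<Omega>" using spN by (simp add: \<mu>_def)
    show "sets \<mu> = sets (restrict_space borel \<Omega>)" using N(2) by (simp add: \<mu>_def X_def)
    show "finite_measure \<mu>"
    proof (rule finite_measureI)
      have "emeasure \<mu> (space \<mu>) = (\<integral>\<^sup>+x. ennreal (norm (v x)) \<partial>N)" by (simp add: \<mu>_def emeasure_density)
      also have "\<dots> = ennreal (LINT x|N. norm (v x))" by (rule nn_integral_eq_integral) (use iv in auto)
      finally show "emeasure \<mu> (space \<mu>) \<noteq> \<infinity>" by simp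
    qed
    show "\<sigma> \<in> borel_measurable \<mu>" by (simp add: \<mu>_def)
    show "AE x in \<mu>. norm (\<sigma> x) = 1" unfolding \<mu>_def by (subst AE_density) (auto simp: \<sigma>_def)
    fix \<phi> :: "real^'n \<Rightarrow> real^'n" assume \<phi>: "\<phi> \<in> C1c \<Omega>"
    have \<phi>i: "(\<lambda>x. \<phi> x $ i) \<in> C1c \<Omega>" for i by (rule C1c_component(1)[OF \<phi>])
    have mN: "f \<in> borel_measurable N" if "continuous_on UNIV f" for f :: "real^'n \<Rightarrow> 'b::metric_space"
    proof -
      have "f \<in> borel_measurable X" unfolding X_def
        by (intro measurable_restrict_space1 borel_measurable_continuous_onI that)
      then show ?thesis using measurable_cong_sets[OF N(2) refl] by blast
    qed
    obtain b where b: "0 \<le> b" "\<And>x. norm (\<phi> x) \<le> b" using C1c_bounded[OF \<phi>] by metis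
    have \<phi>m: "\<phi> \<in> borel_measurable N" by (rule mN[OF C1c_continuous[OF \<phi>]])
    have \<phi>im: "(\<lambda>x. \<phi> x $ i) \<in> borel_measurable N" for i by (rule mN[OF C1c_continuous[OF \<phi>i]])
    have iF: "integrable N (\<lambda>x. F t x * \<phi> x $ i)" for t i
    proof (rule Bochner_Integration.integrable_bound)
      show "integrable N (\<lambda>x. norm (F t x) * b)" by (intro integrable_mult_left integrable_norm F(2))
      show "(\<lambda>x. F t x * \<phi> x $ i) \<in> borel_measurable N" using F(1) \<phi>im by measurable
      show "AE x in N. norm (F t x * \<phi> x $ i) \<le> norm (norm (F t x) * b)"
      proof (rule AE_I2)
        fix x
        have "\<bar>\<phi> x $ i\<bar> \<le> b" using component_le_norm_cart[of "\<phi> x" i] b(2)[of x] by linarith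
        then have "\<bar>F t x\<bar> * \<bar>\<phi> x $ i\<bar> \<le> \<bar>F t x\<bar> * b" by (intro mult_left_mono) auto
        then show "norm (F t x * \<phi> x $ i) \<le> norm (norm (F t x) * b)" using b(1) by (simp add: abs_mult)
      qed
    qed
    have i0: "integrable lborel (\<lambda>x. u x * frechet_derivative (\<lambda>x. \<phi> x $ i) (at x) (axis i 1))" for i
    proof -
      obtain L' where L': "\<And>x v. norm (frechet_derivative (\<lambda>x. \<phi> x $ i) (at x) v) \<le> L' * norm v"
        using C1c_deriv_bounded[OF \<phi>i] by metis
      show ?thesis
        by (rule u_mult_integrable[OF C1c_deriv_measurable[OF \<phi>i], where B=L'])
          (use L'[of _ "axis i 1"] in \<open>simp add: norm_axis_1\<close>)
    qed
    have "(LINT x|\<mu>. \<phi> x \<bullet> \<sigma> x) = (LINT x|N. norm (v x) *\<^sub>R (\<phi> x \<bullet> \<sigma> x))"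
      unfolding \<mu>_def by (rule integral_density) (use \<phi>m in auto)
    also have "\<dots> = (LINT x|N. (\<Sum>i\<in>UNIV. F (i, True) x * \<phi> x $ i - F (i, False) x * \<phi> x $ i))"
    proof (rule Bochner_Integration.integral_cong[OF refl])
      fix x
      have "norm (v x) *\<^sub>R (\<phi> x \<bullet> \<sigma> x) = \<phi> x \<bullet> v x" by (cases "v x = 0") (auto simp: \<sigma>_def)
      also have "\<dots> = (\<Sum>i\<in>UNIV. F (i, True) x * \<phi> x $ i - F (i, False) x * \<phi> x $ i)"
        by (simp add: inner_vec_def vi algebra_simps)
      finally show "norm (v x) *\<^sub>R (\<phi> x \<bullet> \<sigma> x) = (\<Sum>i\<in>UNIV. F (i, True) x * \<phi> x $ i - F (i, False) x * \<phi> x $ i)" .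
    qed
    also have "\<dots> = (\<Sum>i\<in>UNIV. LINT x|N. F (i, True) x * \<phi> x $ i - F (i, False) x * \<phi> x $ i)"
      by (intro Bochner_Integration.integral_sum Bochner_Integration.integrable_diff iF)
    also have "\<dots> = (\<Sum>i\<in>UNIV. - (LINT x|lborel. u x * frechet_derivative (\<lambda>x. \<phi> x $ i) (at x) (axis i 1)))"
    proof (rule sum.cong)
      fix i
      have "(LINT x|N. F (i, True) x * \<phi> x $ i - F (i, False) x * \<phi> x $ i)
        = (LINT x|N. F (i, True) x * \<phi> x $ i) - (LINT x|N. F (i, False) x * \<phi> x $ i)"
        by (rule Bochner_Integration.integral_diff[OF iF iF])
      also have "\<dots> = (LINT x|\<nu> (i, True). \<phi> x $ i) - (LINT x|\<nu> (i, False). \<phi> x $ i)"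
        unfolding F(3)[OF \<phi>im] ..
      also have "\<dots> = - (LINT x|lborel. u x * frechet_derivative (\<lambda>x. \<phi> x $ i) (at x) (axis i 1))"
        by (rule rep[OF \<phi>i, symmetric])
      finally show "(LINT x|N. F (i, True) x * \<phi> x $ i - F (i, False) x * \<phi> x $ i)
        = - (LINT x|lborel. u x * frechet_derivative (\<lambda>x. \<phi> x $ i) (at x) (axis i 1))" .
    qed simp
    also have "\<dots> = - (\<Sum>i\<in>UNIV. LINT x|lborel. u x * frechet_derivative (\<lambda>x. \<phi> x $ i) (at x) (axis i 1))"
      by (rule sum_negf)
    also have "(\<Sum>i\<in>UNIV. LINT x|lborel. u x * frechet_derivative (\<lambda>x. \<phi> x $ i) (at x) (axis i 1))
      = (LINT x|lborel. u x * divergence \<phi> x)"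
    proof -
      have "(\<Sum>i\<in>UNIV. LINT x|lborel. u x * frechet_derivative (\<lambda>x. \<phi> x $ i) (at x) (axis i 1))
        = (LINT x|lborel. (\<Sum>i\<in>UNIV. u x * frechet_derivative (\<lambda>x. \<phi> x $ i) (at x) (axis i 1)))"
        by (rule Bochner_Integration.integral_sum[symmetric]) (rule i0)
      then show ?thesis by (simp add: divergence_eq[OF \<phi>] sum_distrib_left)
    qed
    finally show "(LINT x|lebesgue_on \<Omega>. w x * divergence \<phi> x) = - (LINT x|\<mu>. \<phi> x \<bullet> \<sigma> x)"
      using integral_test_eq[OF open_dom u_borel u_zero w \<phi>] by simp
  qed
  then show ?thesis unfolding derivative_measure_def by (rule someI[of "is_derivative_measure \<Omega> w"])
qed

text \<open>D is an arbitrary derivative measure, and its total mass is not compared with T. A third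
  function \<zeta> in \<open>C1c\<close>, within an arbitrary e of \<psi>, carries the estimate: the
  mass of D is multiplied by e only, while \<zeta> - \<eta> is a test function of size e + s and
  costs (e + s) T. Letting e tend to 0 leaves s T, a bound that is uniform over functions with a
  common T.\<close>

lemma derivative_pairing_close:
  assumes w: "w \<in> borel_measurable (lebesgue_on \<Omega>)" "AE x in lborel. x \<in> \<Omega> \<longrightarrow> w x = u x"
    and D: "is_derivative_measure \<Omega> w D" and \<psi>: "\<psi> \<in> C0 \<Omega>" and \<eta>: "\<eta> \<in> C1c \<Omega>"
    and s: "0 \<le> s" "\<And>x. x \<in> \<Omega> \<Longrightarrow> \<bar>\<psi> x - \<eta> x\<bar> \<le> s"
  shows "\<bar>vector_measure_integral D \<psi> $ i + (LINT x|lborel. u x * frechet_derivative \<eta> (at x) (axis i 1))\<bar> \<le> s * T"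
proof -
  have test_eq: "(LINT x|lebesgue_on \<Omega>. w x * divergence \<phi> x) = (LINT x|lborel. u x * divergence \<phi> x)"
    if "\<phi> \<in> C1c \<Omega>" for \<phi> by (rule integral_test_eq[OF open_dom u_borel u_zero w that])
  obtain \<mu> \<sigma> where D': "D = (\<mu>, \<sigma>)" by (cases D)
  have m: "space \<mu> = \<Omega>" "sets \<mu> = sets (restrict_space borel \<Omega>)" "finite_measure \<mu>"
    "\<sigma> \<in> borel_measurable \<mu>" "AE x in \<mu>. norm (\<sigma> x) = 1"
    "\<And>\<phi>. \<phi> \<in> C1c \<Omega> \<Longrightarrow> (LINT x|lebesgue_on \<Omega>. w x * divergence \<phi> x) = - (LINT x|\<mu>. \<phi> x \<bullet> \<sigma> x)"
    using D unfolding D' is_derivative_measure_def by auto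
  interpret finite_measure \<mu> by (rule m(3))
  have meas: "f \<in> borel_measurable \<mu>" if "continuous_on \<Omega> f" for f :: "real^'n \<Rightarrow> real"
    using borel_measurable_continuous_on_restrict[OF that] measurable_cong_sets[OF m(2) refl] by blast
  have bint: "integrable \<mu> (\<lambda>x. f x *\<^sub>R \<sigma> x)" if f: "continuous_on \<Omega> f" and b: "\<And>x. x \<in> \<Omega> \<Longrightarrow> \<bar>f x\<bar> \<le> b" for f :: "real^'n \<Rightarrow> real" and b
  proof (rule integrable_const_bound[where B=b])
    show "AE x in \<mu>. norm (f x *\<^sub>R \<sigma> x) \<le> b"
      using m(5) AE_space
      by eventually_elim (use b m(1) in auto)
    show "(\<lambda>x. f x *\<^sub>R \<sigma> x) \<in> borel_measurable \<mu>" using meas[OF f] m(4) by measurable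
  qed
  define L where "L f = vector_measure_integral D f $ i" for f
  have Ldiff: "\<bar>L f - L g\<bar> \<le> e * measure \<mu> (space \<mu>)"
    if f: "continuous_on \<Omega> f" "\<And>x. x \<in> \<Omega> \<Longrightarrow> \<bar>f x\<bar> \<le> b" and g: "continuous_on \<Omega> g" "\<And>x. x \<in> \<Omega> \<Longrightarrow> \<bar>g x\<bar> \<le> b'"
      and e: "\<And>x. x \<in> \<Omega> \<Longrightarrow> \<bar>f x - g x\<bar> \<le> e" for f g b b' e
  proof -
    have i: "integrable \<mu> (\<lambda>x. f x *\<^sub>R \<sigma> x)" "integrable \<mu> (\<lambda>x. g x *\<^sub>R \<sigma> x)" by (rule bint[OF f], simp) (rule bint[OF g], simp)
    have "L f - L g = (LINT x|\<mu>. (f x - g x) *\<^sub>R \<sigma> x) $ i"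
      unfolding L_def vector_measure_integral_def D' using i by (simp add: scaleR_diff_left)
    then have "\<bar>L f - L g\<bar> \<le> norm (LINT x|\<mu>. (f x - g x) *\<^sub>R \<sigma> x)" using component_le_norm_cart by metis
    also have "\<dots> \<le> (LINT x|\<mu>. norm ((f x - g x) *\<^sub>R \<sigma> x))" by (rule integral_norm_bound)
    also have "\<dots> \<le> (LINT x|\<mu>. e)"
    proof (rule integral_mono_AE)
      show "integrable \<mu> (\<lambda>x. norm ((f x - g x) *\<^sub>R \<sigma> x))"
        unfolding scaleR_diff_left by (intro integrable_norm Bochner_Integration.integrable_diff i)
      show "AE x in \<mu>. norm ((f x - g x) *\<^sub>R \<sigma> x) \<le> e"
        using m(5) AE_space by eventually_elim (use e m(1) in auto)
    qed simp
    finally show ?thesis by (simp add: mult.commute)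
  qed
  have LC: "L \<zeta> = - (LINT x|lborel. u x * frechet_derivative \<zeta> (at x) (axis i 1))" if \<zeta>: "\<zeta> \<in> C1c \<Omega>" for \<zeta>
  proof -
    obtain b where b: "\<And>x. norm (\<zeta> x) \<le> b" using C1c_bounded[OF \<zeta>] by metis
    have ib: "integrable \<mu> (\<lambda>x. \<zeta> x *\<^sub>R \<sigma> x)" by (rule bint[OF C1c_continuous[OF \<zeta>]]) (use b in simp)
    have "L \<zeta> = (LINT x|\<mu>. (\<zeta> x *\<^sub>R \<sigma> x) $ i)"
      unfolding L_def vector_measure_integral_def D' using integral_bounded_linear[OF bounded_linear_vec_nth ib] by simp
    also have "\<dots> = (LINT x|\<mu>. (\<zeta> x *\<^sub>R axis i 1) \<bullet> \<sigma> x)" by (simp add: inner_axis')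
    also have "\<dots> = - (LINT x|lebesgue_on \<Omega>. w x * divergence (\<lambda>x. \<zeta> x *\<^sub>R axis i 1) x)"
      using m(6)[OF C1c_axis(1)[OF \<zeta>, of i]] by simp
    also have "\<dots> = - (LINT x|lborel. u x * frechet_derivative \<zeta> (at x) (axis i 1))"
      using test_eq[OF C1c_axis(1)[OF \<zeta>, of i]] by (simp only: C1c_axis(2)[OF \<zeta>])
    finally show ?thesis .
  qed
  obtain b\<eta> where b\<eta>: "\<And>x. norm (\<eta> x) \<le> b\<eta>" using C1c_bounded[OF \<eta>] by metis
  have \<psi>b: "\<bar>\<psi> x\<bar> \<le> b\<eta> + s" if "x \<in> \<Omega>" for x using s(2)[OF that] b\<eta>[of x] by simp
  have \<psi>c: "continuous_on \<Omega> \<psi>" using \<psi> by (simp add: C0_def)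
  define m0 where "m0 = measure \<mu> (space \<mu>)"
  have m0: "0 \<le> m0" by (simp add: m0_def)
  have main: "\<bar>L \<psi> - L \<eta>\<bar> \<le> s * T + e * (m0 + T)" if e: "0 < e" for e
  proof -
    obtain \<zeta> where \<zeta>: "\<zeta> \<in> C1c \<Omega>" "\<And>x. x \<in> \<Omega> \<Longrightarrow> \<bar>\<psi> x - \<zeta> x\<bar> \<le> e" using C0_approx[OF open_dom \<psi> e] by metis
    obtain b\<zeta> where b\<zeta>: "\<And>x. norm (\<zeta> x) \<le> b\<zeta>" using C1c_bounded[OF \<zeta>(1)] by metis
    have 1: "\<bar>L \<psi> - L \<zeta>\<bar> \<le> e * m0" unfolding m0_def
      by (rule Ldiff[OF \<psi>c \<psi>b C1c_continuous[OF \<zeta>(1)] _ \<zeta>(2)]) (use b\<zeta> in auto)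
    have ii: "integrable lborel (\<lambda>x. u x * frechet_derivative f (at x) (axis i 1))" if f: "f \<in> C1c \<Omega>" for f :: "real^'n \<Rightarrow> real"
    proof -
      obtain L' where L': "\<And>x v. norm (frechet_derivative f (at x) v) \<le> L' * norm v"
        using C1c_deriv_bounded[OF f] by metis
      show ?thesis
        by (rule u_mult_integrable[OF C1c_deriv_measurable[OF f], of "axis i 1" L'])
          (use L'[of _ "axis i 1"] in \<open>simp add: norm_axis_1\<close>)
    qed
    have "\<bar>LINT x|lborel. u x * frechet_derivative (\<lambda>x. \<zeta> x - \<eta> x) (at x) (axis i 1)\<bar> \<le> (e + s) * T"
    proof (rule partial_le[OF C1c_diff(1)[OF \<zeta>(1) \<eta>]])
      fix x
      show "\<bar>\<zeta> x - \<eta> x\<bar> \<le> e + s"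
      proof (cases "x \<in> \<Omega>")
        case True
        then show ?thesis using \<zeta>(2)[OF True] s(2)[OF True] by linarith
      next
        case False
        then show ?thesis using C1c_outside[OF \<zeta>(1)] C1c_outside[OF \<eta>] e s(1) by simp
      qed
    qed
    moreover have "frechet_derivative (\<lambda>x. \<zeta> x - \<eta> x) (at x) (axis i 1)
      = frechet_derivative \<zeta> (at x) (axis i 1) - frechet_derivative \<eta> (at x) (axis i 1)" for x
      by (rule C1c_diff(2)[OF \<zeta>(1) \<eta>])
    ultimately have "\<bar>L \<zeta> - L \<eta>\<bar> \<le> (e + s) * T"
      unfolding LC[OF \<zeta>(1)] LC[OF \<eta>] using ii[OF \<zeta>(1)] ii[OF \<eta>] by (simp add: right_diff_distrib abs_minus_commute)
    then show ?thesis using 1 by (simp add: algebra_simps)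
  qed
  have "\<bar>L \<psi> - L \<eta>\<bar> \<le> s * T"
  proof (rule field_le_epsilon)
    fix e :: real assume e: "0 < e"
    have pos: "0 < m0 + T + 1" using m0 T_nonneg by simp
    have "e / (m0 + T + 1) * (m0 + T) \<le> e" using pos e by (simp add: field_simps)
    then show "\<bar>L \<psi> - L \<eta>\<bar> \<le> s * T + e" using main[of "e / (m0 + T + 1)"] e pos by simp
  qed
  then show ?thesis unfolding LC[OF \<eta>] by (simp add: L_def)
qed

end

subsection \<open>The recovery sequence\<close>

lemma TV_borel_le:
  fixes v :: "real^'n \<Rightarrow> real"
  assumes \<Omega>: "open \<Omega>" and v: "v \<in> borel_measurable borel" "\<And>x. x \<notin> \<Omega> \<Longrightarrow> v x = 0"
    and le: "\<And>\<phi>. \<phi> \<in> C1c \<Omega> \<Longrightarrow> (\<And>x. norm (\<phi> x) \<le> 1) \<Longrightarrow> (LINT x|lborel. v x * divergence \<phi> x) \<le> C"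
  shows "TV \<Omega> v \<le> ereal C"
  unfolding TV_def
proof (rule SUP_least, clarify)
  fix \<phi> :: "real^'n \<Rightarrow> real^'n" assume \<phi>: "\<phi> \<in> C1c \<Omega>" "\<forall>x. norm (\<phi> x) \<le> 1"
  have vm: "v \<in> borel_measurable (lebesgue_on \<Omega>)"
    using v(1) by (intro measurable_restrict_space1 measurable_completion) simp
  have "(LINT x|lebesgue_on \<Omega>. v x * divergence \<phi> x) = (LINT x|lborel. v x * divergence \<phi> x)"
    by (rule integral_test_eq[OF \<Omega> v vm _ \<phi>(1)]) simp_all
  then show "ereal (LINT x|lebesgue_on \<Omega>. v x * divergence \<phi> x) \<le> ereal C" using le[OF \<phi>(1)] \<phi>(2) by simp
qed

lemma integrable_lebesgue_on_borel:
  fixes v :: "real^'n \<Rightarrow> real"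
  assumes \<Omega>: "open \<Omega>" "bounded \<Omega>" and v: "v \<in> borel_measurable borel" "\<And>x. \<bar>v x\<bar> \<le> B"
  shows "integrable (lebesgue_on \<Omega>) v"
proof -
  have [measurable]: "\<Omega> \<in> sets borel" "v \<in> borel_measurable borel" using \<Omega>(1) v(1) by auto
  have "integrable lborel (\<lambda>x. indicator \<Omega> x *\<^sub>R v x)"
  proof (rule integrable_lborel_bounded_support[where B=B and K=\<Omega>])
    show "(\<lambda>x. indicator \<Omega> x *\<^sub>R v x) \<in> borel_measurable borel" by measurable
    show "norm (indicator \<Omega> x *\<^sub>R v x) \<le> B" for x
      using v(2)[of x] order_trans[OF abs_ge_zero v(2)[of x]] by (auto simp: indicator_def)
  qed (use \<Omega> in auto)
  then have "integrable lebesgue (\<lambda>x. indicator \<Omega> x *\<^sub>R v x)" by (subst integrable_completion) auto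
  then show ?thesis using \<Omega>(1) by (subst integrable_restrict_space) auto
qed

text \<open>Sampling evaluates the function at points, so the representative takes values in W at
  every point of \<Omega>: where the Borel version leaves W, an element k of W is inserted.\<close>

lemma borel_representative:
  fixes w :: "real^'n \<Rightarrow> real"
  assumes \<Omega>: "open \<Omega>" and w: "w \<in> borel_measurable (lebesgue_on \<Omega>)" and W: "finite W" "W \<noteq> {}"
    and ae: "AE x in lebesgue_on \<Omega>. w x \<in> W"
  obtains u where "u \<in> borel_measurable borel" "\<And>x. x \<in> \<Omega> \<Longrightarrow> u x \<in> W" "\<And>x. x \<notin> \<Omega> \<Longrightarrow> u x = 0"
    "AE x in lborel. x \<in> \<Omega> \<longrightarrow> w x = u x" "\<And>x. \<bar>u x\<bar> \<le> (\<Sum>k\<in>W. \<bar>k\<bar>)"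
proof -
  have "(\<lambda>x. indicator \<Omega> x *\<^sub>R w x) \<in> borel_measurable lebesgue"
    using w \<Omega> by (subst (asm) borel_measurable_restrict_space_iff) auto
  from completion_ex_borel_measurable_real[OF this] obtain g :: "real^'n \<Rightarrow> real"
    where [measurable]: "g \<in> borel_measurable lborel" and g: "AE x in lborel. indicator \<Omega> x *\<^sub>R w x = g x" by blast
  obtain k where k: "k \<in> W" using W by blast
  have [measurable]: "\<Omega> \<in> sets borel" "W \<in> sets borel" using \<Omega> finite_imp_closed[OF W(1)] by auto
  define u where "u x = (if x \<in> \<Omega> then if g x \<in> W then g x else k else 0)" for x
  show ?thesis
  proof
    show "u \<in> borel_measurable borel" unfolding u_def by measurable
    show "u x \<in> W" if "x \<in> \<Omega>" for x using that k by (simp add: u_def)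
    show "u x = 0" if "x \<notin> \<Omega>" for x using that by (simp add: u_def)
    have "AE x in lborel. x \<in> \<Omega> \<longrightarrow> w x \<in> W" using ae AE_lebesgue_on_iff[OF \<Omega>] by simp
    with g show "AE x in lborel. x \<in> \<Omega> \<longrightarrow> w x = u x" by eventually_elim (auto simp: u_def)
    show "\<bar>u x\<bar> \<le> (\<Sum>k\<in>W. \<bar>k\<bar>)" for x
      using member_le_sum[of "u x" W abs] \<open>\<And>x. x \<in> \<Omega> \<Longrightarrow> u x \<in> W\<close>[of x] W(1)
      by (cases "x \<in> \<Omega>") (auto simp: u_def sum_nonneg)
  qed
qed

text \<open>The same function u is viewed on two meshes: the shift is chosen on the input mesh, and
  \<open>TVh_le\<close> is applied on the TV mesh. The bound on the weighted sum from
  \<open>good_sample\<close> splits into two because both terms are nonnegative.\<close>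

lemma recovery_step:
  fixes \<Omega> :: "(real^'n) set"
  assumes lip: "lipschitz_domain \<Omega>" and u: "bv_function \<Omega> u M T" and uW: "\<And>x. x \<in> \<Omega> \<Longrightarrow> u x \<in> W"
    and pair: "admissible_mesh_pair \<Omega> h \<tau> \<Q> \<R>"
  obtains v where "v \<in> borel_measurable borel" "\<exists>B. \<forall>x. \<bar>v x\<bar> \<le> B" "\<And>x. x \<notin> \<Omega> \<Longrightarrow> v x = 0"
    "AE x in lborel. x \<in> \<Omega> \<longrightarrow> v x \<in> W" "v \<in> P0 \<R>"
    "\<And>\<phi>. \<phi> \<in> C1c \<Omega> \<Longrightarrow> (\<And>x. norm (\<phi> x) \<le> 1) \<Longrightarrow>
      (LINT x|lborel. v x * divergence \<phi> x) \<le> sqrt (real CARD('n)) * T * (1 + 2 ^ CARD('n) * sqrt (\<tau> / h))"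
    "TVh \<Omega> \<Q> v \<le> ereal (T + 2 * real CARD('n) * (sqrt (real CARD('n)) * T * (1 + 2 ^ CARD('n))) * sqrt (\<tau> / h))"
    "(LINT x|lborel. \<bar>v x - u x\<bar>) \<le> sqrt (real CARD('n)) * T * (1 + 2 ^ CARD('n)) * h"
proof -
  interpret u: bv_function \<Omega> u M T by (rule u)
  have m: "is_mesh \<Omega> h \<Q>" "is_mesh \<Omega> \<tau> \<R>" "0 < h" "0 < \<tau>" "\<tau> \<le> h"
    using pair by (auto simp: admissible_mesh_pair_def)
  have "cubical_mesh \<Omega> h \<Q>" by (rule cubical_mesh.intro[OF m(1) lip u.bounded_dom])
  then interpret coarse: sampling \<Omega> h \<Q> u M T by (rule sampling.intro[OF _ u])
  have "cubical_mesh \<Omega> \<tau> \<R>" by (rule cubical_mesh.intro[OF m(2) lip u.bounded_dom])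
  then interpret fine: sampling \<Omega> \<tau> \<R> u M T by (rule sampling.intro[OF _ u])
  define \<delta> where "\<delta> = sqrt (\<tau> / h)"
  have \<delta>: "0 < \<delta>" "\<delta> \<le> 1" "\<delta> * \<delta> = \<tau> / h" using m by (auto simp: \<delta>_def)
  define k where "k = sqrt (real CARD('n)) * T"
  have k0: "0 \<le> k" using u.T_nonneg by (simp add: k_def)
  obtain y where y: "y \<in> box 0 (vec \<tau>)"
    "\<tau> ^ (CARD('n) - 1) * (\<Sum>i\<in>UNIV. fine.jump_sum (\<lambda>a. u (a + y)) i) + \<delta> / \<tau> * fine.defect y
      \<le> k * (1 + \<delta> * 2 ^ CARD('n))"
    using fine.good_sample[OF \<delta>(1)] unfolding k_def by blast
  define c where "c = (\<lambda>a. u (a + y))"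
  define v where "v = fine.step_fun c"
  define J where "J = \<tau> ^ (CARD('n) - 1) * (\<Sum>i\<in>UNIV. fine.jump_sum c i)"
  define E where "E = (LINT x|lborel. \<bar>v x - u x\<bar>)"
  have J0: "0 \<le> J" unfolding J_def using m(4) fine.jump_sum_nonneg by (simp add: sum_nonneg)
  have E0: "0 \<le> E" by (simp add: E_def)
  have JE: "J + \<delta> / \<tau> * E \<le> k * (1 + \<delta> * 2 ^ CARD('n))"
    using y(2) by (simp add: J_def E_def fine.defect_def c_def v_def)
  have J1: "J \<le> k * (1 + 2 ^ CARD('n) * \<delta>)"
  proof -
    have "0 \<le> \<delta> / \<tau> * E" using \<delta>(1) m(4) E0 by simp
    then show ?thesis using JE by (simp add: mult.commute)
  qed
  have E1: "E \<le> k * (1 + 2 ^ CARD('n)) * (\<delta> * h)"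
  proof -
    have "\<delta> / \<tau> * E \<le> k * (1 + \<delta> * 2 ^ CARD('n))" using JE J0 by linarith
    also have "\<dots> \<le> k * (1 + 2 ^ CARD('n))" using \<delta> k0 by (intro mult_left_mono add_mono) (auto simp: mult_left_le_one_le)
    finally have "E \<le> k * (1 + 2 ^ CARD('n)) * (\<tau> / \<delta>)" using \<delta>(1) m(4) by (simp add: field_simps)
    \<comment> \<open>This is where the square root matters: the error \<tau> / \<delta> equals
      \<delta> h, which after division by h leaves the small factor \<delta>.\<close>
    moreover have "\<tau> / \<delta> = \<delta> * h" using \<delta>(1,3) m(3) by (simp add: field_simps)
    ultimately show ?thesis by simp
  qed
  have vb: "\<bar>v x\<bar> \<le> (\<Sum>a\<in>fine.corners. \<bar>c a\<bar>)" for x unfolding v_def by (rule fine.step_fun_bound)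
  show ?thesis
  proof
    show vm: "v \<in> borel_measurable borel" unfolding v_def by (rule fine.step_fun_measurable)
    show "\<exists>B. \<forall>x. \<bar>v x\<bar> \<le> B" using vb by blast
    show vz: "v x = 0" if "x \<notin> \<Omega>" for x unfolding v_def by (rule fine.step_fun_outside[OF that])
    have cW: "c a \<in> W" if a: "a \<in> fine.corners" for a
    proof -
      have "a + y \<in> box a (a + vec \<tau>)" using y(1) by (simp add: mem_box_cart)
      then show ?thesis unfolding c_def using fine.cell_subset[OF a] uW by blast
    qed
    show "AE x in lborel. x \<in> \<Omega> \<longrightarrow> v x \<in> W"
      using fine.AE_cell by (rule eventually_mono) (use fine.step_fun_cell cW in \<open>auto simp: v_def\<close>)
    show "v \<in> P0 \<R>"
      unfolding P0_def
    proof (intro CollectI ballI)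
      fix Q assume "Q \<in> \<R>"
      then obtain a where a: "a \<in> fine.corners" "Q = cube a \<tau>" using fine.Q_eq by blast
      have "cube a \<tau> - box a (a + vec \<tau>) \<in> null_sets lebesgue"
        unfolding negligible_iff_null_sets[symmetric] cube_def by (rule negligible_frontier_interval)
      then have "AE x in lebesgue. x \<notin> cube a \<tau> - box a (a + vec \<tau>)" by (rule AE_not_in)
      then have "AE x in lebesgue. x \<in> Q \<longrightarrow> v x = c a"
        by (rule eventually_mono) (use fine.step_fun_cell[OF a(1)] a(2) in \<open>auto simp: v_def\<close>)
      then have "AE x in lebesgue_on Q. v x = c a"
        by (subst AE_restrict_space_iff) (auto simp: a(2) cube_def)
      then show "\<exists>r. AE x in lebesgue_on Q. v x = r" by blast
    qed
    show "(LINT x|lborel. v x * divergence \<phi> x) \<le> sqrt (real CARD('n)) * T * (1 + 2 ^ CARD('n) * sqrt (\<tau> / h))"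
      if \<phi>: "\<phi> \<in> C1c \<Omega>" "\<And>x. norm (\<phi> x) \<le> 1" for \<phi>
      using fine.step_fun_variation_le[OF \<phi>, of c] J1 unfolding v_def J_def k_def \<delta>_def by linarith
    have "TVh \<Omega> \<Q> v \<le> ereal (T + 2 * real CARD('n) / h * E)"
      unfolding E_def by (rule coarse.TVh_le[OF vm vb vz])
    also have "T + 2 * real CARD('n) / h * E \<le> T + 2 * real CARD('n) / h * (k * (1 + 2 ^ CARD('n)) * (\<delta> * h))"
      using m(3) by (intro add_left_mono mult_left_mono E1) auto
    also have "\<dots> = T + 2 * real CARD('n) * (k * (1 + 2 ^ CARD('n))) * \<delta>" using m(3) by simp
    finally show "TVh \<Omega> \<Q> v \<le> ereal (T + 2 * real CARD('n) * (sqrt (real CARD('n)) * T * (1 + 2 ^ CARD('n))) * sqrt (\<tau> / h))"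
      by (simp add: k_def \<delta>_def)
    have "E \<le> k * (1 + 2 ^ CARD('n)) * (1 * h)"
      by (rule order_trans[OF E1]) (use \<delta>(2) m(3) k0 in \<open>intro mult_left_mono mult_right_mono; auto\<close>)
    then show "(LINT x|lborel. \<bar>v x - u x\<bar>) \<le> sqrt (real CARD('n)) * T * (1 + 2 ^ CARD('n)) * h"
      by (simp add: E_def k_def)
  qed
qed

text \<open>Thanks to the common bound T', the estimate of \<open>derivative_pairing_close\<close>
  is uniform along the filter. So \<psi> can be replaced by a fixed test function \<eta> at the cost
  s (T' + T), and for \<eta> the pairing is an integral of the function against a bounded
  derivative, which converges with the L1 distance.\<close>

lemma weak_star_BV_I:
  fixes ws us :: "'i \<Rightarrow> real^'n \<Rightarrow> real"
  assumes u: "bv_function \<Omega> u M T" and w: "w \<in> BV \<Omega>" "AE x in lborel. x \<in> \<Omega> \<longrightarrow> w x = u x"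
    and ws: "\<forall>\<^sub>F i in \<F>. ws i \<in> BV \<Omega> \<and> ws i \<in> borel_measurable borel \<and> (\<exists>B. bv_function \<Omega> (ws i) B T')"
    and lim: "((\<lambda>i. LINT x|lborel. \<bar>ws i x - u x\<bar>) \<longlongrightarrow> 0) \<F>"
  shows "weak_star_BV \<Omega> ws w \<F>"
  unfolding weak_star_BV_def
proof (intro conjI ballI)
  interpret u: bv_function \<Omega> u M T by (rule u)
  have wm: "w \<in> borel_measurable (lebesgue_on \<Omega>)" using w(1) by (auto simp: BV_def L1_def)
  show "\<forall>\<^sub>F i in \<F>. ws i \<in> BV \<Omega>" using ws by (rule eventually_mono) simp
  show "w \<in> BV \<Omega>" by (rule w(1))
  have "\<forall>\<^sub>F i in \<F>. (LINT x|lborel. \<bar>ws i x - u x\<bar>) = L1_dist \<Omega> (ws i) w"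
    using ws
  proof (rule eventually_mono)
    fix i assume i: "ws i \<in> BV \<Omega> \<and> ws i \<in> borel_measurable borel \<and> (\<exists>B. bv_function \<Omega> (ws i) B T')"
    then obtain B where "bv_function \<Omega> (ws i) B T'" by blast
    then interpret v: bv_function \<Omega> "ws i" B T' .
    have vm: "ws i \<in> borel_measurable (lebesgue_on \<Omega>)"
      using v.u_borel by (intro measurable_restrict_space1 measurable_completion) simp
    have "L1_dist \<Omega> (ws i) w = (LINT x|lborel. \<bar>ws i x - u x\<bar>)"
      unfolding L1_dist_def
    proof (rule integral_lebesgue_on_borel[OF u.open_dom])
      show "(\<lambda>x. \<bar>ws i x - w x\<bar>) \<in> borel_measurable (lebesgue_on \<Omega>)" using vm wm by measurable
      show "(\<lambda>x. \<bar>ws i x - u x\<bar>) \<in> borel_measurable borel" by measurable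
      show "AE x in lborel. x \<in> \<Omega> \<longrightarrow> \<bar>ws i x - w x\<bar> = \<bar>ws i x - u x\<bar>" using w(2) by eventually_elim auto
    qed (simp add: v.u_zero u.u_zero)
    then show "(LINT x|lborel. \<bar>ws i x - u x\<bar>) = L1_dist \<Omega> (ws i) w" by simp
  qed
  then show "((\<lambda>i. L1_dist \<Omega> (ws i) w) \<longlongrightarrow> 0) \<F>" by (rule Lim_transform_eventually[OF lim])
  fix \<psi> assume \<psi>: "\<psi> \<in> C0 \<Omega>"
  show "((\<lambda>i. vector_measure_integral (derivative_measure \<Omega> (ws i)) \<psi>)
        \<longlongrightarrow> vector_measure_integral (derivative_measure \<Omega> w) \<psi>) \<F>"
  proof (rule vec_tendstoI, rule tendstoI)
    fix j and \<epsilon> :: real assume \<epsilon>: "0 < \<epsilon>"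
    \<comment> \<open>The summand 1 makes P positive; the modulus is taken since T' is known to be
      nonnegative only once some member of the family has been fixed.\<close>
    define P where "P = \<bar>T'\<bar> + T + 1"
    define s where "s = \<epsilon> / (2 * P)"
    have pos: "0 < P" using u.T_nonneg unfolding P_def by linarith
    have s: "0 < s" using \<epsilon> pos by (simp add: s_def)
    have s2: "s * \<bar>T'\<bar> + s * T < \<epsilon> / 2"
    proof -
      have "s * (\<bar>T'\<bar> + T) < s * P" using s by (intro mult_strict_left_mono) (auto simp: P_def)
      also have "\<dots> = \<epsilon> / 2" using pos by (simp add: s_def)
      finally show ?thesis by (simp add: distrib_left)
    qed
    obtain \<eta> where \<eta>: "\<eta> \<in> C1c \<Omega>" "\<And>x. x \<in> \<Omega> \<Longrightarrow> \<bar>\<psi> x - \<eta> x\<bar> \<le> s"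
      using C0_approx[OF u.open_dom \<psi> s] by metis
    obtain L where L: "0 \<le> L" "\<And>x v. norm (frechet_derivative \<eta> (at x) v) \<le> L * norm v"
      using C1c_deriv_bounded[OF \<eta>(1)] by metis
    define g where "g x = frechet_derivative \<eta> (at x) (axis j 1)" for x
    have g: "g \<in> borel_measurable borel" "\<And>x. \<bar>g x\<bar> \<le> L"
      using C1c_deriv_measurable[OF \<eta>(1)] L(2)[of _ "axis j 1"] by (auto simp: g_def[abs_def] norm_axis_1)
    have wclose: "\<bar>vector_measure_integral (derivative_measure \<Omega> w) \<psi> $ j + (LINT x|lborel. u x * g x)\<bar> \<le> s * T"
      unfolding g_def
      by (rule u.derivative_pairing_close[OF wm w(2) u.derivative_measure_exists[OF wm w(2)] \<psi> \<eta>(1)])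
        (use s \<eta>(2) in auto)
    have "\<forall>\<^sub>F i in \<F>. (LINT x|lborel. \<bar>ws i x - u x\<bar>) < \<epsilon> / (2 * (L + 1))"
      by (rule order_tendstoD(2)[OF lim]) (use \<epsilon> L(1) in simp)
    with ws show "\<forall>\<^sub>F i in \<F>. dist (vector_measure_integral (derivative_measure \<Omega> (ws i)) \<psi> $ j)
      (vector_measure_integral (derivative_measure \<Omega> w) \<psi> $ j) < \<epsilon>"
    proof eventually_elim
      case (elim i)
      then obtain B where "bv_function \<Omega> (ws i) B T'" by blast
      then interpret v: bv_function \<Omega> "ws i" B T' .
      have vm: "ws i \<in> borel_measurable (lebesgue_on \<Omega>)"
        using v.u_borel by (intro measurable_restrict_space1 measurable_completion) simp
      have vae: "AE x in lborel. x \<in> \<Omega> \<longrightarrow> ws i x = ws i x" by simp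
      have vclose: "\<bar>vector_measure_integral (derivative_measure \<Omega> (ws i)) \<psi> $ j + (LINT x|lborel. ws i x * g x)\<bar> \<le> s * T'"
        unfolding g_def
        by (rule v.derivative_pairing_close[OF vm vae v.derivative_measure_exists[OF vm vae] \<psi> \<eta>(1)])
          (use s \<eta>(2) in auto)
      have i1: "integrable lborel (\<lambda>x. u x * g x)" by (rule u.u_mult_integrable[OF g])
      have i2: "integrable lborel (\<lambda>x. ws i x * g x)" by (rule v.u_mult_integrable[OF g])
      have id: "integrable lborel (\<lambda>x. L * \<bar>ws i x - u x\<bar>)"
        using v.u_integrable u.u_integrable by auto
      have "norm (LINT x|lborel. ws i x * g x - u x * g x) \<le> (LINT x|lborel. L * \<bar>ws i x - u x\<bar>)"
      proof (rule lborel_norm_integral_le[OF Bochner_Integration.integrable_diff[OF i2 i1] id])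
        fix x
        show "norm (ws i x * g x - u x * g x) \<le> L * \<bar>ws i x - u x\<bar>"
          unfolding left_diff_distrib[symmetric] real_norm_def abs_mult mult.commute[of "\<bar>ws i x - u x\<bar>"]
          by (rule mult_right_mono[OF g(2)]) simp
      qed
      then have "\<bar>(LINT x|lborel. ws i x * g x) - (LINT x|lborel. u x * g x)\<bar> \<le> L * (LINT x|lborel. \<bar>ws i x - u x\<bar>)"
        using i1 i2 by simp
      also have "\<dots> \<le> L * (\<epsilon> / (2 * (L + 1)))" using elim L(1) by (intro mult_left_mono) auto
      also have "\<dots> \<le> \<epsilon> / 2" using L(1) \<epsilon> by (simp add: field_simps)
      finally have 3: "\<bar>(LINT x|lborel. ws i x * g x) - (LINT x|lborel. u x * g x)\<bar> \<le> \<epsilon> / 2" .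
      have "s * T' \<le> s * \<bar>T'\<bar>" using s by (intro mult_left_mono) auto
      then show ?case using 3 vclose wclose s2 unfolding dist_real_def by linarith
    qed
  qed
qed

theorem theorem3p3:
  fixes \<Omega> :: "(real^'n) set"
    and W :: "int set"
    and F :: "(real^'n \<Rightarrow> real) \<Rightarrow> real"
    and \<alpha> c :: real
    and H :: "real set"
    and \<tau> :: "real \<Rightarrow> real"
    and \<Q> \<R> :: "real \<Rightarrow> (real^'n) set set"
    and w :: "real^'n \<Rightarrow> real"
  assumes "CARD('n) \<in> {1, 2, 3}"
    and "cubical_lipschitz_domain \<Omega>"
    and "finite W" and "W \<noteq> {}"
    and "L1_continuous \<Omega> F"
    and "\<exists>m. \<forall>v\<in>L1 \<Omega>. m \<le> F v"
    and "0 < \<alpha>"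
    and "CARD('n) = 1 \<Longrightarrow> 1 \<le> c"
    and "CARD('n) = 2 \<Longrightarrow> sqrt 2 \<le> c"
    and "CARD('n) = 3 \<Longrightarrow> 13 * sqrt 3 \<le> c"
    and "H \<subseteq> {0<..}" and "0 islimpt H"
    and "\<And>h. h \<in> H \<Longrightarrow> admissible_mesh_pair \<Omega> h (\<tau> h) (\<Q> h) (\<R> h)"
    and "((\<lambda>h. \<tau> h / h) \<longlongrightarrow> 0) (at 0 within H)"
    and "w \<in> BV_W \<Omega> W"
  shows "\<exists>(ws :: real \<Rightarrow> real^'n \<Rightarrow> real) (V :: real \<Rightarrow> real).
           (\<forall>h\<in>H. ws h \<in> BV_W \<Omega> W) \<and>
           (\<forall>h\<in>H. (ws h, V h) \<in> Zh_set \<Omega> W c (\<Q> h) (\<R> h)) \<and>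
           weak_star_BV \<Omega> ws w (at 0 within H) \<and>
           G_fun \<Omega> W F \<alpha> c w \<ge>
             Limsup (at 0 within H) (\<lambda>h. Gh_fun \<Omega> W F \<alpha> c (\<Q> h) (\<R> h) (ws h) (V h))"
proof -
  have \<Omega>: "open \<Omega>" "bounded \<Omega>" and lip: "lipschitz_domain \<Omega>"
    using assms(2) by (auto simp: cubical_lipschitz_domain_def lipschitz_domain_def)
  define d where "d = real CARD('n)"
  have d1: "1 \<le> d" unfolding d_def by (simp add: Suc_leI)
  have sd: "1 \<le> sqrt d" using d1 by simp
  \<comment> \<open>In each dimension the bound on c yields c \<ge> sqrt d, the form in which it
    meets the variation of the sample.\<close>
  have cd: "sqrt d \<le> c"
  proof -
    have "0 \<le> sqrt (3::real)" by simp
    then have "sqrt 3 \<le> c" if "13 * sqrt 3 \<le> c" using that by linarith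
    then show ?thesis using assms(1,8,9,10) unfolding d_def by auto
  qed
  have c1: "1 \<le> c" using sd cd by linarith
  have wL1: "integrable (lebesgue_on \<Omega>) w" and wW: "AE x in lebesgue_on \<Omega>. w x \<in> real_of_int ` W"
    and TVfin: "TV \<Omega> w < \<infinity>" and wBV: "w \<in> BV \<Omega>"
    using assms(15) by (auto simp: BV_W_def L1_W_def L1_def BV_def)
  have wm: "w \<in> borel_measurable (lebesgue_on \<Omega>)" using wL1 by auto
  have zero: "((\<lambda>x. 0) :: real^'n \<Rightarrow> real^'n) \<in> C1c \<Omega>" by (rule C1cI[where D="\<lambda>_ _. 0" and K="{}"]) auto
  have "ereal (LINT x|lebesgue_on \<Omega>. w x * divergence (\<lambda>x. 0) x) \<le> TV \<Omega> w"
    unfolding TV_def by (rule SUP_upper) (use zero in simp)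
  then have TV0: "0 \<le> TV \<Omega> w" by (simp add: divergence_def zero_ereal_def)
  define T where "T = real_of_ereal (TV \<Omega> w)"
  have T: "TV \<Omega> w = ereal T" "0 \<le> T"
    using TV0 TVfin by (cases "TV \<Omega> w"; simp add: T_def)+
  obtain u where u: "u \<in> borel_measurable borel" "\<And>x. x \<in> \<Omega> \<Longrightarrow> u x \<in> real_of_int ` W" "\<And>x. x \<notin> \<Omega> \<Longrightarrow> u x = 0"
    "AE x in lborel. x \<in> \<Omega> \<longrightarrow> w x = u x" "\<And>x. \<bar>u x\<bar> \<le> (\<Sum>k\<in>real_of_int ` W. \<bar>k\<bar>)"
    using borel_representative[OF \<Omega>(1) wm _ _ wW] assms(3,4) by auto
  have bvu: "bv_function \<Omega> u (\<Sum>k\<in>real_of_int ` W. \<bar>k\<bar>) T"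
  proof
    fix \<phi> :: "real^'n \<Rightarrow> real^'n" assume \<phi>: "\<phi> \<in> C1c \<Omega>" "\<And>x. norm (\<phi> x) \<le> 1"
    have "ereal (LINT x|lebesgue_on \<Omega>. w x * divergence \<phi> x) \<le> TV \<Omega> w"
      unfolding TV_def by (rule SUP_upper) (use \<phi> in simp)
    then show "(LINT x|lborel. u x * divergence \<phi> x) \<le> T"
      unfolding T(1) using integral_test_eq[OF \<Omega>(1) u(1,3) wm u(4) \<phi>(1)] by simp
  qed (use \<Omega> u in auto)
  define A where "A = sqrt d * T"
  have A0: "0 \<le> A" using T(2) d1 by (simp add: A_def)
  define e where "e h = sqrt (\<tau> h / h)" for h
  have "\<forall>h\<in>H. \<exists>v. v \<in> borel_measurable borel \<and> (\<exists>B. \<forall>x. \<bar>v x\<bar> \<le> B) \<and> (\<forall>x. x \<notin> \<Omega> \<longrightarrow> v x = 0) \<and>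
    (AE x in lborel. x \<in> \<Omega> \<longrightarrow> v x \<in> real_of_int ` W) \<and> v \<in> P0 (\<R> h) \<and>
    (\<forall>\<phi>. \<phi> \<in> C1c \<Omega> \<longrightarrow> (\<forall>x. norm (\<phi> x) \<le> 1) \<longrightarrow>
      (LINT x|lborel. v x * divergence \<phi> x) \<le> A * (1 + 2 ^ CARD('n) * e h)) \<and>
    TVh \<Omega> (\<Q> h) v \<le> ereal (T + 2 * d * (A * (1 + 2 ^ CARD('n))) * e h) \<and>
    (LINT x|lborel. \<bar>v x - u x\<bar>) \<le> A * (1 + 2 ^ CARD('n)) * h"
  proof
    fix h assume h: "h \<in> H"
    show "\<exists>v. v \<in> borel_measurable borel \<and> (\<exists>B. \<forall>x. \<bar>v x\<bar> \<le> B) \<and> (\<forall>x. x \<notin> \<Omega> \<longrightarrow> v x = 0) \<and>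
      (AE x in lborel. x \<in> \<Omega> \<longrightarrow> v x \<in> real_of_int ` W) \<and> v \<in> P0 (\<R> h) \<and>
      (\<forall>\<phi>. \<phi> \<in> C1c \<Omega> \<longrightarrow> (\<forall>x. norm (\<phi> x) \<le> 1) \<longrightarrow>
        (LINT x|lborel. v x * divergence \<phi> x) \<le> A * (1 + 2 ^ CARD('n) * e h)) \<and>
      TVh \<Omega> (\<Q> h) v \<le> ereal (T + 2 * d * (A * (1 + 2 ^ CARD('n))) * e h) \<and>
      (LINT x|lborel. \<bar>v x - u x\<bar>) \<le> A * (1 + 2 ^ CARD('n)) * h"
      unfolding A_def d_def e_def
      by (rule recovery_step[OF lip bvu u(2) assms(13)[OF h]]) blast+
  qed
  from bchoice[OF this] obtain ws where "\<forall>h\<in>H. ws h \<in> borel_measurable borel \<and> (\<exists>B. \<forall>x. \<bar>ws h x\<bar> \<le> B) \<and> (\<forall>x. x \<notin> \<Omega> \<longrightarrow> ws h x = 0) \<and>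
    (AE x in lborel. x \<in> \<Omega> \<longrightarrow> ws h x \<in> real_of_int ` W) \<and> ws h \<in> P0 (\<R> h) \<and>
    (\<forall>\<phi>. \<phi> \<in> C1c \<Omega> \<longrightarrow> (\<forall>x. norm (\<phi> x) \<le> 1) \<longrightarrow>
      (LINT x|lborel. ws h x * divergence \<phi> x) \<le> A * (1 + 2 ^ CARD('n) * e h)) \<and>
    TVh \<Omega> (\<Q> h) (ws h) \<le> ereal (T + 2 * d * (A * (1 + 2 ^ CARD('n))) * e h) \<and>
    (LINT x|lborel. \<bar>ws h x - u x\<bar>) \<le> A * (1 + 2 ^ CARD('n)) * h" by (rule exE)
  then have ws: "\<And>h. h \<in> H \<Longrightarrow> ws h \<in> borel_measurable borel" "\<And>h. h \<in> H \<Longrightarrow> \<exists>B. \<forall>x. \<bar>ws h x\<bar> \<le> B"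
    "\<And>h x. h \<in> H \<Longrightarrow> x \<notin> \<Omega> \<Longrightarrow> ws h x = 0"
    "\<And>h. h \<in> H \<Longrightarrow> AE x in lborel. x \<in> \<Omega> \<longrightarrow> ws h x \<in> real_of_int ` W" "\<And>h. h \<in> H \<Longrightarrow> ws h \<in> P0 (\<R> h)"
    "\<And>h \<phi>. h \<in> H \<Longrightarrow> \<phi> \<in> C1c \<Omega> \<Longrightarrow> (\<And>x. norm (\<phi> x) \<le> 1) \<Longrightarrow>
      (LINT x|lborel. ws h x * divergence \<phi> x) \<le> A * (1 + 2 ^ CARD('n) * e h)"
    "\<And>h. h \<in> H \<Longrightarrow> TVh \<Omega> (\<Q> h) (ws h) \<le> ereal (T + 2 * d * (A * (1 + 2 ^ CARD('n))) * e h)"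
    "\<And>h. h \<in> H \<Longrightarrow> (LINT x|lborel. \<bar>ws h x - u x\<bar>) \<le> A * (1 + 2 ^ CARD('n)) * h"
    by simp_all
  \<comment> \<open>The bound of \<open>recovery_step\<close> for the discretized variation is
    itself taken as V, so this half of admissibility holds by construction.\<close>
  define V where "V h = T + 2 * d * (A * (1 + 2 ^ CARD('n))) * e h" for h
  have e: "0 \<le> e h" "e h \<le> 1" if "h \<in> H" for h
    using assms(13)[OF that] by (auto simp: e_def admissible_mesh_pair_def)
  have TVws: "TV \<Omega> (ws h) \<le> ereal (A * (1 + 2 ^ CARD('n) * e h))" if h: "h \<in> H" for h
    by (rule TV_borel_le[OF \<Omega>(1) ws(1)[OF h] ws(3)[OF h] ws(6)[OF h]])
  have wsL1: "integrable (lebesgue_on \<Omega>) (ws h)" if h: "h \<in> H" for h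
  proof -
    obtain B where "\<And>x. \<bar>ws h x\<bar> \<le> B" using ws(2)[OF h] by blast
    then show ?thesis by (rule integrable_lebesgue_on_borel[OF \<Omega> ws(1)[OF h]])
  qed
  have wsL1W: "ws h \<in> L1_W \<Omega> W" if h: "h \<in> H" for h
    using wsL1[OF h] ws(4)[OF h] AE_lebesgue_on_iff[OF \<Omega>(1)] by (simp add: L1_W_def L1_def)
  have wsBV: "ws h \<in> BV \<Omega>" if h: "h \<in> H" for h
    using wsL1[OF h] TVws[OF h] by (auto simp: BV_def L1_def)
  have Zh: "(ws h, V h) \<in> Zh_set \<Omega> W c (\<Q> h) (\<R> h)" if h: "h \<in> H" for h
  proof -
    have "A * (1 + 2 ^ CARD('n) * e h) \<le> c * V h"
    proof -
      define q where "q = (2::real) ^ CARD('n)"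
      have q: "1 \<le> q" by (simp add: q_def)
      \<comment> \<open>The surplus 2^d T e in the variation is below the surplus of V: T \<le> A
        because sqrt d \<ge> 1, and 2 d \<ge> 1. So c has to pay for the factor sqrt d only.\<close>
      have "q * T * e h \<le> 2 * d * (A * (1 + q)) * e h"
      proof (rule mult_right_mono[OF _ e(1)[OF h]])
        have "q * T \<le> (1 + q) * A"
          using q T(2) mult_right_mono[OF sd T(2)] by (intro mult_mono) (auto simp: A_def)
        also have "\<dots> \<le> 2 * d * ((1 + q) * A)"
          using d1 q A0 mult_right_mono[of 1 "2 * d" "(1 + q) * A"] by simp
        finally show "q * T \<le> 2 * d * (A * (1 + q))" by (simp add: mult.commute)
      qed
      then have "sqrt d * (T * (1 + q * e h)) \<le> sqrt d * V h"
        using d1 by (intro mult_left_mono) (auto simp: V_def q_def algebra_simps)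
      also have "\<dots> \<le> c * V h"
      proof (rule mult_right_mono[OF cd])
        show "0 \<le> V h" unfolding V_def using T(2) A0 d1 e(1)[OF h] by simp
      qed
      finally show ?thesis by (simp add: A_def q_def mult.assoc)
    qed
    then have "TV \<Omega> (ws h) \<le> ereal (c * V h)" using TVws[OF h] order_trans by fastforce
    then show ?thesis using ws(5,7)[OF h] wsL1W[OF h] by (simp add: Zh_set_def V_def)
  qed
  have inH: "\<forall>\<^sub>F h in at 0 within H. h \<in> H" by (simp add: eventually_at_filter)
  define C where "C = A * (1 + 2 ^ CARD('n))"
  have lim: "((\<lambda>h. LINT x|lborel. \<bar>ws h x - u x\<bar>) \<longlongrightarrow> 0) (at 0 within H)"
  proof (rule Lim_null_comparison)
    show "\<forall>\<^sub>F h in at 0 within H. norm (LINT x|lborel. \<bar>ws h x - u x\<bar>) \<le> C * h"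
      using inH by (rule eventually_mono) (use ws(8) in \<open>simp add: C_def\<close>)
    have "((\<lambda>h. C * h) \<longlongrightarrow> C * 0) (at 0 within H)" by (intro tendsto_intros)
    then show "((\<lambda>h. C * h) \<longlongrightarrow> 0) (at 0 within H)" by simp
  qed
  \<comment> \<open>One variation bound C for the whole family, as \<open>weak_star_BV_I\<close>
    demands; it rests on e h \<le> 1.\<close>
  have bvws: "\<exists>B. bv_function \<Omega> (ws h) B C" if h: "h \<in> H" for h
  proof -
    obtain B where B: "\<And>x. \<bar>ws h x\<bar> \<le> B" using ws(2)[OF h] by blast
    have "A * (1 + 2 ^ CARD('n) * e h) \<le> C"
      unfolding C_def using e[OF h] A0 by (intro mult_left_mono add_mono) (auto simp: mult_left_le)
    then have "bv_function \<Omega> (ws h) B C"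
      using \<Omega> ws(1)[OF h] B ws(3)[OF h] order_trans[OF ws(6)[OF h]] by unfold_locales auto
    then show ?thesis by blast
  qed
  have weak: "weak_star_BV \<Omega> ws w (at 0 within H)"
    by (rule weak_star_BV_I[OF bvu wBV u(4) _ lim, of C])
      (use inH in \<open>rule eventually_mono\<close>, use wsBV ws(1) bvws in blast)
  have L1lim: "((\<lambda>h. L1_dist \<Omega> (ws h) w) \<longlongrightarrow> 0) (at 0 within H)" using weak by (simp add: weak_star_BV_def)
  have Flim: "((\<lambda>h. F (ws h)) \<longlongrightarrow> F w) (at 0 within H)"
  proof (rule tendstoI)
    fix \<epsilon> :: real assume "0 < \<epsilon>"
    then obtain \<delta> where \<delta>: "0 < \<delta>" "\<And>v. v \<in> L1 \<Omega> \<Longrightarrow> L1_dist \<Omega> v w < \<delta> \<Longrightarrow> \<bar>F v - F w\<bar> < \<epsilon>"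
      using assms(5) wL1 unfolding L1_continuous_def L1_def by blast
    have "\<forall>\<^sub>F h in at 0 within H. L1_dist \<Omega> (ws h) w < \<delta>" by (rule order_tendstoD(2)[OF L1lim \<delta>(1)])
    with inH show "\<forall>\<^sub>F h in at 0 within H. dist (F (ws h)) (F w) < \<epsilon>"
      by eventually_elim (use \<delta>(2) wsL1 in \<open>auto simp: dist_real_def L1_def\<close>)
  qed
  have Vlim: "(V \<longlongrightarrow> T) (at 0 within H)"
  proof -
    have "(e \<longlongrightarrow> sqrt 0) (at 0 within H)" unfolding e_def by (intro tendsto_real_sqrt assms(14))
    then have "((\<lambda>h. T + 2 * d * (A * (1 + 2 ^ CARD('n))) * e h) \<longlongrightarrow> T + 2 * d * (A * (1 + 2 ^ CARD('n))) * 0) (at 0 within H)"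
      by (intro tendsto_intros) simp
    then show ?thesis by (simp add: V_def[abs_def])
  qed
  have "((\<lambda>h. ereal (F (ws h) + \<alpha> * V h)) \<longlongrightarrow> ereal (F w + \<alpha> * T)) (at 0 within H)"
    by (intro tendsto_intros Flim Vlim)
  \<comment> \<open>Since 0 is a limit point of H, the filter is proper, and the upper limit of a
    convergent family is its limit.\<close>
  moreover have "at 0 within H \<noteq> bot" using assms(12) by (simp add: trivial_limit_within)
  ultimately have "Limsup (at 0 within H) (\<lambda>h. ereal (F (ws h) + \<alpha> * V h)) = ereal (F w + \<alpha> * T)"
    by (rule lim_imp_Limsup[rotated])
  moreover have "Limsup (at 0 within H) (\<lambda>h. Gh_fun \<Omega> W F \<alpha> c (\<Q> h) (\<R> h) (ws h) (V h))
    = Limsup (at 0 within H) (\<lambda>h. ereal (F (ws h) + \<alpha> * V h))"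
    by (rule Limsup_eq) (use inH in \<open>rule eventually_mono\<close>, use Zh in \<open>simp add: Gh_fun_def ind_fun_def\<close>)
  moreover have "G_fun \<Omega> W F \<alpha> c w = ereal (F w + \<alpha> * T)"
  proof -
    have "T \<le> c * T" using c1 T(2) mult_right_mono[of 1 c T] by simp
    then have "w \<in> Z_set \<Omega> W c" using assms(15) by (simp add: Z_set_def BV_W_def T(1))
    then show ?thesis by (simp add: G_fun_def ind_fun_def T(1))
  qed
  ultimately have "Limsup (at 0 within H) (\<lambda>h. Gh_fun \<Omega> W F \<alpha> c (\<Q> h) (\<R> h) (ws h) (V h)) \<le> G_fun \<Omega> W F \<alpha> c w"
    by simp
  then show ?thesis using wsL1W wsBV Zh weak by (intro exI[of _ ws] exI[of _ V]) (auto simp: BV_W_def)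
qed

end
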